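(* Let $\Omega=\{\frac{x_1^2}{a^2}+\frac{x_2^2}{b^2}<1\}\subset\mathbb{R}^2$ with $a>b>0$, $R=\sqrt{a^2-b^2}$, with elliptic coordinates $x_1=R\cosh\rho\cos\omega$, $x_2=R\sinh\rho\sin\omega$ ($\rho\ge0$, $0\le\omega\le2\pi$), and $\rho_0>0$ defined by $a=R\cosh\rho_0$, $b=R\sinh\rho_0$, so that $\partial\Omega=\{\rho=\rho_0\}$. Put $k_0=\frac{\mu}{2(2\mu+\lambda)}$, $h_0(\omega)=R\sqrt{\sinh^2\rho_0+\sin^2\omega}$, $q=(\lambda+\mu)\sinh2\rho_0$, and $$\gamma_n^{\pm}=\sqrt{e^{4n\rho_0}\mu^2+(\lambda+\mu)(\lambda+3\mu)+nq(\pm2e^{2n\rho_0}\mu+nq)}.$$ Then the eigenvalues of $\mathbf{K}^*$ are $\frac12$ and $k_{j,n}$, $j=1,\ldots,4$, where $$k_{1,n}=\frac{e^{-2n\rho_0}}{2(\lambda+2\mu)}(-qn+\gamma_n^-),\ n\ge1,\qquad k_{2,n}=\frac{e^{-2n\rho_0}}{2(\lambda+2\mu)}(qn+\gamma_n^+),\ n\ge2,$$ $$k_{3,n}=\frac{e^{-2n\rho_0}}{2(\lambda+2\mu)}(-qn-\gamma_n^-),\ n\ge1,\qquad k_{4,n}=\frac{e^{-2n\rho_0}}{2(\lambda+2\mu)}(qn-\gamma_n^+),\ n\ge1.$$ The corresponding eigenfunctions (as functions of $\omega$ on $\partial\Omega$) are: (i) for $\frac12$: $$\frac1{h_0(\omega)}\begin{bmatrix}1\\0\end{bmatrix},\quad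 \frac1{h_0(\omega)}\begin{bmatrix}0\\1\end{bmatrix},\quad \frac1{h_0(\omega)}\begin{bmatrix}\left((\lambda+\mu)e^{-2\rho_0}-(\lambda+3\mu)\right)\sin\omega\\ \left((\lambda+\mu)e^{-2\rho_0}+(\lambda+3\mu)\right)\cos\omega\end{bmatrix};$$ (ii) for $k_{j,n}$, the function $\boldsymbol{\varphi}_{j,n}$, where $$\boldsymbol{\varphi}_{1,n}=\boldsymbol{\psi}_{1,n}+\frac{p_n}{k_0+k_{1,n}}\boldsymbol{\psi}_{3,n}\ (n\ge1),\qquad \boldsymbol{\varphi}_{2,n}=\boldsymbol{\psi}_{2,n}+\frac{p_n}{k_0+k_{2,n}}\boldsymbol{\psi}_{4,n}\ (n\ge2),$$ $$\boldsymbol{\varphi}_{3,n}=\frac{k_0+k_{3,n}}{p_n}\boldsymbol{\psi}_{1,n}+\boldsymbol{\psi}_{3,n}\ (n\ge1),\qquad \boldsymbol{\varphi}_{4,n}=\frac{k_0+k_{4,n}}{p_n}\boldsymbol{\psi}_{2,n}+\boldsymbol{\psi}_{4,n}\ (n\ge1),$$ with $p_n=\left(\frac12-k_0\right)e^{-2n\rho_0}$ and $$\boldsymbol{\psi}_{1,n}=\frac1{h_0}\begin{bmatrix}\cos n\omega\\ \sin n\omega\end{bmatrix},\quad \boldsymbol{\psi}_{2,n}=\frac1{h_0}\begin{bmatrix}-\sin n\omega\\ \cos n\omega\end{bmatrix},\quad \boldsymbol{\psi}_{3,n}=\frac1{h_0}\begin{bmatrix}\cos n\omega\\ -\sin n\omega\end{bmatrix},\quad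 \boldsymbol{\psi}_{4,n}=\frac1{h_0}\begin{bmatrix}\sin n\omega\\ \cos n\omega\end{bmatrix}.$$
   Context: Let $\lambda,\mu\in\mathbb{R}$ with $\mu>0$, $2\lambda+2\mu>0$. Put $\widehat\nabla\mathbf{u}=\frac12(\nabla\mathbf{u}+\nabla\mathbf{u}^T)$ and, with $\mathbf{n}$ the outward unit normal to $\partial\Omega$, $\partial_\nu\mathbf{u}=\lambda(\nabla\cdot\mathbf{u})\mathbf{n}+2\mu(\widehat\nabla\mathbf{u})\mathbf{n}$. The Kelvin matrix is $\Gamma_{ij}(\mathbf{x})=\frac{\alpha_1}{2\pi}\delta_{ij}\ln|\mathbf{x}|-\frac{\alpha_2}{2\pi}\frac{x_ix_j}{|\mathbf{x}|^2}$ $(i,j=1,2)$, $\alpha_1=\frac12\left(\frac1\mu+\frac1{2\mu+\lambda}\right)$, $\alpha_2=\frac12\left(\frac1\mu-\frac1{2\mu+\lambda}\right)$, and $\partial_{\nu_{\mathbf{x}}}\mathbf{\Gamma}(\mathbf{x}-\mathbf{y})\mathbf{b}=\partial_{\nu_{\mathbf{x}}}(\mathbf{\Gamma}(\mathbf{x}-\mathbf{y})\mathbf{b})$ for constant $\mathbf{b}$. The Neumann-Poincaré operator $\mathbf{K}^*$ on $\mathcal{H}^*=H^{-1/2}(\partial\Omega)^2$ is $\mathbf{K}^*[\boldsymbol{\varphi}](\mathbf{x})=\mathrm{p.v.}\int_{\partial\Omega}\partial_{\nu_{\mathbf{x}}}\mathbf{\Gamma}(\mathbf{x}-\mathbf{y})\boldsymbol{\varphi}(\mathbf{y})\,d\sigma(\mathbf{y})$.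 *)

theory Defs
  imports "HOL-Analysis.Analysis" "HOL-Library.Function_Algebras"
begin

definition conormal :: "real \<Rightarrow> real \<Rightarrow> real^2 \<Rightarrow> (real^2 \<Rightarrow> real^2) \<Rightarrow> real^2 \<Rightarrow> real^2" where
  "conormal lam mu n u x =
     (let J = jacobian u (at x) in
       (lam * trace J) *\<^sub>R n + (2 * mu) *\<^sub>R (((1/2) *\<^sub>R (J + transpose J)) *v n))"

definition kelvin :: "real \<Rightarrow> real \<Rightarrow> real^2 \<Rightarrow> real^2^2" where
  "kelvin lam mu x =
     (let alpha1 = (1/2) * (1 / mu + 1 / (2 * mu + lam));
          alpha2 = (1/2) * (1 / mu - 1 / (2 * mu + lam))
      in \<chi> i j. alpha1 / (2 * pi) * (if i = j then 1 else 0) * ln (norm x)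
               - alpha2 / (2 * pi) * (x $ i * x $ j / (norm x)\<^sup>2))"

text \<open>The matrix whose product with a constant vector \<open>b\<close> is the conormal derivative
  at \<open>x\<close> of \<open>z \<mapsto> \<Gamma>(z - y) b\<close>, where \<open>nu x\<close> is the normal at \<open>x\<close>.\<close>

definition NP_kernel ::
    "real \<Rightarrow> real \<Rightarrow> (real^2 \<Rightarrow> real^2) \<Rightarrow> real^2 \<Rightarrow> real^2 \<Rightarrow> real^2^2" where
  "NP_kernel lam mu nu x y =
     (\<chi> i j. conormal lam mu (nu x) (\<lambda>z. kelvin lam mu (z - y) *v axis j 1) x $ i)"

text \<open>Densities are complex valued; the real kernel acts on them by complex linearity.\<close>

definition cmat :: "real^2^2 \<Rightarrow> complex^2^2" where
  "cmat A = (\<chi> i j. complex_of_real (A $ i $ j))"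

definition cvec :: "real^2 \<Rightarrow> complex^2" where
  "cvec v = (\<chi> i. complex_of_real (v $ i))"

definition NP_pv :: "real \<Rightarrow> real \<Rightarrow> (real^2) measure \<Rightarrow> (real^2 \<Rightarrow> real^2)
    \<Rightarrow> (real^2 \<Rightarrow> complex^2) \<Rightarrow> real^2 \<Rightarrow> complex^2" where
  "NP_pv lam mu \<sigma> nu \<phi> x =
     Lim (at_right 0) (\<lambda>\<epsilon>.
       \<integral>y\<in>{y. \<epsilon> < dist x y}. (cmat (NP_kernel lam mu nu x y) *v \<phi> y) \<partial>\<sigma>)"

text \<open>\<open>\<sigma>\<close> is the arc length measure of a curve, and \<open>space \<sigma>\<close> is the curve. Order \<open>1/2\<close> is
  given by the Gagliardo double integral. Elements are functions, not classes: functions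
  that agree almost everywhere have distance zero.\<close>

definition H_half :: "(real^2) measure \<Rightarrow> (real^2 \<Rightarrow> complex^2) set" where
  "H_half \<sigma> = {f. f \<in> borel_measurable \<sigma> \<and> integrable \<sigma> (\<lambda>x. (norm (f x))\<^sup>2) \<and>
     integrable (\<sigma> \<Otimes>\<^sub>M \<sigma>) (\<lambda>(x, y). (norm (f x - f y))\<^sup>2 / (dist x y)\<^sup>2)}"

definition H_half_norm :: "(real^2) measure \<Rightarrow> (real^2 \<Rightarrow> complex^2) \<Rightarrow> real" where
  "H_half_norm \<sigma> f =
     sqrt ((\<integral>x. (norm (f x))\<^sup>2 \<partial>\<sigma>)
       + (\<integral>(x, y). (norm (f x - f y))\<^sup>2 / (dist x y)\<^sup>2 \<partial>(\<sigma> \<Otimes>\<^sub>M \<sigma>)))"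

text \<open>Order \<open>-1/2\<close> is the dual space: bounded linear functionals, extended by zero
  off \<^term>\<open>H_half \<sigma>\<close> so that equality of functionals is equality of functions.\<close>

type_synonym functional = "(real^2 \<Rightarrow> complex^2) \<Rightarrow> complex"

definition H_mhalf :: "(real^2) measure \<Rightarrow> functional set" where
  "H_mhalf \<sigma> = {F.
     (\<forall>f\<in>H_half \<sigma>. \<forall>g\<in>H_half \<sigma>. F (\<lambda>x. f x + g x) = F f + F g) \<and>
     (\<forall>c. \<forall>f\<in>H_half \<sigma>. F (\<lambda>x. c *s f x) = c * F f) \<and>
     (\<exists>C. \<forall>f\<in>H_half \<sigma>. cmod (F f) \<le> C * H_half_norm \<sigma> f) \<and>
     (\<forall>f. f \<notin> H_half \<sigma> \<longrightarrow> F f = 0)}"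

definition H_mhalf_norm :: "(real^2) measure \<Rightarrow> functional \<Rightarrow> real" where
  "H_mhalf_norm \<sigma> F = (SUP f\<in>{f \<in> H_half \<sigma>. H_half_norm \<sigma> f \<le> 1}. cmod (F f))"

definition density_functional :: "(real^2) measure \<Rightarrow> (real^2 \<Rightarrow> complex^2) \<Rightarrow> functional" where
  "density_functional \<sigma> \<phi> =
     (\<lambda>f. if f \<in> H_half \<sigma> then (\<integral>x. (\<Sum>i\<in>UNIV. \<phi> x $ i * f x $ i) \<partial>\<sigma>) else 0)"

text \<open>The principal value is a pointwise formula for regular densities only. On the dual
  space the operator is its unique bounded linear extension from Lipschitz densities, which
  are dense. It is set to zero off \<^term>\<open>H_mhalf \<sigma>\<close>.\<close>

definition bounded_operator_on :: "(real^2) measure \<Rightarrow> (functional \<Rightarrow> functional) \<Rightarrow> bool" where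
  "bounded_operator_on \<sigma> T \<longleftrightarrow>
     (\<forall>F\<in>H_mhalf \<sigma>. T F \<in> H_mhalf \<sigma>) \<and>
     (\<forall>F\<in>H_mhalf \<sigma>. \<forall>G\<in>H_mhalf \<sigma>. T (F + G) = T F + T G) \<and>
     (\<forall>c. \<forall>F\<in>H_mhalf \<sigma>. T (\<lambda>f. c * F f) = (\<lambda>f. c * T F f)) \<and>
     (\<exists>C. \<forall>F\<in>H_mhalf \<sigma>. H_mhalf_norm \<sigma> (T F) \<le> C * H_mhalf_norm \<sigma> F)"

definition NP_operator :: "real \<Rightarrow> real \<Rightarrow> (real^2) measure \<Rightarrow> (real^2 \<Rightarrow> real^2)
    \<Rightarrow> functional \<Rightarrow> functional" where
  "NP_operator lam mu \<sigma> nu = (THE T.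
     bounded_operator_on \<sigma> T \<and>
     (\<forall>\<phi>. (\<exists>L. L-lipschitz_on (space \<sigma>) \<phi>) \<longrightarrow>
        T (density_functional \<sigma> \<phi>) = density_functional \<sigma> (NP_pv lam mu \<sigma> nu \<phi>)) \<and>
     (\<forall>F. F \<notin> H_mhalf \<sigma> \<longrightarrow> T F = 0))"

definition eigenspace ::
    "functional set \<Rightarrow> (functional \<Rightarrow> functional) \<Rightarrow> complex \<Rightarrow> functional set" where
  "eigenspace V T \<kappa> = {F \<in> V. T F = (\<lambda>f. \<kappa> * F f)}"

definition eigenvalues ::
    "functional set \<Rightarrow> (functional \<Rightarrow> functional) \<Rightarrow> complex set" where
  "eigenvalues V T = {\<kappa>. \<exists>F\<in>eigenspace V T \<kappa>. F \<noteq> 0}"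

abbreviation cspan :: "functional set \<Rightarrow> functional set" where
  "cspan \<equiv> module.span (\<lambda>(c::complex) F f. c * F f)"

definition ellipse :: "real \<Rightarrow> real \<Rightarrow> (real^2) set" where
  "ellipse a b = {x. (x $ 1)\<^sup>2 / a\<^sup>2 + (x $ 2)\<^sup>2 / b\<^sup>2 < 1}"

definition ellipse_param :: "real \<Rightarrow> real \<Rightarrow> real \<Rightarrow> real^2" where
  "ellipse_param a b t = vector [a * cos t, b * sin t]"

definition ellipse_measure :: "real \<Rightarrow> real \<Rightarrow> (real^2) measure" where
  "ellipse_measure a b =
     distr (density (restrict_space lborel {0..2*pi})
              (\<lambda>t. ennreal (norm (vector_derivative (ellipse_param a b) (at t)))))
           (restrict_space borel (frontier (ellipse a b))) (ellipse_param a b)"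

text \<open>Outward unit normal: the normalised gradient (up to the factor 2) of the
  function whose sublevel set is the ellipse.\<close>

definition ellipse_normal :: "real \<Rightarrow> real \<Rightarrow> real^2 \<Rightarrow> real^2" where
  "ellipse_normal a b x = sgn (vector [x $ 1 / a\<^sup>2, x $ 2 / b\<^sup>2])"

definition H_star :: "real \<Rightarrow> real \<Rightarrow> functional set" where
  "H_star a b = H_mhalf (ellipse_measure a b)"

definition K_star :: "real \<Rightarrow> real \<Rightarrow> real \<Rightarrow> real \<Rightarrow> functional \<Rightarrow> functional" where
  "K_star lam mu a b = NP_operator lam mu (ellipse_measure a b) (ellipse_normal a b)"

definition elliptic_coord :: "real \<Rightarrow> real \<Rightarrow> real \<Rightarrow> real^2" where
  "elliptic_coord R \<rho> \<omega> = vector [R * cosh \<rho> * cos \<omega>, R * sinh \<rho> * sin \<omega>]"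

text \<open>The element of \<^term>\<open>H_star a b\<close> given by a (\<open>2\<pi>\<close>-periodic) function of the elliptic
  angle on the boundary \<open>\<rho> = \<rho>0\<close>.\<close>

definition boundary_density ::
    "real \<Rightarrow> real \<Rightarrow> real \<Rightarrow> real \<Rightarrow> (real \<Rightarrow> real^2) \<Rightarrow> functional" where
  "boundary_density a b R \<rho>0 g =
     density_functional (ellipse_measure a b)
       (\<lambda>x. cvec (g (THE \<omega>. 0 \<le> \<omega> \<and> \<omega> < 2 * pi \<and> elliptic_coord R \<rho>0 \<omega> = x)))"

definition k0 :: "real \<Rightarrow> real \<Rightarrow> real" where
  "k0 lam mu = mu / (2 * (2 * mu + lam))"

definition h0 :: "real \<Rightarrow> real \<Rightarrow> real \<Rightarrow> real" where
  "h0 R \<rho>0 \<omega> = R * sqrt ((sinh \<rho>0)\<^sup>2 + (sin \<omega>)\<^sup>2)"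

definition q0 :: "real \<Rightarrow> real \<Rightarrow> real \<Rightarrow> real" where
  "q0 lam mu \<rho>0 = (lam + mu) * sinh (2 * \<rho>0)"

definition gamma_plus :: "real \<Rightarrow> real \<Rightarrow> real \<Rightarrow> nat \<Rightarrow> real" where
  "gamma_plus lam mu \<rho>0 n =
     (let q = q0 lam mu \<rho>0 in
       sqrt (exp (4 * real n * \<rho>0) * mu\<^sup>2 + (lam + mu) * (lam + 3 * mu)
             + real n * q * (2 * exp (2 * real n * \<rho>0) * mu + real n * q)))"

definition gamma_minus :: "real \<Rightarrow> real \<Rightarrow> real \<Rightarrow> nat \<Rightarrow> real" where
  "gamma_minus lam mu \<rho>0 n =
     (let q = q0 lam mu \<rho>0 in
       sqrt (exp (4 * real n * \<rho>0) * mu\<^sup>2 + (lam + mu) * (lam + 3 * mu)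
             + real n * q * (- (2 * exp (2 * real n * \<rho>0) * mu) + real n * q)))"

definition k1 :: "real \<Rightarrow> real \<Rightarrow> real \<Rightarrow> nat \<Rightarrow> real" where
  "k1 lam mu \<rho>0 n = exp (- 2 * real n * \<rho>0) / (2 * (lam + 2 * mu))
     * (- (q0 lam mu \<rho>0 * real n) + gamma_minus lam mu \<rho>0 n)"

definition k2 :: "real \<Rightarrow> real \<Rightarrow> real \<Rightarrow> nat \<Rightarrow> real" where
  "k2 lam mu \<rho>0 n = exp (- 2 * real n * \<rho>0) / (2 * (lam + 2 * mu))
     * (q0 lam mu \<rho>0 * real n + gamma_plus lam mu \<rho>0 n)"

definition k3 :: "real \<Rightarrow> real \<Rightarrow> real \<Rightarrow> nat \<Rightarrow> real" where
  "k3 lam mu \<rho>0 n = exp (- 2 * real n * \<rho>0) / (2 * (lam + 2 * mu))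
     * (- (q0 lam mu \<rho>0 * real n) - gamma_minus lam mu \<rho>0 n)"

definition k4 :: "real \<Rightarrow> real \<Rightarrow> real \<Rightarrow> nat \<Rightarrow> real" where
  "k4 lam mu \<rho>0 n = exp (- 2 * real n * \<rho>0) / (2 * (lam + 2 * mu))
     * (q0 lam mu \<rho>0 * real n - gamma_plus lam mu \<rho>0 n)"

definition p0 :: "real \<Rightarrow> real \<Rightarrow> real \<Rightarrow> nat \<Rightarrow> real" where
  "p0 lam mu \<rho>0 n = (1/2 - k0 lam mu) * exp (- 2 * real n * \<rho>0)"

definition psi1 :: "real \<Rightarrow> real \<Rightarrow> nat \<Rightarrow> real \<Rightarrow> real^2" where
  "psi1 R \<rho>0 n \<omega> = (1 / h0 R \<rho>0 \<omega>) *\<^sub>R vector [cos (real n * \<omega>), sin (real n * \<omega>)]"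

definition psi2 :: "real \<Rightarrow> real \<Rightarrow> nat \<Rightarrow> real \<Rightarrow> real^2" where
  "psi2 R \<rho>0 n \<omega> = (1 / h0 R \<rho>0 \<omega>) *\<^sub>R vector [- sin (real n * \<omega>), cos (real n * \<omega>)]"

definition psi3 :: "real \<Rightarrow> real \<Rightarrow> nat \<Rightarrow> real \<Rightarrow> real^2" where
  "psi3 R \<rho>0 n \<omega> = (1 / h0 R \<rho>0 \<omega>) *\<^sub>R vector [cos (real n * \<omega>), - sin (real n * \<omega>)]"

definition psi4 :: "real \<Rightarrow> real \<Rightarrow> nat \<Rightarrow> real \<Rightarrow> real^2" where
  "psi4 R \<rho>0 n \<omega> = (1 / h0 R \<rho>0 \<omega>) *\<^sub>R vector [sin (real n * \<omega>), cos (real n * \<omega>)]"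

definition phi1 :: "real \<Rightarrow> real \<Rightarrow> real \<Rightarrow> real \<Rightarrow> nat \<Rightarrow> real \<Rightarrow> real^2" where
  "phi1 lam mu R \<rho>0 n \<omega> = psi1 R \<rho>0 n \<omega>
     + (p0 lam mu \<rho>0 n / (k0 lam mu + k1 lam mu \<rho>0 n)) *\<^sub>R psi3 R \<rho>0 n \<omega>"

definition phi2 :: "real \<Rightarrow> real \<Rightarrow> real \<Rightarrow> real \<Rightarrow> nat \<Rightarrow> real \<Rightarrow> real^2" where
  "phi2 lam mu R \<rho>0 n \<omega> = psi2 R \<rho>0 n \<omega>
     + (p0 lam mu \<rho>0 n / (k0 lam mu + k2 lam mu \<rho>0 n)) *\<^sub>R psi4 R \<rho>0 n \<omega>"

definition phi3 :: "real \<Rightarrow> real \<Rightarrow> real \<Rightarrow> real \<Rightarrow> nat \<Rightarrow> real \<Rightarrow> real^2" where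
  "phi3 lam mu R \<rho>0 n \<omega> =
     ((k0 lam mu + k3 lam mu \<rho>0 n) / p0 lam mu \<rho>0 n) *\<^sub>R psi1 R \<rho>0 n \<omega> + psi3 R \<rho>0 n \<omega>"

definition phi4 :: "real \<Rightarrow> real \<Rightarrow> real \<Rightarrow> real \<Rightarrow> nat \<Rightarrow> real \<Rightarrow> real^2" where
  "phi4 lam mu R \<rho>0 n \<omega> =
     ((k0 lam mu + k4 lam mu \<rho>0 n) / p0 lam mu \<rho>0 n) *\<^sub>R psi2 R \<rho>0 n \<omega> + psi4 R \<rho>0 n \<omega>"

definition eigenpairs :: "real \<Rightarrow> real \<Rightarrow> real \<Rightarrow> real \<Rightarrow> (real \<times> (real \<Rightarrow> real^2)) set" where
  "eigenpairs lam mu R \<rho>0 =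
     {(1/2, \<lambda>\<omega>. (1 / h0 R \<rho>0 \<omega>) *\<^sub>R vector [1, 0]),
      (1/2, \<lambda>\<omega>. (1 / h0 R \<rho>0 \<omega>) *\<^sub>R vector [0, 1]),
      (1/2, \<lambda>\<omega>. (1 / h0 R \<rho>0 \<omega>) *\<^sub>R
         vector [((lam + mu) * exp (- 2 * \<rho>0) - (lam + 3 * mu)) * sin \<omega>,
                 ((lam + mu) * exp (- 2 * \<rho>0) + (lam + 3 * mu)) * cos \<omega>])}
     \<union> {(k1 lam mu \<rho>0 n, phi1 lam mu R \<rho>0 n) | n. 1 \<le> n}
     \<union> {(k2 lam mu \<rho>0 n, phi2 lam mu R \<rho>0 n) | n. 2 \<le> n}
     \<union> {(k3 lam mu \<rho>0 n, phi3 lam mu R \<rho>0 n) | n. 1 \<le> n}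
     \<union> {(k4 lam mu \<rho>0 n, phi4 lam mu R \<rho>0 n) | n. 1 \<le> n}"

end

theory Submission
  imports Defs
begin

text \<open>Let \<open>\<kappa> = mu / (2 mu + lam)\<close>. On the parametrized ellipse the Neumann-Poincare kernel
  times the speed is \<open>\<kappa>/(4 pi) cot((\<omega> - \<theta>)/2) J + G(\<omega> + \<theta>)\<close>, where \<open>J\<close> is the rotation by a right
  angle and \<open>G\<close> is a smooth matrix function. After multiplying densities by the speed, the
  operator therefore acts on the Fourier coefficients by a multiplier coupling only the frequencies
  \<open>n\<close> and \<open>-n\<close>: the Hilbert transform gives \<open>sgn n\<close> and \<open>G\<close> reverses the frequency.
  Functionals in \<open>H\<^sup>-\<^sup>1\<^sup>/\<^sup>2\<close> are exactly the coefficient sequences that are square summable with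
  the weight \<open>1 / (1 + |n|)\<close>, because the squared Gagliardo seminorm of order one half on the circle is
  \<open>4 pi\<^sup>2\<close> times the sum of \<open>|n| |c\<^sub>n|\<^sup>2\<close>; hence the operator extends continuously, and
  uniquely by density.
  In the combinations \<open>x\<^sub>1 \<plusminus> i x\<^sub>2\<close> the frequencies \<open>n\<close> and \<open>-n\<close> split into two blocks of
  size two, whose roots are \<open>k1, k3\<close> and \<open>k2, k4\<close>. No number is a root for infinitely
  many \<open>n\<close>, so every eigenspace involves only finitely many blocks.\<close>

section \<open>Fourier coefficients on the circle\<close>

text \<open>The squared distance of two points of the ellipse factors as 4 sin^2((s - t)/2) times a
  function of s + t alone (\<open>dist_par_el\<close>). This makes the Sobolev norm comparable with
  that of the circle and splits the kernel into a cotangent of the difference and a function of the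
  sum. The latter is built from the Poisson kernel with parameter e^(-2 \<rho>0), its conjugate, and
  multiples of their derivatives; differentiation is the origin of the factor n in n q. Three
  obstacles shape the proof. The principal value is truncated by Euclidean distance, so the removed
  parameter interval is not symmetric and the truncated integral of the cotangent vanishes only in
  the limit. \<open>NP_operator\<close> is a definite description, so nothing can be said about its
  spectrum before existence and uniqueness of the bounded extension are settled. Finally, a
  functional is accessible only through its values on trigonometric monomials; that these determine
  it rests on Parseval's identity, applied to every difference f(t + s) - f(t) and integrated over
  s.\<close>

definition circ :: "real measure" where
  "circ = restrict_space lborel {0..2*pi}"

lemma sets_circ [measurable_cong]: "sets circ = sets (restrict_space borel {0..2*pi})"
  by (simp add: circ_def sets_restrict_space)

lemma space_circ: "space circ = {0..2*pi}"
  by (simp add: circ_def space_restrict_space)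

lemma measurable_circ: "f \<in> measurable borel N \<Longrightarrow> f \<in> measurable circ N"
  by (simp add: circ_def measurable_restrict_space1)

lemma id_circ [measurable]: "(\<lambda>x. x) \<in> borel_measurable circ"
  by (rule measurable_circ) simp

lemma emeasure_circ: "emeasure circ (space circ) = ennreal (2*pi)"
  by (simp add: circ_def emeasure_restrict_space space_restrict_space)

interpretation circ: finite_measure circ
  by standard (simp add: emeasure_circ)

interpretation circ_circ: pair_sigma_finite circ circ ..

lemma measure_circ: "measure circ (space circ) = 2*pi"
  by (simp add: measure_def emeasure_circ)

lemma nn_integral_circ:
  "f \<in> borel_measurable borel \<Longrightarrow> (\<integral>\<^sup>+t. f t \<partial>circ) = (\<integral>\<^sup>+t. f t * indicator {0..2*pi} t \<partial>lborel)"
  unfolding circ_def by (rule nn_integral_restrict_space) simp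

lemma integral_circ:
  fixes f :: "real \<Rightarrow> 'a::{banach,second_countable_topology}"
  shows "(\<integral>t. f t \<partial>circ) = (\<integral>t. indicator {0..2*pi} t *\<^sub>R f t \<partial>lborel)"
  unfolding circ_def by (rule integral_restrict_space) simp

lemma integrable_circ_bounded:
  fixes f :: "real \<Rightarrow> 'a::{banach,second_countable_topology}"
  assumes "f \<in> borel_measurable borel" "\<And>t. t \<in> {0..2*pi} \<Longrightarrow> norm (f t) \<le> B"
  shows "integrable circ f"
  by (rule circ.integrable_const_bound[where B=B])
     (use assms measurable_circ in \<open>auto simp: space_circ\<close>)

lemma integral_circ_FTC:
  fixes F :: "real \<Rightarrow> 'a::euclidean_space"
  assumes "\<And>t. (F has_vector_derivative f t) (at t)" "continuous_on UNIV f"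
  shows "(\<integral>t. f t \<partial>circ) = F (2*pi) - F 0"
  unfolding integral_circ
  by (rule integral_FTC_Icc)
     (use assms in \<open>auto intro: has_vector_derivative_at_within continuous_on_subset\<close>)

text \<open>The half-angle sine vanishes only at the two end points of the closed interval, so
  quotients by sin(s/2) are meaningful almost everywhere, whatever division by zero yields at the
  ends.\<close>

lemma AE_circ_sin_half: "AE t in circ. sin (t/2) \<noteq> 0"
proof -
  have "AE t in lborel. t \<noteq> 0 \<and> t \<noteq> 2*pi"
    using AE_lborel_singleton[of "0::real"] AE_lborel_singleton[of "2*pi"] by eventually_elim auto
  then have "AE t in lborel. t \<in> {0..2*pi} \<longrightarrow> sin (t/2) \<noteq> 0"
  proof eventually_elim
    case (elim t)
    then show ?case using sin_gt_zero[of "t/2"] by auto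
  qed
  then show ?thesis unfolding circ_def by (simp add: AE_restrict_space_iff)
qed

subsection \<open>Periodic functions\<close>

definition periodic :: "(real \<Rightarrow> 'a) \<Rightarrow> bool" where
  "periodic f \<longleftrightarrow> (\<forall>t. f (t + 2*pi) = f t)"

lemma periodicD: "periodic f \<Longrightarrow> f (t + 2*pi) = f t"
  by (simp add: periodic_def)

lemma periodic_nat: "periodic f \<Longrightarrow> f (t + 2*pi*real n) = f t"
proof (induction n)
  case (Suc n)
  have "t + 2*pi*real (Suc n) = (t + 2*pi*real n) + 2*pi" by (simp add: algebra_simps)
  then show ?case using Suc by (simp only: periodicD)
qed simp

lemma periodic_int:
  assumes "periodic f" shows "f (t + 2*pi * of_int k) = f t"
proof (cases "k \<ge> 0")
  case True
  then show ?thesis using periodic_nat[OF assms, of t "nat k"] by simp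
next
  case False
  then show ?thesis using periodic_nat[OF assms, of "t + 2*pi * of_int k" "nat (-k)"] by simp
qed

text \<open>Representative modulo 2 pi in [0, 2 pi). Periodic functions factor through it, which
  reduces statements about all of them to one about an image measure of \<open>circ\<close>.\<close>

definition wrap :: "real \<Rightarrow> real" where
  "wrap t = t - 2*pi * of_int \<lfloor>t/(2*pi)\<rfloor>"

lemma wrap_measurable [measurable]: "wrap \<in> borel_measurable borel"
  proof -
  have "(\<lambda>t. real_of_int \<lfloor>t/(2*pi)\<rfloor>) \<in> borel_measurable borel"
    by (rule measurable_compose[OF _ borel_measurable_real_floor]) simp
  then show ?thesis unfolding wrap_def by simp
qed

lemma periodic_wrap: "periodic f \<Longrightarrow> f (wrap t) = f t"
  using periodic_int[of f t "- \<lfloor>t/(2*pi)\<rfloor>"] by (simp add: wrap_def)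

lemma wrap_range: "0 \<le> wrap t" "wrap t < 2*pi"
proof -
  have "of_int \<lfloor>t/(2*pi)\<rfloor> \<le> t/(2*pi)" "t/(2*pi) < of_int \<lfloor>t/(2*pi)\<rfloor> + 1" by linarith+
  then show "0 \<le> wrap t" "wrap t < 2*pi"
    unfolding wrap_def using mult_left_mono[of "of_int \<lfloor>t/(2*pi)\<rfloor>" "t/(2*pi)" "2*pi"]
      mult_strict_left_mono[of "t/(2*pi)" "of_int \<lfloor>t/(2*pi)\<rfloor> + 1" "2*pi"]
    by (simp_all add: algebra_simps)
qed

lemma periodic_wrap_self: "periodic wrap"
proof -
  have "(t + 2*pi)/(2*pi) = t/(2*pi) + 1" for t by (simp add: field_simps)
  then have "\<lfloor>(t + 2*pi)/(2*pi)\<rfloor> = \<lfloor>t/(2*pi)\<rfloor> + 1" for t by simp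
  then show ?thesis by (simp add: periodic_def wrap_def algebra_simps)
qed

text \<open>The shift is reduced to u in [0, 2 pi); the part of [u, u + 2 pi] beyond 2 pi is moved
  back by one period and fills the gap [0, u].\<close>

lemma nn_integral_periodic_shift:
  assumes f[measurable]: "f \<in> borel_measurable borel" and per: "periodic f"
  shows "(\<integral>\<^sup>+t. f (t + s) \<partial>circ) = (\<integral>\<^sup>+t. f t \<partial>circ)"
proof -
  define u where "u = wrap s"
  have u: "0 \<le> u" "u < 2*pi" using wrap_range u_def by auto
  have fs: "f (t + s) = f (t + u)" for t
    using periodic_int[OF per, of "t + s" "- \<lfloor>s/(2*pi)\<rfloor>"] by (simp add: u_def wrap_def add_diff_eq)
  have sh: "(\<integral>\<^sup>+t. f t * indicator {a..b} t \<partial>lborel) = (\<integral>\<^sup>+t. f (t + c) * indicator {a-c..b-c} t \<partial>lborel)" for a b c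
  proof -
    have "(\<integral>\<^sup>+t. f t * indicator {a..b} t \<partial>lborel) = (\<integral>\<^sup>+t. f (c + 1 * t) * indicator {a..b} (c + 1 * t) \<partial>lborel)"
      by (subst nn_integral_real_affine[where c=1 and t=c]) auto
    also have "\<dots> = (\<integral>\<^sup>+t. f (t + c) * indicator {a-c..b-c} t \<partial>lborel)"
      by (rule nn_integral_cong) (auto simp: indicator_def algebra_simps)
    finally show ?thesis .
  qed
  \<comment> \<open>The two closed intervals on the right overlap in the point b, which is a null
    set.\<close>
  have split: "(\<integral>\<^sup>+t. f t * indicator {a..c} t \<partial>lborel) = (\<integral>\<^sup>+t. f t * indicator {a..b} t \<partial>lborel) + (\<integral>\<^sup>+t. f t * indicator {b..c} t \<partial>lborel)"
    if "a \<le> b" "b \<le> c" for a b c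
  proof -
    have "(\<integral>\<^sup>+t. f t * indicator {a..c} t \<partial>lborel) = (\<integral>\<^sup>+t. f t * indicator {a..b} t + f t * indicator {b..c} t \<partial>lborel)"
    proof (rule nn_integral_cong_AE)
      show "AE t in lborel. f t * indicator {a..c} t = f t * indicator {a..b} t + f t * indicator {b..c} t"
        using AE_lborel_singleton[of b] by eventually_elim (use that in \<open>auto simp: indicator_def\<close>)
    qed
    then show ?thesis by (simp add: nn_integral_add)
  qed
  have "(\<integral>\<^sup>+t. f (t + s) \<partial>circ) = (\<integral>\<^sup>+t. f (t + u) * indicator {0..2*pi} t \<partial>lborel)"
    by (simp add: fs nn_integral_circ)
  also have "\<dots> = (\<integral>\<^sup>+t. f t * indicator {u..u + 2*pi} t \<partial>lborel)"
    using sh[of u "u+2*pi" u] by simp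
  also have "\<dots> = (\<integral>\<^sup>+t. f t * indicator {u..2*pi} t \<partial>lborel) + (\<integral>\<^sup>+t. f t * indicator {2*pi..u + 2*pi} t \<partial>lborel)"
    using u by (intro split) auto
  also have "(\<integral>\<^sup>+t. f t * indicator {2*pi..u + 2*pi} t \<partial>lborel) = (\<integral>\<^sup>+t. f t * indicator {0..u} t \<partial>lborel)"
    using sh[of "2*pi" "u+2*pi" "2*pi"] by (simp add: periodicD[OF per])
  also have "(\<integral>\<^sup>+t. f t * indicator {u..2*pi} t \<partial>lborel) + (\<integral>\<^sup>+t. f t * indicator {0..u} t \<partial>lborel) = (\<integral>\<^sup>+t. f t * indicator {0..2*pi} t \<partial>lborel)"
    using split[of 0 u "2*pi"] u by (simp add: add.commute)
  finally show ?thesis by (simp add: nn_integral_circ)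
qed

text \<open>Translation invariance phrased as an identity of measures, so that it passes from
  nonnegative functions to Bochner integrals and to integrability.\<close>

lemma distr_wrap_shift: "distr circ borel (\<lambda>t. wrap (t + s)) = distr circ borel wrap"
proof (rule measure_eqI)
  fix A :: "real set" assume "A \<in> sets (distr circ borel (\<lambda>t. wrap (t + s)))"
  then have A[measurable]: "A \<in> sets borel" by simp
  have "emeasure (distr circ borel (\<lambda>t. wrap (t + s))) A = (\<integral>\<^sup>+t. indicator A (wrap (t + s)) \<partial>circ)"
    by (subst nn_integral_indicator[symmetric], simp, subst nn_integral_distr) auto
  also have "\<dots> = (\<integral>\<^sup>+t. indicator A (wrap t) \<partial>circ)"
    by (rule nn_integral_periodic_shift) (use periodic_wrap_self in \<open>auto simp: periodic_def\<close>)
  also have "\<dots> = emeasure (distr circ borel wrap) A"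
    by (subst nn_integral_indicator[of A "distr circ borel wrap", symmetric], simp, subst nn_integral_distr) auto
  finally show "emeasure (distr circ borel (\<lambda>t. wrap (t + s))) A = emeasure (distr circ borel wrap) A" .
qed simp

lemma
  fixes f :: "real \<Rightarrow> 'a::{banach,second_countable_topology}"
  assumes f[measurable]: "f \<in> borel_measurable borel" and per: "periodic f"
  shows integral_periodic_shift: "(\<integral>t. f (t + s) \<partial>circ) = (\<integral>t. f t \<partial>circ)"
    and integrable_periodic_shift: "integrable circ (\<lambda>t. f (t + s)) \<longleftrightarrow> integrable circ f"
proof -
  have m: "(\<lambda>t. wrap (t + s)) \<in> measurable circ borel" "wrap \<in> measurable circ borel" by measurable
  have "(\<integral>t. f (t + s) \<partial>circ) = (\<integral>t. f (wrap (t + s)) \<partial>circ)" by (simp add: periodic_wrap[OF per])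
  also have "\<dots> = (\<integral>t. f t \<partial>distr circ borel (\<lambda>t. wrap (t + s)))" by (rule integral_distr[symmetric]) (use m in auto)
  also have "\<dots> = (\<integral>t. f t \<partial>distr circ borel wrap)" by (simp only: distr_wrap_shift)
  also have "\<dots> = (\<integral>t. f (wrap t) \<partial>circ)" by (rule integral_distr) (use m in auto)
  finally show "(\<integral>t. f (t + s) \<partial>circ) = (\<integral>t. f t \<partial>circ)" by (simp add: periodic_wrap[OF per])
  have "integrable circ (\<lambda>t. f (t + s)) \<longleftrightarrow> integrable circ (\<lambda>t. f (wrap (t + s)))" by (simp add: periodic_wrap[OF per])
  also have "\<dots> \<longleftrightarrow> integrable (distr circ borel (\<lambda>t. wrap (t + s))) f" by (rule integrable_distr_eq[symmetric]) (use m in auto)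
  also have "\<dots> \<longleftrightarrow> integrable (distr circ borel wrap) f" by (simp only: distr_wrap_shift)
  also have "\<dots> \<longleftrightarrow> integrable circ (\<lambda>t. f (wrap t))" by (rule integrable_distr_eq) (use m in auto)
  finally show "integrable circ (\<lambda>t. f (t + s)) \<longleftrightarrow> integrable circ f" by (simp add: periodic_wrap[OF per])
qed

lemma cot_measurable [measurable]: "(cot :: real \<Rightarrow> real) \<in> borel_measurable borel"
  unfolding cot_def[abs_def] by measurable

lemma cis_measurable [measurable]: "cis \<in> borel_measurable borel"
  by (intro borel_measurable_continuous_onI continuous_intros)

lemma periodic_cis: "periodic (\<lambda>t. cis (of_int n * t))"
proof -
  have "cis (of_int n * (t + 2*pi)) = cis (of_int n * t) * cis (2 * pi * of_int n)" for t
    by (simp add: cis_mult algebra_simps)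
  moreover have "cis (2 * pi * of_int n) = 1"
    by (rule cis_multiple_2pi) simp
  ultimately show ?thesis by (simp add: periodic_def)
qed

lemma integrable_cis [simp]: "integrable circ (\<lambda>t. cis (r * t))"
  by (rule integrable_circ_bounded[where B=1]) auto

lemma integral_cis: "(\<integral>t. cis (of_int n * t) \<partial>circ) = (if n = 0 then 2*pi else 0)"
proof (cases "n = 0")
  case True
  then show ?thesis by (simp add: measure_circ scaleR_conv_of_real)
next
  case False
  have "((\<lambda>t. cis (of_int n * t) / (\<i> * of_int n)) has_vector_derivative cis (of_int n * t)) (at t)" for t
  proof -
    have "((\<lambda>t. cis (of_int n * t)) has_vector_derivative of_int n *\<^sub>R (\<i> * cis (of_int n * t))) (at t)"
      by (rule vector_diff_chain_at[unfolded o_def, where g=cis and g'="\<i> * cis (of_int n * t)"])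
         (auto intro!: derivative_eq_intros simp: has_vector_derivative_def cis_conv_exp scaleR_conv_of_real
            has_real_derivative_iff_has_vector_derivative[symmetric] algebra_simps)
    from has_vector_derivative_divide[OF this, of "\<i> * of_int n"]
    show ?thesis using False by (simp add: scaleR_conv_of_real)
  qed
  from integral_circ_FTC[OF this] have "(\<integral>t. cis (of_int n * t) \<partial>circ) = cis (of_int n * (2*pi)) / (\<i> * of_int n) - 1 / (\<i> * of_int n)"
    by (simp add: continuous_intros)
  moreover have "cis (of_int n * (2*pi)) = 1" using periodicD[OF periodic_cis, of n 0] by simp
  ultimately show ?thesis using False by simp
qed

subsection \<open>Square integrable functions and Bessel's identity\<close>

definition L2 :: "(real \<Rightarrow> complex) \<Rightarrow> bool" where
  "L2 f \<longleftrightarrow> f \<in> borel_measurable borel \<and> periodic f \<and> integrable circ (\<lambda>t. (cmod (f t))\<^sup>2)"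

definition l2_sq :: "(real \<Rightarrow> complex) \<Rightarrow> real" where
  "l2_sq f = (\<integral>t. (cmod (f t))\<^sup>2 \<partial>circ)"

definition fourier :: "(real \<Rightarrow> complex) \<Rightarrow> int \<Rightarrow> complex" where
  "fourier f n = (\<integral>t. f t * cis (- (of_int n * t)) \<partial>circ) / (2*pi)"

definition trig :: "int set \<Rightarrow> (int \<Rightarrow> complex) \<Rightarrow> real \<Rightarrow> complex" where
  "trig J d t = (\<Sum>n\<in>J. d n * cis (of_int n * t))"

lemma L2_measurable [measurable_dest]: "L2 f \<Longrightarrow> f \<in> borel_measurable borel"
  and L2_periodic: "L2 f \<Longrightarrow> periodic f"
  and L2_sq: "L2 f \<Longrightarrow> integrable circ (\<lambda>t. (cmod (f t))\<^sup>2)"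
  by (auto simp: L2_def)

lemma mult_le_sum_squares: "a * b \<le> a\<^sup>2 + (b::real)\<^sup>2"
  using sum_squares_bound[of a b] zero_le_power2[of a] zero_le_power2[of b] by linarith

lemma cmod_add_sq_le: "(cmod (x + y))\<^sup>2 \<le> 2 * (cmod x)\<^sup>2 + 2 * (cmod y)\<^sup>2"
proof -
  have "(cmod (x + y))\<^sup>2 \<le> (cmod x + cmod y)\<^sup>2" by (intro power_mono norm_triangle_ineq) auto
  also have "\<dots> \<le> 2 * (cmod x)\<^sup>2 + 2 * (cmod y)\<^sup>2"
    using sum_squares_bound[of "cmod x" "cmod y"] by (simp add: power2_sum)
  finally show ?thesis .
qed

lemma cmod_diff_sq_le: "(cmod (x - y))\<^sup>2 \<le> 2 * (cmod x)\<^sup>2 + 2 * (cmod y)\<^sup>2"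
  using cmod_add_sq_le[of x "-y"] by simp

lemma L2_add: assumes "L2 f" "L2 g" shows "L2 (\<lambda>t. f t + g t)"
proof -
  have [measurable]: "f \<in> borel_measurable borel" "g \<in> borel_measurable borel"
    using assms by (auto dest: L2_measurable)
  have "integrable circ (\<lambda>t. (cmod (f t + g t))\<^sup>2)"
    by (rule Bochner_Integration.integrable_bound[where f="\<lambda>t. 2 * (cmod (f t))\<^sup>2 + 2 * (cmod (g t))\<^sup>2"])
       (use assms cmod_add_sq_le in \<open>auto simp: L2_sq intro!: AE_I2 Bochner_Integration.integrable_add integrable_mult_right\<close>)
  then show ?thesis using assms by (auto simp: L2_def periodic_def)
qed

lemma L2_cmult: "L2 f \<Longrightarrow> L2 (\<lambda>t. c * f t)"
  by (auto simp: L2_def periodic_def norm_mult power_mult_distrib)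

lemma L2_diff: assumes "L2 f" "L2 g" shows "L2 (\<lambda>t. f t - g t)"
  using L2_add[OF assms(1) L2_cmult[OF assms(2), of "-1"]] by simp

lemma L2_bounded:
  assumes [measurable]: "f \<in> borel_measurable borel" and "periodic f" and "\<And>t. cmod (f t) \<le> B"
  shows "L2 f"
  using assms by (auto simp: L2_def intro!: integrable_circ_bounded[where B="B\<^sup>2"] power_mono)

lemma L2_cis: "L2 (\<lambda>t. cis (of_int n * t))"
  by (rule L2_bounded[where B=1]) (auto simp: periodic_cis)

lemma L2_trig: "L2 (trig J d)"
proof (induction J rule: infinite_finite_induct)
  case (insert n J)
  have "trig (insert n J) d = (\<lambda>t. d n * cis (of_int n * t) + trig J d t)"
    using insert by (auto simp: trig_def)
  then show ?case using insert L2_add L2_cmult L2_cis by metis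
qed (auto simp: trig_def[abs_def] L2_def periodic_def)

lemma L2_shift: assumes "L2 f" shows "L2 (\<lambda>t. f (t + s))"
proof -
  have [measurable]: "f \<in> borel_measurable borel" using assms by (auto dest: L2_measurable)
  have "integrable circ (\<lambda>t. (cmod (f (t + s)))\<^sup>2)"
    using integrable_periodic_shift[of "\<lambda>t. (cmod (f t))\<^sup>2" s] assms by (auto simp: L2_def periodic_def)
  moreover have "periodic (\<lambda>t. f (t + s))"
    unfolding periodic_def using assms
    by (metis L2_periodic periodicD add.assoc add.commute)
  ultimately show ?thesis by (auto simp: L2_def)
qed

lemma l2_sq_shift: assumes "L2 f" shows "l2_sq (\<lambda>t. f (t + s)) = l2_sq f"
  unfolding l2_sq_def using integral_periodic_shift[of "\<lambda>t. (cmod (f t))\<^sup>2" s] assms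
  by (auto simp: L2_def periodic_def)

lemma l2_sq_nonneg [simp]: "l2_sq f \<ge> 0"
  by (simp add: l2_sq_def)

lemma L2_mult: assumes "L2 f" "L2 g" shows "integrable circ (\<lambda>t. f t * cnj (g t))"
proof -
  have [measurable]: "f \<in> borel_measurable borel" "g \<in> borel_measurable borel"
    using assms by (auto dest: L2_measurable)
  have b: "cmod (f t) * cmod (g t) \<le> (cmod (f t))\<^sup>2 + (cmod (g t))\<^sup>2" for t
    by (rule mult_le_sum_squares)
  have [measurable]: "(\<lambda>t. cnj (g t)) \<in> borel_measurable circ"
    by (rule borel_measurable_continuous_on[of cnj, unfolded o_def]) (auto intro: continuous_intros)
  show ?thesis
    by (rule Bochner_Integration.integrable_bound[where f="\<lambda>t. (cmod (f t))\<^sup>2 + (cmod (g t))\<^sup>2"])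
       (use assms b in \<open>auto simp: L2_sq norm_mult intro!: AE_I2 Bochner_Integration.integrable_add\<close>)
qed

lemma integrable_fourier: assumes "L2 f" shows "integrable circ (\<lambda>t. f t * cis (- (of_int n * t)))"
  using L2_mult[OF assms L2_cis, of n] by (simp add: cis_cnj)

lemma fourier_add: "L2 f \<Longrightarrow> L2 g \<Longrightarrow> fourier (\<lambda>t. f t + g t) n = fourier f n + fourier g n"
  by (simp add: fourier_def distrib_right integrable_fourier add_divide_distrib)

lemma fourier_diff: "L2 f \<Longrightarrow> L2 g \<Longrightarrow> fourier (\<lambda>t. f t - g t) n = fourier f n - fourier g n"
  by (simp add: fourier_def left_diff_distrib integrable_fourier diff_divide_distrib)

lemma fourier_cmult: "fourier (\<lambda>t. c * f t) n = c * fourier f n"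
  by (simp add: fourier_def mult.assoc)

lemma fourier_cis: "fourier (\<lambda>t. cis (of_int m * t)) n = (if n = m then 1 else 0)"
proof -
  have "(\<integral>t. cis (of_int m * t) * cis (- (of_int n * t)) \<partial>circ) = (\<integral>t. cis (of_int (m - n) * t) \<partial>circ)"
    by (simp add: cis_mult left_diff_distrib)
  then show ?thesis using integral_cis[of "m - n"] by (simp add: fourier_def)
qed

lemma fourier_trig: "finite J \<Longrightarrow> fourier (trig J d) n = (if n \<in> J then d n else 0)"
proof (induction J rule: finite_induct)
  case (insert m J)
  have "trig (insert m J) d = (\<lambda>t. d m * cis (of_int m * t) + trig J d t)"
    using insert by (auto simp: trig_def)
  then have "fourier (trig (insert m J) d) n = fourier (\<lambda>t. d m * cis (of_int m * t)) n + fourier (trig J d) n"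
    by (simp only: fourier_add[OF L2_cmult[OF L2_cis] L2_trig])
  then show ?case using insert by (auto simp: fourier_cmult fourier_cis)
qed (simp add: trig_def[abs_def] fourier_def)

lemma fourier_shift: assumes "L2 f" shows "fourier (\<lambda>t. f (t + s)) n = cis (of_int n * s) * fourier f n"
proof -
  have [measurable]: "f \<in> borel_measurable borel" using assms by (auto dest: L2_measurable)
  have per: "periodic (\<lambda>t. f t * cis (- (of_int n * t)))"
    using L2_periodic[OF assms] periodic_cis[of "-n"] by (simp add: periodic_def)
  have "(\<integral>t. f (t + s) * cis (- (of_int n * t)) \<partial>circ) = (\<integral>t. cis (of_int n * s) * (f (t + s) * cis (- (of_int n * (t + s)))) \<partial>circ)"
    by (rule Bochner_Integration.integral_cong) (auto simp: cis_mult algebra_simps cis_divide[symmetric] simp flip: cis_inverse)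
  also have "\<dots> = cis (of_int n * s) * (\<integral>t. f t * cis (- (of_int n * t)) \<partial>circ)"
    using integral_periodic_shift[OF _ per, of s] by simp
  finally show ?thesis by (simp add: fourier_def)
qed

lemma cmod_diff_sq: "(cmod (x - y))\<^sup>2 = (cmod x)\<^sup>2 + (cmod y)\<^sup>2 - 2 * Re (x * cnj y)"
  unfolding cmod_power2 by (simp add: power2_eq_square algebra_simps)

lemma l2_sq_diff:
  assumes "L2 f" "L2 g"
  shows "l2_sq (\<lambda>t. f t - g t) = l2_sq f + l2_sq g - 2 * Re (\<integral>t. f t * cnj (g t) \<partial>circ)"
  using assms unfolding l2_sq_def cmod_diff_sq
  by (simp del: complex_cnj_mult times_complex.sel add: L2_sq L2_mult integral_Re integrable_Re)

lemma integral_mult_cnj_trig: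
  assumes "L2 f" "finite J"
  shows "(\<integral>t. f t * cnj (trig J d t) \<partial>circ) = 2*pi * (\<Sum>n\<in>J. cnj (d n) * fourier f n)"
proof -
  have "(\<integral>t. f t * cnj (trig J d t) \<partial>circ) = (\<integral>t. (\<Sum>n\<in>J. cnj (d n) * (f t * cis (- (of_int n * t)))) \<partial>circ)"
    by (simp add: trig_def sum_distrib_left cis_cnj mult_ac)
  also have "\<dots> = (\<Sum>n\<in>J. cnj (d n) * (\<integral>t. f t * cis (- (of_int n * t)) \<partial>circ))"
    by (subst Bochner_Integration.integral_sum) (auto intro!: integrable_fourier assms)
  also have "\<dots> = 2*pi * (\<Sum>n\<in>J. cnj (d n) * fourier f n)"
    by (simp add: fourier_def sum_distrib_left)
  finally show ?thesis .
qed

lemma cmod_sq_cnj: "(complex_of_real (cmod z))\<^sup>2 = z * cnj z"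
  by (metis complex_norm_square of_real_power)

lemma l2_sq_trig: assumes "finite J" shows "l2_sq (trig J d) = 2*pi * (\<Sum>n\<in>J. (cmod (d n))\<^sup>2)"
proof -
  have "complex_of_real (l2_sq (trig J d)) = (\<integral>t. trig J d t * cnj (trig J d t) \<partial>circ)"
    unfolding l2_sq_def by (subst integral_complex_of_real[symmetric]) (simp add: cmod_sq_cnj)
  also have "\<dots> = complex_of_real (2*pi * (\<Sum>n\<in>J. (cmod (d n))\<^sup>2))"
    using assms by (simp add: integral_mult_cnj_trig L2_trig fourier_trig cmod_sq_cnj mult.commute)
  finally show ?thesis by (simp only: of_real_eq_iff)
qed

text \<open>The Fourier partial sum is the orthogonal projection of f. As an identity this yields
  Bessel's inequality now and, together with Parseval, mean square convergence later.\<close>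

lemma bessel_eq:
  assumes "L2 f" "finite J"
  shows "l2_sq (\<lambda>t. f t - trig J (fourier f) t) = l2_sq f - 2*pi * (\<Sum>n\<in>J. (cmod (fourier f n))\<^sup>2)"
proof -
  have "(\<integral>t. f t * cnj (trig J (fourier f) t) \<partial>circ) = complex_of_real (2*pi * (\<Sum>n\<in>J. (cmod (fourier f n))\<^sup>2))"
    using assms by (simp add: integral_mult_cnj_trig cmod_sq_cnj mult.commute)
  then have "Re (\<integral>t. f t * cnj (trig J (fourier f) t) \<partial>circ) = 2*pi * (\<Sum>n\<in>J. (cmod (fourier f n))\<^sup>2)"
    by (simp only: Re_complex_of_real)
  then show ?thesis using assms by (simp add: l2_sq_diff L2_trig l2_sq_trig)
qed

lemma bessel: "L2 f \<Longrightarrow> finite J \<Longrightarrow> 2*pi * (\<Sum>n\<in>J. (cmod (fourier f n))\<^sup>2) \<le> l2_sq f"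
  using bessel_eq[of f J] l2_sq_nonneg[of "\<lambda>t. f t - trig J (fourier f) t"] by linarith

subsection \<open>Sobolev functions of order one sobolev_half and Parseval's identity\<close>

text \<open>Squared mean square modulus of continuity. Integrating over the base point first turns
  the Gagliardo double integral into a single integral in the shift s.\<close>

definition diffsq :: "(real \<Rightarrow> complex) \<Rightarrow> real \<Rightarrow> real" where
  "diffsq f s = l2_sq (\<lambda>t. f (t + s) - f t)"

definition sobolev_half :: "(real \<Rightarrow> complex) \<Rightarrow> bool" where
  "sobolev_half f \<longleftrightarrow> L2 f \<and> integrable circ (\<lambda>s. diffsq f s / (4 * (sin (s/2))\<^sup>2))"

text \<open>The denominator is the squared chord \<open>|e\<^sup>i\<^sup>(\<^sup>t\<^sup>+\<^sup>s\<^sup>) - e\<^sup>i\<^sup>t|\<^sup>2\<close>.\<close>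

definition gagliardo :: "(real \<Rightarrow> complex) \<Rightarrow> real" where
  "gagliardo f = (\<integral>s. diffsq f s / (4 * (sin (s/2))\<^sup>2) \<partial>circ)"

text \<open>The autocorrelation has value \<open>l2_sq f\<close> at 0 and its Fourier integrals are
  multiples of the numbers |fourier f m|^2. Parseval's identity thus becomes summability of its
  Fourier series at the single point 0.\<close>

definition autocorr :: "(real \<Rightarrow> complex) \<Rightarrow> real \<Rightarrow> complex" where
  "autocorr f s = (\<integral>t. f (t + s) * cnj (f t) \<partial>circ)"

lemma cnj_measurable [measurable (raw)]:
  "f \<in> borel_measurable M \<Longrightarrow> (\<lambda>x. cnj (f x)) \<in> borel_measurable M"
  by (rule borel_measurable_continuous_on[of cnj, unfolded o_def]) (auto intro: continuous_intros)

lemma diffsq_measurable [measurable]: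
  assumes [measurable]: "f \<in> borel_measurable borel" shows "diffsq f \<in> borel_measurable borel"
  unfolding diffsq_def l2_sq_def by measurable

lemma autocorr_measurable [measurable]:
  assumes [measurable]: "f \<in> borel_measurable borel" shows "autocorr f \<in> borel_measurable borel"
  unfolding autocorr_def by measurable

lemma diffsq_nonneg [simp]: "diffsq f s \<ge> 0" by (simp add: diffsq_def)

lemma diffsq_autocorr: assumes "L2 f" shows "diffsq f s = 2 * l2_sq f - 2 * Re (autocorr f s)"
  unfolding diffsq_def autocorr_def using l2_sq_diff[OF L2_shift[OF assms, of s] assms] l2_sq_shift[OF assms, of s]
  by simp

text \<open>By Fubini the integral over s produces the coefficient of a translate of f, namely
  \<open>cis (of_int m * t) * fourier f m\<close>; the remaining integral over t is the conjugate
  coefficient.\<close>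

lemma integral_autocorr:
  assumes f: "L2 f"
  shows "(\<integral>s. autocorr f s * cis (- (of_int m * s)) \<partial>circ) = complex_of_real ((2*pi)\<^sup>2 * (cmod (fourier f m))\<^sup>2)"
    and "integrable circ (\<lambda>s. autocorr f s * cis (- (of_int m * s)))"
proof -
  have [measurable]: "f \<in> borel_measurable borel" using f by (auto dest: L2_measurable)
  define F where "F = (\<lambda>(s, t). f (t + s) * cnj (f t) * cis (- (of_int m * s)))"
  have Fm[measurable]: "F \<in> borel_measurable (circ \<Otimes>\<^sub>M circ)" unfolding F_def by measurable
  have i1: "integrable circ (\<lambda>t. f (t + s) * cnj (f t))" for s by (intro L2_mult L2_shift f)
  \<comment> \<open>A bound uniform in s supplies the integrability that Fubini's theorem asks
    for.\<close>
  have b: "(\<integral>t. cmod (f (t + s)) * cmod (f t) \<partial>circ) \<le> 2 * l2_sq f" for s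
  proof -
    have "(\<integral>t. cmod (f (t + s)) * cmod (f t) \<partial>circ) \<le> (\<integral>t. (cmod (f (t + s)))\<^sup>2 + (cmod (f t))\<^sup>2 \<partial>circ)"
    proof (rule integral_mono)
      show "integrable circ (\<lambda>t. cmod (f (t + s)) * cmod (f t))" using integrable_norm[OF i1[of s]] by (simp add: norm_mult)
      show "cmod (f (t + s)) * cmod (f t) \<le> (cmod (f (t + s)))\<^sup>2 + (cmod (f t))\<^sup>2" for t
        by (rule mult_le_sum_squares)
    qed (intro Bochner_Integration.integrable_add L2_sq f L2_shift)
    also have "\<dots> = l2_sq (\<lambda>t. f (t + s)) + l2_sq f"
      unfolding l2_sq_def by (intro Bochner_Integration.integral_add L2_sq f L2_shift)
    finally show ?thesis by (simp add: l2_sq_shift[OF f])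
  qed
  have int: "integrable (circ \<Otimes>\<^sub>M circ) F"
  proof (rule circ_circ.Fubini_integrable[OF Fm])
    show "integrable circ (\<lambda>s. \<integral>t. norm (F (s, t)) \<partial>circ)"
      unfolding F_def
      by (rule integrable_circ_bounded[where B="2 * l2_sq f"]) (use b in \<open>auto simp: norm_mult\<close>)
    show "AE s in circ. integrable circ (\<lambda>t. F (s, t))"
      unfolding F_def using i1 by auto
  qed
  have e1: "(\<integral>t. F (s, t) \<partial>circ) = autocorr f s * cis (- (of_int m * s))" for s
    unfolding F_def autocorr_def by simp
  have "(\<integral>s. (\<integral>t. F (s, t) \<partial>circ) \<partial>circ) = (\<integral>t. (\<integral>s. F (s, t) \<partial>circ) \<partial>circ)"
    using circ_circ.Fubini_integral[of "\<lambda>s t. F (s, t)"] int by simp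
  also have "\<dots> = (\<integral>t. (2*pi * fourier f m) * cnj (f t * cis (- (of_int m * t))) \<partial>circ)"
  proof (rule Bochner_Integration.integral_cong[OF refl])
    fix t
    have "(\<integral>s. F (s, t) \<partial>circ) = (\<integral>s. cnj (f t) * (f (s + t) * cis (- (of_int m * s))) \<partial>circ)"
      unfolding F_def by (simp add: mult_ac add.commute)
    also have "\<dots> = cnj (f t) * (2*pi * (cis (of_int m * t) * fourier f m))"
      using fourier_shift[OF f, of t m] by (simp add: fourier_def field_simps)
    finally show "(\<integral>s. F (s, t) \<partial>circ) = (2*pi * fourier f m) * cnj (f t * cis (- (of_int m * t)))"
      by (simp add: cis_cnj mult_ac)
  qed
  also have "\<dots> = (2*pi * fourier f m) * cnj (\<integral>t. f t * cis (- (of_int m * t)) \<partial>circ)"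
    by (simp only: integral_mult_right_zero integral_bounded_linear[OF bounded_linear_cnj integrable_fourier[OF f]])
  also have "\<dots> = (2*pi * fourier f m) * cnj (2*pi * fourier f m)"
    by (simp add: fourier_def)
  also have "\<dots> = complex_of_real ((2*pi)\<^sup>2 * (cmod (fourier f m))\<^sup>2)"
    by (simp add: cmod_sq_cnj power_mult_distrib) (simp add: power2_eq_square mult_ac)
  finally show "(\<integral>s. autocorr f s * cis (- (of_int m * s)) \<partial>circ) = complex_of_real ((2*pi)\<^sup>2 * (cmod (fourier f m))\<^sup>2)"
    by (simp only: e1)
  show "integrable circ (\<lambda>s. autocorr f s * cis (- (of_int m * s)))"
    using circ_circ.integrable_fst[OF int[unfolded F_def]] e1 unfolding F_def by simp
qed

lemma cmod_cis_minus_1: "(cmod (cis t - 1))\<^sup>2 = 4 * (sin (t/2))\<^sup>2"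
proof -
  have "cos t = 1 - 2 * (sin (t/2))\<^sup>2" using cos_double_sin[of "t/2"] by simp
  then show ?thesis using sin_cos_squared_add[of t] unfolding cmod_power2
    by (simp add: power2_eq_square algebra_simps)
qed

text \<open>The squared modulus of the geometric sum is N times Fejer's kernel. The closed form
  serves twice: as an upper bound in \<open>parseval\<close>, and in
  \<open>integral_cis_quotient\<close> to recognise a quotient as a trigonometric
  polynomial.\<close>

lemma cis_geometric: "(cmod (trig {0..<int N} (\<lambda>_. 1) t))\<^sup>2 * (4 * (sin (t/2))\<^sup>2) = (cmod (cis (real N * t) - 1))\<^sup>2"
proof -
  have "trig {0..<int N} (\<lambda>_. 1) t = (\<Sum>k<N. cis t ^ k)"
    unfolding trig_def
  proof (rule sum.reindex_bij_witness[where i=int and j=nat])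
    fix a assume "a \<in> {0..<int N}"
    then have "0 \<le> a" by simp
    then show "cis t ^ nat a = 1 * cis (of_int a * t)" by (simp only: Complex.DeMoivre of_nat_nat mult_1)
  qed auto
  then have "(cis t - 1) * trig {0..<int N} (\<lambda>_. 1) t = cis (real N * t) - 1"
    using power_diff_1_eq[of "cis t" N] by (simp add: Complex.DeMoivre)
  then have "(cmod (cis t - 1))\<^sup>2 * (cmod (trig {0..<int N} (\<lambda>_. 1) t))\<^sup>2 = (cmod (cis (real N * t) - 1))\<^sup>2"
    by (metis norm_mult power_mult_distrib)
  then show ?thesis by (simp add: cmod_cis_minus_1 mult.commute)
qed

lemma fejer_expand:
  "(cmod (trig {0..<int N} (\<lambda>_. 1) t))\<^sup>2 = Re (\<Sum>j\<in>{0..<int N}. \<Sum>k\<in>{0..<int N}. cis (- (of_int (j - k) * t)))"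
proof -
  have "complex_of_real ((cmod (trig {0..<int N} (\<lambda>_. 1) t))\<^sup>2) = cnj (trig {0..<int N} (\<lambda>_. 1) t) * trig {0..<int N} (\<lambda>_. 1) t"
    by (simp add: cmod_sq_cnj mult.commute)
  also have "\<dots> = (\<Sum>j\<in>{0..<int N}. \<Sum>k\<in>{0..<int N}. cis (- (of_int (j - k) * t)))"
    unfolding trig_def by (simp add: sum_product cis_cnj cis_mult left_diff_distrib)
  finally show ?thesis by (metis Re_complex_of_real)
qed

lemma sobolev_half_L2: "sobolev_half f \<Longrightarrow> L2 f"
  and sobolev_half_int: "sobolev_half f \<Longrightarrow> integrable circ (\<lambda>s. diffsq f s / (4 * (sin (s/2))\<^sup>2))"
  by (auto simp: sobolev_half_def)

lemma gagliardo_nonneg: "gagliardo f \<ge> 0" by (simp add: gagliardo_def)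

text \<open>Fejer's kernel is at most \<open>1 / (N sin\<^sup>2 (s/2))\<close>, so the Gagliardo integral
  controls the error of the Fejer means.\<close>

lemma parseval:
  assumes hf: "sobolev_half f"
  shows "(\<lambda>N. 2*pi * (\<Sum>n\<in>{-int N..int N}. (cmod (fourier f n))\<^sup>2)) \<longlonglongrightarrow> l2_sq f"
proof -
  have f: "L2 f" using hf by (rule sobolev_half_L2)
  have [measurable]: "f \<in> borel_measurable borel" using f by (rule L2_measurable)
  define s where "s N = (\<Sum>n\<in>{-int N..int N}. (cmod (fourier f n))\<^sup>2)" for N
  define K where "K N t = (cmod (trig {0..<int N} (\<lambda>_. 1) t))\<^sup>2" for N t
  have Km[measurable]: "K N \<in> borel_measurable borel" for N
    unfolding K_def[abs_def] trig_def by measurable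
  \<comment> \<open>The numerator of the kernel is at most 4, which gives a bound independent of N
    by four times the Gagliardo integrand.\<close>
  have K_le: "K N t * diffsq f t \<le> 4 * (diffsq f t / (4 * (sin (t/2))\<^sup>2))" if "sin (t/2) \<noteq> 0" for N t
  proof -
    have "K N t * (4 * (sin (t/2))\<^sup>2) = (cmod (cis (real N * t) - 1))\<^sup>2" unfolding K_def by (rule cis_geometric)
    also have "\<dots> \<le> 4" using cmod_diff_sq_le[of "cis (real N * t)" 1] by simp
    finally have "K N t \<le> 4 / (4 * (sin (t/2))\<^sup>2)" using that by (simp add: field_simps)
    from mult_right_mono[OF this diffsq_nonneg[of f t]] show ?thesis by simp
  qed
  have corrK: "integrable circ (\<lambda>t. Re (autocorr f t) * K N t)"
    and corrK_eq: "(\<integral>t. Re (autocorr f t) * K N t \<partial>circ) = (2*pi)\<^sup>2 * (\<Sum>j\<in>{0..<int N}. \<Sum>k\<in>{0..<int N}. (cmod (fourier f (j - k)))\<^sup>2)" for N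
  proof -
    have i: "integrable circ (\<lambda>t. \<Sum>j\<in>{0..<int N}. \<Sum>k\<in>{0..<int N}. autocorr f t * cis (- (of_int (j - k) * t)))"
      by (intro Bochner_Integration.integrable_sum integral_autocorr(2) f)
    \<comment> \<open>Exchanging j and k changes the sign of every sine. The double sum is therefore
      real, and taking the real part of its product with \<open>autocorr f t\<close> involves only
      the real part of the latter.\<close>
    have im: "Im (\<Sum>j\<in>{0..<int N}. \<Sum>k\<in>{0..<int N}. cis (- (of_int (j - k) * t))) = 0" for t
    proof -
      have "Im (\<Sum>j\<in>{0..<int N}. \<Sum>k\<in>{0..<int N}. cis (- (of_int (j - k) * t))) = - (\<Sum>j\<in>{0..<int N}. \<Sum>k\<in>{0..<int N}. sin (of_int (j - k) * t))"
        by (simp add: sum_negf)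
      moreover have "(\<Sum>j\<in>{0..<int N}. \<Sum>k\<in>{0..<int N}. sin (of_int (j - k) * t)) = (\<Sum>j\<in>{0..<int N}. \<Sum>k\<in>{0..<int N}. sin (of_int (k - j) * t))"
        by (rule sum.swap)
      moreover have "\<dots> = - (\<Sum>j\<in>{0..<int N}. \<Sum>k\<in>{0..<int N}. sin (of_int (j - k) * t))"
        by (simp add: sum_negf[symmetric] flip: sin_minus) (simp add: algebra_simps)
      ultimately show ?thesis by linarith
    qed
    have e: "Re (\<Sum>j\<in>{0..<int N}. \<Sum>k\<in>{0..<int N}. autocorr f t * cis (- (of_int (j - k) * t))) = Re (autocorr f t) * K N t" for t
      unfolding K_def fejer_expand
      using im[of t] by (simp only: sum_distrib_left[symmetric] times_complex.sel mult_zero_right diff_zero)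
    have "integrable circ (\<lambda>t. Re (\<Sum>j\<in>{0..<int N}. \<Sum>k\<in>{0..<int N}. autocorr f t * cis (- (of_int (j - k) * t))))"
      by (rule integrable_Re[OF i])
    then show "integrable circ (\<lambda>t. Re (autocorr f t) * K N t)" by (simp only: e)
    have "(\<integral>t. Re (autocorr f t) * K N t \<partial>circ) = Re (\<integral>t. (\<Sum>j\<in>{0..<int N}. \<Sum>k\<in>{0..<int N}. autocorr f t * cis (- (of_int (j - k) * t))) \<partial>circ)"
      unfolding e[symmetric] by (rule integral_Re[OF i])
    also have "(\<integral>t. (\<Sum>j\<in>{0..<int N}. \<Sum>k\<in>{0..<int N}. autocorr f t * cis (- (of_int (j - k) * t))) \<partial>circ)
        = (\<Sum>j\<in>{0..<int N}. \<Sum>k\<in>{0..<int N}. (\<integral>t. autocorr f t * cis (- (of_int (j - k) * t)) \<partial>circ))"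
      by (subst Bochner_Integration.integral_sum)
         (auto intro!: Bochner_Integration.integrable_sum integral_autocorr(2) f Bochner_Integration.integral_sum sum.cong simp del: of_int_diff)
    also have "\<dots> = complex_of_real ((2*pi)\<^sup>2 * (\<Sum>j\<in>{0..<int N}. \<Sum>k\<in>{0..<int N}. (cmod (fourier f (j - k)))\<^sup>2))"
      by (simp only: integral_autocorr(1)[OF f] of_real_sum of_real_mult sum_distrib_left)
    finally show "(\<integral>t. Re (autocorr f t) * K N t \<partial>circ) = (2*pi)\<^sup>2 * (\<Sum>j\<in>{0..<int N}. \<Sum>k\<in>{0..<int N}. (cmod (fourier f (j - k)))\<^sup>2)"
      by (simp only: Re_complex_of_real)
  qed
  have Kint: "(\<integral>t. K N t \<partial>circ) = 2*pi*real N" for N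
    using l2_sq_trig[of "{0..<int N}" "\<lambda>_. 1"] unfolding l2_sq_def K_def by simp
  have Kible: "integrable circ (K N)" for N
    using L2_sq[OF L2_trig] unfolding K_def by simp
  \<comment> \<open>For fixed j the differences j - k are distinct and lie in [-N, N], so each of
    the N rows is dominated by the symmetric partial sum.\<close>
  have sum_le: "(\<Sum>j\<in>{0..<int N}. \<Sum>k\<in>{0..<int N}. (cmod (fourier f (j - k)))\<^sup>2) \<le> real N * s N" for N
  proof -
    have "(\<Sum>k\<in>{0..<int N}. (cmod (fourier f (j - k)))\<^sup>2) \<le> s N" if "j \<in> {0..<int N}" for j
    proof -
      have "(\<Sum>k\<in>{0..<int N}. (cmod (fourier f (j - k)))\<^sup>2) = (\<Sum>n\<in>(\<lambda>k. j - k) ` {0..<int N}. (cmod (fourier f n))\<^sup>2)"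
        by (subst sum.reindex) (auto simp: inj_on_def)
      also have "\<dots> \<le> s N" unfolding s_def by (rule sum_mono2) (use that in auto)
      finally show ?thesis .
    qed
    from sum_bounded_above[of "{0..<int N}", OF this] show ?thesis by simp
  qed
  \<comment> \<open>Integrating \<open>diffsq f t = 2 * l2_sq f - 2 * Re (autocorr f t)\<close>
    against the kernel, whose mass is 2 pi N, while the left side stays below 4 times the Gagliardo
    integral, yields the rate 1/N.\<close>
  have main: "l2_sq f - 2*pi * s N \<le> (gagliardo f / pi) * (1 / real N)" if "N > 0" for N
  proof -
    have "diffsq f t * K N t = 2 * l2_sq f * K N t - 2 * (Re (autocorr f t) * K N t)" for t
      by (simp add: diffsq_autocorr[OF f] algebra_simps)
    then have "(\<integral>t. diffsq f t * K N t \<partial>circ) = 2 * l2_sq f * (2*pi*real N) - 2 * ((2*pi)\<^sup>2 * (\<Sum>j\<in>{0..<int N}. \<Sum>k\<in>{0..<int N}. (cmod (fourier f (j - k)))\<^sup>2))"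
      and ib: "integrable circ (\<lambda>t. diffsq f t * K N t)"
      using corrK[of N] Kible[of N] by (simp_all add: corrK_eq Kint)
    moreover have "(\<integral>t. diffsq f t * K N t \<partial>circ) \<le> 4 * gagliardo f"
    proof -
      have "(\<integral>t. diffsq f t * K N t \<partial>circ) \<le> (\<integral>t. 4 * (diffsq f t / (4 * (sin (t/2))\<^sup>2)) \<partial>circ)"
        by (rule integral_mono_AE[OF ib]) (use sobolev_half_int[OF hf] AE_circ_sin_half in \<open>auto elim!: eventually_mono simp: K_le mult.commute[of "diffsq f _" "K N _"] simp del: times_divide_eq_right\<close>)
      then show ?thesis by (simp only: gagliardo_def integral_mult_right_zero)
    qed
    moreover have "(2*pi)\<^sup>2 * (\<Sum>j\<in>{0..<int N}. \<Sum>k\<in>{0..<int N}. (cmod (fourier f (j - k)))\<^sup>2) \<le> (2*pi)\<^sup>2 * (real N * s N)"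
      by (rule mult_left_mono[OF sum_le]) simp
    ultimately have "2 * l2_sq f * (2*pi*real N) - 2 * ((2*pi)\<^sup>2 * (real N * s N)) \<le> 4 * gagliardo f"
      by linarith
    then have "(4*pi*real N) * (l2_sq f - 2*pi * s N) \<le> 4 * gagliardo f" by (simp add: power2_eq_square algebra_simps)
    then show ?thesis using that by (simp add: field_simps)
  qed
  have lower: "(\<lambda>N. l2_sq f - (gagliardo f / pi) * (1 / real N)) \<longlonglongrightarrow> l2_sq f"
    using tendsto_diff[OF tendsto_const tendsto_mult[OF tendsto_const lim_1_over_n], of "l2_sq f" "gagliardo f / pi"] by simp
  have "(\<lambda>N. 2*pi * s N) \<longlonglongrightarrow> l2_sq f"
  proof (rule tendsto_sandwich[OF _ _ lower tendsto_const])
    show "\<forall>\<^sub>F N in sequentially. l2_sq f - gagliardo f / pi * (1 / real N) \<le> 2*pi * s N"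
      using eventually_gt_at_top[of 0]
    proof eventually_elim
      case (elim N)
      then show ?case using main[of N] by linarith
    qed
    show "\<forall>\<^sub>F N in sequentially. 2*pi * s N \<le> l2_sq f"
      unfolding s_def by (intro always_eventually allI bessel f) auto
  qed
  then show ?thesis by (simp add: s_def)
qed

lemma diffsq_shift_diff_le:
  assumes "L2 f" shows "diffsq (\<lambda>t. f (t + s) - f t) u \<le> 4 * diffsq f u"
proof -
  have L: "L2 (\<lambda>t. f (t + u) - f t)" using assms by (intro L2_diff L2_shift)
  have "diffsq (\<lambda>t. f (t + s) - f t) u = l2_sq (\<lambda>t. (f ((t + s) + u) - f (t + s)) - (f (t + u) - f t))"
    unfolding diffsq_def by (simp add: algebra_simps)
  also have "\<dots> \<le> (\<integral>t. 2 * (cmod (f ((t + s) + u) - f (t + s)))\<^sup>2 + 2 * (cmod (f (t + u) - f t))\<^sup>2 \<partial>circ)"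
    unfolding l2_sq_def
    by (intro integral_mono L2_sq L2_diff L2_shift[OF L, of s] L Bochner_Integration.integrable_add integrable_mult_right cmod_diff_sq_le)
  also have "\<dots> = 2 * l2_sq (\<lambda>t. f ((t + s) + u) - f (t + s)) + 2 * diffsq f u"
    unfolding l2_sq_def diffsq_def
    by (subst Bochner_Integration.integral_add) (auto intro!: L2_sq L2_shift[OF L, of s] L)
  also have "l2_sq (\<lambda>t. f ((t + s) + u) - f (t + s)) = diffsq f u"
    using l2_sq_shift[OF L, of s] by (simp add: diffsq_def)
  finally show ?thesis by simp
qed

text \<open>\<open>parseval\<close> is stated for this class, and the proof of convergence in the
  Gagliardo seminorm applies it to the differences of f; hence the class must be closed under
  forming them.\<close>

lemma sobolev_half_shift_diff: assumes "sobolev_half f" shows "sobolev_half (\<lambda>t. f (t + s) - f t)"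
  unfolding sobolev_half_def
proof
  show L: "L2 (\<lambda>t. f (t + s) - f t)" using sobolev_half_L2[OF assms] by (intro L2_diff L2_shift)
  have [measurable]: "diffsq (\<lambda>t. f (t + s) - f t) \<in> borel_measurable borel"
    using L by (intro diffsq_measurable L2_measurable)
  show "integrable circ (\<lambda>u. diffsq (\<lambda>t. f (t + s) - f t) u / (4 * (sin (u/2))\<^sup>2))"
  proof (rule Bochner_Integration.integrable_bound)
    show "integrable circ (\<lambda>u. 4 * (diffsq f u / (4 * (sin (u/2))\<^sup>2)))"
      by (intro integrable_mult_right sobolev_half_int assms)
    have "diffsq (\<lambda>t. f (t + s) - f t) u / (4 * (sin (u/2))\<^sup>2) \<le> 4 * diffsq f u / (4 * (sin (u/2))\<^sup>2)" for u
      by (intro divide_right_mono diffsq_shift_diff_le sobolev_half_L2 assms) auto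
    then show "AE u in circ. norm (diffsq (\<lambda>t. f (t + s) - f t) u / (4 * (sin (u/2))\<^sup>2)) \<le> norm (4 * (diffsq f u / (4 * (sin (u/2))\<^sup>2)))"
      by (intro AE_I2) simp
  qed measurable
qed

lemma fourier_shift_diff: "L2 f \<Longrightarrow> fourier (\<lambda>t. f (t + s) - f t) n = (cis (of_int n * s) - 1) * fourier f n"
  by (simp add: fourier_diff L2_shift fourier_shift algebra_simps)

text \<open>Almost everywhere the quotient is the squared modulus of a sum of |n| exponentials,
  whose integral is 2 pi |n|. This is where the weight |n| of order one half comes from.\<close>

lemma integral_cis_quotient:
  "integrable circ (\<lambda>s. (cmod (cis (of_int n * s) - 1))\<^sup>2 / (4 * (sin (s/2))\<^sup>2))"
  "(\<integral>s. (cmod (cis (of_int n * s) - 1))\<^sup>2 / (4 * (sin (s/2))\<^sup>2) \<partial>circ) = 2*pi * \<bar>of_int n\<bar>"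
proof -
  define N where "N = nat \<bar>n\<bar>"
  have eq: "(cmod (cis (of_int n * s) - 1))\<^sup>2 = (cmod (cis (real N * s) - 1))\<^sup>2" for s
  proof (cases "n \<ge> 0")
    case False
    then have "of_int n * s = - (real N * s)" by (simp add: N_def)
    then show ?thesis by (simp only: cmod_cis_minus_1) simp
  qed (simp add: N_def)
  have ae: "AE s in circ. (cmod (cis (of_int n * s) - 1))\<^sup>2 / (4 * (sin (s/2))\<^sup>2) = (cmod (trig {0..<int N} (\<lambda>_. 1) s))\<^sup>2"
    using AE_circ_sin_half
    by eventually_elim (simp add: eq cis_geometric[symmetric])
  have m: "(\<lambda>s. (cmod (cis (of_int n * s) - 1))\<^sup>2 / (4 * (sin (s/2))\<^sup>2)) \<in> borel_measurable circ" by measurable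
  have i: "integrable circ (\<lambda>s. (cmod (trig {0..<int N} (\<lambda>_. 1) s))\<^sup>2)" by (rule L2_sq[OF L2_trig])
  show "integrable circ (\<lambda>s. (cmod (cis (of_int n * s) - 1))\<^sup>2 / (4 * (sin (s/2))\<^sup>2))"
    using integrable_cong_AE[OF m _ ae] i by auto
  have "(\<integral>s. (cmod (cis (of_int n * s) - 1))\<^sup>2 / (4 * (sin (s/2))\<^sup>2) \<partial>circ) = l2_sq (trig {0..<int N} (\<lambda>_. 1))"
    unfolding l2_sq_def by (rule integral_cong_AE[OF m _ ae]) (use i in auto)
  then show "(\<integral>s. (cmod (cis (of_int n * s) - 1))\<^sup>2 / (4 * (sin (s/2))\<^sup>2) \<partial>circ) = 2*pi * \<bar>of_int n\<bar>"
    by (simp add: l2_sq_trig N_def)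
qed

text \<open>Bessel's inequality for f(t + s) - f(t), whose coefficients carry the factor
  \<open>cis (of_int n * s) - 1\<close>, is integrated over s against the reciprocal squared
  chord.\<close>

lemma gagliardo_bessel:
  assumes "sobolev_half f" "finite J"
  shows "(2*pi)\<^sup>2 * (\<Sum>n\<in>J. \<bar>of_int n\<bar> * (cmod (fourier f n))\<^sup>2) \<le> gagliardo f"
proof -
  have L: "L2 f" by (rule sobolev_half_L2[OF assms(1)])
  have b: "2*pi * (\<Sum>n\<in>J. (cmod (fourier f n))\<^sup>2 * (cmod (cis (of_int n * s) - 1))\<^sup>2) \<le> diffsq f s" for s
    using bessel[OF L2_diff[OF L2_shift[OF L, of s] L] assms(2)]
    by (simp add: diffsq_def fourier_shift_diff[OF L] norm_mult power_mult_distrib mult.commute)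
  have "(\<integral>s. (\<Sum>n\<in>J. 2*pi * (cmod (fourier f n))\<^sup>2 * ((cmod (cis (of_int n * s) - 1))\<^sup>2 / (4 * (sin (s/2))\<^sup>2))) \<partial>circ) \<le> gagliardo f"
    unfolding gagliardo_def
  proof (rule integral_mono)
    fix s
    have "(\<Sum>n\<in>J. 2*pi * (cmod (fourier f n))\<^sup>2 * ((cmod (cis (of_int n * s) - 1))\<^sup>2 / (4 * (sin (s/2))\<^sup>2)))
      = (2*pi * (\<Sum>n\<in>J. (cmod (fourier f n))\<^sup>2 * (cmod (cis (of_int n * s) - 1))\<^sup>2)) / (4 * (sin (s/2))\<^sup>2)"
      by (simp add: sum_distrib_left sum_divide_distrib mult_ac)
    also have "\<dots> \<le> diffsq f s / (4 * (sin (s/2))\<^sup>2)" by (intro divide_right_mono b) simp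
    finally show "(\<Sum>n\<in>J. 2*pi * (cmod (fourier f n))\<^sup>2 * ((cmod (cis (of_int n * s) - 1))\<^sup>2 / (4 * (sin (s/2))\<^sup>2))) \<le> diffsq f s / (4 * (sin (s/2))\<^sup>2)" .
  qed (intro Bochner_Integration.integrable_sum integrable_mult_right integral_cis_quotient sobolev_half_int assms)+
  also have "(\<integral>s. (\<Sum>n\<in>J. 2*pi * (cmod (fourier f n))\<^sup>2 * ((cmod (cis (of_int n * s) - 1))\<^sup>2 / (4 * (sin (s/2))\<^sup>2))) \<partial>circ)
    = (\<Sum>n\<in>J. 2*pi * (cmod (fourier f n))\<^sup>2 * (2*pi * \<bar>of_int n\<bar>))"
    by (subst Bochner_Integration.integral_sum)
       (simp_all add: integral_cis_quotient integrable_mult_right del: times_divide_eq_right)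
  finally show ?thesis by (simp add: sum_distrib_left power2_eq_square mult_ac)
qed

lemma diffsq_trig:
  assumes "finite J"
  shows "diffsq (trig J d) s = 2*pi * (\<Sum>n\<in>J. (cmod (d n))\<^sup>2 * (cmod (cis (of_int n * s) - 1))\<^sup>2)"
proof -
  have "(\<lambda>t. trig J d (t + s) - trig J d t) = trig J (\<lambda>n. d n * (cis (of_int n * s) - 1))"
    by (auto simp: trig_def sum_subtractf[symmetric] cis_mult[symmetric] algebra_simps intro!: sum.cong)
  then show ?thesis using assms by (simp add: diffsq_def l2_sq_trig norm_mult power_mult_distrib)
qed

lemma
  assumes "finite J"
  shows sobolev_half_trig: "sobolev_half (trig J d)"
    and gagliardo_trig: "gagliardo (trig J d) = (2*pi)\<^sup>2 * (\<Sum>n\<in>J. \<bar>of_int n\<bar> * (cmod (d n))\<^sup>2)"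
proof -
  have e: "diffsq (trig J d) s / (4 * (sin (s/2))\<^sup>2) = (\<Sum>n\<in>J. 2*pi * (cmod (d n))\<^sup>2 * ((cmod (cis (of_int n * s) - 1))\<^sup>2 / (4 * (sin (s/2))\<^sup>2)))" for s
    by (simp add: diffsq_trig[OF assms] sum_distrib_left sum_divide_distrib mult_ac)
  have "integrable circ (\<lambda>s. (\<Sum>n\<in>J. 2*pi * (cmod (d n))\<^sup>2 * ((cmod (cis (of_int n * s) - 1))\<^sup>2 / (4 * (sin (s/2))\<^sup>2))))"
    by (intro Bochner_Integration.integrable_sum integrable_mult_right integral_cis_quotient)
  then show "sobolev_half (trig J d)" unfolding sobolev_half_def e using L2_trig by blast
  have "gagliardo (trig J d) = (\<Sum>n\<in>J. 2*pi * (cmod (d n))\<^sup>2 * (2*pi * \<bar>of_int n\<bar>))"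
    unfolding gagliardo_def e
    by (subst Bochner_Integration.integral_sum)
       (simp_all add: integral_cis_quotient integrable_mult_right del: times_divide_eq_right)
  then show "gagliardo (trig J d) = (2*pi)\<^sup>2 * (\<Sum>n\<in>J. \<bar>of_int n\<bar> * (cmod (d n))\<^sup>2)"
    by (simp add: sum_distrib_left power2_eq_square mult_ac)
qed

text \<open>Trigonometric polynomials are dense in the norm of order one half. For each s the
  difference of the remainder tends to zero in mean square by Parseval, and the integrand of f
  itself is a majorant for dominated convergence in s.\<close>

lemma
  assumes hf: "sobolev_half f"
  shows l2_sq_fourier_remainder: "(\<lambda>N. l2_sq (\<lambda>t. f t - trig {-int N..int N} (fourier f) t)) \<longlonglongrightarrow> 0"
    and sobolev_half_fourier_remainder: "sobolev_half (\<lambda>t. f t - trig {-int N..int N} (fourier f) t)"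
    and gagliardo_fourier_remainder: "(\<lambda>N. gagliardo (\<lambda>t. f t - trig {-int N..int N} (fourier f) t)) \<longlonglongrightarrow> 0"
proof -
  have L: "L2 f" by (rule sobolev_half_L2[OF hf])
  have [measurable]: "f \<in> borel_measurable borel" using L by (rule L2_measurable)
  have c: "(\<lambda>N. l2_sq (\<lambda>t. g t - trig {-int N..int N} (fourier g) t)) \<longlonglongrightarrow> 0" if "sobolev_half g" for g
  proof -
    have "(\<lambda>N. l2_sq g - 2*pi * (\<Sum>n\<in>{-int N..int N}. (cmod (fourier g n))\<^sup>2)) \<longlonglongrightarrow> l2_sq g - l2_sq g"
      by (intro tendsto_intros parseval that)
    then show ?thesis by (simp add: bessel_eq[OF sobolev_half_L2[OF that]])
  qed
  then show "(\<lambda>N. l2_sq (\<lambda>t. f t - trig {-int N..int N} (fourier f) t)) \<longlonglongrightarrow> 0" using hf by blast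
  define r where "r N = (\<lambda>t. f t - trig {-int N..int N} (fourier f) t)" for N
  have rL: "L2 (r N)" for N unfolding r_def by (intro L2_diff L L2_trig)
  have [measurable]: "r N \<in> borel_measurable borel" for N by (rule L2_measurable[OF rL])
  define g where "g s = (\<lambda>t. f (t + s) - f t)" for s
  have g: "sobolev_half (g s)" for s unfolding g_def by (rule sobolev_half_shift_diff[OF hf])
  \<comment> \<open>Truncating the Fourier series commutes with translations, so the difference of
    the remainder is the remainder of the difference.\<close>
  have dr: "diffsq (r N) s = l2_sq (\<lambda>t. g s t - trig {-int N..int N} (fourier (g s)) t)" for N s
  proof -
    have tr: "trig {-int N..int N} (fourier (g s)) t = trig {-int N..int N} (fourier f) (t + s) - trig {-int N..int N} (fourier f) t" for t
      unfolding g_def trig_def fourier_shift_diff[OF L]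
      by (auto simp: sum_subtractf[symmetric] cis_mult[symmetric] algebra_simps intro!: sum.cong)
    then show ?thesis unfolding diffsq_def r_def tr by (simp add: g_def algebra_simps)
  qed
  have le: "diffsq (r N) s \<le> diffsq f s" for N s
  proof -
    have "diffsq (r N) s = diffsq f s - 2*pi * (\<Sum>n\<in>{-int N..int N}. (cmod (fourier (g s) n))\<^sup>2)"
      unfolding dr by (subst bessel_eq[OF sobolev_half_L2[OF g]]) (auto simp: diffsq_def g_def)
    then show ?thesis by (simp add: sum_nonneg)
  qed
  have bound: "diffsq (r N) s / (4 * (sin (s/2))\<^sup>2) \<le> diffsq f s / (4 * (sin (s/2))\<^sup>2)" for N s
    by (intro divide_right_mono le) simp
  have "integrable circ (\<lambda>s. diffsq (r N) s / (4 * (sin (s/2))\<^sup>2))" for N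
    by (rule Bochner_Integration.integrable_bound[OF sobolev_half_int[OF hf]]) (use bound in \<open>auto intro!: AE_I2\<close>)
  then show "sobolev_half (\<lambda>t. f t - trig {-int N..int N} (fourier f) t)"
    using rL[of N] by (auto simp: sobolev_half_def r_def)
  have "(\<lambda>N. gagliardo (r N)) \<longlonglongrightarrow> (\<integral>s. 0 \<partial>circ)"
    unfolding gagliardo_def
  proof (rule integral_dominated_convergence[OF _ _ sobolev_half_int[OF hf]])
    show "AE s in circ. (\<lambda>N. diffsq (r N) s / (4 * (sin (s/2))\<^sup>2)) \<longlonglongrightarrow> 0"
    proof (rule AE_I2)
      fix s
      have "(\<lambda>N. diffsq (r N) s) \<longlonglongrightarrow> 0" unfolding dr by (rule c[OF g])
      from tendsto_mult_right[OF this, of "1 / (4 * (sin (s/2))\<^sup>2)"]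
      show "(\<lambda>N. diffsq (r N) s / (4 * (sin (s/2))\<^sup>2)) \<longlonglongrightarrow> 0" by simp
    qed
    show "AE s in circ. norm (diffsq (r N) s / (4 * (sin (s/2))\<^sup>2)) \<le> diffsq f s / (4 * (sin (s/2))\<^sup>2)" for N
      using bound by (intro AE_I2) simp
  qed measurable
  then show "(\<lambda>N. gagliardo (\<lambda>t. f t - trig {-int N..int N} (fourier f) t)) \<longlonglongrightarrow> 0" by (simp add: r_def)
qed

lemma sobolev_half_add: assumes "sobolev_half f" "sobolev_half g" shows "sobolev_half (\<lambda>t. f t + g t)"
  unfolding sobolev_half_def
proof
  have L: "L2 f" "L2 g" using assms by (auto dest: sobolev_half_L2)
  show Lfg: "L2 (\<lambda>t. f t + g t)" by (intro L2_add L)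
  have [measurable]: "diffsq (\<lambda>t. f t + g t) \<in> borel_measurable borel"
    by (intro diffsq_measurable L2_measurable Lfg)
  have d: "diffsq (\<lambda>t. f t + g t) s \<le> 2 * diffsq f s + 2 * diffsq g s" for s
  proof -
    have i: "L2 (\<lambda>t. f (t + s) - f t)" "L2 (\<lambda>t. g (t + s) - g t)" by (intro L2_diff L2_shift L)+
    have "diffsq (\<lambda>t. f t + g t) s = (\<integral>t. (cmod ((f (t + s) - f t) + (g (t + s) - g t)))\<^sup>2 \<partial>circ)"
      unfolding diffsq_def l2_sq_def by (simp add: algebra_simps)
    also have "\<dots> \<le> (\<integral>t. 2 * (cmod (f (t + s) - f t))\<^sup>2 + 2 * (cmod (g (t + s) - g t))\<^sup>2 \<partial>circ)"
      by (intro integral_mono L2_sq[OF L2_add[OF i]] Bochner_Integration.integrable_add integrable_mult_right L2_sq i cmod_add_sq_le)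
    also have "\<dots> = 2 * diffsq f s + 2 * diffsq g s"
      unfolding diffsq_def l2_sq_def using L2_sq[OF i(1)] L2_sq[OF i(2)] by simp
    finally show ?thesis .
  qed
  show "integrable circ (\<lambda>s. diffsq (\<lambda>t. f t + g t) s / (4 * (sin (s/2))\<^sup>2))"
  proof (rule Bochner_Integration.integrable_bound)
    show "integrable circ (\<lambda>s. 2 * (diffsq f s / (4 * (sin (s/2))\<^sup>2)) + 2 * (diffsq g s / (4 * (sin (s/2))\<^sup>2)))"
      by (intro Bochner_Integration.integrable_add integrable_mult_right sobolev_half_int assms)
    have "diffsq (\<lambda>t. f t + g t) s / (4 * (sin (s/2))\<^sup>2) \<le> (2 * diffsq f s + 2 * diffsq g s) / (4 * (sin (s/2))\<^sup>2)" for s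
      by (intro divide_right_mono d) simp
    then show "AE s in circ. norm (diffsq (\<lambda>t. f t + g t) s / (4 * (sin (s/2))\<^sup>2)) \<le> norm (2 * (diffsq f s / (4 * (sin (s/2))\<^sup>2)) + 2 * (diffsq g s / (4 * (sin (s/2))\<^sup>2)))"
      by (intro AE_I2) (simp add: add_divide_distrib)
  qed measurable
qed

lemma diffsq_cmult: "diffsq (\<lambda>t. c * f t) s = (cmod c)\<^sup>2 * diffsq f s"
  unfolding diffsq_def l2_sq_def
  by (simp add: right_diff_distrib[symmetric] norm_mult power_mult_distrib)

lemma sobolev_half_cmult: "sobolev_half f \<Longrightarrow> sobolev_half (\<lambda>t. c * f t)"
  unfolding sobolev_half_def diffsq_cmult using integrable_mult_right[of "(cmod c)\<^sup>2" circ "\<lambda>s. diffsq f s / (4 * (sin (s/2))\<^sup>2)"]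
  by (auto simp: L2_cmult)

lemma nn_diffsq: assumes "L2 g" shows "(\<integral>\<^sup>+t. ennreal ((cmod (g (t + s) - g t))\<^sup>2) \<partial>circ) = ennreal (diffsq g s)"
  unfolding diffsq_def l2_sq_def
  by (rule nn_integral_eq_integral) (use assms in \<open>auto intro!: L2_sq L2_diff L2_shift\<close>)

lemma nn_gagliardo:
  assumes "sobolev_half g"
  shows "(\<integral>\<^sup>+s. ennreal (diffsq g s / (4 * (sin (s/2))\<^sup>2)) \<partial>circ) = ennreal (gagliardo g)"
  unfolding gagliardo_def by (rule nn_integral_eq_integral) (use assms in \<open>auto intro!: sobolev_half_int\<close>)

lemma sobolev_half_iff_nn:
  assumes "L2 g"
  shows "sobolev_half g \<longleftrightarrow> (\<integral>\<^sup>+s. ennreal (diffsq g s / (4 * (sin (s/2))\<^sup>2)) \<partial>circ) < \<infinity>"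
proof -
  have [measurable]: "diffsq g \<in> borel_measurable borel" using assms by (intro diffsq_measurable L2_measurable)
  have "(\<lambda>s. diffsq g s / (4 * (sin (s/2))\<^sup>2)) \<in> borel_measurable circ" by measurable
  then show ?thesis using assms by (auto simp: sobolev_half_def integrable_iff_bounded)
qed

text \<open>The substitution t = u + s and Tonelli's theorem. Both the integrand and the squared
  half-angle sine are 2 pi periodic in t, although the sine itself changes sign.\<close>

lemma nn_gagliardo_circ:
  assumes L: "L2 g"
  shows "(\<integral>\<^sup>+s. (\<integral>\<^sup>+t. ennreal ((cmod (g t - g s))\<^sup>2 / (4 * (sin ((t - s)/2))\<^sup>2)) \<partial>circ) \<partial>circ)
    = (\<integral>\<^sup>+u. ennreal (diffsq g u / (4 * (sin (u/2))\<^sup>2)) \<partial>circ)"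
proof -
  have [measurable]: "g \<in> borel_measurable borel" by (rule L2_measurable[OF L])
  have "(\<integral>\<^sup>+s. (\<integral>\<^sup>+t. ennreal ((cmod (g t - g s))\<^sup>2 / (4 * (sin ((t - s)/2))\<^sup>2)) \<partial>circ) \<partial>circ)
     = (\<integral>\<^sup>+s. (\<integral>\<^sup>+u. ennreal ((cmod (g (u + s) - g s))\<^sup>2 / (4 * (sin (u/2))\<^sup>2)) \<partial>circ) \<partial>circ)"
  proof (rule nn_integral_cong)
    fix s
    have p: "periodic (\<lambda>t. ennreal ((cmod (g t - g s))\<^sup>2 / (4 * (sin ((t - s)/2))\<^sup>2)))"
      unfolding periodic_def
    proof
      fix t
      have "(t + 2*pi - s)/2 = (t - s)/2 + pi" by (simp add: field_simps)
      then have "(sin ((t + 2*pi - s)/2))\<^sup>2 = (sin ((t - s)/2))\<^sup>2" by (simp only: sin_periodic_pi power2_minus)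
      then show "ennreal ((cmod (g (t + 2*pi) - g s))\<^sup>2 / (4 * (sin ((t + 2*pi - s)/2))\<^sup>2)) = ennreal ((cmod (g t - g s))\<^sup>2 / (4 * (sin ((t - s)/2))\<^sup>2))"
        using L2_periodic[OF L] by (simp only: periodicD)
    qed
    show "(\<integral>\<^sup>+t. ennreal ((cmod (g t - g s))\<^sup>2 / (4 * (sin ((t - s)/2))\<^sup>2)) \<partial>circ) = (\<integral>\<^sup>+u. ennreal ((cmod (g (u + s) - g s))\<^sup>2 / (4 * (sin (u/2))\<^sup>2)) \<partial>circ)"
      using nn_integral_periodic_shift[OF _ p, of s] by simp
  qed
  also have "\<dots> = (\<integral>\<^sup>+u. (\<integral>\<^sup>+s. ennreal ((cmod (g (u + s) - g s))\<^sup>2 / (4 * (sin (u/2))\<^sup>2)) \<partial>circ) \<partial>circ)"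
    by (rule circ_circ.Fubini'[symmetric]) measurable
  also have "\<dots> = (\<integral>\<^sup>+u. ennreal (diffsq g u / (4 * (sin (u/2))\<^sup>2)) \<partial>circ)"
  proof (rule nn_integral_cong)
    fix u
    have "(\<integral>\<^sup>+s. ennreal ((cmod (g (u + s) - g s))\<^sup>2 / (4 * (sin (u/2))\<^sup>2)) \<partial>circ)
       = (\<integral>\<^sup>+s. ennreal ((cmod (g (s + u) - g s))\<^sup>2) * ennreal (1 / (4 * (sin (u/2))\<^sup>2)) \<partial>circ)"
      by (simp add: ennreal_mult[symmetric] add.commute)
    also have "\<dots> = ennreal (diffsq g u) * ennreal (1 / (4 * (sin (u/2))\<^sup>2))"
      by (subst nn_integral_multc) (simp_all add: nn_diffsq[OF L])
    finally show "(\<integral>\<^sup>+s. ennreal ((cmod (g (u + s) - g s))\<^sup>2 / (4 * (sin (u/2))\<^sup>2)) \<partial>circ) = ennreal (diffsq g u / (4 * (sin (u/2))\<^sup>2))"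
      by (simp add: ennreal_mult[symmetric])
  qed
  finally show ?thesis .
qed

section \<open>The Sobolev spaces on the ellipse\<close>

lemma norm_vec2_sq: "(norm (v::complex^2))\<^sup>2 = (cmod (v$1))\<^sup>2 + (cmod (v$2))\<^sup>2"
  by (simp add: norm_vec_def L2_set_def sum_2)

lemma norm_real2_sq: "(norm (v::real^2))\<^sup>2 = (v$1)\<^sup>2 + (v$2)\<^sup>2"
  by (simp add: norm_vec_def L2_set_def sum_2)

section \<open>Parametrization, chord lengths and arc length measure of the ellipse\<close>

locale ell =
  fixes a b :: real
  assumes b_pos: "0 < b" and b_less: "b < a"
begin

lemma a_pos: "0 < a" using b_pos b_less by simp

definition par :: "real \<Rightarrow> real^2" where "par = ellipse_param a b"

definition speed :: "real \<Rightarrow> real" where "speed t = sqrt (a\<^sup>2 * (sin t)\<^sup>2 + b\<^sup>2 * (cos t)\<^sup>2)"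

definition sig :: "(real^2) measure" where "sig = ellipse_measure a b"

lemma par_nth [simp]: "par t $ 1 = a * cos t" "par t $ 2 = b * sin t"
  by (simp_all add: par_def ellipse_param_def)

lemma par_axis: "par t = (a * cos t) *\<^sub>R axis 1 1 + (b * sin t) *\<^sub>R axis 2 1"
  by (simp add: vec_eq_iff forall_2 axis_def)

lemma par_derivative: "(par has_vector_derivative vector [- a * sin t, b * cos t]) (at t)"
proof -
  have "((\<lambda>t. (a * cos t) *\<^sub>R axis 1 1 + (b * sin t) *\<^sub>R axis 2 1 :: real^2) has_vector_derivative
     ((- a * sin t) *\<^sub>R axis 1 1 + (b * cos t) *\<^sub>R axis 2 1)) (at t)"
    by (auto intro!: derivative_eq_intros simp: has_real_derivative_iff_has_vector_derivative[symmetric] mult.commute)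
  moreover have "((- a * sin t) *\<^sub>R axis 1 1 + (b * cos t) *\<^sub>R axis 2 1 :: real^2) = vector [- a * sin t, b * cos t]"
    by (simp add: vec_eq_iff forall_2 axis_def)
  ultimately show ?thesis by (simp add: par_axis[abs_def])
qed

lemma norm_par_derivative: "norm (vector_derivative par (at t)) = speed t"
  by (simp add: vector_derivative_at[OF par_derivative] speed_def norm_vec_def L2_set_def sum_2 power_mult_distrib)

text \<open>A convex combination of a^2 and b^2. The same expression occurs as the squared speed
  and, at the mean angle, as the ratio of squared chords on the ellipse and on the unit
  circle.\<close>

lemma wavg_bounds: "b\<^sup>2 \<le> a\<^sup>2 * (sin t)\<^sup>2 + b\<^sup>2 * (cos t)\<^sup>2" "a\<^sup>2 * (sin t)\<^sup>2 + b\<^sup>2 * (cos t)\<^sup>2 \<le> a\<^sup>2"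
proof -
  have ab: "b\<^sup>2 \<le> a\<^sup>2" using b_pos b_less by (intro power_mono) auto
  have c: "(cos t)\<^sup>2 = 1 - (sin t)\<^sup>2" by (simp add: cos_squared_eq)
  have e: "a\<^sup>2 * (sin t)\<^sup>2 + b\<^sup>2 * (cos t)\<^sup>2 = b\<^sup>2 + (a\<^sup>2 - b\<^sup>2) * (sin t)\<^sup>2" unfolding c by algebra
  have "(sin t)\<^sup>2 \<le> 1" by (simp add: abs_square_le_1)
  then have "0 \<le> (a\<^sup>2 - b\<^sup>2) * (sin t)\<^sup>2" "(a\<^sup>2 - b\<^sup>2) * (sin t)\<^sup>2 \<le> (a\<^sup>2 - b\<^sup>2) * 1"
    using ab by (auto intro!: mult_left_mono simp del: mult.right_neutral)
  then show "b\<^sup>2 \<le> a\<^sup>2 * (sin t)\<^sup>2 + b\<^sup>2 * (cos t)\<^sup>2" "a\<^sup>2 * (sin t)\<^sup>2 + b\<^sup>2 * (cos t)\<^sup>2 \<le> a\<^sup>2"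
    unfolding e by auto
qed

lemma speed_bounds: "b \<le> speed t" "speed t \<le> a"
  unfolding speed_def using wavg_bounds[of t] b_pos a_pos
  by (auto intro: real_le_rsqrt real_le_lsqrt)

lemma speed_pos: "0 < speed t" using speed_bounds(1)[of t] b_pos by linarith

lemma speed_periodic: "periodic speed" by (simp add: periodic_def speed_def)

lemma speed_continuous [continuous_intros]: "continuous_on A speed"
  unfolding speed_def[abs_def] by (intro continuous_intros)

lemma speed_measurable [measurable]: "speed \<in> borel_measurable borel"
  by (intro borel_measurable_continuous_onI continuous_intros)

lemma par_periodic: "par (t + 2*pi) = par t" by (simp add: vec_eq_iff forall_2)

lemma par_continuous [continuous_intros]: "continuous_on A par"
  unfolding par_axis[abs_def] by (intro continuous_intros)

text \<open>The sum-to-product formulas put sin((s - t)/2) into both coordinates, so it factors out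
  and leaves a function of s + t bounded above and below.\<close>

lemma dist_par: "(dist (par s) (par t))\<^sup>2 = 4 * (sin ((s - t)/2))\<^sup>2 * (a\<^sup>2 * (sin ((s + t)/2))\<^sup>2 + b\<^sup>2 * (cos ((s + t)/2))\<^sup>2)"
proof -
  have m: "sin ((t - s)/2) = - sin ((s - t)/2)"
    by (metis minus_diff_eq minus_divide_left sin_minus)
  have c: "a * cos s - a * cos t = - (2 * a * sin ((s + t)/2) * sin ((s - t)/2))"
    unfolding right_diff_distrib[symmetric] cos_diff_cos m by simp
  have d: "b * sin s - b * sin t = 2 * b * sin ((s - t)/2) * cos ((s + t)/2)"
    unfolding right_diff_distrib[symmetric] sin_diff_sin by simp
  show ?thesis
    unfolding dist_norm norm_real2_sq vector_minus_component par_nth c d by algebra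
qed

text \<open>The ellipse is the image of the unit disc under an invertible linear map, which commutes
  with closure and interior.\<close>

lemma frontier_ellipse: "frontier (ellipse a b) = {x. (x$1)\<^sup>2 / a\<^sup>2 + (x$2)\<^sup>2 / b\<^sup>2 = 1}"
proof -
  define L :: "real^2 \<Rightarrow> real^2" where "L x = vector [a * x$1, b * x$2]" for x
  have L_nth [simp]: "L x $ 1 = a * x$1" "L x $ 2 = b * x$2" for x by (simp_all add: L_def)
  have lin: "linear L" by (rule linearI) (simp_all add: vec_eq_iff forall_2 algebra_simps)
  have inj: "inj L" by (rule injI) (use a_pos b_pos in \<open>simp add: vec_eq_iff forall_2\<close>)
  have surj: "L (vector [y$1/a, y$2/b]) = y" for y :: "real^2" using a_pos b_pos by (simp add: vec_eq_iff forall_2)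
  \<comment> \<open>The predicate P is left open so that the open ball and the closed ball are
    handled at once.\<close>
  have img: "L ` {x. P (norm x)} = {y. P (sqrt ((y$1)\<^sup>2 / a\<^sup>2 + (y$2)\<^sup>2 / b\<^sup>2))}" for P
  proof -
    have n: "norm (x::real^2) = sqrt ((L x$1)\<^sup>2 / a\<^sup>2 + (L x$2)\<^sup>2 / b\<^sup>2)" for x
      using a_pos b_pos by (simp add: norm_vec_def L2_set_def sum_2 power_mult_distrib)
    show ?thesis
    proof safe
      fix y :: "real^2" assume "P (sqrt ((y$1)\<^sup>2 / a\<^sup>2 + (y$2)\<^sup>2 / b\<^sup>2))"
      then have "P (norm (vector [y$1/a, y$2/b] :: real^2))" unfolding n surj .
      then show "y \<in> L ` {x. P (norm x)}" using surj[of y] by (metis (mono_tags) imageI mem_Collect_eq)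
    qed (use n in auto)
  qed
  have e: "ellipse a b = L ` ball 0 1"
    using img[of "\<lambda>r. r < 1"] by (simp add: ellipse_def ball_def dist_norm)
  have "frontier (ellipse a b) = L ` cball 0 1 - L ` ball 0 1"
    unfolding frontier_def e
    using closure_injective_linear_image[OF lin inj, of "ball 0 1"]
      interior_bijective_linear_image[OF lin, of "ball 0 1"] inj surj
    by (simp add: bij_def surj_def) metis
  also have "\<dots> = {y. (y$1)\<^sup>2 / a\<^sup>2 + (y$2)\<^sup>2 / b\<^sup>2 = 1}"
    using img[of "\<lambda>r. r < 1"] img[of "\<lambda>r. r \<le> 1"] by (auto simp: ball_def cball_def dist_norm)
  finally show ?thesis .
qed

lemma par_in_frontier: "par t \<in> frontier (ellipse a b)"
  using a_pos b_pos by (simp add: frontier_ellipse power_mult_distrib)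

lemma frontier_par: assumes "x \<in> frontier (ellipse a b)" obtains t where "0 \<le> t" "t < 2*pi" "x = par t"
proof -
  have "(x$1/a)\<^sup>2 + (x$2/b)\<^sup>2 = 1" using assms by (simp add: frontier_ellipse power_divide)
  then obtain t where t: "0 \<le> t" "t < 2*pi" "x$1/a = cos t" "x$2/b = sin t" by (rule sincos_total_2pi)
  have "x = par t" using t a_pos b_pos by (simp add: vec_eq_iff forall_2 field_simps)
  then show ?thesis using t that by blast
qed

lemma space_sig: "space sig = frontier (ellipse a b)"
  and sets_sig [measurable_cong]: "sets sig = sets (restrict_space borel (frontier (ellipse a b)))"
  by (simp_all add: sig_def ellipse_measure_def space_restrict_space)

lemma par_measurable: "par \<in> measurable borel (restrict_space borel (frontier (ellipse a b)))"
  by (rule measurable_restrict_space2) (use par_in_frontier in \<open>auto intro!: borel_measurable_continuous_onI continuous_intros\<close>)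

lemma par_measurable_sig [measurable]: "par \<in> measurable borel sig"
  using par_measurable measurable_cong_sets[OF refl sets_sig] by blast

lemma id_sig [measurable]: "(\<lambda>x. x) \<in> borel_measurable sig"
  by (subst measurable_cong_sets[OF sets_sig refl]) (rule measurable_restrict_space1, simp)

lemma sig_distr: "sig = distr (density circ (\<lambda>t. ennreal (speed t))) (restrict_space borel (frontier (ellipse a b))) par"
  unfolding sig_def ellipse_measure_def circ_def par_def[symmetric] norm_par_derivative ..

lemma nn_integral_sig:
  assumes "f \<in> borel_measurable sig"
  shows "(\<integral>\<^sup>+x. f x \<partial>sig) = (\<integral>\<^sup>+t. ennreal (speed t) * f (par t) \<partial>circ)"
proof -
  have f: "f \<in> borel_measurable (restrict_space borel (frontier (ellipse a b)))"
    using assms measurable_cong_sets[OF sets_sig refl] by blast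
  have [measurable]: "(\<lambda>t. f (par t)) \<in> borel_measurable borel" by (rule measurable_compose[OF par_measurable f])
  have [measurable]: "par \<in> measurable circ (restrict_space borel (frontier (ellipse a b)))"
    by (rule measurable_circ[OF par_measurable])
  have "(\<integral>\<^sup>+x. f x \<partial>sig) = (\<integral>\<^sup>+t. f (par t) \<partial>density circ (\<lambda>t. ennreal (speed t)))"
    unfolding sig_distr by (rule nn_integral_distr) (use f in auto)
  also have "\<dots> = (\<integral>\<^sup>+t. ennreal (speed t) * f (par t) \<partial>circ)"
    by (rule nn_integral_density) measurable
  finally show ?thesis .
qed

lemma
  fixes f :: "real^2 \<Rightarrow> 'x::{banach,second_countable_topology}"
  assumes "f \<in> borel_measurable sig"
  shows integral_sig: "(\<integral>x. f x \<partial>sig) = (\<integral>t. speed t *\<^sub>R f (par t) \<partial>circ)"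
    and integrable_sig: "integrable sig f \<longleftrightarrow> integrable circ (\<lambda>t. speed t *\<^sub>R f (par t))"
proof -
  have f: "f \<in> borel_measurable (restrict_space borel (frontier (ellipse a b)))"
    using assms measurable_cong_sets[OF sets_sig refl] by blast
  have [measurable]: "(\<lambda>t. f (par t)) \<in> borel_measurable borel" by (rule measurable_compose[OF par_measurable f])
  have [measurable]: "par \<in> measurable circ (restrict_space borel (frontier (ellipse a b)))"
    by (rule measurable_circ[OF par_measurable])
  have p: "par \<in> measurable (density circ (\<lambda>t. ennreal (speed t))) (restrict_space borel (frontier (ellipse a b)))" by simp
  have "(\<integral>x. f x \<partial>sig) = (\<integral>t. f (par t) \<partial>density circ (\<lambda>t. ennreal (speed t)))"
    unfolding sig_distr by (rule integral_distr[OF p f])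
  also have "\<dots> = (\<integral>t. speed t *\<^sub>R f (par t) \<partial>circ)"
    by (rule integral_density) (auto intro!: AE_I2 less_imp_le speed_pos)
  finally show "(\<integral>x. f x \<partial>sig) = (\<integral>t. speed t *\<^sub>R f (par t) \<partial>circ)" .
  have "integrable sig f \<longleftrightarrow> integrable (density circ (\<lambda>t. ennreal (speed t))) (\<lambda>t. f (par t))"
    unfolding sig_distr by (rule integrable_distr_eq[OF p f])
  also have "\<dots> \<longleftrightarrow> integrable circ (\<lambda>t. speed t *\<^sub>R f (par t))"
    by (rule integrable_density) (auto intro!: AE_I2 less_imp_le speed_pos)
  finally show "integrable sig f \<longleftrightarrow> integrable circ (\<lambda>t. speed t *\<^sub>R f (par t))" .
qed

lemma finite_measure_sig: "finite_measure sig"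
proof
  have "emeasure sig (space sig) = (\<integral>\<^sup>+x. 1 \<partial>sig)" by simp
  also have "\<dots> = (\<integral>\<^sup>+t. ennreal (speed t) \<partial>circ)" by (subst nn_integral_sig) auto
  also have "\<dots> \<le> (\<integral>\<^sup>+t. ennreal a \<partial>circ)" by (intro nn_integral_mono ennreal_leI speed_bounds)
  also have "\<dots> < \<infinity>" using a_pos by (simp add: emeasure_circ ennreal_mult_less_top)
  finally show "emeasure sig (space sig) \<noteq> \<infinity>" by simp
qed

end

lemma vec_nth_measurable [measurable (raw)]:
  fixes f :: "'x \<Rightarrow> complex^2"
  shows "f \<in> borel_measurable M \<Longrightarrow> (\<lambda>x. f x $ i) \<in> borel_measurable M"
  by (rule borel_measurable_continuous_on[of "\<lambda>v. v $ i", unfolded o_def]) (auto intro: continuous_intros)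

context ell
begin

section \<open>Transfer of the norm of order one half to the circle\<close>

definition pullback :: "(real^2 \<Rightarrow> complex^2) \<Rightarrow> 2 \<Rightarrow> real \<Rightarrow> complex" where
  "pullback f i t = f (par t) $ i"

definition pullback_norm_sq :: "(real^2 \<Rightarrow> complex^2) \<Rightarrow> real" where
  "pullback_norm_sq f = (l2_sq (pullback f 1) + gagliardo (pullback f 1)) + (l2_sq (pullback f 2) + gagliardo (pullback f 2))"

lemma compose_par_measurable: "f \<in> borel_measurable sig \<Longrightarrow> (\<lambda>t. f (par t)) \<in> borel_measurable borel"
  by (rule measurable_compose[OF par_measurable_sig])

lemma pullback_measurable: "f \<in> borel_measurable sig \<Longrightarrow> pullback f i \<in> borel_measurable borel"
  unfolding pullback_def[abs_def] by (intro vec_nth_measurable compose_par_measurable)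

lemma pullback_periodic: "periodic (pullback f i)"
  by (simp add: periodic_def pullback_def par_periodic)

lemma L2_pullback_iff:
  assumes f: "f \<in> borel_measurable sig"
  shows "integrable sig (\<lambda>x. (norm (f x))\<^sup>2) \<longleftrightarrow> L2 (pullback f 1) \<and> L2 (pullback f 2)"
proof -
  have [measurable]: "pullback f i \<in> borel_measurable borel" for i by (rule pullback_measurable[OF f])
  have m: "(\<lambda>x. (norm (f x))\<^sup>2) \<in> borel_measurable sig" using f by measurable
  have e: "speed t *\<^sub>R (norm (f (par t)))\<^sup>2 = speed t * ((cmod (pullback f 1 t))\<^sup>2 + (cmod (pullback f 2 t))\<^sup>2)" for t
    by (simp add: norm_vec2_sq pullback_def)
  have "integrable sig (\<lambda>x. (norm (f x))\<^sup>2) \<longleftrightarrow> integrable circ (\<lambda>t. speed t * ((cmod (pullback f 1 t))\<^sup>2 + (cmod (pullback f 2 t))\<^sup>2))"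
    unfolding integrable_sig[OF m] e ..
  also have "\<dots> \<longleftrightarrow> L2 (pullback f 1) \<and> L2 (pullback f 2)"
  proof
    assume i: "integrable circ (\<lambda>t. speed t * ((cmod (pullback f 1 t))\<^sup>2 + (cmod (pullback f 2 t))\<^sup>2))"
    have "integrable circ (\<lambda>t. (cmod (pullback f i t))\<^sup>2)" for i
    proof (rule Bochner_Integration.integrable_bound[OF integrable_mult_right[OF i, of "1/b"]])
      have "(cmod (pullback f i t))\<^sup>2 \<le> (1/b) * (speed t * ((cmod (pullback f 1 t))\<^sup>2 + (cmod (pullback f 2 t))\<^sup>2))" for t
      proof -
        have "b * (cmod (pullback f i t))\<^sup>2 \<le> speed t * ((cmod (pullback f 1 t))\<^sup>2 + (cmod (pullback f 2 t))\<^sup>2)"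
          by (rule mult_mono) (use speed_bounds[of t] speed_pos[of t] exhaust_2[of i] in auto)
        then show ?thesis using b_pos by (simp add: field_simps)
      qed
      then show "AE t in circ. norm ((cmod (pullback f i t))\<^sup>2) \<le> norm ((1/b) * (speed t * ((cmod (pullback f 1 t))\<^sup>2 + (cmod (pullback f 2 t))\<^sup>2)))"
        using speed_pos b_pos by (intro AE_I2) (auto simp: abs_mult abs_of_pos)
    qed measurable
    then show "L2 (pullback f 1) \<and> L2 (pullback f 2)" by (auto simp: L2_def pullback_periodic)
  next
    assume L: "L2 (pullback f 1) \<and> L2 (pullback f 2)"
    show "integrable circ (\<lambda>t. speed t * ((cmod (pullback f 1 t))\<^sup>2 + (cmod (pullback f 2 t))\<^sup>2))"
    proof (rule Bochner_Integration.integrable_bound)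
      show "integrable circ (\<lambda>t. a * ((cmod (pullback f 1 t))\<^sup>2 + (cmod (pullback f 2 t))\<^sup>2))"
        using L by (auto intro!: integrable_mult_right Bochner_Integration.integrable_add L2_sq)
      show "AE t in circ. norm (speed t * ((cmod (pullback f 1 t))\<^sup>2 + (cmod (pullback f 2 t))\<^sup>2)) \<le> norm (a * ((cmod (pullback f 1 t))\<^sup>2 + (cmod (pullback f 2 t))\<^sup>2))"
        using speed_bounds speed_pos a_pos by (intro AE_I2) (auto simp: abs_mult abs_of_pos intro!: mult_right_mono)
    qed measurable
  qed
  finally show ?thesis .
qed

lemma sq_integral_bounds:
  assumes f: "f \<in> borel_measurable sig" and L: "L2 (pullback f 1)" "L2 (pullback f 2)"
  shows "b * (l2_sq (pullback f 1) + l2_sq (pullback f 2)) \<le> (\<integral>x. (norm (f x))\<^sup>2 \<partial>sig)"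
    and "(\<integral>x. (norm (f x))\<^sup>2 \<partial>sig) \<le> a * (l2_sq (pullback f 1) + l2_sq (pullback f 2))"
proof -
  have m: "(\<lambda>x. (norm (f x))\<^sup>2) \<in> borel_measurable sig" using f by measurable
  have e: "speed t *\<^sub>R (norm (f (par t)))\<^sup>2 = speed t * ((cmod (pullback f 1 t))\<^sup>2 + (cmod (pullback f 2 t))\<^sup>2)" for t
    by (simp add: norm_vec2_sq pullback_def)
  have i: "integrable circ (\<lambda>t. speed t * ((cmod (pullback f 1 t))\<^sup>2 + (cmod (pullback f 2 t))\<^sup>2))"
    using L2_pullback_iff[OF f] L integrable_sig[OF m] unfolding e by blast
  have s: "c * (l2_sq (pullback f 1) + l2_sq (pullback f 2)) = (\<integral>t. c * ((cmod (pullback f 1 t))\<^sup>2 + (cmod (pullback f 2 t))\<^sup>2) \<partial>circ)" for c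
    unfolding l2_sq_def using L by (simp add: L2_sq)
  have j: "integrable circ (\<lambda>t. c * ((cmod (pullback f 1 t))\<^sup>2 + (cmod (pullback f 2 t))\<^sup>2))" for c
    using L by (auto intro!: integrable_mult_right Bochner_Integration.integrable_add L2_sq)
  show "b * (l2_sq (pullback f 1) + l2_sq (pullback f 2)) \<le> (\<integral>x. (norm (f x))\<^sup>2 \<partial>sig)"
    unfolding integral_sig[OF m] e s by (intro integral_mono i j mult_right_mono speed_bounds) auto
  show "(\<integral>x. (norm (f x))\<^sup>2 \<partial>sig) \<le> a * (l2_sq (pullback f 1) + l2_sq (pullback f 2))"
    unfolding integral_sig[OF m] e s by (intro integral_mono i j mult_right_mono speed_bounds) auto
qed

abbreviation "quot f \<equiv> (\<lambda>(x, y). (norm (f x - f y))\<^sup>2 / (dist x y)\<^sup>2)"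

lemma quot_measurable:
  fixes f :: "real^2 \<Rightarrow> complex^2"
  assumes [measurable]: "f \<in> borel_measurable sig"
  shows "quot f \<in> borel_measurable (sig \<Otimes>\<^sub>M sig)"
proof -
  have [measurable]: "fst \<in> borel_measurable (sig \<Otimes>\<^sub>M sig)" "snd \<in> borel_measurable (sig \<Otimes>\<^sub>M sig)"
    using measurable_compose[OF measurable_fst id_sig] measurable_compose[OF measurable_snd id_sig] by (simp_all add: o_def)
  show ?thesis unfolding case_prod_beta by measurable
qed

definition gdens :: "(real^2 \<Rightarrow> complex^2) \<Rightarrow> real \<Rightarrow> real \<Rightarrow> real" where
  "gdens f s t = (cmod (pullback f 1 t - pullback f 1 s))\<^sup>2 / (4 * (sin ((t - s)/2))\<^sup>2) + (cmod (pullback f 2 t - pullback f 2 s))\<^sup>2 / (4 * (sin ((t - s)/2))\<^sup>2)"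

text \<open>The circular and elliptic quotients differ by the factor
  \<open>speed s * speed t / m\<close>, in which numerator and denominator both lie in [b^2, a^2].
  On the diagonal both quotients are 0, so the bounds persist there.\<close>

lemma quot_par_bounds:
  "b\<^sup>2 / a\<^sup>2 * gdens f s t \<le> speed s * (speed t * quot f (par s, par t))"
  "speed s * (speed t * quot f (par s, par t)) \<le> a\<^sup>2 / b\<^sup>2 * gdens f s t"
proof -
  define X where "X = (norm (f (par s) - f (par t)))\<^sup>2"
  define D where "D = 4 * (sin ((t - s)/2))\<^sup>2"
  define m where "m = a\<^sup>2 * (sin ((s + t)/2))\<^sup>2 + b\<^sup>2 * (cos ((s + t)/2))\<^sup>2"
  have g: "gdens f s t = X / D"
    by (simp add: gdens_def X_def D_def norm_minus_commute[of "f (par s)"] norm_vec2_sq pullback_def add_divide_distrib)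
  have s2: "(sin ((s - t)/2))\<^sup>2 = (sin ((t - s)/2))\<^sup>2"
    by (metis minus_diff_eq minus_divide_left power2_minus sin_minus)
  have q: "quot f (par s, par t) = X / (D * m)"
    by (simp add: X_def D_def m_def dist_par s2)
  have m: "b\<^sup>2 \<le> m" "m \<le> a\<^sup>2" unfolding m_def by (rule wavg_bounds)+
  have b2: "0 < b\<^sup>2" using b_pos by simp
  have mp: "0 < m" using m b2 by linarith
  have XD: "0 \<le> X / D" by (simp add: X_def D_def)
  have eq: "speed s * (speed t * quot f (par s, par t)) = (speed s * speed t / m) * (X / D)"
    unfolding q by (simp add: mult_ac)
  have p: "b\<^sup>2 \<le> speed s * speed t" "speed s * speed t \<le> a\<^sup>2"
    unfolding power2_eq_square using speed_bounds[of s] speed_bounds[of t] b_pos by (auto intro!: mult_mono)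
  have "0 \<le> speed s * speed t" using speed_pos[of s] speed_pos[of t] by simp
  from frac_le[OF this p(1) mp m(2)] have "b\<^sup>2 / a\<^sup>2 \<le> speed s * speed t / m" .
  from mult_right_mono[OF this XD] show "b\<^sup>2 / a\<^sup>2 * gdens f s t \<le> speed s * (speed t * quot f (par s, par t))"
    unfolding eq g .
  have "speed s * speed t / m \<le> a\<^sup>2 / b\<^sup>2"
    by (rule frac_le[OF zero_le_power2 p(2) b2 m(1)])
  from mult_right_mono[OF this XD] show "speed s * (speed t * quot f (par s, par t)) \<le> a\<^sup>2 / b\<^sup>2 * gdens f s t"
    unfolding eq g .
qed

text \<open>Extended nonnegative form of the seminorm, so that two-sided bounds can be stated before
  finiteness is known and then decide integrability in both directions.\<close>

definition nng :: "(real^2 \<Rightarrow> complex^2) \<Rightarrow> ennreal" where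
  "nng f = (\<integral>\<^sup>+u. ennreal (diffsq (pullback f 1) u / (4 * (sin (u/2))\<^sup>2)) \<partial>circ)
     + (\<integral>\<^sup>+u. ennreal (diffsq (pullback f 2) u / (4 * (sin (u/2))\<^sup>2)) \<partial>circ)"

lemma nn_quot_bounds:
  assumes f: "f \<in> borel_measurable sig" and L: "L2 (pullback f 1)" "L2 (pullback f 2)"
  shows "ennreal (b\<^sup>2 / a\<^sup>2) * nng f \<le> (\<integral>\<^sup>+p. ennreal (quot f p) \<partial>(sig \<Otimes>\<^sub>M sig))"
    and "(\<integral>\<^sup>+p. ennreal (quot f p) \<partial>(sig \<Otimes>\<^sub>M sig)) \<le> ennreal (a\<^sup>2 / b\<^sup>2) * nng f"
proof -
  interpret S: finite_measure sig by (rule finite_measure_sig)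
  have [measurable]: "pullback f i \<in> borel_measurable borel" for i by (rule pullback_measurable[OF f])
  have [measurable]: "f \<in> borel_measurable sig" by (rule f)
  have qm[measurable]: "quot f \<in> borel_measurable (sig \<Otimes>\<^sub>M sig)" by (rule quot_measurable[OF f])
  have gm[measurable]: "(\<lambda>(s, t). gdens f s t) \<in> borel_measurable (circ \<Otimes>\<^sub>M circ)"
    unfolding gdens_def by measurable
  have G: "(\<integral>\<^sup>+s. (\<integral>\<^sup>+t. ennreal (c * gdens f s t) \<partial>circ) \<partial>circ) = ennreal c * nng f" if "c \<ge> 0" for c
  proof -
    have "(\<integral>\<^sup>+s. (\<integral>\<^sup>+t. ennreal (c * gdens f s t) \<partial>circ) \<partial>circ) = (\<integral>\<^sup>+s. (\<integral>\<^sup>+t. ennreal c * ennreal (gdens f s t) \<partial>circ) \<partial>circ)"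
      using that by (simp add: ennreal_mult' )
    also have "\<dots> = (\<integral>\<^sup>+s. ennreal c * (\<integral>\<^sup>+t. ennreal (gdens f s t) \<partial>circ) \<partial>circ)"
      by (intro nn_integral_cong nn_integral_cmult) measurable
    also have "\<dots> = ennreal c * (\<integral>\<^sup>+s. (\<integral>\<^sup>+t. ennreal (gdens f s t) \<partial>circ) \<partial>circ)"
      by (rule nn_integral_cmult) measurable
    also have "(\<integral>\<^sup>+s. (\<integral>\<^sup>+t. ennreal (gdens f s t) \<partial>circ) \<partial>circ) = nng f"
    proof -
      define V where "V i s t = ennreal ((cmod (pullback f i t - pullback f i s))\<^sup>2 / (4 * (sin ((t - s)/2))\<^sup>2))" for i s t
      have [measurable]: "(\<lambda>(s, t). V i s t) \<in> borel_measurable (circ \<Otimes>\<^sub>M circ)" for i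
        unfolding V_def by measurable
      have "(\<integral>\<^sup>+s. (\<integral>\<^sup>+t. ennreal (gdens f s t) \<partial>circ) \<partial>circ) = (\<integral>\<^sup>+s. (\<integral>\<^sup>+t. V 1 s t + V 2 s t \<partial>circ) \<partial>circ)"
        unfolding gdens_def V_def by (simp add: ennreal_plus[symmetric] del: ennreal_plus)
      also have "\<dots> = (\<integral>\<^sup>+s. (\<integral>\<^sup>+t. V 1 s t \<partial>circ) + (\<integral>\<^sup>+t. V 2 s t \<partial>circ) \<partial>circ)"
        by (intro nn_integral_cong nn_integral_add) measurable
      also have "\<dots> = (\<integral>\<^sup>+s. (\<integral>\<^sup>+t. V 1 s t \<partial>circ) \<partial>circ) + (\<integral>\<^sup>+s. (\<integral>\<^sup>+t. V 2 s t \<partial>circ) \<partial>circ)"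
        by (rule nn_integral_add) measurable
      finally show ?thesis unfolding nng_def V_def by (simp add: nn_gagliardo_circ L)
    qed
    finally show ?thesis .
  qed
  have "(\<integral>\<^sup>+p. ennreal (quot f p) \<partial>(sig \<Otimes>\<^sub>M sig)) = (\<integral>\<^sup>+x. (\<integral>\<^sup>+y. ennreal (quot f (x, y)) \<partial>sig) \<partial>sig)"
    by (rule S.nn_integral_fst[symmetric]) measurable
  also have "\<dots> = (\<integral>\<^sup>+s. ennreal (speed s) * (\<integral>\<^sup>+y. ennreal (quot f (par s, y)) \<partial>sig) \<partial>circ)"
    by (rule nn_integral_sig) measurable
  also have "\<dots> = (\<integral>\<^sup>+s. ennreal (speed s) * (\<integral>\<^sup>+t. ennreal (speed t) * ennreal (quot f (par s, par t)) \<partial>circ) \<partial>circ)"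
  proof (rule nn_integral_cong)
    fix s
    have "(\<lambda>y. (par s, y)) \<in> measurable sig (sig \<Otimes>\<^sub>M sig)"
      by (rule measurable_Pair1') (simp add: space_sig par_in_frontier)
    then have "(\<lambda>y. ennreal (quot f (par s, y))) \<in> borel_measurable sig"
      using measurable_compose[OF _ qm] by simp
    then show "ennreal (speed s) * (\<integral>\<^sup>+y. ennreal (quot f (par s, y)) \<partial>sig) = ennreal (speed s) * (\<integral>\<^sup>+t. ennreal (speed t) * ennreal (quot f (par s, par t)) \<partial>circ)"
      by (simp add: nn_integral_sig)
  qed
  also have "\<dots> = (\<integral>\<^sup>+s. (\<integral>\<^sup>+t. ennreal (speed s * (speed t * quot f (par s, par t))) \<partial>circ) \<partial>circ)"
  proof (rule nn_integral_cong)
    fix s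
    have "(\<lambda>y. (par s, y)) \<in> measurable sig (sig \<Otimes>\<^sub>M sig)"
      by (rule measurable_Pair1') (simp add: space_sig par_in_frontier)
    then have "(\<lambda>y. quot f (par s, y)) \<in> borel_measurable sig"
      using measurable_compose[OF _ qm] by simp
    then have "(\<lambda>t. quot f (par s, par t)) \<in> borel_measurable borel" by (rule compose_par_measurable)
    then have [measurable]: "(\<lambda>t. quot f (par s, par t)) \<in> borel_measurable circ" by (rule measurable_circ)
    have "ennreal (speed s * (speed t * quot f (par s, par t))) = ennreal (speed s) * (ennreal (speed t) * ennreal (quot f (par s, par t)))" for t
      using speed_pos[of s] speed_pos[of t] by (simp add: ennreal_mult del: times_divide_eq_right)
    then show "ennreal (speed s) * (\<integral>\<^sup>+t. ennreal (speed t) * ennreal (quot f (par s, par t)) \<partial>circ) = (\<integral>\<^sup>+t. ennreal (speed s * (speed t * quot f (par s, par t))) \<partial>circ)"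
      by (simp only:) (rule nn_integral_cmult[symmetric], measurable)
  qed
  finally have E: "(\<integral>\<^sup>+p. ennreal (quot f p) \<partial>(sig \<Otimes>\<^sub>M sig)) = (\<integral>\<^sup>+s. (\<integral>\<^sup>+t. ennreal (speed s * (speed t * quot f (par s, par t))) \<partial>circ) \<partial>circ)" .
  have p: "0 \<le> b\<^sup>2 / a\<^sup>2" "0 \<le> a\<^sup>2 / b\<^sup>2" by simp_all
  show "ennreal (b\<^sup>2 / a\<^sup>2) * nng f \<le> (\<integral>\<^sup>+p. ennreal (quot f p) \<partial>(sig \<Otimes>\<^sub>M sig))"
    unfolding E G[OF p(1), symmetric] by (intro nn_integral_mono ennreal_leI quot_par_bounds)
  show "(\<integral>\<^sup>+p. ennreal (quot f p) \<partial>(sig \<Otimes>\<^sub>M sig)) \<le> ennreal (a\<^sup>2 / b\<^sup>2) * nng f"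
    unfolding E G[OF p(2), symmetric] by (intro nn_integral_mono ennreal_leI quot_par_bounds)
qed

lemma nng_sobolev_half: "sobolev_half (pullback f 1) \<Longrightarrow> sobolev_half (pullback f 2) \<Longrightarrow> nng f = ennreal (gagliardo (pullback f 1) + gagliardo (pullback f 2))"
  by (simp add: nng_def nn_gagliardo gagliardo_nonneg)

lemma integrable_quot_iff:
  assumes f: "f \<in> borel_measurable sig" and L: "L2 (pullback f 1)" "L2 (pullback f 2)"
  shows "integrable (sig \<Otimes>\<^sub>M sig) (quot f) \<longleftrightarrow> sobolev_half (pullback f 1) \<and> sobolev_half (pullback f 2)"
proof -
  have "integrable (sig \<Otimes>\<^sub>M sig) (quot f) \<longleftrightarrow> (\<integral>\<^sup>+p. ennreal (quot f p) \<partial>(sig \<Otimes>\<^sub>M sig)) < \<infinity>"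
    using quot_measurable[OF f] by (subst integrable_iff_bounded) (auto simp: case_prod_beta)
  also have "\<dots> \<longleftrightarrow> nng f < \<infinity>"
  proof
    assume "(\<integral>\<^sup>+p. ennreal (quot f p) \<partial>(sig \<Otimes>\<^sub>M sig)) < \<infinity>"
    then have "ennreal (b\<^sup>2 / a\<^sup>2) * nng f < \<infinity>" using nn_quot_bounds(1)[OF f L] by (rule le_less_trans[rotated])
    then show "nng f < \<infinity>" using a_pos b_pos by (auto simp: ennreal_mult_less_top)
  next
    assume "nng f < \<infinity>"
    then have "ennreal (a\<^sup>2 / b\<^sup>2) * nng f < \<infinity>" by (simp add: ennreal_mult_less_top)
    then show "(\<integral>\<^sup>+p. ennreal (quot f p) \<partial>(sig \<Otimes>\<^sub>M sig)) < \<infinity>" using nn_quot_bounds(2)[OF f L] by (rule le_less_trans[rotated])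
  qed
  also have "\<dots> \<longleftrightarrow> sobolev_half (pullback f 1) \<and> sobolev_half (pullback f 2)"
    by (simp add: nng_def sobolev_half_iff_nn L)
  finally show ?thesis .
qed

lemma H_half_iff: "f \<in> H_half sig \<longleftrightarrow> f \<in> borel_measurable sig \<and> sobolev_half (pullback f 1) \<and> sobolev_half (pullback f 2)"
proof -
  have "f \<in> H_half sig \<longleftrightarrow> f \<in> borel_measurable sig \<and> integrable sig (\<lambda>x. (norm (f x))\<^sup>2) \<and> integrable (sig \<Otimes>\<^sub>M sig) (quot f)"
    by (simp add: H_half_def)
  then show ?thesis using L2_pullback_iff integrable_quot_iff sobolev_half_L2 by blast
qed

text \<open>Norm equivalence constants: \<open>b\<close> and \<open>a\<close> bound the square
  integral through the speed, the quotients of squares bound the seminorm as in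
  \<open>quot_par_bounds\<close>.\<close>

definition c1 :: real where "c1 = min b (b\<^sup>2 / a\<^sup>2)"
definition c2 :: real where "c2 = max a (a\<^sup>2 / b\<^sup>2)"

lemma c1_pos: "0 < c1" and c2_pos: "0 < c2"
  using a_pos b_pos by (auto simp: c1_def c2_def)

lemma H_half_norm_bounds:
  assumes "f \<in> H_half sig"
  shows "c1 * pullback_norm_sq f \<le> (H_half_norm sig f)\<^sup>2" "(H_half_norm sig f)\<^sup>2 \<le> c2 * pullback_norm_sq f"
proof -
  have f: "f \<in> borel_measurable sig" and h: "sobolev_half (pullback f 1)" "sobolev_half (pullback f 2)" using assms by (auto simp: H_half_iff)
  have L: "L2 (pullback f 1)" "L2 (pullback f 2)" using h by (auto dest: sobolev_half_L2)
  define I where "I = (\<integral>p. quot f p \<partial>(sig \<Otimes>\<^sub>M sig))"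
  define g where "g = gagliardo (pullback f 1) + gagliardo (pullback f 2)"
  define q where "q = l2_sq (pullback f 1) + l2_sq (pullback f 2)"
  have I0: "0 \<le> I" unfolding I_def by (rule Bochner_Integration.integral_nonneg) (auto simp: case_prod_beta)
  have g0: "0 \<le> g" by (simp add: g_def gagliardo_nonneg)
  have q0: "0 \<le> q" by (simp add: q_def)
  have eI: "(\<integral>\<^sup>+p. ennreal (quot f p) \<partial>(sig \<Otimes>\<^sub>M sig)) = ennreal I"
    unfolding I_def using h integrable_quot_iff[OF f L] by (intro nn_integral_eq_integral) (blast, auto)
  have "ennreal (b\<^sup>2 / a\<^sup>2 * g) \<le> ennreal I" "ennreal I \<le> ennreal (a\<^sup>2 / b\<^sup>2 * g)"
    using nn_quot_bounds[OF f L] unfolding eI nng_sobolev_half[OF h] g_def[symmetric]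
    by (simp_all only: ennreal_mult[OF zero_le_divide_iff[THEN iffD2] g0] zero_le_power2 simp_thms ennreal_mult' g0 ennreal_mult'')
  then have Ib: "b\<^sup>2 / a\<^sup>2 * g \<le> I" "I \<le> a\<^sup>2 / b\<^sup>2 * g"
    using I0 g0 by (simp_all only: ennreal_le_iff mult_nonneg_nonneg divide_nonneg_nonneg zero_le_power2)
  have n: "(H_half_norm sig f)\<^sup>2 = (\<integral>x. (norm (f x))\<^sup>2 \<partial>sig) + I"
    unfolding H_half_norm_def I_def[symmetric] using I0 by (simp add: I_def[symmetric])
  have t: "pullback_norm_sq f = q + g" by (simp add: pullback_norm_sq_def q_def g_def)
  have "c1 * q \<le> b * q" "c1 * g \<le> b\<^sup>2 / a\<^sup>2 * g" "a * q \<le> c2 * q" "a\<^sup>2 / b\<^sup>2 * g \<le> c2 * g"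
    using q0 g0 unfolding c1_def c2_def
    by (intro mult_right_mono; simp)+
  then show "c1 * pullback_norm_sq f \<le> (H_half_norm sig f)\<^sup>2" "(H_half_norm sig f)\<^sup>2 \<le> c2 * pullback_norm_sq f"
    unfolding n t using sq_integral_bounds[OF f L] Ib unfolding q_def[symmetric] distrib_left by linarith+
qed

lemma H_half_norm_nonneg: "0 \<le> H_half_norm sig f"
  unfolding H_half_norm_def by (intro real_sqrt_ge_zero add_nonneg_nonneg Bochner_Integration.integral_nonneg) (auto simp: case_prod_beta)

lemma H_half_add: "f \<in> H_half sig \<Longrightarrow> g \<in> H_half sig \<Longrightarrow> (\<lambda>x. f x + g x) \<in> H_half sig"
  unfolding H_half_iff pullback_def[abs_def] by (auto intro!: sobolev_half_add)

lemma vec_scale_measurable [measurable (raw)]: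
  fixes f :: "'x \<Rightarrow> complex^2"
  shows "f \<in> borel_measurable M \<Longrightarrow> (\<lambda>x. c *s f x) \<in> borel_measurable M"
  by (rule borel_measurable_continuous_on[of "\<lambda>v. c *s v", unfolded o_def])
     (auto intro!: linear_continuous_on linearI simp: linear_conv_bounded_linear[symmetric] vec_eq_iff algebra_simps)

lemma H_half_scale: "f \<in> H_half sig \<Longrightarrow> (\<lambda>x. c *s f x) \<in> H_half sig"
  unfolding H_half_iff pullback_def[abs_def] by (auto intro!: sobolev_half_cmult)

lemma norm_vec_scale: "norm (c *s (v::complex^2)) = cmod c * norm v"
proof -
  have "(norm (c *s v))\<^sup>2 = (cmod c * norm v)\<^sup>2"
    by (simp add: norm_vec2_sq power_mult_distrib norm_mult distrib_left)
  then show ?thesis by (metis abs_norm_cancel mult_nonneg_nonneg norm_ge_zero power2_eq_iff_nonneg)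
qed

lemma H_half_norm_scale: "H_half_norm sig (\<lambda>x. c *s f x) = cmod c * H_half_norm sig f"
proof -
  have d: "(c *s f x - c *s f y) = c *s (f x - f y)" for x y by (simp add: vec_eq_iff algebra_simps)
  have "quot (\<lambda>x. c *s f x) = (\<lambda>p. (cmod c)\<^sup>2 * quot f p)"
    by (intro ext) (simp only: case_prod_beta d norm_vec_scale power_mult_distrib times_divide_eq_right)
  then have "H_half_norm sig (\<lambda>x. c *s f x) = sqrt ((cmod c)\<^sup>2 * ((\<integral>x. (norm (f x))\<^sup>2 \<partial>sig) + (\<integral>p. quot f p \<partial>(sig \<Otimes>\<^sub>M sig))))"
    unfolding H_half_norm_def
    by (simp add: norm_vec_scale power_mult_distrib distrib_left)
  then show ?thesis by (simp add: H_half_norm_def real_sqrt_mult)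
qed

end

subsection \<open>Sequence representation of the dual space\<close>

definition nsq :: "(int \<Rightarrow> 2 \<Rightarrow> complex) \<Rightarrow> int \<Rightarrow> real" where
  "nsq c n = (cmod (c n 1))\<^sup>2 + (cmod (c n 2))\<^sup>2"

definition pr :: "(int \<Rightarrow> 2 \<Rightarrow> complex) \<Rightarrow> (int \<Rightarrow> 2 \<Rightarrow> complex) \<Rightarrow> int \<Rightarrow> complex" where
  "pr x c n = x n 1 * c n 1 + x n 2 * c n 2"

definition wt :: "int \<Rightarrow> real" where "wt n = 1 + \<bar>of_int n\<bar>"

text \<open>Membership in the weighted sequence space, with squared norm at most M, expressed by
  finite partial sums only. The weight 1 / (1 + |n|) is dual to the weight of order one
  half.\<close>

definition weighted_bounded :: "(int \<Rightarrow> 2 \<Rightarrow> complex) \<Rightarrow> real \<Rightarrow> bool" where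
  "weighted_bounded x M \<longleftrightarrow> (\<forall>J. finite J \<longrightarrow> (\<Sum>n\<in>J. nsq x n / wt n) \<le> M)"

lemma nsq_nonneg [simp]: "0 \<le> nsq c n" by (simp add: nsq_def)

lemma wt_pos [simp]: "0 < wt n" "wt n \<noteq> 0" "0 \<le> wt n" by (auto simp: wt_def)

lemma weighted_bounded_nonneg: "weighted_bounded x M \<Longrightarrow> 0 \<le> M"
  unfolding weighted_bounded_def by (drule spec[of _ "{}"]) simp

lemma cmod_pr_le: "cmod (pr x c n) \<le> sqrt (nsq x n) * sqrt (nsq c n)"
proof -
  have "cmod (pr x c n) \<le> cmod (x n 1) * cmod (c n 1) + cmod (x n 2) * cmod (c n 2)"
    unfolding pr_def by (metis norm_mult norm_triangle_ineq)
  also have "\<dots> \<le> sqrt (nsq x n * nsq c n)"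
  proof (rule real_le_rsqrt)
    show "(cmod (x n 1) * cmod (c n 1) + cmod (x n 2) * cmod (c n 2))\<^sup>2 \<le> nsq x n * nsq c n"
      using zero_le_power2[of "cmod (x n 1) * cmod (c n 2) - cmod (x n 2) * cmod (c n 1)"]
      unfolding nsq_def by (simp add: power2_eq_square algebra_simps)
  qed
  finally show ?thesis by (simp add: real_sqrt_mult)
qed

text \<open>Cauchy-Schwarz twice: over the two components at each frequency, and over the
  frequencies with \<open>sqrt (wt n)\<close> shifted from one sequence to the other.\<close>

lemma sum_pr_le:
  assumes "finite J"
  shows "(\<Sum>n\<in>J. cmod (pr x c n)) \<le> sqrt (\<Sum>n\<in>J. nsq x n / wt n) * sqrt (\<Sum>n\<in>J. wt n * nsq c n)"
proof -
  have "(\<Sum>n\<in>J. cmod (pr x c n)) \<le> (\<Sum>n\<in>J. \<bar>sqrt (nsq x n / wt n)\<bar> * \<bar>sqrt (wt n * nsq c n)\<bar>)"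
  proof (rule sum_mono)
    fix n
    have "sqrt (nsq x n / wt n) * sqrt (wt n * nsq c n) = sqrt (nsq x n) * sqrt (nsq c n)"
      by (simp add: real_sqrt_mult[symmetric])
    then show "cmod (pr x c n) \<le> \<bar>sqrt (nsq x n / wt n)\<bar> * \<bar>sqrt (wt n * nsq c n)\<bar>"
      using cmod_pr_le[of x c n] by simp
  qed
  also have "\<dots> \<le> L2_set (\<lambda>n. sqrt (nsq x n / wt n)) J * L2_set (\<lambda>n. sqrt (wt n * nsq c n)) J"
    by (rule L2_set_mult_ineq)
  finally show ?thesis by (simp add: L2_set_def)
qed

text \<open>Choose a finite set whose sum is within e of the supremum; any finite set disjoint from
  it can contribute at most e more.\<close>

lemma weighted_bounded_tail:
  assumes x: "weighted_bounded x M" and e: "0 < e"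
  obtains N :: nat where "\<And>J. finite J \<Longrightarrow> J \<inter> {-int N..int N} = {} \<Longrightarrow> (\<Sum>n\<in>J. nsq x n / wt n) \<le> e"
proof -
  define S where "S = (SUP J\<in>{J. finite J}. \<Sum>n\<in>J. nsq x n / wt n)"
  have bdd: "bdd_above ((\<lambda>J. \<Sum>n\<in>J. nsq x n / wt n) ` {J. finite J})"
    using x by (auto simp: weighted_bounded_def bdd_above_def)
  have "\<exists>J\<in>{J. finite J}. S - e < (\<Sum>n\<in>J. nsq x n / wt n)"
    unfolding S_def by (rule less_cSUP_iff[THEN iffD1, OF _ bdd]) (use e in \<open>auto simp: S_def\<close>)
  then obtain J0 where J0: "finite J0" "S - e < (\<Sum>n\<in>J0. nsq x n / wt n)" by auto
  define N where "N = nat (Max (insert 0 (abs ` J0)))"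
  have N: "\<bar>n\<bar> \<le> int N" if "n \<in> J0" for n
  proof -
    have "\<bar>n\<bar> \<le> Max (insert 0 (abs ` J0))" using that J0 by (intro Max_ge) auto
    moreover have "0 \<le> Max (insert 0 (abs ` J0))" using J0 by (intro Max_ge) auto
    ultimately show ?thesis by (simp add: N_def)
  qed
  show ?thesis
  proof (rule that)
    fix J assume J: "finite J" "J \<inter> {-int N..int N} = {}"
    have disj: "J \<inter> J0 = {}" using J(2) N by fastforce
    have "(\<Sum>n\<in>J. nsq x n / wt n) + (\<Sum>n\<in>J0. nsq x n / wt n) = (\<Sum>n\<in>J \<union> J0. nsq x n / wt n)"
      using J J0 disj by (simp add: sum.union_disjoint)
    also have "\<dots> \<le> S" unfolding S_def by (rule cSUP_upper[OF _ bdd]) (use J J0 in auto)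
    finally show "(\<Sum>n\<in>J. nsq x n / wt n) \<le> e" using J0 by simp
  qed
qed

context ell
begin

abbreviation "Hm \<equiv> H_mhalf sig"

text \<open>\<open>ez n\<close> is a trigonometric monomial: at \<open>par t\<close> it equals \<open>cis (n t)\<close>.\<close>

definition zc :: "real^2 \<Rightarrow> complex" where
  "zc x = of_real (x$1 / a) + \<i> * of_real (x$2 / b)"

definition ez :: "int \<Rightarrow> real^2 \<Rightarrow> complex" where
  "ez n x = (if n \<ge> 0 then zc x ^ nat n else cnj (zc x) ^ nat (-n))"

definition tvec :: "int set \<Rightarrow> (int \<Rightarrow> 2 \<Rightarrow> complex) \<Rightarrow> real^2 \<Rightarrow> complex^2" where
  "tvec J d x = (\<chi> i. \<Sum>n\<in>J. d n i * ez n x)"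

definition eb :: "int \<Rightarrow> 2 \<Rightarrow> real^2 \<Rightarrow> complex^2" where
  "eb n i = tvec {n} (\<lambda>_ j. if j = i then 1 else 0)"

text \<open>The functional is tested on the monomial of frequency +n. For a density this is an
  integral against \<open>cis (of_int n * t)\<close>, that is, 2 pi times the Fourier coefficient at
  -n; the sign changes of frequencies below stem from this.\<close>

definition hat :: "functional \<Rightarrow> int \<Rightarrow> 2 \<Rightarrow> complex" where
  "hat F n i = F (eb n i)"

definition cf :: "(real^2 \<Rightarrow> complex^2) \<Rightarrow> int \<Rightarrow> 2 \<Rightarrow> complex" where
  "cf f n i = fourier (pullback f i) n"

lemma zc_par: "zc (par t) = cis t"
  using a_pos b_pos by (simp add: zc_def complex_eq_iff)

lemma ez_par: "ez n (par t) = cis (of_int n * t)"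
proof (cases "n \<ge> 0")
  case True
  then have "real (nat n) = of_int n" by simp
  then show ?thesis using True by (simp add: ez_def zc_par Complex.DeMoivre)
next
  case False
  then have "real (nat (-n)) * - t = of_int n * t" by simp
  then show ?thesis using False by (simp add: ez_def zc_par cis_cnj Complex.DeMoivre)
qed

lemma ez_continuous: "continuous_on A (ez n)"
  unfolding ez_def[abs_def] zc_def[abs_def] by (cases "n \<ge> 0") (use a_pos b_pos in \<open>auto intro!: continuous_intros\<close>)

lemma pullback_tvec: "pullback (tvec J d) i = trig J (\<lambda>n. d n i)"
  by (auto simp: pullback_def tvec_def trig_def ez_par)

lemma tvec_measurable: "tvec J d \<in> borel_measurable sig"
proof -
  have "continuous_on UNIV (tvec J d)"
    unfolding tvec_def[abs_def] by (intro continuous_on_vec_lambda continuous_intros ez_continuous)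
  then show ?thesis by (intro measurable_compose[OF id_sig] borel_measurable_continuous_onI)
qed

lemma tvec_H: "finite J \<Longrightarrow> tvec J d \<in> H_half sig"
  by (simp add: H_half_iff tvec_measurable pullback_tvec sobolev_half_trig)

lemma zero_H: "(\<lambda>x. 0) \<in> H_half sig"
proof -
  have "tvec {} (\<lambda>_ _. 0) = (\<lambda>x. 0)" by (auto simp: tvec_def vec_eq_iff)
  then show ?thesis using tvec_H[of "{}" "\<lambda>_ _. 0"] by simp
qed

lemma cf_tvec: "finite J \<Longrightarrow> cf (tvec J d) n i = (if n \<in> J then d n i else 0)"
  by (simp add: cf_def pullback_tvec fourier_trig)

lemma sum_wt_cf_le:
  assumes "f \<in> H_half sig" "finite J"
  shows "(\<Sum>n\<in>J. wt n * nsq (cf f) n) \<le> pullback_norm_sq f"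
proof -
  have h: "sobolev_half (pullback f i)" for i using assms(1) exhaust_2[of i] by (auto simp: H_half_iff)
  have one: "(\<Sum>n\<in>J. wt n * (cmod (cf f n i))\<^sup>2) \<le> l2_sq (pullback f i) + gagliardo (pullback f i)" for i
  proof -
    define A where "A = (\<Sum>n\<in>J. (cmod (cf f n i))\<^sup>2)"
    define B where "B = (\<Sum>n\<in>J. \<bar>of_int n\<bar> * (cmod (cf f n i))\<^sup>2)"
    have AB: "0 \<le> A" "0 \<le> B" by (auto simp: A_def B_def sum_nonneg)
    have "2*pi * A \<le> l2_sq (pullback f i)" "(2*pi)\<^sup>2 * B \<le> gagliardo (pullback f i)"
      using bessel[OF sobolev_half_L2[OF h] assms(2)] gagliardo_bessel[OF h assms(2)] by (auto simp: A_def B_def cf_def)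
    moreover have "1 \<le> 2*pi" using pi_ge_two by simp
    then have "1 * A \<le> 2*pi * A" "1 * B \<le> (2*pi)\<^sup>2 * B"
      using AB by (auto intro!: mult_right_mono simp only: one_le_power)
    ultimately have "A + B \<le> l2_sq (pullback f i) + gagliardo (pullback f i)" by simp
    moreover have "(\<Sum>n\<in>J. wt n * (cmod (cf f n i))\<^sup>2) = A + B"
      by (simp add: A_def B_def wt_def distrib_right sum.distrib)
    ultimately show ?thesis by simp
  qed
  have "(\<Sum>n\<in>J. wt n * nsq (cf f) n) = (\<Sum>n\<in>J. wt n * (cmod (cf f n 1))\<^sup>2) + (\<Sum>n\<in>J. wt n * (cmod (cf f n 2))\<^sup>2)"
    by (simp add: nsq_def distrib_left sum.distrib)
  then show ?thesis using one[of 1] one[of 2] by (simp add: pullback_norm_sq_def)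
qed

lemma pullback_norm_sq_tvec_le:
  assumes "finite J"
  shows "pullback_norm_sq (tvec J d) \<le> (2*pi)\<^sup>2 * (\<Sum>n\<in>J. wt n * nsq d n)"
proof -
  have one: "l2_sq (trig J (\<lambda>n. d n i)) + gagliardo (trig J (\<lambda>n. d n i)) \<le> (2*pi)\<^sup>2 * (\<Sum>n\<in>J. wt n * (cmod (d n i))\<^sup>2)" for i
  proof -
    have "1 \<le> 2*pi" using pi_ge_two by simp
    then have "2*pi \<le> (2*pi)\<^sup>2" by (simp only: power2_eq_square mult_le_cancel_right1) simp
    then have "2*pi * (\<Sum>n\<in>J. (cmod (d n i))\<^sup>2) \<le> (2*pi)\<^sup>2 * (\<Sum>n\<in>J. (cmod (d n i))\<^sup>2)"
      by (intro mult_right_mono) (auto intro: sum_nonneg)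
    then show ?thesis using assms by (simp add: l2_sq_trig gagliardo_trig wt_def distrib_right sum.distrib distrib_left)
  qed
  have "pullback_norm_sq (tvec J d) \<le> (2*pi)\<^sup>2 * (\<Sum>n\<in>J. wt n * (cmod (d n 1))\<^sup>2) + (2*pi)\<^sup>2 * (\<Sum>n\<in>J. wt n * (cmod (d n 2))\<^sup>2)"
    unfolding pullback_norm_sq_def pullback_tvec using one[of 1] one[of 2] by linarith
  then show ?thesis by (simp add: nsq_def distrib_left sum.distrib)
qed

lemma Hm_add: "F \<in> Hm \<Longrightarrow> f \<in> H_half sig \<Longrightarrow> g \<in> H_half sig \<Longrightarrow> F (\<lambda>x. f x + g x) = F f + F g"
  and Hm_scale: "F \<in> Hm \<Longrightarrow> f \<in> H_half sig \<Longrightarrow> F (\<lambda>x. c *s f x) = c * F f"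
  and Hm_off: "F \<in> Hm \<Longrightarrow> f \<notin> H_half sig \<Longrightarrow> F f = 0"
  by (auto simp: H_mhalf_def)

text \<open>The norm is a supremum of reals, so the set is first bounded with the existential
  constant from the definition. That constant also disposes of functions of norm zero, which cannot
  be normalised.\<close>

lemma Hm_bound:
  assumes F: "F \<in> Hm" and f: "f \<in> H_half sig"
  shows "cmod (F f) \<le> H_mhalf_norm sig F * H_half_norm sig f"
proof -
  obtain C where C: "\<And>f. f \<in> H_half sig \<Longrightarrow> cmod (F f) \<le> C * H_half_norm sig f"
    using F unfolding H_mhalf_def by blast
  have bdd: "bdd_above ((\<lambda>f. cmod (F f)) ` {f \<in> H_half sig. H_half_norm sig f \<le> 1})"
  proof (rule bdd_aboveI2[where M="\<bar>C\<bar>"])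
    fix f assume "f \<in> {f \<in> H_half sig. H_half_norm sig f \<le> 1}"
    then have "cmod (F f) \<le> C * H_half_norm sig f" "H_half_norm sig f \<le> 1" using C by auto
    moreover have "C * H_half_norm sig f \<le> \<bar>C\<bar> * 1"
      using calculation H_half_norm_nonneg[of f] by (intro mult_mono) auto
    ultimately show "cmod (F f) \<le> \<bar>C\<bar>" by simp
  qed
  show ?thesis
  proof (cases "H_half_norm sig f = 0")
    case True
    then show ?thesis using C[OF f] by simp
  next
    case False
    define n where "n = H_half_norm sig f"
    have n: "0 < n" using False H_half_norm_nonneg[of f] by (simp add: n_def)
    define g where "g = (\<lambda>x. complex_of_real (1/n) *s f x)"
    have g: "g \<in> H_half sig" unfolding g_def by (rule H_half_scale[OF f])
    have "H_half_norm sig g = cmod (complex_of_real (1/n)) * n" unfolding g_def H_half_norm_scale n_def ..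
    then have "H_half_norm sig g \<le> 1" using n by (simp del: of_real_divide)
    then have "cmod (F g) \<le> H_mhalf_norm sig F"
      unfolding H_mhalf_norm_def using g by (intro cSUP_upper bdd) auto
    moreover have "F g = complex_of_real (1/n) * F f" unfolding g_def by (rule Hm_scale[OF F f])
    then have "cmod (F g) = cmod (F f) / n" using n by (simp add: norm_mult norm_divide)
    ultimately show ?thesis using n by (simp add: n_def[symmetric] field_simps)
  qed
qed

lemma Hm_norm_nonneg: assumes "F \<in> Hm" shows "0 \<le> H_mhalf_norm sig F"
proof -
  have "0 \<le> cmod (F (\<lambda>x. 0))" by simp
  have d: "eb 0 1 \<in> H_half sig" by (simp add: eb_def tvec_H)
  have "0 < pullback_norm_sq (eb 0 1)"
    unfolding eb_def pullback_norm_sq_def pullback_tvec by (simp add: l2_sq_trig gagliardo_trig)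
  then have "0 < c1 * pullback_norm_sq (eb 0 1)" using c1_pos by simp
  also have "\<dots> \<le> (H_half_norm sig (eb 0 1))\<^sup>2" by (rule H_half_norm_bounds[OF d])
  finally have "0 < H_half_norm sig (eb 0 1)" using H_half_norm_nonneg[of "eb 0 1"] by (simp add: less_le)
  moreover have "0 \<le> H_mhalf_norm sig F * H_half_norm sig (eb 0 1)"
    using Hm_bound[OF assms d] norm_ge_zero order_trans by blast
  ultimately show ?thesis by (simp add: zero_le_mult_iff)
qed

lemma Hm_norm_le:
  assumes "\<And>f. f \<in> H_half sig \<Longrightarrow> cmod (F f) \<le> B * H_half_norm sig f" "0 \<le> B"
  shows "H_mhalf_norm sig F \<le> B"
  unfolding H_mhalf_norm_def
proof (rule cSUP_least)
  have "H_half_norm sig (\<lambda>x. 0) = 0" using H_half_norm_scale[of 0 "\<lambda>x. 0"] by simp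
  then show "{f \<in> H_half sig. H_half_norm sig f \<le> 1} \<noteq> {}" using zero_H by force
next
  fix f assume f: "f \<in> {f \<in> H_half sig. H_half_norm sig f \<le> 1}"
  then have "cmod (F f) \<le> B * H_half_norm sig f" using assms by auto
  also have "\<dots> \<le> B * 1" using f assms by (intro mult_left_mono) auto
  finally show "cmod (F f) \<le> B" by simp
qed

lemma Hm_tvec:
  assumes F: "F \<in> Hm" and "finite J"
  shows "F (tvec J d) = (\<Sum>n\<in>J. pr d (hat F) n)"
  using \<open>finite J\<close>
proof (induction J)
  case empty
  have "tvec {} d = (\<lambda>x. 0 *s tvec {} d x)" by (auto simp: tvec_def vec_eq_iff)
  then have "F (tvec {} d) = 0 * F (tvec {} d)" using Hm_scale[OF F tvec_H[of "{}"], of 0] by (metis finite.emptyI)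
  then show ?case by simp
next
  case (insert n J)
  have H: "eb n i \<in> H_half sig" for i by (simp add: eb_def tvec_H)
  have "tvec (insert n J) d = (\<lambda>x. (d n 1 *s eb n 1 x + d n 2 *s eb n 2 x) + tvec J d x)"
    using insert by (auto simp: tvec_def eb_def vec_eq_iff forall_2)
  then have "F (tvec (insert n J) d) = d n 1 * F (eb n 1) + d n 2 * F (eb n 2) + F (tvec J d)"
    using insert by (simp add: Hm_add[OF F] Hm_scale[OF F] H H_half_scale H_half_add tvec_H)
  then show ?case using insert by (simp add: pr_def hat_def)
qed

text \<open>Duality: a well chosen test polynomial gives X for the value of F and at most
  \<open>K * X\<close> for the squared test norm, so X^2 \<le> B^2 K X, and one factor X
  cancels.\<close>

lemma hat_weighted_bounded:
  assumes F: "F \<in> Hm"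
  shows "weighted_bounded (hat F) ((H_mhalf_norm sig F)\<^sup>2 * (c2 * (2*pi)\<^sup>2))"
  unfolding weighted_bounded_def
proof (intro allI impI)
  fix J :: "int set" assume J: "finite J"
  define X where "X = (\<Sum>n\<in>J. nsq (hat F) n / wt n)"
  \<comment> \<open>The extremal sequence of the weighted Cauchy-Schwarz inequality.\<close>
  define d where "d n i = cnj (hat F n i) / wt n" for n i
  define B where "B = H_mhalf_norm sig F"
  define K where "K = c2 * (2*pi)\<^sup>2"
  have X0: "0 \<le> X" by (auto simp: X_def intro!: sum_nonneg divide_nonneg_nonneg)
  have "pr d (hat F) n = complex_of_real (nsq (hat F) n / wt n)" for n
    by (simp add: pr_def d_def nsq_def cmod_sq_cnj add_divide_distrib mult.commute)
  then have "F (tvec J d) = complex_of_real X"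
    using Hm_tvec[OF F J, of d] by (simp add: X_def)
  then have "X \<le> B * H_half_norm sig (tvec J d)"
    using Hm_bound[OF F tvec_H[OF J], of d] X0 by (simp add: B_def)
  then have "X\<^sup>2 \<le> B\<^sup>2 * (H_half_norm sig (tvec J d))\<^sup>2"
    using power_mono[OF _ X0, of "B * H_half_norm sig (tvec J d)" 2] by (simp add: power_mult_distrib)
  also have "\<dots> \<le> B\<^sup>2 * (K * X)"
  proof (rule mult_left_mono)
    have "wt n * nsq d n = nsq (hat F) n / wt n" for n
      by (simp add: nsq_def d_def norm_divide power_divide) (simp add: add_divide_distrib[symmetric] power2_eq_square)
    then have "pullback_norm_sq (tvec J d) \<le> (2*pi)\<^sup>2 * X"
      using pullback_norm_sq_tvec_le[OF J, of d] by (simp add: X_def)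
    then have "c2 * pullback_norm_sq (tvec J d) \<le> c2 * ((2*pi)\<^sup>2 * X)" using c2_pos by simp
    then show "(H_half_norm sig (tvec J d))\<^sup>2 \<le> K * X"
      using H_half_norm_bounds(2)[OF tvec_H[OF J], of d] by (simp add: K_def)
  qed simp
  finally have "X * X \<le> (B\<^sup>2 * K) * X" by (simp add: power2_eq_square)
  then have "X \<le> B\<^sup>2 * K"
  proof (cases "X = 0")
    case True
    then show ?thesis using c2_pos by (simp add: K_def)
  next
    case False
    then show ?thesis using \<open>X * X \<le> (B\<^sup>2 * K) * X\<close> X0 by simp
  qed
  then show "(\<Sum>n\<in>J. nsq (hat F) n / wt n) \<le> (H_mhalf_norm sig F)\<^sup>2 * (c2 * (2*pi)\<^sup>2)"
    by (simp only: X_def B_def K_def)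
qed

text \<open>The symmetric partial sums of f converge in the norm of order one half, and F is
  continuous in it. Hence F is determined by its values on the monomials.\<close>

lemma Hm_expansion:
  assumes F: "F \<in> Hm" and f: "f \<in> H_half sig"
  shows "(\<lambda>N. \<Sum>n\<in>{-int N..int N}. pr (cf f) (hat F) n) \<longlonglongrightarrow> F f"
proof -
  define S where "S N = tvec {-int N..int N} (cf f)" for N :: nat
  define r where "r N = (\<lambda>x. f x + (-1) *s S N x)" for N
  have SH: "S N \<in> H_half sig" for N by (simp add: S_def tvec_H)
  have rH: "r N \<in> H_half sig" for N unfolding r_def by (intro H_half_add f H_half_scale SH)
  have h: "sobolev_half (pullback f i)" for i using f exhaust_2[of i] by (auto simp: H_half_iff)
  have cr: "pullback (r N) i = (\<lambda>t. pullback f i t - trig {-int N..int N} (fourier (pullback f i)) t)" for N i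
    using pullback_tvec[of "{-int N..int N}" "cf f" i] by (auto simp: r_def S_def pullback_def cf_def fun_eq_iff)
  have "(\<lambda>N. pullback_norm_sq (r N)) \<longlonglongrightarrow> (0 + 0) + (0 + 0)"
    unfolding pullback_norm_sq_def cr by (intro tendsto_add l2_sq_fourier_remainder gagliardo_fourier_remainder h)
  then have t0: "(\<lambda>N. sqrt (c2 * pullback_norm_sq (r N))) \<longlonglongrightarrow> 0"
    using tendsto_real_sqrt[OF tendsto_mult_left[of "\<lambda>N. pullback_norm_sq (r N)" 0 sequentially c2]] by simp
  have "H_half_norm sig (r N) \<le> sqrt (c2 * pullback_norm_sq (r N))" for N
    using H_half_norm_bounds(2)[OF rH[of N]] by (intro real_le_rsqrt)
  then have b: "cmod (F (r N)) \<le> H_mhalf_norm sig F * sqrt (c2 * pullback_norm_sq (r N))" for N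
    using Hm_bound[OF F rH[of N]] mult_left_mono[OF _ Hm_norm_nonneg[OF F]] order_trans by blast
  have "(\<lambda>N. F (r N)) \<longlonglongrightarrow> 0"
    by (rule Lim_null_comparison[OF always_eventually[OF allI[OF b]] tendsto_mult_right_zero[OF t0]])
  moreover have "F (r N) = F f - (\<Sum>n\<in>{-int N..int N}. pr (cf f) (hat F) n)" for N
  proof -
    have "F (r N) = F f + (-1) * F (S N)"
      unfolding r_def by (simp only: Hm_add[OF F f H_half_scale[OF SH]] Hm_scale[OF F SH])
    then show ?thesis using Hm_tvec[OF F, of "{-int N..int N}" "cf f"] by (simp add: S_def)
  qed
  ultimately have "(\<lambda>N. F f - (\<Sum>n\<in>{-int N..int N}. pr (cf f) (hat F) n)) \<longlonglongrightarrow> 0" by simp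
  from tendsto_diff[OF tendsto_const[of "F f"] this] show ?thesis by simp
qed

text \<open>Elements of the dual space vanish off \<open>H_half sig\<close>, so equal coefficients
  give equality as total functions, not merely on the test space.\<close>

lemma Hm_eqI:
  assumes "F \<in> Hm" "G \<in> Hm" "\<And>n i. hat F n i = hat G n i"
  shows "F = G"
proof
  fix f
  have "hat F = hat G" using assms(3) by blast
  then show "F f = G f"
    using Hm_expansion[OF assms(1), of f] Hm_expansion[OF assms(2), of f] Hm_off[OF assms(1), of f] Hm_off[OF assms(2), of f]
    by (cases "f \<in> H_half sig") (auto intro: LIMSEQ_unique)
qed

lemma sum_pr_cf_le:
  assumes x: "weighted_bounded x M" and f: "f \<in> H_half sig" and J: "finite J"
  shows "(\<Sum>n\<in>J. cmod (pr x (cf f) n)) \<le> sqrt (M / c1) * H_half_norm sig f"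
proof -
  have M: "0 \<le> M" by (rule weighted_bounded_nonneg[OF x])
  have "(\<Sum>n\<in>J. cmod (pr x (cf f) n)) \<le> sqrt (\<Sum>n\<in>J. nsq x n / wt n) * sqrt (\<Sum>n\<in>J. wt n * nsq (cf f) n)"
    by (rule sum_pr_le[OF J])
  also have "\<dots> \<le> sqrt M * sqrt (pullback_norm_sq f)"
    using x J sum_wt_cf_le[OF f J] M by (intro mult_mono) (auto simp: weighted_bounded_def intro!: sum_nonneg)
  also have "sqrt (pullback_norm_sq f) \<le> sqrt ((H_half_norm sig f)\<^sup>2 / c1)"
    using H_half_norm_bounds(1)[OF f] c1_pos by (simp add: field_simps)
  finally show ?thesis
    using M H_half_norm_nonneg[of f] c1_pos by (simp add: real_sqrt_divide mult_left_mono)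
qed

lemma Hm_norm_hat:
  assumes F: "F \<in> Hm" and x: "weighted_bounded (hat F) M"
  shows "H_mhalf_norm sig F \<le> sqrt (M / c1)"
proof (rule Hm_norm_le)
  fix f assume f: "f \<in> H_half sig"
  have "cmod (\<Sum>n\<in>{-int N..int N}. pr (cf f) (hat F) n) \<le> sqrt (M / c1) * H_half_norm sig f" for N
    using order_trans[OF norm_sum sum_pr_cf_le[OF x f, of "{-int N..int N}"]] by (simp add: pr_def mult.commute)
  with Hm_expansion[OF F f] show "cmod (F f) \<le> sqrt (M / c1) * H_half_norm sig f"
    by (intro tendsto_upperbound[OF tendsto_norm]) auto
qed (use weighted_bounded_nonneg[OF x] c1_pos in simp)

text \<open>Inverse of \<open>hat\<close> on sequences bounded in the weighted sense; the value 0
  elsewhere is the one prescribed by \<open>H_mhalf\<close>.\<close>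

definition of_seq :: "(int \<Rightarrow> 2 \<Rightarrow> complex) \<Rightarrow> functional" where
  "of_seq x f = (if f \<in> H_half sig then (\<Sum>\<^sub>\<infinity>n. pr x (cf f) n) else 0)"

lemma summable_pr:
  assumes "weighted_bounded x M" "f \<in> H_half sig"
  shows "(\<lambda>n. cmod (pr x (cf f) n)) summable_on UNIV"
  by (rule nonneg_bdd_above_summable_on) (use sum_pr_cf_le[OF assms] in \<open>auto simp: bdd_above_def\<close>)

lemma cf_add: "f \<in> H_half sig \<Longrightarrow> g \<in> H_half sig \<Longrightarrow> cf (\<lambda>x. f x + g x) n i = cf f n i + cf g n i"
  unfolding cf_def pullback_def[abs_def] vector_add_component
  by (rule fourier_add) (use exhaust_2[of i] in \<open>auto simp: H_half_iff pullback_def[abs_def] intro: sobolev_half_L2\<close>)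

lemma cf_scale: "cf (\<lambda>x. c *s f x) n i = c * cf f n i"
  unfolding cf_def pullback_def[abs_def] by (simp add: fourier_cmult)

lemma of_seq_Hm:
  assumes x: "weighted_bounded x M" shows "of_seq x \<in> Hm"
proof -
  have bound: "cmod (of_seq x f) \<le> sqrt (M / c1) * H_half_norm sig f" if f: "f \<in> H_half sig" for f
  proof -
    have "cmod (\<Sum>\<^sub>\<infinity>n. pr x (cf f) n) \<le> (\<Sum>\<^sub>\<infinity>n. cmod (pr x (cf f) n))"
      by (rule norm_infsum_bound[OF summable_pr[OF x f]])
    also have "\<dots> \<le> sqrt (M / c1) * H_half_norm sig f"
      by (rule infsum_le_finite_sums[OF summable_pr[OF x f] sum_pr_cf_le[OF x f]])
    finally show ?thesis using f by (simp add: of_seq_def)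
  qed
  have s: "(\<lambda>n. pr x (cf f) n) summable_on UNIV" if "f \<in> H_half sig" for f
    by (rule abs_summable_summable[OF summable_pr[OF x that]])
  show ?thesis
    unfolding H_mhalf_def
  proof (intro CollectI conjI ballI allI impI)
    fix f g assume "f \<in> H_half sig" "g \<in> H_half sig"
    then show "of_seq x (\<lambda>x. f x + g x) = of_seq x f + of_seq x g"
      by (simp add: of_seq_def H_half_add pr_def[abs_def] cf_add distrib_left add_ac infsum_add[OF s s, unfolded pr_def[abs_def], symmetric])
  next
    fix c f assume "f \<in> H_half sig"
    then show "of_seq x (\<lambda>x. c *s f x) = c * of_seq x f"
      by (simp add: of_seq_def H_half_scale pr_def[abs_def] cf_scale infsum_cmult_right'[symmetric] algebra_simps)
  next
    show "\<exists>C. \<forall>f\<in>H_half sig. cmod (of_seq x f) \<le> C * H_half_norm sig f" using bound by blast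
  qed (simp add: of_seq_def)
qed

lemma hat_of_seq: "hat (of_seq x) n i = x n i"
proof -
  have H: "eb n i \<in> H_half sig" by (simp add: eb_def tvec_H)
  have c: "cf (eb n i) m j = (if m = n \<and> j = i then 1 else 0)" for m j
    by (simp add: eb_def cf_tvec)
  have "(\<Sum>\<^sub>\<infinity>m. pr x (cf (eb n i)) m) = (\<Sum>\<^sub>\<infinity>m\<in>{n}. pr x (cf (eb n i)) m)"
    by (rule infsum_cong_neutral) (auto simp: pr_def c)
  also have "\<dots> = x n i" using exhaust_2[of i] by (auto simp: pr_def c)
  finally show ?thesis using H by (simp add: hat_def of_seq_def)
qed

lemma Hm_plus: assumes "F \<in> Hm" "G \<in> Hm" shows "F + G \<in> Hm"
proof -
  have "\<exists>C. \<forall>f\<in>H_half sig. cmod ((F + G) f) \<le> C * H_half_norm sig f"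
  proof (intro exI ballI)
    fix f assume f: "f \<in> H_half sig"
    show "cmod ((F + G) f) \<le> (H_mhalf_norm sig F + H_mhalf_norm sig G) * H_half_norm sig f"
      using Hm_bound[OF assms(1) f] Hm_bound[OF assms(2) f] norm_triangle_ineq[of "F f" "G f"]
      by (simp add: distrib_right)
  qed
  then show ?thesis using assms unfolding H_mhalf_def by (auto simp: distrib_left)
qed

lemma Hm_cmult: assumes "F \<in> Hm" shows "(\<lambda>f. c * F f) \<in> Hm"
proof -
  have "\<exists>C. \<forall>f\<in>H_half sig. cmod (c * F f) \<le> C * H_half_norm sig f"
  proof (intro exI ballI)
    fix f assume f: "f \<in> H_half sig"
    show "cmod (c * F f) \<le> (cmod c * H_mhalf_norm sig F) * H_half_norm sig f"
      using mult_left_mono[OF Hm_bound[OF assms f], of "cmod c"] by (simp add: norm_mult mult.assoc)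
  qed
  then show ?thesis using assms unfolding H_mhalf_def by (auto simp: distrib_left)
qed

lemma hat_plus: "hat (F + G) n i = hat F n i + hat G n i"
  and hat_cmult: "hat (\<lambda>f. c * F f) n i = c * hat F n i"
  by (simp_all add: hat_def)

subsection \<open>Multiplier operators\<close>

text \<open>The last condition allows a multiplier to mix the frequencies \<open>n\<close> and \<open>-n\<close>.\<close>

definition mult_seq :: "((int \<Rightarrow> 2 \<Rightarrow> complex) \<Rightarrow> (int \<Rightarrow> 2 \<Rightarrow> complex)) \<Rightarrow> real \<Rightarrow> bool" where
  "mult_seq T K \<longleftrightarrow> 0 \<le> K \<and> (\<forall>x y. T (\<lambda>n i. x n i + y n i) = (\<lambda>n i. T x n i + T y n i)) \<and>
     (\<forall>c x. T (\<lambda>n i. c * x n i) = (\<lambda>n i. c * T x n i)) \<and>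
     (\<forall>x n. nsq (T x) n \<le> K * (nsq x n + nsq x (-n)))"

text \<open>The value 0 off \<open>Hm\<close> is dictated by the last clause in the description of
  \<open>NP_operator\<close>.\<close>

definition mult_op :: "((int \<Rightarrow> 2 \<Rightarrow> complex) \<Rightarrow> (int \<Rightarrow> 2 \<Rightarrow> complex)) \<Rightarrow> functional \<Rightarrow> functional" where
  "mult_op T F = (if F \<in> Hm then of_seq (T (hat F)) else 0)"

text \<open>The weight is even in n, so the terms at n and at -n each contribute at most K
  M.\<close>

lemma mult_seq_weighted_bounded:
  assumes T: "mult_seq T K" and x: "weighted_bounded x M"
  shows "weighted_bounded (T x) (2 * K * M)"
  unfolding weighted_bounded_def
proof (intro allI impI)
  fix J :: "int set" assume J: "finite J"
  have K: "0 \<le> K" using T by (simp add: mult_seq_def)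
  have "(\<Sum>n\<in>J. nsq (T x) n / wt n) \<le> (\<Sum>n\<in>J. K * (nsq x n / wt n) + K * (nsq x (-n) / wt (-n)))"
  proof (rule sum_mono)
    fix n
    have "nsq (T x) n / wt n \<le> K * (nsq x n + nsq x (-n)) / wt n"
      using T by (intro divide_right_mono) (auto simp: mult_seq_def)
    also have "\<dots> = K * (nsq x n / wt n) + K * (nsq x (-n) / wt (-n))"
      by (simp add: wt_def distrib_left add_divide_distrib)
    finally show "nsq (T x) n / wt n \<le> K * (nsq x n / wt n) + K * (nsq x (-n) / wt (-n))" .
  qed
  also have "\<dots> = K * (\<Sum>n\<in>J. nsq x n / wt n) + K * (\<Sum>n\<in>J. nsq x (-n) / wt (-n))"
    by (simp add: sum.distrib sum_distrib_left)
  also have "(\<Sum>n\<in>J. nsq x (-n) / wt (-n)) = (\<Sum>n\<in>uminus ` J. nsq x n / wt n)"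
    by (subst sum.reindex) auto
  also have "K * (\<Sum>n\<in>J. nsq x n / wt n) + K * (\<Sum>n\<in>uminus ` J. nsq x n / wt n) \<le> K * M + K * M"
    using x J K by (intro add_mono mult_left_mono) (auto simp: weighted_bounded_def)
  finally show "(\<Sum>n\<in>J. nsq (T x) n / wt n) \<le> 2 * K * M" by simp
qed

lemma mult_op_Hm: "mult_seq T K \<Longrightarrow> F \<in> Hm \<Longrightarrow> mult_op T F \<in> Hm"
  by (simp add: mult_op_def) (rule of_seq_Hm[OF mult_seq_weighted_bounded[OF _ hat_weighted_bounded]])

lemma hat_mult_op: "F \<in> Hm \<Longrightarrow> hat (mult_op T F) = T (hat F)"
  by (simp add: mult_op_def fun_eq_iff hat_of_seq)

lemma bounded_mult_op:
  assumes T: "mult_seq T K"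
  shows "bounded_operator_on sig (mult_op T)"
  unfolding bounded_operator_on_def
proof (intro conjI ballI allI)
  fix F G assume FG: "F \<in> Hm" "G \<in> Hm"
  show "mult_op T (F + G) = mult_op T F + mult_op T G"
  proof (rule Hm_eqI)
    fix n i
    have "hat (F + G) = (\<lambda>n i. hat F n i + hat G n i)" by (simp add: hat_plus fun_eq_iff)
    then have "T (hat (F + G)) = (\<lambda>n i. T (hat F) n i + T (hat G) n i)" using T by (simp add: mult_seq_def)
    then show "hat (mult_op T (F + G)) n i = hat (mult_op T F + mult_op T G) n i"
      using FG by (simp add: hat_mult_op Hm_plus hat_plus)
  qed (intro mult_op_Hm[OF T] Hm_plus FG)+
next
  fix c F assume F: "F \<in> Hm"
  show "mult_op T (\<lambda>f. c * F f) = (\<lambda>f. c * mult_op T F f)"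
  proof (rule Hm_eqI)
    fix n i
    have "hat (\<lambda>f. c * F f) = (\<lambda>n i. c * hat F n i)" by (simp add: hat_cmult fun_eq_iff)
    then have "T (hat (\<lambda>f. c * F f)) = (\<lambda>n i. c * T (hat F) n i)" using T by (simp add: mult_seq_def)
    then show "hat (mult_op T (\<lambda>f. c * F f)) n i = hat (\<lambda>f. c * mult_op T F f) n i"
      using F by (simp add: hat_mult_op Hm_cmult hat_cmult)
  qed (intro mult_op_Hm[OF T] Hm_cmult F)+
next
  show "\<exists>C. \<forall>F\<in>Hm. H_mhalf_norm sig (mult_op T F) \<le> C * H_mhalf_norm sig F"
  proof (intro exI ballI)
    fix F assume F: "F \<in> Hm"
    have "weighted_bounded (hat (mult_op T F)) (2 * K * ((H_mhalf_norm sig F)\<^sup>2 * (c2 * (2*pi)\<^sup>2)))"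
      unfolding hat_mult_op[OF F] by (rule mult_seq_weighted_bounded[OF T hat_weighted_bounded[OF F]])
    from Hm_norm_hat[OF mult_op_Hm[OF T F] this]
    have "H_mhalf_norm sig (mult_op T F) \<le> sqrt ((2 * K * (c2 * (2*pi)\<^sup>2) / c1) * (H_mhalf_norm sig F)\<^sup>2)"
      by (simp add: mult_ac)
    then show "H_mhalf_norm sig (mult_op T F) \<le> sqrt (2 * K * (c2 * (2*pi)\<^sup>2) / c1) * H_mhalf_norm sig F"
      unfolding real_sqrt_mult real_sqrt_abs by (simp only: abs_of_nonneg[OF Hm_norm_nonneg[OF F]])
  qed
qed (rule mult_op_Hm[OF T])

text \<open>Uniqueness of continuous extensions. F is split into finitely many frequencies, where T
  and U agree, and a tail so small in norm that both operators send it below \<epsilon> on a fixed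
  monomial.\<close>

lemma bounded_operator_eqI:
  assumes T: "bounded_operator_on sig T" and U: "bounded_operator_on sig U"
    and eq: "\<And>F N. F \<in> Hm \<Longrightarrow> (\<And>n i. n \<notin> {-int N..int N} \<Longrightarrow> hat F n i = 0) \<Longrightarrow> T F = U F"
    and F: "F \<in> Hm"
  shows "T F = U F"
proof (rule Hm_eqI)
  show TF: "T F \<in> Hm" "U F \<in> Hm" using T U F by (auto simp: bounded_operator_on_def)
  obtain C where C: "\<And>F. F \<in> Hm \<Longrightarrow> H_mhalf_norm sig (T F) \<le> C * H_mhalf_norm sig F"
    using T unfolding bounded_operator_on_def by blast
  obtain D where D: "\<And>F. F \<in> Hm \<Longrightarrow> H_mhalf_norm sig (U F) \<le> D * H_mhalf_norm sig F"
    using U unfolding bounded_operator_on_def by blast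
  have weighted_bounded_restrict: "weighted_bounded (\<lambda>n i. if P n then x n i else 0) M" if "weighted_bounded x M" for P x M
    unfolding weighted_bounded_def
  proof (intro allI impI)
    fix J :: "int set" assume "finite J"
    have "(\<Sum>n\<in>J. nsq (\<lambda>n i. if P n then x n i else 0) n / wt n) \<le> (\<Sum>n\<in>J. nsq x n / wt n)"
      by (intro sum_mono divide_right_mono) (auto simp: nsq_def)
    then show "(\<Sum>n\<in>J. nsq (\<lambda>n i. if P n then x n i else 0) n / wt n) \<le> M"
      using that \<open>finite J\<close> by (fastforce simp: weighted_bounded_def)
  qed
  fix n i
  have H: "eb n i \<in> H_half sig" by (simp add: eb_def tvec_H)
  have "cmod (hat (T F) n i - hat (U F) n i) \<le> 0 + \<epsilon>" if "0 < \<epsilon>" for \<epsilon>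
  proof -
    \<comment> \<open>Collects both operator bounds on the chosen monomial; the summand 1 keeps B
      positive for the division below.\<close>
    define B where "B = (\<bar>C\<bar> + \<bar>D\<bar>) * H_half_norm sig (eb n i) + 1"
    have B: "0 < B" unfolding B_def using H_half_norm_nonneg[of "eb n i"] by (simp add: add_nonneg_pos)
    \<comment> \<open>Chosen so that the bound \<open>sqrt (e / c1)\<close> of
      \<open>Hm_norm_hat\<close> for the tail equals \<epsilon> / B.\<close>
    define e where "e = c1 * (\<epsilon> / B)\<^sup>2"
    have e: "0 < e" using that B c1_pos by (simp add: e_def)
    obtain N :: nat where N: "\<And>J. finite J \<Longrightarrow> J \<inter> {-int N..int N} = {} \<Longrightarrow> (\<Sum>n\<in>J. nsq (hat F) n / wt n) \<le> e"
      using weighted_bounded_tail[OF hat_weighted_bounded[OF F] e] by blast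
    define x where "x n i = (if n \<in> {-int N..int N} then hat F n i else 0)" for n i
    define y where "y n i = (if n \<notin> {-int N..int N} then hat F n i else 0)" for n i
    have x: "of_seq x \<in> Hm" and y: "of_seq y \<in> Hm"
      unfolding x_def y_def by (intro of_seq_Hm[OF weighted_bounded_restrict[OF hat_weighted_bounded[OF F]]])+
    have FG: "F = of_seq x + of_seq y"
      by (rule Hm_eqI[OF F Hm_plus[OF x y]]) (simp add: hat_plus hat_of_seq x_def y_def)
    have "weighted_bounded (hat (of_seq y)) e"
      unfolding weighted_bounded_def
    proof (intro allI impI)
      fix J :: "int set" assume J: "finite J"
      have "(\<Sum>n\<in>J. nsq (hat (of_seq y)) n / wt n) = (\<Sum>n\<in>J - {-int N..int N}. nsq (hat F) n / wt n)"
        by (rule sum.mono_neutral_cong_right) (use J in \<open>auto simp: nsq_def hat_of_seq y_def\<close>)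
      also have "\<dots> \<le> e" by (rule N) (use J in auto)
      finally show "(\<Sum>n\<in>J. nsq (hat (of_seq y)) n / wt n) \<le> e" .
    qed
    from Hm_norm_hat[OF y this] have ny: "H_mhalf_norm sig (of_seq y) \<le> \<epsilon> / B"
      using c1_pos that B by (simp add: e_def)
    have "T (of_seq x) = U (of_seq x)"
      by (rule eq[OF x, of N]) (auto simp: hat_of_seq x_def)
    moreover have "T F = T (of_seq x) + T (of_seq y)" "U F = U (of_seq x) + U (of_seq y)"
      using T U x y unfolding bounded_operator_on_def by (auto simp only: FG)
    ultimately have "hat (T F) n i - hat (U F) n i = hat (T (of_seq y)) n i - hat (U (of_seq y)) n i"
      by (simp add: hat_plus)
    then have "cmod (hat (T F) n i - hat (U F) n i) \<le> cmod (T (of_seq y) (eb n i)) + cmod (U (of_seq y) (eb n i))"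
      by (simp add: hat_def norm_triangle_ineq4)
    also have "\<dots> \<le> (\<bar>C\<bar> * (\<epsilon> / B)) * H_half_norm sig (eb n i) + (\<bar>D\<bar> * (\<epsilon> / B)) * H_half_norm sig (eb n i)"
    proof -
      have "cmod (V (of_seq y) (eb n i)) \<le> (\<bar>c\<bar> * (\<epsilon> / B)) * H_half_norm sig (eb n i)"
        if V: "V (of_seq y) \<in> Hm" and c: "H_mhalf_norm sig (V (of_seq y)) \<le> c * H_mhalf_norm sig (of_seq y)" for V c
      proof -
        have "c * H_mhalf_norm sig (of_seq y) \<le> \<bar>c\<bar> * (\<epsilon> / B)"
          using ny Hm_norm_nonneg[OF y] by (intro mult_mono) auto
        then have "H_mhalf_norm sig (V (of_seq y)) \<le> \<bar>c\<bar> * (\<epsilon> / B)" using c by linarith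
        from mult_right_mono[OF this H_half_norm_nonneg[of "eb n i"]]
        show ?thesis using Hm_bound[OF V H] by linarith
      qed
      then show ?thesis using T U y C[OF y] D[OF y] by (intro add_mono) (auto simp: bounded_operator_on_def)
    qed
    also have "\<dots> = ((\<bar>C\<bar> + \<bar>D\<bar>) * H_half_norm sig (eb n i)) * (\<epsilon> / B)" by (simp add: algebra_simps)
    also have "\<dots> \<le> B * (\<epsilon> / B)" using that B by (intro mult_right_mono) (auto simp: B_def)
    finally show ?thesis using B by simp
  qed
  then have "cmod (hat (T F) n i - hat (U F) n i) \<le> 0" by (rule field_le_epsilon)
  then show "hat (T F) n i = hat (U F) n i" by simp
qed

end

section \<open>Densities\<close>

text \<open>Nonnegativity of the squared norm of f - k c g, taken at the minimizing k = 1 /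
  \<open>l2_sq g\<close>. If g is null, a large k forces c = 0.\<close>

lemma L2_cauchy_schwarz:
  assumes f: "L2 f" and g: "L2 g"
  shows "(cmod (\<integral>t. f t * cnj (g t) \<partial>circ))\<^sup>2 \<le> l2_sq f * l2_sq g"
proof -
  define c where "c = (\<integral>t. f t * cnj (g t) \<partial>circ)"
  have *: "0 \<le> l2_sq f + k\<^sup>2 * (cmod c)\<^sup>2 * l2_sq g - 2 * k * (cmod c)\<^sup>2" for k :: real
  proof -
    have e: "(\<integral>t. f t * cnj (k * c * g t) \<partial>circ) = cnj (k * c) * c"
    proof -
      have "f t * cnj (k * c * g t) = cnj (k * c) * (f t * cnj (g t))" for t by simp
      then show ?thesis by (simp only: integral_mult_right_zero c_def[symmetric])
    qed
    have "Re (\<integral>t. f t * cnj (k * c * g t) \<partial>circ) = k * (cmod c)\<^sup>2"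
      unfolding e cmod_power2 by (simp add: power2_eq_square algebra_simps)
    moreover have "l2_sq (\<lambda>t. k * c * g t) = k\<^sup>2 * (cmod c)\<^sup>2 * l2_sq g"
      by (simp add: l2_sq_def norm_mult power_mult_distrib)
    ultimately show ?thesis
      using l2_sq_nonneg[of "\<lambda>t. f t - k * c * g t"] l2_sq_diff[OF f L2_cmult[OF g, of "k * c"]]
      by simp
  qed
  show ?thesis
  proof (cases "l2_sq g = 0")
    case True
    have "(cmod c)\<^sup>2 = 0"
    proof (rule ccontr)
      assume "(cmod c)\<^sup>2 \<noteq> 0"
      then have "2 * ((l2_sq f + 1) / (cmod c)\<^sup>2) * (cmod c)\<^sup>2 = 2 * (l2_sq f + 1)" by simp
      then show False using *[of "(l2_sq f + 1) / (cmod c)\<^sup>2"] True l2_sq_nonneg[of f] by simp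
    qed
    then show ?thesis using True by (simp add: c_def)
  next
    case False
    then have "0 < l2_sq g" by (simp add: less_le)
    then show ?thesis using *[of "1 / l2_sq g"] by (simp add: c_def[symmetric] field_simps power2_eq_square)
  qed
qed

context ell
begin

text \<open>Inverse of \<open>par\<close> with values in [0, 2 pi). Clamping to [-1, 1] keeps
  \<open>arccos\<close> in its domain away from the ellipse, so the formula is Borel measurable on
  the whole plane.\<close>

definition ang :: "real^2 \<Rightarrow> real" where
  "ang x = (let t = arccos (max (-1) (min 1 (x$1/a))) in if 0 \<le> x$2 then t else 2*pi - t)"

lemma ang_par: assumes "0 \<le> t" "t < 2*pi" shows "ang (par t) = t"
proof -
  have c: "max (-1) (min 1 (par t $ 1 / a)) = cos t" using a_pos by simp
  show ?thesis
  proof (cases "t \<le> pi")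
    case True
    then have "0 \<le> par t $ 2" using sin_ge_zero[of t] assms b_pos by simp
    then show ?thesis unfolding ang_def c using True assms by (simp add: arccos_cos)
  next
    case False
    then have "0 < sin (2*pi - t)" using assms by (intro sin_gt_zero) auto
    then have "\<not> 0 \<le> par t $ 2" using b_pos by (simp add: sin_diff mult_le_0_iff zero_le_mult_iff)
    moreover have "arccos (cos (2*pi - t)) = 2*pi - t" using False assms by (intro arccos_cos) auto
    ultimately show ?thesis unfolding ang_def c by (simp add: cos_diff)
  qed
qed

lemma ang_measurable: "ang \<in> borel_measurable borel"
proof -
  have "continuous_on UNIV (\<lambda>x::real^2. arccos (max (-1) (min 1 (x$1/a))))"
    by (intro continuous_on_arccos continuous_intros) (use a_pos in auto)
  then have [measurable]: "(\<lambda>x::real^2. arccos (max (-1) (min 1 (x$1/a)))) \<in> borel_measurable borel"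
    by (rule borel_measurable_continuous_onI)
  have [measurable]: "(\<lambda>x::real^2. x $ 2) \<in> borel_measurable borel"
    by (intro borel_measurable_continuous_onI continuous_intros)
  show ?thesis unfolding ang_def Let_def by measurable
qed

lemma par_ang: "x \<in> frontier (ellipse a b) \<Longrightarrow> par (ang x) = x"
  by (metis ang_par frontier_par)

lemma par_inj: "0 \<le> s \<Longrightarrow> s < 2*pi \<Longrightarrow> 0 \<le> t \<Longrightarrow> t < 2*pi \<Longrightarrow> par s = par t \<Longrightarrow> s = t"
  by (metis ang_par)

text \<open>On the curve the function equals u composed with \<open>ang\<close>. Measurability in
  the angle is thus enough, which matters for densities and kernels given only through the
  parameter.\<close>

lemma sig_measurable_par:
  fixes u :: "real \<Rightarrow> 'x::topological_space"
  assumes u: "u \<in> borel_measurable borel" and eq: "\<And>t. ch (par t) = u t"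
  shows "ch \<in> borel_measurable sig"
proof -
  have "(\<lambda>x. u (ang x)) \<in> borel_measurable sig"
    by (rule measurable_compose[OF measurable_compose[OF id_sig ang_measurable] u])
  moreover have "ch x = u (ang x)" if "x \<in> space sig" for x
    using that par_ang[of x] eq[of "ang x"] by (simp add: space_sig)
  ultimately show ?thesis by (subst measurable_cong) auto
qed

text \<open>The speed from arc length is absorbed into V, so the coefficients are those of V on the
  circle. This is why the eigenfunctions carry the factor 1 / h0.\<close>

lemma density_functional_Hm:
  assumes V: "V \<in> borel_measurable borel" "periodic V" "\<And>t. norm (V t) \<le> B"
    and eq: "\<And>t. V t = speed t *\<^sub>R ch (par t)"
  shows "density_functional sig ch \<in> Hm"
    and "hat (density_functional sig ch) n i = (\<integral>t. V t $ i * cis (of_int n * t) \<partial>circ)"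
proof -
  have [measurable]: "V \<in> borel_measurable borel" by (rule V)
  have Vn: "V t $ i = complex_of_real (speed t) * ch (par t) $ i" for t i
    by (metis eq vector_scaleR_component scaleR_conv_of_real)
  have chV: "ch (par t) = (1 / speed t) *\<^sub>R V t" for t using speed_pos[of t] by (simp add: eq)
  have [measurable]: "ch \<in> borel_measurable sig"
    by (rule sig_measurable_par[where u="\<lambda>t. (1 / speed t) *\<^sub>R V t", OF _ chV]) measurable
  have Vi: "L2 (\<lambda>t. cnj (V t $ i))" for i
  proof (rule L2_bounded[where B=B])
    show "cmod (cnj (V t $ i)) \<le> B" for t using V(3)[of t] Finite_Cartesian_Product.norm_nth_le[of "V t" i] by simp
    show "periodic (\<lambda>t. cnj (V t $ i))" using V(2) by (simp add: periodic_def)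
  qed measurable
  define DF where "DF = density_functional sig ch"
  have DFeq: "DF f = (\<integral>t. pullback f 1 t * V t $ 1 \<partial>circ) + (\<integral>t. pullback f 2 t * V t $ 2 \<partial>circ)" if f: "f \<in> H_half sig" for f
  proof -
    have [measurable]: "f \<in> borel_measurable sig" using f by (simp add: H_half_iff)
    have L: "L2 (pullback f i)" for i using f exhaust_2[of i] by (auto simp: H_half_iff sobolev_half_L2)
    have i: "integrable circ (\<lambda>t. pullback f i t * V t $ i)" for i using L2_mult[OF L[of i] Vi[of i]] by simp
    have "DF f = (\<integral>x. (\<Sum>i\<in>UNIV. ch x $ i * f x $ i) \<partial>sig)" using f by (simp add: DF_def density_functional_def)
    also have "\<dots> = (\<integral>t. speed t *\<^sub>R (\<Sum>i\<in>UNIV. ch (par t) $ i * f (par t) $ i) \<partial>circ)"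
      by (rule integral_sig) measurable
    also have "\<dots> = (\<integral>t. pullback f 1 t * V t $ 1 + pullback f 2 t * V t $ 2 \<partial>circ)"
      by (simp add: sum_2 Vn pullback_def scaleR_conv_of_real distrib_left mult_ac)
    also have "\<dots> = (\<integral>t. pullback f 1 t * V t $ 1 \<partial>circ) + (\<integral>t. pullback f 2 t * V t $ 2 \<partial>circ)"
      by (rule Bochner_Integration.integral_add[OF i i])
    finally show ?thesis .
  qed
  have "DF \<in> Hm"
    unfolding H_mhalf_def
  proof (intro CollectI conjI ballI allI impI)
    fix f g assume fg: "f \<in> H_half sig" "g \<in> H_half sig"
    have L: "L2 (pullback f i)" "L2 (pullback g i)" for i using fg exhaust_2[of i] by (auto simp: H_half_iff sobolev_half_L2)
    have i: "integrable circ (\<lambda>t. pullback f i t * V t $ i)" "integrable circ (\<lambda>t. pullback g i t * V t $ i)" for i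
      using L2_mult[OF L(1)[of i] Vi[of i]] L2_mult[OF L(2)[of i] Vi[of i]] by simp_all
    have c: "pullback (\<lambda>x. f x + g x) i t = pullback f i t + pullback g i t" for i t by (simp add: pullback_def)
    show "DF (\<lambda>x. f x + g x) = DF f + DF g"
      using fg i by (simp add: DFeq H_half_add c distrib_right)
  next
    fix c f assume f: "f \<in> H_half sig"
    have c: "pullback (\<lambda>x. c *s f x) i t = c * pullback f i t" for i t by (simp add: pullback_def)
    show "DF (\<lambda>x. c *s f x) = c * DF f"
      using f by (simp add: DFeq H_half_scale c mult.assoc distrib_left)
  next
    define K where "K = sqrt (l2_sq (\<lambda>t. cnj (V t $ 1)) / c1) + sqrt (l2_sq (\<lambda>t. cnj (V t $ 2)) / c1)"
    show "\<exists>C. \<forall>f\<in>H_half sig. cmod (DF f) \<le> C * H_half_norm sig f"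
    proof (intro exI ballI)
      fix f assume f: "f \<in> H_half sig"
      have L: "L2 (pullback f i)" for i using f exhaust_2[of i] by (auto simp: H_half_iff sobolev_half_L2)
      have one: "cmod (\<integral>t. pullback f i t * V t $ i \<partial>circ) \<le> sqrt (l2_sq (\<lambda>t. cnj (V t $ i)) / c1) * H_half_norm sig f" for i
      proof -
        have "(cmod (\<integral>t. pullback f i t * V t $ i \<partial>circ))\<^sup>2 \<le> l2_sq (pullback f i) * l2_sq (\<lambda>t. cnj (V t $ i))"
          using L2_cauchy_schwarz[OF L[of i] Vi[of i]] by simp
        also have "\<dots> \<le> ((H_half_norm sig f)\<^sup>2 / c1) * l2_sq (\<lambda>t. cnj (V t $ i))"
        proof (rule mult_right_mono)
          have "l2_sq (pullback f i) \<le> pullback_norm_sq f" using exhaust_2[of i] gagliardo_nonneg[of "pullback f 1"] gagliardo_nonneg[of "pullback f 2"]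
            l2_sq_nonneg[of "pullback f 1"] l2_sq_nonneg[of "pullback f 2"] by (auto simp: pullback_norm_sq_def)
          also have "\<dots> \<le> (H_half_norm sig f)\<^sup>2 / c1"
            using H_half_norm_bounds(1)[OF f] c1_pos by (simp add: field_simps)
          finally show "l2_sq (pullback f i) \<le> (H_half_norm sig f)\<^sup>2 / c1" .
        qed simp
        finally have "(cmod (\<integral>t. pullback f i t * V t $ i \<partial>circ))\<^sup>2 \<le> l2_sq (\<lambda>t. cnj (V t $ i)) / c1 * (H_half_norm sig f)\<^sup>2" by (simp add: mult.commute)
        from real_le_rsqrt[OF this] show ?thesis
          by (simp only: real_sqrt_mult real_sqrt_abs abs_of_nonneg[OF H_half_norm_nonneg])
      qed
      show "cmod (DF f) \<le> K * H_half_norm sig f"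
        unfolding DFeq[OF f] K_def distrib_right
        using one[of 1] one[of 2] norm_triangle_ineq order_trans add_mono by meson
    qed
  qed (simp add: DF_def density_functional_def)
  then show "density_functional sig ch \<in> Hm" by (simp add: DF_def)
  have H: "eb n i \<in> H_half sig" by (simp add: eb_def tvec_H)
  have c: "pullback (eb n i) j t = (if j = i then cis (of_int n * t) else 0)" for j t
    by (simp add: eb_def pullback_tvec trig_def)
  show "hat (density_functional sig ch) n i = (\<integral>t. V t $ i * cis (of_int n * t) \<partial>circ)"
    unfolding hat_def DF_def[symmetric] DFeq[OF H]
    using exhaust_2[of i] by (auto simp: c mult.commute)
qed

end

section \<open>The kernel on the ellipse\<close>

lemma kelvin_has_derivative:
  fixes x y :: "real^2"
  assumes "x \<noteq> y"
  defines "v \<equiv> x - y"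
  shows "((\<lambda>z. kelvin lam mu (z - y) *v axis j 1) has_derivative
     (\<lambda>w. \<chi> i. (1/2) * (1 / mu + 1 / (2 * mu + lam)) / (2*pi) * (if i = j then 1 else 0) * ((v$1 * w$1 + v$2 * w$2) / ((v$1)\<^sup>2 + (v$2)\<^sup>2))
        - (1/2) * (1 / mu - 1 / (2 * mu + lam)) / (2*pi) * ((w$i * v$j + v$i * w$j) / ((v$1)\<^sup>2 + (v$2)\<^sup>2)
            - 2 * v$i * v$j * (v$1 * w$1 + v$2 * w$2) / ((v$1)\<^sup>2 + (v$2)\<^sup>2)\<^sup>2))) (at x)"
proof -
  define A where "A = (1/2) * (1 / mu + 1 / (2 * mu + lam)) / (2*pi)"
  define B where "B = (1/2) * (1 / mu - 1 / (2 * mu + lam)) / (2*pi)"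
  define S where "S z = (z$1 - y$1)\<^sup>2 + (z$2 - y$2)\<^sup>2" for z :: "real^2"
  have Sx: "S x = (v$1)\<^sup>2 + (v$2)\<^sup>2" by (simp add: S_def v_def)
  have "v \<noteq> 0" using assms by simp
  then have S0: "0 < S x" unfolding Sx norm_real2_sq[symmetric] by simp
  define f where "f i z = A * (if i = j then 1 else 0) * (ln (S z) / 2) - B * ((z$i - y$i) * (z$j - y$j) / S z)" for i and z :: "real^2"
  \<comment> \<open>The logarithm is rewritten in terms of the squared norm, which is a polynomial.
    At z = y both sides are 0, so the identity holds for all z and the function can be replaced as a
    whole.\<close>
  have ln: "ln (norm (z - y)) = ln (S z) / 2" for z
  proof -
    have "norm (z - y) = sqrt (S z)" by (simp add: S_def norm_vec_def L2_set_def sum_2)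
    then show ?thesis by (cases "S z = 0") (auto simp: ln_sqrt S_def add_nonneg_pos add_nonneg_nonneg less_le)
  qed
  have "(kelvin lam mu (z - y) *v axis j 1) $ i = f i z" for z i
    unfolding matrix_vector_mul_component kelvin_def Let_def A_def B_def f_def
    by (simp add: matrix_vector_mult_def inner_vec_def axis_def if_distrib cong: if_cong)
       (simp add: ln norm_real2_sq S_def)
  then have u: "(\<lambda>z. kelvin lam mu (z - y) *v axis j 1) = (\<lambda>z. f 1 z *\<^sub>R axis 1 1 + f 2 z *\<^sub>R axis 2 1)"
    by (auto simp: vec_eq_iff forall_2 axis_def)
  define f' where "f' i w = A * (if i = j then 1 else 0) * ((v$1 * w$1 + v$2 * w$2) / S x)
        - B * ((w$i * v$j + v$i * w$j) / S x - 2 * v$i * v$j * (v$1 * w$1 + v$2 * w$2) / (S x)\<^sup>2)" for i and w :: "real^2"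
  have nth: "((\<lambda>z. z $ k) has_derivative (\<lambda>w. w $ k)) (at x)" for k :: 2
    by (rule bounded_linear_imp_has_derivative[OF bounded_linear_vec_nth])
  have S': "(S has_derivative (\<lambda>w. 2 * (v$1 * w$1 + v$2 * w$2))) (at x)"
    unfolding S_def[abs_def] v_def
    by (auto intro!: derivative_eq_intros nth simp: power2_eq_square algebra_simps)
  have d: "(f i has_derivative f' i) (at x)" for i
  proof -
    define l where "l w = v$1 * w$1 + v$2 * w$2" for w :: "real^2"
    have N: "((\<lambda>z. (z$i - y$i) * (z$j - y$j)) has_derivative (\<lambda>w. v$i * w$j + w$i * v$j)) (at x)"
      using has_derivative_mult[OF has_derivative_diff[OF nth[of i] has_derivative_const[of "y$i"]]
          has_derivative_diff[OF nth[of j] has_derivative_const[of "y$j"]]]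
      by (simp add: v_def)
    have S'': "(S has_derivative (\<lambda>w. 2 * l w)) (at x)" using S' by (simp add: l_def)
    have "(f i has_derivative (\<lambda>w. A * (if i = j then 1 else 0) * (2 * l w * inverse (S x) / 2)
        - B * (((v$i * w$j + w$i * v$j) * S x - (v$i * v$j) * (2 * l w)) / (S x * S x)))) (at x)"
      unfolding f_def[abs_def]
      using has_derivative_diff[OF
          has_derivative_mult_right[OF has_derivative_divide[OF has_derivative_ln[OF S0 S''] has_derivative_const[of 2]], of "A * (if i = j then 1 else 0)"]
          has_derivative_mult_right[OF has_derivative_divide'[OF N S''], of B]] S0
      by (simp add: v_def)
    moreover have "(\<lambda>w. A * (if i = j then 1 else 0) * (2 * l w * inverse (S x) / 2)
        - B * (((v$i * w$j + w$i * v$j) * S x - (v$i * v$j) * (2 * l w)) / (S x * S x))) = f' i"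
      unfolding f'_def l_def[symmetric] using S0 by (auto simp: fun_eq_iff field_simps power2_eq_square)
    ultimately show ?thesis by simp
  qed
  have "((\<lambda>z. f 1 z *\<^sub>R axis 1 1 + f 2 z *\<^sub>R axis 2 1 :: real^2) has_derivative (\<lambda>w. f' 1 w *\<^sub>R axis 1 1 + f' 2 w *\<^sub>R axis 2 1)) (at x)"
    by (intro has_derivative_add has_derivative_scaleR_left d)
  moreover have "(\<lambda>w. f' 1 w *\<^sub>R axis 1 1 + f' 2 w *\<^sub>R axis 2 1 :: real^2) = (\<lambda>w. \<chi> i. f' i w)"
    by (auto simp: vec_eq_iff forall_2 axis_def)
  ultimately show ?thesis unfolding u f'_def A_def B_def Sx by simp
qed

text \<open>After contracting with the normal the Lame constants enter only through \<kappa>. The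
  antisymmetric part has the coefficient \<kappa>, and the remaining terms contain the scalar
  product of the chord with the normal.\<close>

lemma NP_kernel_eq:
  fixes x y :: "real^2" and nu :: "real^2 \<Rightarrow> real^2"
  assumes xy: "x \<noteq> y" and mu: "0 < mu" and lm: "0 < 2 * mu + lam"
  defines "v \<equiv> x - y" and "n \<equiv> nu x" and "\<kappa> \<equiv> mu / (2 * mu + lam)"
  defines "S \<equiv> (v$1)\<^sup>2 + (v$2)\<^sup>2" and "vn \<equiv> v$1 * n$1 + v$2 * n$2"
  shows "NP_kernel lam mu nu x y $ i $ j =
    (\<kappa> * ((if i = j then vn else 0) + v$i * n$j - n$i * v$j) + 2 * (1 - \<kappa>) * vn * (v$i * v$j) / S) / (2*pi*S)"
proof -
  define A where "A = (1/2) * (1 / mu + 1 / (2 * mu + lam))"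
  define B where "B = (1/2) * (1 / mu - 1 / (2 * mu + lam))"
  define U :: "real^2 \<Rightarrow> real^2" where "U = (\<lambda>w. \<chi> i. A / (2*pi) * (if i = j then 1 else 0) * ((v$1 * w$1 + v$2 * w$2) / S)
        - B / (2*pi) * ((w$i * v$j + v$i * w$j) / S - 2 * v$i * v$j * (v$1 * w$1 + v$2 * w$2) / S\<^sup>2))"
  have "v \<noteq> 0" using xy by (simp add: v_def)
  then have S0: "S \<noteq> 0" unfolding S_def norm_real2_sq[symmetric] by simp
  have "frechet_derivative (\<lambda>z. kelvin lam mu (z - y) *v axis j 1) (at x) = U"
    using frechet_derivative_at[OF kelvin_has_derivative[OF xy, of lam mu j]]
    unfolding U_def A_def B_def S_def v_def by simp
  then have J: "jacobian (\<lambda>z. kelvin lam mu (z - y) *v axis j 1) (at x) = (\<chi> i k. U (axis k 1) $ i)"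
    by (simp add: jacobian_def matrix_def)
  define M where "M = 2 * mu + lam"
  have M: "0 < M" "\<kappa> = mu / M" "lam = M - 2 * mu" using lm by (simp_all add: M_def \<kappa>_def)
  \<comment> \<open>A and B are the constants alpha1 and alpha2 of the Kelvin matrix; the kernel
    involves them only through A - B and mu B.\<close>
  have AB: "A - B = 1 / M" proof -
    have "(1/2) * (p + q) - (1/2) * (p - q) = q" for p q :: real by (simp add: field_simps)
    then show ?thesis unfolding A_def B_def M_def by blast
  qed
  have muB: "mu * B = (1 - \<kappa>) / 2" unfolding B_def M(2) M_def[symmetric] using mu M(1) by (simp add: field_simps)
  have k1: "mu * (A - B) = \<kappa>" by (simp add: AB M)
  have "lam * (A - B) = 1 - 2 * \<kappa>" unfolding AB M(2,3) using M(1) by (simp add: field_simps)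
  then have k2: "lam * (A - B) - 2 * mu * B = - \<kappa>" using muB by simp
  have k3: "4 * mu * B = 2 * (1 - \<kappa>)" using muB by simp
  define c where "c = 1 / (2*pi)"
  define s where "s = 1 / S"
  define JJ where "JJ i k = c * s * (A * (if i = j then 1 else 0) * v$k - B * ((if i = k then v$j else 0) + (if k = j then v$i else 0) - 2 * v$i * v$j * v$k * s))" for i k :: 2
  define JM where "JM = jacobian (\<lambda>z. kelvin lam mu (z - y) *v axis j 1) (at x)"
  have J2: "JM $ i $ k = JJ i k" for i k
    unfolding JM_def J JJ_def U_def c_def s_def using exhaust_2[of k] exhaust_2[of j] exhaust_2[of i]
    by (elim disjE) (simp_all add: axis_def diff_divide_distrib add_divide_distrib algebra_simps power2_eq_square)
  \<comment> \<open>Needed for the divergence, where the cubic term of the derivative collapses to a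
    linear one.\<close>
  have sS: "s * ((v$1)\<^sup>2 + (v$2)\<^sup>2) = 1" using S0 by (simp add: s_def S_def)
  have "JJ 1 1 + JJ 2 2 = c * s * (v$j * (A - 3 * B) + 2 * B * v$j * (s * ((v$1)\<^sup>2 + (v$2)\<^sup>2)))"
    using exhaust_2[of j] by (elim disjE) (simp_all add: JJ_def algebra_simps power2_eq_square)
  then have tr: "JJ 1 1 + JJ 2 2 = c * s * v$j * (A - B)" unfolding sS by (simp add: algebra_simps)
  have "NP_kernel lam mu nu x y $ i $ j = lam * (JJ 1 1 + JJ 2 2) * n$i
      + mu * ((JJ i 1 + JJ 1 i) * n$1 + (JJ i 2 + JJ 2 i) * n$2)"
    unfolding NP_kernel_def vec_lambda_beta conormal_def Let_def n_def[symmetric] JM_def[symmetric]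
    by (simp add: trace_def sum_2 transpose_def matrix_vector_mult_def J2 algebra_simps)
  also have "\<dots> = ((lam * (A - B) - 2 * mu * B) * (n$i * v$j) + (mu * (A - B)) * ((if i = j then vn else 0) + v$i * n$j) + (4 * mu * B) * vn * (v$i * v$j) * s) * (c * s)"
    unfolding tr using exhaust_2[of i] exhaust_2[of j]
    by (elim disjE) (simp_all add: JJ_def vn_def algebra_simps)
  finally have "NP_kernel lam mu nu x y $ i $ j =
     ((lam * (A - B) - 2 * mu * B) * (n$i * v$j) + (mu * (A - B)) * ((if i = j then vn else 0) + v$i * n$j) + (4 * mu * B) * vn * (v$i * v$j) / S) / (2*pi*S)"
    by (simp add: c_def s_def)
  then show ?thesis unfolding k1 k2 k3 by (simp add: algebra_simps)
qed

context ell
begin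

text \<open>The convex combination of a^2 and b^2 in double-angle form: \<open>el (s + t)\<close> is
  the non-circular factor of the squared chord, and \<open>el (2*t)\<close> the squared
  speed.\<close>

definition el :: "real \<Rightarrow> real" where
  "el t = (a\<^sup>2 + b\<^sup>2) / 2 - (a\<^sup>2 - b\<^sup>2) / 2 * cos t"

lemma el_half: "a\<^sup>2 * (sin t)\<^sup>2 + b\<^sup>2 * (cos t)\<^sup>2 = el (2*t)"
proof -
  have e: "(cos t)\<^sup>2 = (1 + cos (2*t)) / 2" "(sin t)\<^sup>2 = (1 - cos (2*t)) / 2"
    using cos_double_cos[of t] cos_double_sin[of t] by simp_all
  show ?thesis unfolding e el_def by (simp add: field_simps)
qed

lemma el_bounds: "b\<^sup>2 \<le> el t" "el t \<le> a\<^sup>2"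
  using wavg_bounds[of "t/2"] unfolding el_half by simp_all

lemma el_pos: "0 < el t"
  using el_bounds(1)[of t] b_pos by (smt (verit) zero_less_power)

lemma el_periodic: "el (t + 2*pi) = el t" by (simp add: el_def)

lemma el_continuous [continuous_intros]:
  fixes f :: "'q::t2_space \<Rightarrow> real"
  shows "continuous_on A f \<Longrightarrow> continuous_on A (\<lambda>x. el (f x))"
  unfolding el_def by (intro continuous_intros)

lemma el_measurable [measurable]: "el \<in> borel_measurable borel"
  by (intro borel_measurable_continuous_onI el_continuous continuous_on_id)

lemma dist_par_el: "dist (par s) (par t) = 2 * \<bar>sin ((s - t)/2)\<bar> * sqrt (el (s + t))"
proof -
  have "(dist (par s) (par t))\<^sup>2 = (2 * \<bar>sin ((s - t)/2)\<bar> * sqrt (el (s + t)))\<^sup>2"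
    unfolding dist_par el_half using el_pos[of "s + t"] by (simp add: power_mult_distrib del: distrib_left_numeral add_divide_distrib)
  then show ?thesis using el_pos[of "s + t"] by (simp add: power2_eq_iff_nonneg)
qed

lemma dist_par_bounds:
  "2 * b * \<bar>sin ((s - t)/2)\<bar> \<le> dist (par s) (par t)" "dist (par s) (par t) \<le> 2 * a * \<bar>sin ((s - t)/2)\<bar>"
proof -
  have "b \<le> sqrt (el (s + t))" "sqrt (el (s + t)) \<le> a"
    using el_bounds[of "s + t"] b_pos a_pos by (auto intro: real_le_rsqrt real_le_lsqrt)
  then show "2 * b * \<bar>sin ((s - t)/2)\<bar> \<le> dist (par s) (par t)" "dist (par s) (par t) \<le> 2 * a * \<bar>sin ((s - t)/2)\<bar>"
    unfolding dist_par_el by (auto intro!: mult_left_mono simp: mult.commute[of _ "sqrt _"] mult_right_mono)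
qed

lemma speed_el: "speed t = sqrt (el (2*t))" unfolding speed_def el_half ..

lemma normal_par: "ellipse_normal a b (par t) = (1 / speed t) *\<^sub>R vector [b * cos t, a * sin t]"
proof -
  have e: "vector [par t $ 1 / a\<^sup>2, par t $ 2 / b\<^sup>2] = (1 / (a * b)) *\<^sub>R (vector [b * cos t, a * sin t] :: real^2)"
    using a_pos b_pos by (simp add: vec_eq_iff forall_2 power2_eq_square)
  have n: "norm (vector [b * cos t, a * sin t] :: real^2) = speed t"
    by (simp add: norm_vec_def L2_set_def sum_2 speed_def power_mult_distrib add.commute)
  show ?thesis
    unfolding ellipse_normal_def e sgn_scaleR using a_pos b_pos
    by (simp add: sgn_div_norm[of "vector _"] n divide_inverse sgn_mult)
qed

text \<open>\<open>kP\<close> is the Poisson kernel and \<open>kQ\<close> the conjugate Poisson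
  kernel with parameter \<open>rr\<close>. Up to the factor \<open>SS\<close> and a sign,
  \<open>kY\<close> and \<open>kZ\<close> are the derivatives of \<open>kP\<close> and
  \<open>kQ\<close>.\<close>

definition kP :: "real \<Rightarrow> real" where "kP t = a * b / el t"
definition kQ :: "real \<Rightarrow> real" where "kQ t = (a\<^sup>2 - b\<^sup>2) * sin t / (2 * el t)"
definition kZ :: "real \<Rightarrow> real" where "kZ t = kP t * ((a\<^sup>2 - b\<^sup>2) - (a\<^sup>2 + b\<^sup>2) * cos t) / (2 * el t)"
definition kY :: "real \<Rightarrow> real" where "kY t = - (kP t * (a * b) * sin t / el t)"

definition smooth_kernel :: "real \<Rightarrow> 2 \<Rightarrow> 2 \<Rightarrow> real \<Rightarrow> real" where
  "smooth_kernel \<kappa> i j t = (if i = 1 then (if j = 1 then kP t + (1 - \<kappa>) * kZ t else - \<kappa> * kQ t + (1 - \<kappa>) * kY t)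
                  else (if j = 1 then \<kappa> * kQ t + (1 - \<kappa>) * kY t else kP t - (1 - \<kappa>) * kZ t)) / (4*pi)"

definition rot90 :: "2 \<Rightarrow> 2 \<Rightarrow> real" where
  "rot90 i j = (if i = 1 \<and> j = 2 then -1 else if i = 2 \<and> j = 1 then 1 else 0)"

text \<open>In terms of the half difference h and the half sum s, the squared chord and its product
  with the normal are both of order sin^2 h, so their quotient is a function of s. The cross product
  is only of order sin h and leaves the single singular term cot h.\<close>

lemma kernel_par:
  assumes mu: "0 < mu" and lm: "0 < 2 * mu + lam" and sn: "sin ((\<omega> - \<theta>)/2) \<noteq> 0"
  defines "\<kappa> \<equiv> mu / (2 * mu + lam)"
  shows "speed \<omega> * NP_kernel lam mu (ellipse_normal a b) (par \<omega>) (par \<theta>) $ i $ j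
    = \<kappa> / (4*pi) * cot ((\<omega> - \<theta>)/2) * rot90 i j + smooth_kernel \<kappa> i j (\<omega> + \<theta>)"
proof -
  define h where "h = (\<omega> - \<theta>)/2"
  define s where "s = (\<omega> + \<theta>)/2"
  have os: "\<omega> = s + h" "\<theta> = s - h" "\<omega> + \<theta> = 2 * s" by (simp_all add: h_def s_def field_simps)
  have sh: "sin h \<noteq> 0" using sn by (simp add: h_def)
  define v where "v = par \<omega> - par \<theta>"
  define N :: "real^2" where "N = vector [b * cos \<omega>, a * sin \<omega>]"
  define S where "S = (v$1)\<^sup>2 + (v$2)\<^sup>2"
  define E where "E = el (2 * s)"
  have E: "E = a\<^sup>2 * (sin s)\<^sup>2 + b\<^sup>2 * (cos s)\<^sup>2" "0 < E" by (simp_all add: E_def el_half el_pos)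
  have v: "v$1 = - (2 * a * sin h * sin s)" "v$2 = 2 * b * sin h * cos s"
    unfolding v_def os by (simp_all add: cos_add cos_diff sin_add sin_diff algebra_simps)
  have S: "S = 4 * (sin h)\<^sup>2 * E" unfolding S_def v E by (simp add: power2_eq_square algebra_simps)
  have S0: "S \<noteq> 0" using S sh E by simp
  have xy: "par \<omega> \<noteq> par \<theta>"
  proof
    assume "par \<omega> = par \<theta>"
    then show False using S0 by (simp add: S_def v_def)
  qed
  have sc: "(sin h)\<^sup>2 + (cos h)\<^sup>2 = 1" "(sin s)\<^sup>2 + (cos s)\<^sup>2 = 1" by simp_all
  have vN: "v$1 * N$1 + v$2 * N$2 = 2 * a * b * (sin h)\<^sup>2"
  proof -
    have "- (2 * a * x * z) * (b * (w * y - z * x)) + 2 * b * x * w * (a * (z * y + w * x)) = 2 * a * b * x\<^sup>2 * (z\<^sup>2 + w\<^sup>2)" for x y z w :: real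
      by (simp add: power2_eq_square algebra_simps)
    then have "v$1 * N$1 + v$2 * N$2 = 2 * a * b * (sin h)\<^sup>2 * ((sin s)\<^sup>2 + (cos s)\<^sup>2)"
      unfolding v N_def os(1) vector_2 cos_add sin_add by blast
    then show ?thesis by simp
  qed
  have cr: "N$1 * v$2 - N$2 * v$1 = 2 * sin h * (E * cos h + (a\<^sup>2 - b\<^sup>2) * (sin s * cos s) * sin h)"
    unfolding v N_def os(1) E by (simp add: cos_add sin_add power2_eq_square algebra_simps)
  define c where "c = cos (2 * s)"
  have ss: "(sin s)\<^sup>2 = (1 - c) / 2" "(cos s)\<^sup>2 = (1 + c) / 2" "sin s * cos s = sin (2 * s) / 2"
    using cos_double_cos[of s] cos_double_sin[of s] sin_double[of s] by (simp_all add: c_def)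
  have Ec: "E = (a\<^sup>2 + b\<^sup>2) / 2 - (a\<^sup>2 - b\<^sup>2) / 2 * c" by (simp add: E_def el_def c_def)
  define Z where "Z = ((a\<^sup>2 - b\<^sup>2) - (a\<^sup>2 + b\<^sup>2) * c) / (2 * E)"
  have q1: "(v$1 * N$1 + v$2 * N$2) / S = kP (2 * s) / 2"
    unfolding vN S kP_def E_def[symmetric] using sh E(2) by (simp add: field_simps)
  have q2: "v$1 * v$1 / S = (1 + Z) / 2"
  proof -
    have "v$1 * v$1 / S = a\<^sup>2 * (sin s)\<^sup>2 / E"
      unfolding v S using sh E(2) by (simp add: field_simps power2_eq_square)
    also have "\<dots> = (1 + Z) / 2" unfolding Z_def ss using E(2) by (simp add: field_simps) (simp add: Ec field_simps)
    finally show ?thesis .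
  qed
  have q3: "v$2 * v$2 / S = (1 - Z) / 2"
  proof -
    have "v$2 * v$2 / S = b\<^sup>2 * (cos s)\<^sup>2 / E"
      unfolding v S using sh E(2) by (simp add: field_simps power2_eq_square)
    also have "\<dots> = (1 - Z) / 2" unfolding Z_def ss using E(2) by (simp add: field_simps) (simp add: Ec field_simps)
    finally show ?thesis .
  qed
  have q4: "v$1 * v$2 / S = - (a * b * sin (2 * s) / (2 * E))"
  proof -
    have "v$1 * v$2 / S = - (a * b * (sin s * cos s) / E)"
      unfolding v S using sh E(2) by (simp add: field_simps power2_eq_square)
    then show ?thesis unfolding ss by simp
  qed
  have q5: "(N$1 * v$2 - N$2 * v$1) / S = (cot h + kQ (2 * s)) / 2"
    unfolding cr S ss kQ_def E_def[symmetric] cot_def using sh E(2) by (simp add: field_simps power2_eq_square)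
  have Zk: "kZ (2 * s) = kP (2 * s) * Z" by (simp add: kZ_def Z_def E_def c_def)
  have Yk: "kY (2 * s) = - (kP (2 * s) * (a * b * sin (2 * s) / E))" by (simp add: kY_def E_def)
  define n where "n = ellipse_normal a b (par \<omega>)"
  have n: "speed \<omega> * n$k = N$k" for k using speed_pos[of \<omega>] by (simp add: n_def normal_par N_def)
  have "speed \<omega> * NP_kernel lam mu (ellipse_normal a b) (par \<omega>) (par \<theta>) $ i $ j
    = (\<kappa> * ((if i = j then v$1 * (speed \<omega> * n$1) + v$2 * (speed \<omega> * n$2) else 0) + v$i * (speed \<omega> * n$j) - (speed \<omega> * n$i) * v$j)
       + 2 * (1 - \<kappa>) * (v$1 * (speed \<omega> * n$1) + v$2 * (speed \<omega> * n$2)) * (v$i * v$j) / S) / (2*pi*S)"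
    unfolding NP_kernel_eq[OF xy mu lm] v_def[symmetric] n_def[symmetric] \<kappa>_def[symmetric] S_def[symmetric]
    by (simp add: algebra_simps add_divide_distrib diff_divide_distrib)
  also have "\<dots> = (\<kappa> * ((if i = j then (v$1 * N$1 + v$2 * N$2) / S else 0) + (v$i * N$j - N$i * v$j) / S)
       + 2 * (1 - \<kappa>) * ((v$1 * N$1 + v$2 * N$2) / S) * (v$i * v$j / S)) / (2*pi)"
    unfolding n using S0 by (simp add: field_simps)
  also have "\<dots> = \<kappa> / (4*pi) * cot h * rot90 i j + smooth_kernel \<kappa> i j (2 * s)"
  proof -
    have q4': "v$2 * v$1 / S = - (a * b * sin (2 * s) / (2 * E))" using q4 by (simp add: mult.commute)
    have q5': "(v$2 * N$1 - N$2 * v$1) / S = (cot h + kQ (2 * s)) / 2" using q5 by (simp add: mult.commute)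
    have q5'': "(v$1 * N$2 - N$1 * v$2) / S = - ((cot h + kQ (2 * s)) / 2)"
      using q5 by (metis minus_diff_eq minus_divide_left mult.commute)
    have q6: "(v$k * N$k - N$k * v$k) / S = 0" for k by simp
    show ?thesis
      using exhaust_2[of i] exhaust_2[of j]
    proof (elim disjE)
      assume "i = 1" "j = 1"
      then show ?thesis unfolding smooth_kernel_def rot90_def Zk by (simp add: q1 q2 q6) (use E(2) in \<open>simp add: field_simps\<close>)
    next
      assume "i = 1" "j = 2"
      then show ?thesis unfolding smooth_kernel_def rot90_def Yk by (simp add: q1 q4 q5'' del: minus_add_distrib) (use E(2) in \<open>simp add: field_simps\<close>)
    next
      assume "i = 2" "j = 1"
      then show ?thesis unfolding smooth_kernel_def rot90_def Yk by (simp add: q1 q4' q5') (use E(2) in \<open>simp add: field_simps\<close>)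
    next
      assume "i = 2" "j = 2"
      then show ?thesis unfolding smooth_kernel_def rot90_def Zk by (simp add: q1 q3 q6) (use E(2) in \<open>simp add: field_simps\<close>)
    qed
  qed
  finally show ?thesis by (simp add: h_def os(3))
qed

subsection \<open>The cut-off integral of the cotangent\<close>

text \<open>Truncation by Euclidean distance as in \<open>NP_pv\<close>. The removed set of angles
  is not symmetric about \<omega>, so the truncated integral of the odd function cot does not vanish
  by symmetry.\<close>

definition cut :: "real \<Rightarrow> real \<Rightarrow> real \<Rightarrow> real" where
  "cut \<epsilon> \<omega> t = (if \<epsilon> < dist (par \<omega>) (par t) then 1 else 0)"

lemma cut_measurable [measurable]: "cut \<epsilon> \<omega> \<in> borel_measurable borel"
proof -
  have "continuous_on UNIV (\<lambda>t. dist (par \<omega>) (par t))" by (intro continuous_intros)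
  then have [measurable]: "(\<lambda>t. dist (par \<omega>) (par t)) \<in> borel_measurable borel" by (rule borel_measurable_continuous_onI)
  show ?thesis unfolding cut_def[abs_def] by measurable
qed

lemma cut_abs: "\<bar>cut \<epsilon> \<omega> t\<bar> \<le> 1" by (simp add: cut_def)

text \<open>Where the cut-off is active, the chord exceeds \<epsilon> and is at most 2 a
  |sin((\<omega> - t)/2)|, so the sine is bounded away from zero.\<close>

lemma cut_cot_bound:
  assumes "0 < \<epsilon>" shows "\<bar>cut \<epsilon> \<omega> t * cot ((\<omega> - t)/2)\<bar> \<le> 2 * a / \<epsilon>"
proof (cases "\<epsilon> < dist (par \<omega>) (par t)")
  case True
  define u where "u = \<bar>sin ((\<omega> - t)/2)\<bar>"
  have *: "\<epsilon> < 2 * a * u" using True dist_par_bounds(2)[of \<omega> t] by (simp add: u_def)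
  then have u: "0 < u" using assms a_pos by (smt (verit) mult_nonneg_nonpos u_def)
  have "\<bar>cot ((\<omega> - t)/2)\<bar> \<le> 1 / u"
    using u by (simp add: cot_def u_def abs_divide divide_right_mono)
  also have "1 / u \<le> 2 * a / \<epsilon>" using * assms u by (simp add: field_simps)
  finally show ?thesis using True by (simp add: cut_def)
qed (use assms a_pos in \<open>simp add: cut_def\<close>)

definition el' :: "real \<Rightarrow> real" where "el' t = (a\<^sup>2 - b\<^sup>2) / 2 * sin t"

lemma el_deriv: "(el has_real_derivative el' t) (at t)"
  unfolding el_def[abs_def] el'_def by (auto intro!: derivative_eq_intros)

lemma el'_continuous [continuous_intros]:
  fixes f :: "'q::t2_space \<Rightarrow> real"
  shows "continuous_on A f \<Longrightarrow> continuous_on A (\<lambda>x. el' (f x))"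
  unfolding el'_def by (intro continuous_intros)

lemma el'_measurable [measurable]: "el' \<in> borel_measurable borel"
  by (intro borel_measurable_continuous_onI el'_continuous continuous_on_id)

lemma el'_el_bound: "\<bar>el' t / el t\<bar> \<le> (a\<^sup>2 - b\<^sup>2) / (2 * b\<^sup>2)"
proof -
  have ab: "0 \<le> a\<^sup>2 - b\<^sup>2" using b_pos b_less by (simp add: power_mono)
  have "\<bar>el' t\<bar> \<le> (a\<^sup>2 - b\<^sup>2) / 2 * 1"
    unfolding el'_def abs_mult using ab by (intro mult_mono) auto
  then have "\<bar>el' t\<bar> / el t \<le> ((a\<^sup>2 - b\<^sup>2) / 2) / b\<^sup>2"
    using el_bounds(1)[of t] b_pos ab by (intro frac_le) auto
  then show ?thesis using el_pos[of t] by (simp add: abs_divide)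
qed

lemma cut_at_right:
  assumes "\<omega> = \<omega>'" and "sin ((\<omega> - t)/2) \<noteq> 0" and X: "X \<longlonglongrightarrow> 0" and Xp: "\<And>n::nat. 0 < X n"
  shows "(\<lambda>n. cut (X n) \<omega> t) \<longlonglongrightarrow> 1"
proof -
  have "0 < \<bar>sin ((\<omega> - t)/2)\<bar> * (2 * b)" using assms b_pos by simp
  also have "\<dots> \<le> dist (par \<omega>) (par t)" using dist_par_bounds(1)[of \<omega> t] by (simp add: mult.commute mult.left_commute)
  finally have "eventually (\<lambda>n. X n < dist (par \<omega>) (par t)) sequentially" using X by (rule order_tendstoD(2)[rotated])
  then show ?thesis by (rule tendsto_eventually[OF eventually_mono]) (simp add: cut_def)
qed

text \<open>Up to the factor 2 the integrand is \<open>r'/r\<close> for the chord length \<open>r\<close>, cut off at \<open>r > \<epsilon>\<close>.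
  It is a limit of functions \<open>h\<^sub>k(r) r'\<close> with continuous \<open>h\<^sub>k\<close>, which are derivatives of functions
  of \<open>r\<close>, and \<open>r\<close> vanishes at both ends of the period.\<close>

lemma cut_log_derivative:
  assumes e: "0 < \<epsilon>"
  shows "(\<integral>t. cut \<epsilon> \<omega> (\<omega> + t) * (cot (t/2) + el' (2*\<omega> + t) / el (2*\<omega> + t)) \<partial>circ) = 0"
proof -
  define r where "r t = 2 * sin (t/2) * sqrt (el (2*\<omega> + t))" for t
  define r' where "r' t = cos (t/2) * sqrt (el (2*\<omega> + t)) + sin (t/2) * (el' (2*\<omega> + t) / sqrt (el (2*\<omega> + t)))" for t
  \<comment> \<open>A ramp that vanishes for u \<le> \<epsilon> and tends to 1 / u beyond it. The
    maximum in the denominator only guards the division and makes 1 / \<epsilon> a bound.\<close>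
  define ch where "ch k u = min 1 (max 0 (real k * (u - \<epsilon>))) / max u \<epsilon>" for k :: nat and u
  have elp: "0 < el t" for t by (rule el_pos)
  have r_deriv: "(r has_real_derivative r' t) (at t)" for t
  proof -
    have "((\<lambda>t. el (2*\<omega> + t)) has_real_derivative el' (2*\<omega> + t)) (at t)"
      using DERIV_shift[of el "el' (2*\<omega> + t)" t "2*\<omega>"] el_deriv[of "2*\<omega> + t"] by (simp add: add.commute)
    then have "((\<lambda>t. sqrt (el (2*\<omega> + t))) has_real_derivative (inverse (sqrt (el (2*\<omega> + t))) / 2 * el' (2*\<omega> + t))) (at t)"
      by (rule DERIV_chain2[where f=sqrt and g="\<lambda>t. el (2*\<omega> + t)" and x=t, OF DERIV_real_sqrt[OF elp]])
    moreover have "((\<lambda>t. 2 * sin (t/2)) has_real_derivative cos (t/2)) (at t)"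
      by (auto intro!: derivative_eq_intros)
    ultimately have "(r has_real_derivative (cos (t/2) * sqrt (el (2*\<omega> + t)) + inverse (sqrt (el (2*\<omega> + t))) / 2 * el' (2*\<omega> + t) * (2 * sin (t/2)))) (at t)"
      unfolding r_def[abs_def] by (rule DERIV_mult[rotated])
    then show ?thesis by (rule DERIV_cong) (simp add: r'_def field_simps)
  qed
  have r'_cont: "continuous_on UNIV r'"
    unfolding r'_def[abs_def] by (intro continuous_intros) (use elp in \<open>auto simp: less_imp_neq[symmetric]\<close>)
  have r_cont: "continuous_on UNIV r"
    unfolding r_def[abs_def] by (intro continuous_intros) auto
  have ch_cont: "continuous_on A (ch k)" for A k
    unfolding ch_def[abs_def] using e by (intro continuous_intros) auto
  have r_range: "r t \<in> {-(2*a)..2*a}" for t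
  proof -
    have "sqrt (el (2*\<omega> + t)) \<le> a" using el_bounds(2) a_pos by (intro real_le_lsqrt) auto
    then have "\<bar>r t\<bar> \<le> 2 * 1 * a"
      unfolding r_def abs_mult using elp[of "2*\<omega> + t"] by (intro mult_mono) auto
    then show ?thesis by auto
  qed
  have zero: "(\<integral>t. ch k (r t) * r' t \<partial>circ) = 0" for k
  proof -
    \<comment> \<open>The interval exceeds the range of r by 1 on either side, so every value of r
      is interior and the antiderivative has a two-sided derivative there.\<close>
    have "-(2*a) - 1 \<le> 2*a + 1" using a_pos by simp
    then obtain F where F: "\<And>u. u \<in> {-(2*a) - 1..2*a + 1} \<Longrightarrow> (F has_vector_derivative ch k u) (at u within {-(2*a) - 1..2*a + 1})"
      using antiderivative_continuous[OF ch_cont[of "{-(2*a) - 1..2*a + 1}" k]] by blast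
    have "(F has_real_derivative ch k (r t)) (at (r t))" for t
    proof -
      have "r t \<in> interior {-(2*a) - 1..2*a + 1}" using r_range[of t] by auto
      then have "at (r t) within {-(2*a) - 1..2*a + 1} = at (r t)" by (rule at_within_interior)
      then show ?thesis using F[of "r t"] r_range[of t] by (simp add: has_real_derivative_iff_has_vector_derivative)
    qed
    then have "((\<lambda>t. F (r t)) has_real_derivative ch k (r t) * r' t) (at t)" for t
      by (rule DERIV_chain2[OF _ r_deriv])
    then have "(\<integral>t. ch k (r t) * r' t \<partial>circ) = F (r (2*pi)) - F (r 0)"
      by (intro integral_circ_FTC) (auto simp: has_real_derivative_iff_has_vector_derivative
        intro!: continuous_intros r'_cont continuous_on_compose2[OF ch_cont r_cont])
    then show ?thesis by (simp add: r_def)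
  qed
  obtain B where B: "\<And>t. t \<in> {0..2*pi} \<Longrightarrow> \<bar>r' t\<bar> \<le> B"
  proof -
    have "compact (r' ` {0..2*pi})" by (intro compact_continuous_image continuous_on_subset[OF r'_cont]) auto
    then have "bounded (r' ` {0..2*pi})" by (rule compact_imp_bounded)
    then obtain B where "\<forall>t\<in>{0..2*pi}. \<bar>r' t\<bar> \<le> B" by (auto simp: bounded_iff)
    then show ?thesis using that by blast
  qed
  have [measurable]: "r \<in> borel_measurable borel" "r' \<in> borel_measurable borel" "ch k \<in> borel_measurable borel" for k
    by (intro borel_measurable_continuous_onI r_cont r'_cont ch_cont)+
  have "(\<lambda>k. \<integral>t. ch k (r t) * r' t \<partial>circ) \<longlonglongrightarrow> (\<integral>t. (if \<epsilon> < r t then r' t / r t else 0) \<partial>circ)"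
  proof (rule integral_dominated_convergence[where w="\<lambda>t. (1/\<epsilon>) * B"])
    show "AE t in circ. (\<lambda>k. ch k (r t) * r' t) \<longlonglongrightarrow> (if \<epsilon> < r t then r' t / r t else 0)"
    proof (rule AE_I2)
      fix t
      show "(\<lambda>k. ch k (r t) * r' t) \<longlonglongrightarrow> (if \<epsilon> < r t then r' t / r t else 0)"
      proof (cases "\<epsilon> < r t")
        case True
        have "eventually (\<lambda>k. 1 / (r t - \<epsilon>) \<le> real k) sequentially"
          by (meson eventually_sequentiallyI order_trans real_nat_ceiling_ge of_nat_mono)
        then have "eventually (\<lambda>k. ch k (r t) * r' t = r' t / r t) sequentially"
          by eventually_elim (use True in \<open>simp add: ch_def field_simps\<close>)
        then show ?thesis using True by (simp add: tendsto_eventually)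
      next
        case False
        then have "real k * (r t - \<epsilon>) \<le> 0" for k by (simp add: mult_nonneg_nonpos)
        then have "max 0 (real k * (r t - \<epsilon>)) = 0" for k by (rule max_absorb1)
        then have "ch k (r t) = 0" for k by (simp add: ch_def)
        then show ?thesis using False by simp
      qed
    qed
    show "AE t in circ. norm (ch k (r t) * r' t) \<le> (1/\<epsilon>) * B" for k
    proof (rule AE_I2)
      fix t assume "t \<in> space circ"
      moreover have "\<bar>ch k u\<bar> \<le> 1 / \<epsilon>" for u
        unfolding ch_def abs_divide using e by (intro frac_le) auto
      ultimately show "norm (ch k (r t) * r' t) \<le> (1/\<epsilon>) * B"
        using mult_mono[of "\<bar>ch k (r t)\<bar>" "1/\<epsilon>" "\<bar>r' t\<bar>" B] B[of t] e
        by (simp add: abs_mult space_circ)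
    qed
  qed measurable
  then have lim: "(\<integral>t. (if \<epsilon> < r t then r' t / r t else 0) \<partial>circ) = 0"
    unfolding zero using LIMSEQ_unique tendsto_const by blast
  have ae: "AE t in circ. cut \<epsilon> \<omega> (\<omega> + t) * (cot (t/2) + el' (2*\<omega> + t) / el (2*\<omega> + t)) = 2 * (if \<epsilon> < r t then r' t / r t else 0)"
    using AE_circ_sin_half AE_space
  proof eventually_elim
    case (elim t)
    have s: "0 < sin (t/2)" using elim sin_ge_zero[of "t/2"] by (simp add: space_circ less_le)
    have "dist (par \<omega>) (par (\<omega> + t)) = r t" unfolding dist_par_el r_def using s by (simp add: algebra_simps)
    moreover have "cot (t/2) + el' (2*\<omega> + t) / el (2*\<omega> + t) = 2 * (r' t / r t)"
    proof -
      define q where "q = sqrt (el (2*\<omega> + t))"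
      have q: "0 < q" "el (2*\<omega> + t) = q * q" using elp[of "2*\<omega> + t"] by (simp_all add: q_def)
      show ?thesis unfolding r_def r'_def cot_def q_def[symmetric] unfolding q(2) using s q(1) by (simp add: field_simps)
    qed
    ultimately show ?case by (simp add: cut_def)
  qed
  have "(\<integral>t. cut \<epsilon> \<omega> (\<omega> + t) * (cot (t/2) + el' (2*\<omega> + t) / el (2*\<omega> + t)) \<partial>circ) = (\<integral>t. 2 * (if \<epsilon> < r t then r' t / r t else 0) \<partial>circ)"
    by (rule integral_cong_AE[OF _ _ ae]) measurable
  then show ?thesis using lim by simp
qed

lemma integral_log_el: "(\<integral>t. el' (c + t) / el (c + t) \<partial>circ) = 0"
proof -
  have "((\<lambda>t. ln (el (c + t))) has_vector_derivative el' (c + t) / el (c + t)) (at t)" for t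
  proof -
    have "((\<lambda>t. el (c + t)) has_real_derivative el' (c + t)) (at t)"
      using DERIV_shift[of el "el' (c + t)" t c] el_deriv[of "c + t"] by (simp add: add.commute)
    then show ?thesis unfolding has_real_derivative_iff_has_vector_derivative[symmetric]
      using el_pos[of "c + t"] by (auto intro!: derivative_eq_intros simp: field_simps)
  qed
  moreover have "continuous_on UNIV (\<lambda>t. el' (c + t) / el (c + t))"
    by (intro continuous_intros) (use el_pos in \<open>auto simp: less_imp_neq[symmetric]\<close>)
  ultimately have "(\<integral>t. el' (c + t) / el (c + t) \<partial>circ) = ln (el (c + 2*pi)) - ln (el (c + 0))"
    by (rule integral_circ_FTC)
  then show ?thesis by (simp add: el_periodic)
qed

lemma cut_cot_integrable:
  assumes "0 < \<epsilon>" shows "integrable circ (\<lambda>t. cut \<epsilon> \<omega> (\<omega> + t) * cot (t/2))"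
proof (rule integrable_circ_bounded[where B="2 * a / \<epsilon>"])
  fix t
  have "\<omega> - (\<omega> + t) = - t" by simp
  then have "\<bar>cut \<epsilon> \<omega> (\<omega> + t) * cot (- (t/2))\<bar> \<le> 2 * a / \<epsilon>" using cut_cot_bound[OF assms, of \<omega> "\<omega> + t"] by simp
  then show "norm (cut \<epsilon> \<omega> (\<omega> + t) * cot (t/2)) \<le> 2 * a / \<epsilon>" by (simp add: cot_def abs_mult)
qed measurable

text \<open>By \<open>cut_log_derivative\<close> the truncated cotangent integral is minus that of
  the logarithmic derivative of \<open>el\<close>, which is bounded; dominated convergence leads to
  its integral over a full period, which is 0.\<close>

lemma cut_cot_tendsto:
  assumes X: "X \<longlonglongrightarrow> 0" and Xp: "\<And>n::nat. 0 < X n"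
  shows "(\<lambda>n. \<integral>t. cut (X n) \<omega> (\<omega> + t) * cot (t/2) \<partial>circ) \<longlonglongrightarrow> 0"
proof -
  define B where "B = (a\<^sup>2 - b\<^sup>2) / (2 * b\<^sup>2)"
  have B: "\<bar>el' t / el t\<bar> \<le> B" for t unfolding B_def by (rule el'_el_bound)
  have bd: "\<bar>cut e \<omega> (\<omega> + t) * (el' (2*\<omega> + t) / el (2*\<omega> + t))\<bar> \<le> B" for e t
    unfolding abs_mult using mult_mono[OF cut_abs[of e \<omega> "\<omega> + t"] B[of "2*\<omega> + t"]] by simp
  have i: "integrable circ (\<lambda>t. cut e \<omega> (\<omega> + t) * (el' (2*\<omega> + t) / el (2*\<omega> + t)))" for e
    by (rule integrable_circ_bounded[where B=B]) (use bd in auto)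
  have "(\<integral>t. cut (X n) \<omega> (\<omega> + t) * cot (t/2) \<partial>circ) = - (\<integral>t. cut (X n) \<omega> (\<omega> + t) * (el' (2*\<omega> + t) / el (2*\<omega> + t)) \<partial>circ)" for n
    using cut_log_derivative[OF Xp[of n], of \<omega>] cut_cot_integrable[OF Xp[of n], of \<omega>] i[of "X n"]
    by (simp add: distrib_left)
  moreover have "(\<lambda>n. \<integral>t. cut (X n) \<omega> (\<omega> + t) * (el' (2*\<omega> + t) / el (2*\<omega> + t)) \<partial>circ) \<longlonglongrightarrow> (\<integral>t. el' (2*\<omega> + t) / el (2*\<omega> + t) \<partial>circ)"
  proof (rule integral_dominated_convergence[where w="\<lambda>_. B"])
    show "AE t in circ. (\<lambda>n. cut (X n) \<omega> (\<omega> + t) * (el' (2*\<omega> + t) / el (2*\<omega> + t))) \<longlonglongrightarrow> el' (2*\<omega> + t) / el (2*\<omega> + t)"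
      using AE_circ_sin_half
    proof eventually_elim
      case (elim t)
      have "(\<omega> - (\<omega> + t))/2 = - (t/2)" by simp
      then have "sin ((\<omega> - (\<omega> + t))/2) \<noteq> 0" using elim by simp
      from tendsto_mult_right[OF cut_at_right[OF refl this X Xp], of "el' (2*\<omega> + t) / el (2*\<omega> + t)"] show ?case
        by (simp only: mult_1)
    qed
  qed (use bd in auto)
  ultimately show ?thesis using tendsto_minus integral_log_el by fastforce
qed

end

subsection \<open>Chordal Lipschitz functions and the periodic Hilbert transform\<close>

text \<open>Lipschitz continuity for the chordal metric of the circle. It contains periodicity,
  compares directly with distances on the ellipse, and exactly compensates the pole of
  cot(t/2).\<close>

definition chordlip :: "(real \<Rightarrow> 'a::real_normed_vector) \<Rightarrow> real \<Rightarrow> bool" where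
  "chordlip f L \<longleftrightarrow> periodic f \<and> (\<forall>s t. norm (f s - f t) \<le> L * \<bar>sin ((s - t)/2)\<bar>)"

lemma chordlip_periodic: "chordlip f L \<Longrightarrow> periodic f"
  and chordlipD: "chordlip f L \<Longrightarrow> norm (f s - f t) \<le> L * \<bar>sin ((s - t)/2)\<bar>"
  by (auto simp: chordlip_def)

lemma chordlip_nonneg: assumes "chordlip f L" shows "0 \<le> L"
proof -
  have "norm (f pi - f 0) \<le> L" using chordlipD[OF assms, of pi 0] by simp
  then show ?thesis using norm_ge_zero[of "f pi - f 0"] by linarith
qed

lemma chordlip_continuous: assumes "chordlip f L" shows "continuous_on A f"
proof -
  have "L-lipschitz_on A f"
  proof (rule lipschitz_onI)
    fix s t
    have "norm (f s - f t) \<le> L * \<bar>sin ((s - t)/2)\<bar>" by (rule chordlipD[OF assms])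
    also have "\<dots> \<le> L * \<bar>s - t\<bar>"
      using abs_sin_x_le_abs_x[of "(s - t)/2"] by (intro mult_left_mono chordlip_nonneg[OF assms]) simp
    finally show "dist (f s) (f t) \<le> L * dist s t" by (simp add: dist_norm)
  qed (rule chordlip_nonneg[OF assms])
  then show ?thesis by (rule lipschitz_on_continuous_on)
qed

lemma chordlip_measurable: "chordlip f L \<Longrightarrow> f \<in> borel_measurable borel"
  by (intro borel_measurable_continuous_onI chordlip_continuous)

lemma chordlip_bound: assumes "chordlip f L" shows "norm (f t) \<le> norm (f 0) + L"
proof -
  have "norm (f t - f 0) \<le> L * \<bar>sin ((t - 0)/2)\<bar>" by (rule chordlipD[OF assms])
  also have "\<dots> \<le> L * 1" by (intro mult_left_mono chordlip_nonneg[OF assms]) simp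
  finally show ?thesis using norm_triangle_ineq2[of "f t" "f 0"] by simp
qed

lemma chordlip_component:
  fixes f :: "real \<Rightarrow> complex^2"
  assumes "chordlip f L" shows "chordlip (\<lambda>t. f t $ i) L"
  unfolding chordlip_def
proof (intro conjI allI)
  show "periodic (\<lambda>t. f t $ i)" using chordlip_periodic[OF assms] by (simp add: periodic_def)
  show "norm (f s $ i - f t $ i) \<le> L * \<bar>sin ((s - t)/2)\<bar>" for s t
    using order_trans[OF Finite_Cartesian_Product.norm_nth_le[of "f s - f t" i] chordlipD[OF assms]] by simp
qed

lemma chordlip_minus: "chordlip f L \<Longrightarrow> chordlip (\<lambda>t. - f t) L"
  by (auto simp: chordlip_def periodic_def norm_minus_commute)

lemma chordlip_L2: "chordlip f L \<Longrightarrow> L2 f"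
  by (rule L2_bounded[OF chordlip_measurable chordlip_periodic chordlip_bound])

lemma periodic_continuous_bounded:
  fixes f :: "real \<Rightarrow> 'a::real_normed_vector"
  assumes "continuous_on UNIV f" "periodic f"
  obtains B where "\<And>t. norm (f t) \<le> B"
proof -
  have "compact (f ` {0..2*pi})" by (intro compact_continuous_image continuous_on_subset[OF assms(1)]) auto
  then obtain B where B: "\<forall>x\<in>f ` {0..2*pi}. norm x \<le> B" by (meson bounded_iff compact_imp_bounded)
  have "norm (f t) \<le> B" for t
    using B wrap_range[of t] periodic_wrap[OF assms(2), of t] by (metis atLeastAtMost_iff imageI less_imp_le)
  then show ?thesis using that by blast
qed

text \<open>Subtracting the value at \<omega> makes the singular integral absolutely convergent. The
  kernel is left unnormalised, so the multiplier is 2 pi i sgn n.\<close>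

definition hilbert :: "(real \<Rightarrow> complex) \<Rightarrow> real \<Rightarrow> complex" where
  "hilbert f \<omega> = (\<integral>t. of_real (cot (t/2)) * (f \<omega> - f (\<omega> + t)) \<partial>circ)"

lemma cot_chordlip_bound:
  assumes "chordlip f L" shows "cmod (of_real (cot (t/2)) * (f \<omega> - f (\<omega> + t))) \<le> L"
proof (cases "sin (t/2) = 0")
  case True
  then show ?thesis using chordlip_nonneg[OF assms] by (simp add: cot_def)
next
  case False
  have e: "(\<omega> - (\<omega> + t))/2 = - (t/2)" by simp
  have "cmod (of_real (cot (t/2)) * (f \<omega> - f (\<omega> + t))) \<le> \<bar>cot (t/2)\<bar> * (L * \<bar>sin (t/2)\<bar>)"
    using chordlipD[OF assms, of \<omega> "\<omega> + t"] unfolding norm_mult e by (auto intro!: mult_left_mono)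
  also have "\<dots> = L * \<bar>cos (t/2)\<bar>" using False by (simp add: cot_def abs_divide)
  also have "\<dots> \<le> L * 1" by (intro mult_left_mono chordlip_nonneg[OF assms]) simp
  finally show ?thesis by simp
qed

lemma norm_integral_circ_le:
  fixes f :: "real \<Rightarrow> 'a::{banach,second_countable_topology}"
  assumes "f \<in> borel_measurable borel" "\<And>t. norm (f t) \<le> B"
  shows "norm (\<integral>t. f t \<partial>circ) \<le> 2*pi * B"
proof -
  have "norm (\<integral>t. f t \<partial>circ) \<le> (\<integral>t. norm (f t) \<partial>circ)" by (rule integral_norm_bound)
  also have "\<dots> \<le> (\<integral>t. B \<partial>circ)"
    using assms order_trans[OF norm_ge_zero assms(2)] by (intro integral_mono integrable_norm integrable_circ_bounded[where B=B]) auto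
  finally show ?thesis by (simp add: measure_circ)
qed

lemma hilbert_measurable: assumes "chordlip f L" shows "hilbert f \<in> borel_measurable borel"
proof -
  have [measurable]: "f \<in> borel_measurable borel" by (rule chordlip_measurable[OF assms])
  show ?thesis unfolding hilbert_def[abs_def] by measurable
qed

lemma hilbert_periodic: assumes "chordlip f L" shows "periodic (hilbert f)"
proof -
  have "f (\<omega> + 2*pi + t) = f (\<omega> + t)" for \<omega> t
    using periodicD[OF chordlip_periodic[OF assms], of "\<omega> + t"] by (simp add: add_ac)
  then show ?thesis using periodicD[OF chordlip_periodic[OF assms]] by (simp add: periodic_def hilbert_def)
qed

lemma hilbert_bound: assumes "chordlip f L" shows "cmod (hilbert f \<omega>) \<le> 2*pi * L"
proof -
  have [measurable]: "f \<in> borel_measurable borel" by (rule chordlip_measurable[OF assms])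
  show ?thesis unfolding hilbert_def by (rule norm_integral_circ_le[OF _ cot_chordlip_bound[OF assms]]) measurable
qed

text \<open>For n > 0 the pole cancels against the first factor of 1 - w^n with w = e^(-it), leaving
  i(1 + w) times a geometric sum. Only one constant term survives integration. Negative n follow by
  conjugation.\<close>

lemma integral_cot_cis:
  "(\<integral>t. of_real (cot (t/2)) * (1 - cis (- (of_int n * t))) \<partial>circ) = 2*pi * \<i> * of_int (sgn n)"
proof -
  have pos: "(\<integral>t. of_real (cot (t/2)) * (1 - cis (- (real N * t))) \<partial>circ) = 2*pi * \<i>" if "0 < N" for N :: nat
  proof -
    have ae: "AE t in circ. of_real (cot (t/2)) * (1 - cis (- (real N * t)))
       = \<i> * ((\<Sum>k<N. cis (of_int (- int k) * t)) + (\<Sum>k<N. cis (of_int (- int (Suc k)) * t)))"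
      using AE_circ_sin_half
    proof eventually_elim
      case (elim t)
      define w where "w = cis (-t)"
      \<comment> \<open>The half-angle formulas in complex form.\<close>
      have c: "of_real (cot (t/2)) * (1 - w) = \<i> * (1 + w)"
      proof -
        define x where "x = t/2"
        have t: "t = 2 * x" by (simp add: x_def)
        have sx: "sin x \<noteq> 0" using elim by (simp add: x_def)
        have c: "cos t = 1 - 2 * (sin x)\<^sup>2" "cos t = 2 * (cos x)\<^sup>2 - 1" "sin t = 2 * sin x * cos x"
          unfolding t by (rule cos_double_sin cos_double_cos sin_double)+
        have "cot x * (1 - cos t) = sin t"
          unfolding c(1,3) using sx by (simp add: cot_def power2_eq_square)
        moreover have "cot x * sin t = 1 + cos t"
          unfolding c(2,3) using sx by (simp add: cot_def power2_eq_square)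
        ultimately show ?thesis by (simp add: w_def complex_eq_iff x_def[symmetric])
      qed
      have g: "1 - w ^ N = (1 - w) * (\<Sum>k<N. w ^ k)" by (rule one_diff_power_eq)
      have p: "cis (- (real k * t)) = w ^ k" for k by (simp add: w_def Complex.DeMoivre)
      have "of_real (cot (t/2)) * (1 - cis (- (real N * t))) = (of_real (cot (t/2)) * (1 - w)) * (\<Sum>k<N. w ^ k)"
        unfolding p g by (simp only: mult.assoc)
      also have "\<dots> = \<i> * ((\<Sum>k<N. w ^ k) + (\<Sum>k<N. w ^ Suc k))"
        unfolding c by (simp add: distrib_right distrib_left sum_distrib_left sum.distrib mult.assoc)
      finally have "of_real (cot (t/2)) * (1 - cis (- (real N * t))) = \<i> * ((\<Sum>k<N. w ^ k) + (\<Sum>k<N. w ^ Suc k))" .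
      moreover have "of_int (- int m) * t = - (real m * t)" for m by simp
      ultimately show ?case by (simp only: p)
    qed
    have "(\<integral>t. of_real (cot (t/2)) * (1 - cis (- (real N * t))) \<partial>circ)
       = (\<integral>t. \<i> * ((\<Sum>k<N. cis (of_int (- int k) * t)) + (\<Sum>k<N. cis (of_int (- int (Suc k)) * t))) \<partial>circ)"
      by (rule integral_cong_AE[OF _ _ ae]) measurable
    also have "\<dots> = \<i> * ((\<Sum>k<N. (\<integral>t. cis (of_int (- int k) * t) \<partial>circ)) + (\<Sum>k<N. (\<integral>t. cis (of_int (- int (Suc k)) * t) \<partial>circ)))"
      by (simp only: integral_mult_right_zero Bochner_Integration.integral_add Bochner_Integration.integrable_sum Bochner_Integration.integral_sum integrable_cis)
    also have "\<dots> = \<i> * (2*pi)"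
    proof -
      have "(\<Sum>k<N. (\<integral>t. cis (of_int (- int k) * t) \<partial>circ)) = (\<Sum>k<N. if k = 0 then 2*pi else 0)"
        by (simp only: integral_cis) (simp add: of_real_sum[symmetric] del: of_real_sum)
      then have "(\<Sum>k<N. (\<integral>t. cis (of_int (- int k) * t) \<partial>circ)) = 2*pi" using that by simp
      moreover have "(\<Sum>k<N. (\<integral>t. cis (of_int (- int (Suc k)) * t) \<partial>circ)) = 0"
        by (simp only: integral_cis) simp
      ultimately show ?thesis by simp
    qed
    finally show ?thesis by simp
  qed
  consider "n = 0" | "0 < n" | "n < 0" by linarith
  then show ?thesis
  proof cases
    case 2
    then have "real (nat n) = of_int n" by simp
    then show ?thesis using pos[of "nat n"] 2 by simp
  next
    case 3
    have r: "real (nat (-n)) = - of_int n" using 3 by simp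
    have "(\<integral>t. of_real (cot (t/2)) * (1 - cis (- (of_int n * t))) \<partial>circ) = (\<integral>t. cnj (of_real (cot (t/2)) * (1 - cis (- (real (nat (-n)) * t)))) \<partial>circ)"
      unfolding r by (simp add: cis_cnj)
    also have "\<dots> = cnj (2*pi * \<i>)"
    proof -
      have p: "(\<integral>t. of_real (cot (t/2)) * (1 - cis (- (real (nat (-n)) * t))) \<partial>circ) = 2*pi * \<i>"
        using 3 by (intro pos) simp
      show ?thesis by (simp only: Bochner_Integration.integral_cnj p)
    qed
    also have "\<dots> = 2*pi * \<i> * of_int (sgn n)" using 3 by simp
    finally show ?thesis .
  qed simp
qed

text \<open>The regularised integrand is bounded by L, so Fubini applies; the translate contributes
  \<open>cis (- (of_int n * t))\<close>, and the remaining integral in t is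
  \<open>integral_cot_cis\<close>.\<close>

lemma hilbert_coefficient:
  assumes f: "chordlip f L"
  shows "(\<integral>\<omega>. hilbert f \<omega> * cis (of_int n * \<omega>) \<partial>circ) = 2*pi * \<i> * of_int (sgn n) * (\<integral>\<omega>. f \<omega> * cis (of_int n * \<omega>) \<partial>circ)"
proof -
  have [measurable]: "f \<in> borel_measurable borel" by (rule chordlip_measurable[OF f])
  have L2f: "L2 f" by (rule chordlip_L2[OF f])
  define x where "x = (\<integral>\<omega>. f \<omega> * cis (of_int n * \<omega>) \<partial>circ)"
  have xfc: "(\<integral>\<omega>. g \<omega> * cis (of_int n * \<omega>) \<partial>circ) = 2*pi * fourier g (-n)" for g
    by (simp add: fourier_def)
  define F where "F = (\<lambda>(\<omega>, t). of_real (cot (t/2)) * (f \<omega> - f (\<omega> + t)) * cis (of_int n * \<omega>))"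
  have Fm: "F \<in> borel_measurable (circ \<Otimes>\<^sub>M circ)" unfolding F_def by measurable
  have Fb: "cmod (F p) \<le> L" for p
    using cot_chordlip_bound[OF f] by (cases p) (simp add: F_def norm_mult)
  have int: "integrable (circ \<Otimes>\<^sub>M circ) F"
  proof (rule circ_circ.Fubini_integrable[OF Fm])
    show "integrable circ (\<lambda>\<omega>. \<integral>t. norm (F (\<omega>, t)) \<partial>circ)"
    proof (rule integrable_circ_bounded[where B="2*pi*L"])
      show "norm (\<integral>t. norm (F (\<omega>, t)) \<partial>circ) \<le> 2*pi*L" for \<omega>
        by (rule norm_integral_circ_le) (use Fb in \<open>auto simp: F_def\<close>)
      show "(\<lambda>\<omega>. \<integral>t. norm (F (\<omega>, t)) \<partial>circ) \<in> borel_measurable borel" unfolding F_def by measurable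
    qed
    show "AE \<omega> in circ. integrable circ (\<lambda>t. F (\<omega>, t))"
      by (intro AE_I2 integrable_circ_bounded[where B=L]) (use Fb in \<open>auto simp: F_def\<close>)
  qed
  have "(\<integral>\<omega>. hilbert f \<omega> * cis (of_int n * \<omega>) \<partial>circ) = (\<integral>\<omega>. (\<integral>t. F (\<omega>, t) \<partial>circ) \<partial>circ)"
    unfolding hilbert_def F_def by simp
  also have "\<dots> = (\<integral>t. (\<integral>\<omega>. F (\<omega>, t) \<partial>circ) \<partial>circ)"
    using circ_circ.Fubini_integral[of "\<lambda>\<omega> t. F (\<omega>, t)"] int by simp
  also have "\<dots> = (\<integral>t. of_real (cot (t/2)) * (1 - cis (- (of_int n * t))) * x \<partial>circ)"
  proof (rule Bochner_Integration.integral_cong[OF refl])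
    fix t
    have "(\<integral>\<omega>. F (\<omega>, t) \<partial>circ) = of_real (cot (t/2)) * (\<integral>\<omega>. (f \<omega> - f (\<omega> + t)) * cis (of_int n * \<omega>) \<partial>circ)"
      unfolding F_def by (simp add: mult.assoc)
    also have "(\<integral>\<omega>. (f \<omega> - f (\<omega> + t)) * cis (of_int n * \<omega>) \<partial>circ) = 2*pi * (fourier f (-n) - cis (- (of_int n * t)) * fourier f (-n))"
      unfolding xfc by (simp add: fourier_diff L2f L2_shift fourier_shift)
    also have "\<dots> = (1 - cis (- (of_int n * t))) * x" unfolding x_def xfc by (simp add: algebra_simps)
    finally show "(\<integral>\<omega>. F (\<omega>, t) \<partial>circ) = of_real (cot (t/2)) * (1 - cis (- (of_int n * t))) * x" by (simp add: mult.assoc)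
  qed
  also have "\<dots> = 2*pi * \<i> * of_int (sgn n) * x"
    by (simp only: integral_mult_left_zero integral_cot_cis)
  finally show ?thesis by (simp add: x_def)
qed

text \<open>Since the kernel depends on the sum of the angles, cis(n \<omega>) is written as cis(n
  (\<omega> + t)) cis(-n t). The kernel keeps the frequency n and f is tested at -n.\<close>

lemma convolution_coefficient:
  fixes g :: "real \<Rightarrow> real"
  assumes g: "continuous_on UNIV g" "periodic g" and f: "chordlip f L"
  shows "(\<integral>\<omega>. (\<integral>t. of_real (g (\<omega> + t)) * f t \<partial>circ) * cis (of_int n * \<omega>) \<partial>circ)
     = (\<integral>t. of_real (g t) * cis (of_int n * t) \<partial>circ) * (\<integral>t. f t * cis (of_int (-n) * t) \<partial>circ)"
    and "\<exists>B. \<forall>\<omega>. cmod (\<integral>t. of_real (g (\<omega> + t)) * f t \<partial>circ) \<le> B"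
    and "integrable circ (\<lambda>t. of_real (g (\<omega> + t)) * f t)"
    and "(\<lambda>\<omega>. \<integral>t. of_real (g (\<omega> + t)) * f t \<partial>circ) \<in> borel_measurable borel"
    and "periodic (\<lambda>\<omega>. \<integral>t. of_real (g (\<omega> + t)) * f t \<partial>circ)"
proof -
  have [measurable]: "f \<in> borel_measurable borel" by (rule chordlip_measurable[OF f])
  have [measurable]: "g \<in> borel_measurable borel" by (rule borel_measurable_continuous_onI[OF g(1)])
  obtain A where A: "\<And>t. norm (g t) \<le> A" using periodic_continuous_bounded[OF g] by blast
  define B where "B = A * (cmod (f 0) + L)"
  have bd: "cmod (of_real (g s) * f t) \<le> B" for s t
    unfolding norm_mult B_def using A[of s] chordlip_bound[OF f, of t] by (intro mult_mono) auto
  show "\<exists>B. \<forall>\<omega>. cmod (\<integral>t. of_real (g (\<omega> + t)) * f t \<partial>circ) \<le> B"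
    by (intro exI[of _ "2*pi*B"] allI norm_integral_circ_le[OF _ bd]) measurable
  show "integrable circ (\<lambda>t. of_real (g (\<omega> + t)) * f t)"
    by (rule integrable_circ_bounded[where B=B]) (use bd in auto)
  show "(\<lambda>\<omega>. \<integral>t. of_real (g (\<omega> + t)) * f t \<partial>circ) \<in> borel_measurable borel" by measurable
  have "g (\<omega> + 2*pi + t) = g (\<omega> + t)" for \<omega> t
    using periodicD[OF g(2), of "\<omega> + t"] by (simp add: add_ac)
  then show "periodic (\<lambda>\<omega>. \<integral>t. of_real (g (\<omega> + t)) * f t \<partial>circ)" by (simp add: periodic_def)
  define F where "F = (\<lambda>(\<omega>, t). of_real (g (\<omega> + t)) * f t * cis (of_int n * \<omega>))"
  have Fm: "F \<in> borel_measurable (circ \<Otimes>\<^sub>M circ)" unfolding F_def by measurable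
  have Fb: "cmod (F p) \<le> B" for p
    using bd by (cases p) (simp add: F_def norm_mult)
  have int: "integrable (circ \<Otimes>\<^sub>M circ) F"
  proof (rule circ_circ.Fubini_integrable[OF Fm])
    show "integrable circ (\<lambda>\<omega>. \<integral>t. norm (F (\<omega>, t)) \<partial>circ)"
    proof (rule integrable_circ_bounded[where B="2*pi*B"])
      show "norm (\<integral>t. norm (F (\<omega>, t)) \<partial>circ) \<le> 2*pi*B" for \<omega>
        by (rule norm_integral_circ_le) (use Fb in \<open>auto simp: F_def\<close>)
      show "(\<lambda>\<omega>. \<integral>t. norm (F (\<omega>, t)) \<partial>circ) \<in> borel_measurable borel" unfolding F_def by measurable
    qed
    show "AE \<omega> in circ. integrable circ (\<lambda>t. F (\<omega>, t))"
      by (intro AE_I2 integrable_circ_bounded[where B=B]) (use Fb in \<open>auto simp: F_def\<close>)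
  qed
  define G where "G = (\<integral>t. of_real (g t) * cis (of_int n * t) \<partial>circ)"
  have "(\<integral>\<omega>. (\<integral>t. of_real (g (\<omega> + t)) * f t \<partial>circ) * cis (of_int n * \<omega>) \<partial>circ) = (\<integral>\<omega>. (\<integral>t. F (\<omega>, t) \<partial>circ) \<partial>circ)"
    unfolding F_def by simp
  also have "\<dots> = (\<integral>t. (\<integral>\<omega>. F (\<omega>, t) \<partial>circ) \<partial>circ)"
    using circ_circ.Fubini_integral[of "\<lambda>\<omega> t. F (\<omega>, t)"] int by simp
  also have "\<dots> = (\<integral>t. G * (f t * cis (of_int (-n) * t)) \<partial>circ)"
  proof (rule Bochner_Integration.integral_cong[OF refl])
    fix t
    have "(\<integral>\<omega>. F (\<omega>, t) \<partial>circ) = (\<integral>\<omega>. (f t * cis (of_int (-n) * t)) * (of_real (g (\<omega> + t)) * cis (of_int n * (\<omega> + t))) \<partial>circ)"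
      unfolding F_def by (intro Bochner_Integration.integral_cong) (auto simp: distrib_left cis_mult[symmetric] simp flip: cis_inverse)
    also have "\<dots> = (f t * cis (of_int (-n) * t)) * (\<integral>\<omega>. of_real (g (\<omega> + t)) * cis (of_int n * (\<omega> + t)) \<partial>circ)" by simp
    also have "(\<integral>\<omega>. of_real (g (\<omega> + t)) * cis (of_int n * (\<omega> + t)) \<partial>circ) = G"
      unfolding G_def
      by (rule integral_periodic_shift[where f="\<lambda>t. of_real (g t) * cis (of_int n * t)"])
         (use g(2) periodic_cis[of n] in \<open>auto simp: periodic_def\<close>)
    finally show "(\<integral>\<omega>. F (\<omega>, t) \<partial>circ) = G * (f t * cis (of_int (-n) * t))" by simp
  qed
  finally show "(\<integral>\<omega>. (\<integral>t. of_real (g (\<omega> + t)) * f t \<partial>circ) * cis (of_int n * \<omega>) \<partial>circ)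
     = G * (\<integral>t. f t * cis (of_int (-n) * t) \<partial>circ)" by simp
qed

context ell
begin

lemma cut_periodic: "cut \<epsilon> \<omega> (t + 2*pi) = cut \<epsilon> \<omega> t"
  by (simp add: cut_def par_periodic)

text \<open>Adding and subtracting f \<omega> leaves the regularised integrand, which converges by
  domination, and f \<omega> times the truncated cotangent integral, which tends to 0.\<close>

lemma pv_cot_tendsto:
  assumes f: "chordlip f L" and X: "X \<longlonglongrightarrow> 0" and Xp: "\<And>n::nat. 0 < X n"
  shows "(\<lambda>n. \<integral>t. of_real (cut (X n) \<omega> t * cot ((\<omega> - t)/2)) * f t \<partial>circ) \<longlonglongrightarrow> hilbert f \<omega>"
proof -
  have [measurable]: "f \<in> borel_measurable borel" by (rule chordlip_measurable[OF f])
  define D where "D n t = of_real (cut (X n) \<omega> (\<omega> + t)) * (of_real (cot (t/2)) * (f \<omega> - f (\<omega> + t)))" for n t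
  have Dm[measurable]: "D n \<in> borel_measurable borel" for n unfolding D_def by measurable
  have Db: "cmod (D n t) \<le> L" for n t
    unfolding D_def norm_mult[of "of_real (cut _ _ _)"]
    using mult_mono[OF cut_abs[of "X n" \<omega> "\<omega> + t"] cot_chordlip_bound[OF f, of t \<omega>]] by simp
  have Di: "integrable circ (D n)" for n by (rule integrable_circ_bounded[OF Dm Db])
  have eq: "(\<integral>t. of_real (cut (X n) \<omega> t * cot ((\<omega> - t)/2)) * f t \<partial>circ)
     = (\<integral>t. D n t \<partial>circ) - of_real (\<integral>t. cut (X n) \<omega> (\<omega> + t) * cot (t/2) \<partial>circ) * f \<omega>" for n
  proof -
    define g where "g t = of_real (cut (X n) \<omega> t * cot ((\<omega> - t)/2)) * f t" for t
    have [measurable]: "g \<in> borel_measurable borel" unfolding g_def by measurable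
    have "periodic g"
    proof -
      have "cot ((\<omega> - (t + 2*pi))/2) = cot ((\<omega> - t)/2)" for t
      proof -
        have "(\<omega> - (t + 2*pi))/2 = (\<omega> - t)/2 - pi" by (simp add: field_simps)
        then show ?thesis by (simp only: cot_def cos_diff sin_diff) simp
      qed
      then show ?thesis using periodicD[OF chordlip_periodic[OF f]] by (simp add: periodic_def g_def cut_periodic del: distrib_left_numeral)
    qed
    then have "(\<integral>t. g t \<partial>circ) = (\<integral>t. g (t + \<omega>) \<partial>circ)"
      by (intro integral_periodic_shift[symmetric]) measurable
    also have "\<dots> = (\<integral>t. D n t - of_real (cut (X n) \<omega> (\<omega> + t) * cot (t/2)) * f \<omega> \<partial>circ)"
    proof (rule Bochner_Integration.integral_cong[OF refl])
      fix t
      have "cot ((\<omega> - (t + \<omega>))/2) = - cot (t/2)" by (simp add: cot_def)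
      then show "g (t + \<omega>) = D n t - of_real (cut (X n) \<omega> (\<omega> + t) * cot (t/2)) * f \<omega>"
        unfolding g_def D_def by (simp add: add.commute algebra_simps)
    qed
    also have "\<dots> = (\<integral>t. D n t \<partial>circ) - (\<integral>t. of_real (cut (X n) \<omega> (\<omega> + t) * cot (t/2)) * f \<omega> \<partial>circ)"
      by (rule Bochner_Integration.integral_diff[OF Di integrable_mult_left[OF integrable_of_real[OF cut_cot_integrable[OF Xp]]]])
    finally show ?thesis
      by (simp only: g_def integral_mult_left_zero integral_complex_of_real)
  qed
  have "(\<lambda>n. \<integral>t. D n t \<partial>circ) \<longlonglongrightarrow> hilbert f \<omega>"
    unfolding hilbert_def
  proof (rule integral_dominated_convergence[where w="\<lambda>_. L"])
    show "AE t in circ. (\<lambda>n. D n t) \<longlonglongrightarrow> of_real (cot (t/2)) * (f \<omega> - f (\<omega> + t))"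
      using AE_circ_sin_half
    proof eventually_elim
      case (elim t)
      have "(\<omega> - (\<omega> + t))/2 = - (t/2)" by simp
      then have "sin ((\<omega> - (\<omega> + t))/2) \<noteq> 0" using elim by simp
      from tendsto_mult_right[OF tendsto_of_real[OF cut_at_right[OF refl this X Xp]], of "of_real (cot (t/2)) * (f \<omega> - f (\<omega> + t))"]
      show ?case unfolding D_def by (simp only: of_real_1 mult_1)
    qed
  qed (use Db in auto)
  then have "(\<lambda>n. (\<integral>t. D n t \<partial>circ) - of_real (\<integral>t. cut (X n) \<omega> (\<omega> + t) * cot (t/2) \<partial>circ) * f \<omega>) \<longlonglongrightarrow> hilbert f \<omega> - of_real 0 * f \<omega>"
    by (intro tendsto_intros cut_cot_tendsto X Xp)
  then show ?thesis unfolding eq by simp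
qed

lemma pv_bounded_tendsto:
  fixes g :: "real \<Rightarrow> complex"
  assumes [measurable]: "g \<in> borel_measurable borel" and g: "periodic g" "\<And>t. cmod (g t) \<le> B"
    and X: "X \<longlonglongrightarrow> 0" and Xp: "\<And>n::nat. 0 < X n"
  shows "(\<lambda>n. \<integral>t. of_real (cut (X n) \<omega> t) * g t \<partial>circ) \<longlonglongrightarrow> (\<integral>t. g t \<partial>circ)"
proof -
  have sh: "(\<integral>t. of_real (cut e \<omega> t) * g t \<partial>circ) = (\<integral>t. of_real (cut e \<omega> (\<omega> + t)) * g (\<omega> + t) \<partial>circ)" for e
    using integral_periodic_shift[where f="\<lambda>t. of_real (cut e \<omega> t) * g t" and s=\<omega>] g(1)
    by (simp add: periodic_def cut_periodic add.commute)
  have sh': "(\<integral>t. g t \<partial>circ) = (\<integral>t. g (\<omega> + t) \<partial>circ)"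
    using integral_periodic_shift[OF _ g(1), where s=\<omega>] by (simp add: add.commute)
  show ?thesis
    unfolding sh sh'
  proof (rule integral_dominated_convergence[where w="\<lambda>_. B"])
    show "AE t in circ. (\<lambda>n. of_real (cut (X n) \<omega> (\<omega> + t)) * g (\<omega> + t)) \<longlonglongrightarrow> g (\<omega> + t)"
      using AE_circ_sin_half
    proof eventually_elim
      case (elim t)
      have "(\<omega> - (\<omega> + t))/2 = - (t/2)" by simp
      then have "sin ((\<omega> - (\<omega> + t))/2) \<noteq> 0" using elim by simp
      from tendsto_mult_right[OF tendsto_of_real[OF cut_at_right[OF refl this X Xp]], of "g (\<omega> + t)"]
      show ?case by (simp only: of_real_1 mult_1)
    qed
    show "AE t in circ. norm (of_real (cut (X n) \<omega> (\<omega> + t)) * g (\<omega> + t)) \<le> B" for n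
      unfolding norm_mult using mult_mono[OF cut_abs[of "X n" \<omega>] g(2)] by (intro AE_I2) simp
  qed auto
qed

end

section \<open>The Neumann-Poincare operator as a multiplier\<close>

lemma norm_vec2_le: "norm (v::complex^2) \<le> cmod (v$1) + cmod (v$2)"
  unfolding norm_vec_def using L2_set_le_sum[of UNIV "\<lambda>i. cmod (v$i)"] by (simp add: sum_2)

lemma vec2_measurable:
  fixes f :: "2 \<Rightarrow> 'x \<Rightarrow> complex"
  assumes [measurable]: "\<And>i. f i \<in> borel_measurable M"
  shows "(\<lambda>t. \<chi> i. f i t) \<in> borel_measurable M"
proof -
  have c: "continuous_on UNIV (\<lambda>p::complex \<times> complex. (\<chi> i. if i = 1 then fst p else snd p) :: complex^2)"
  proof (rule continuous_on_vec_lambda)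
    show "continuous_on UNIV (\<lambda>p::complex \<times> complex. if i = 1 then fst p else snd p)" for i :: 2
      by (cases "i = 1") (auto intro!: continuous_intros)
  qed
  have m: "(\<lambda>t. (f 1 t, f 2 t)) \<in> borel_measurable M" by measurable
  have "(\<chi> i. f i t) = (\<chi> i. if i = 1 then fst (f 1 t, f 2 t) else snd (f 1 t, f 2 t))" for t
    by (simp add: vec_eq_iff forall_2)
  then show ?thesis using measurable_compose[OF m borel_measurable_continuous_onI[OF c]] by simp
qed

lemma chordlip_scaleR:
  assumes f: "chordlip f L" and g: "chordlip g M"
  shows "chordlip (\<lambda>t. f t *\<^sub>R g t) ((norm (f 0) + L) * M + L * (norm (g 0) + M))"
  unfolding chordlip_def
proof (intro conjI allI)
  show "periodic (\<lambda>t. f t *\<^sub>R g t)" using chordlip_periodic[OF f] chordlip_periodic[OF g] by (simp add: periodic_def)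
  fix s t :: real
  define d where "d = \<bar>sin ((s - t)/2)\<bar>"
  have "f s *\<^sub>R g s - f t *\<^sub>R g t = f s *\<^sub>R (g s - g t) + (f s - f t) *\<^sub>R g t"
    by (simp add: algebra_simps)
  then have "norm (f s *\<^sub>R g s - f t *\<^sub>R g t) \<le> norm (f s) * norm (g s - g t) + norm (f s - f t) * norm (g t)"
    by (metis norm_scaleR norm_triangle_ineq real_norm_def)
  also have "\<dots> \<le> (norm (f 0) + L) * (M * d) + (L * d) * (norm (g 0) + M)"
    using chordlip_bound[OF f, of s] chordlip_bound[OF g, of t] chordlipD[OF f, of s t] chordlipD[OF g, of s t] chordlip_nonneg[OF f] chordlip_nonneg[OF g]
    by (intro add_mono mult_mono) (auto simp: d_def)
  finally show "norm (f s *\<^sub>R g s - f t *\<^sub>R g t) \<le> ((norm (f 0) + L) * M + L * (norm (g 0) + M)) * \<bar>sin ((s - t)/2)\<bar>"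
    by (simp add: d_def algebra_simps)
qed

lemma chordlip_add: assumes "chordlip f L" "chordlip g M" shows "chordlip (\<lambda>t. f t + g t) (L + M)"
  unfolding chordlip_def
proof (intro conjI allI)
  show "periodic (\<lambda>t. f t + g t)" using assms by (simp add: chordlip_def periodic_def)
  show "norm (f s + g s - (f t + g t)) \<le> (L + M) * \<bar>sin ((s - t)/2)\<bar>" for s t
    using chordlipD[OF assms(1), of s t] chordlipD[OF assms(2), of s t] norm_triangle_ineq[of "f s - f t" "g s - g t"]
    by (simp add: algebra_simps)
qed

lemma chordlip_cmult: fixes f :: "real \<Rightarrow> complex" assumes "chordlip f L" shows "chordlip (\<lambda>t. c * f t) (cmod c * L)"
  unfolding chordlip_def
proof (intro conjI allI)
  show "periodic (\<lambda>t. c * f t)" using assms by (simp add: chordlip_def periodic_def)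
  show "norm (c * f s - c * f t) \<le> cmod c * L * \<bar>sin ((s - t)/2)\<bar>" for s t
    using mult_left_mono[OF chordlipD[OF assms, of s t], of "cmod c"]
    by (simp add: right_diff_distrib[symmetric] norm_mult mult.assoc)
qed

lemma chordlip_cis: "chordlip (\<lambda>t. cis (of_int n * t)) (2 * \<bar>of_int n\<bar>)"
  unfolding chordlip_def
proof (intro conjI allI)
  fix s t
  have nat: "cmod (cis (real k * s) - cis (real k * t)) \<le> real k * (2 * \<bar>sin ((s - t)/2)\<bar>)" for k
  proof -
    have "cmod (cis (real k * s) - cis (real k * t)) \<le> real k * cmod (cis s - cis t)"
      unfolding Complex.DeMoivre[symmetric] by (rule norm_power_diff) auto
    also have "cmod (cis s - cis t) = 2 * \<bar>sin ((s - t)/2)\<bar>"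
    proof -
      have "cis s - cis t = cis t * (cis (s - t) - 1)" by (simp add: right_diff_distrib cis_mult)
      then have "(cmod (cis s - cis t))\<^sup>2 = (2 * \<bar>sin ((s - t)/2)\<bar>)\<^sup>2"
        by (simp add: norm_mult cmod_cis_minus_1 power_mult_distrib)
      then show ?thesis by (rule power2_eq_imp_eq) auto
    qed
    finally show ?thesis .
  qed
  show "norm (cis (of_int n * s) - cis (of_int n * t)) \<le> 2 * \<bar>of_int n\<bar> * \<bar>sin ((s - t)/2)\<bar>"
  proof (cases "0 \<le> n")
    case True
    then have "real (nat n) = of_int n" by simp
    then show ?thesis using nat[of "nat n"] True by (simp add: mult_ac)
  next
    case False
    then have r: "real (nat (-n)) = - of_int n" by simp
    have "cmod (cis (of_int n * s) - cis (of_int n * t)) = cmod (cnj (cis (- of_int n * s) - cis (- of_int n * t)))"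
      by (simp add: cis_cnj)
    also have "\<dots> = cmod (cis (- of_int n * s) - cis (- of_int n * t))" by (rule complex_mod_cnj)
    finally show ?thesis using nat[of "nat (-n)"] False unfolding r by (simp add: mult_ac)
  qed
qed (rule periodic_cis)

lemma chordlip_vec:
  fixes f :: "2 \<Rightarrow> real \<Rightarrow> complex"
  assumes "\<And>i. chordlip (f i) (L i)" shows "chordlip (\<lambda>t. \<chi> i. f i t) (L 1 + L 2)"
  unfolding chordlip_def
proof (intro conjI allI)
  show "periodic (\<lambda>t. \<chi> i. f i t)" using chordlip_periodic[OF assms] by (simp add: periodic_def)
  fix s t
  have "norm ((\<chi> i. f i s) - (\<chi> i. f i t)) \<le> cmod (f 1 s - f 1 t) + cmod (f 2 s - f 2 t)"
    using norm_vec2_le[of "(\<chi> i. f i s) - (\<chi> i. f i t)"] by simp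
  also have "\<dots> \<le> (L 1 + L 2) * \<bar>sin ((s - t)/2)\<bar>"
    using chordlipD[OF assms[of 1], of s t] chordlipD[OF assms[of 2], of s t] by (simp add: distrib_right)
  finally show "norm ((\<chi> i. f i s) - (\<chi> i. f i t)) \<le> (L 1 + L 2) * \<bar>sin ((s - t)/2)\<bar>" .
qed

lemma chordlip_trig: assumes "finite J" shows "\<exists>L. chordlip (trig J d) L"
  using assms
proof (induction J)
  case empty
  show ?case by (rule exI[of _ 0]) (simp add: chordlip_def periodic_def trig_def)
next
  case (insert n J)
  then obtain L where L: "chordlip (trig J d) L" by blast
  have "trig (insert n J) d = (\<lambda>t. d n * cis (of_int n * t) + trig J d t)"
    using insert by (auto simp: trig_def)
  then show ?case using chordlip_add[OF chordlip_cmult[OF chordlip_cis] L] by metis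
qed

context ell
begin

section \<open>Lipschitz functions on the ellipse and on the circle\<close>

lemma ang_periodic: "periodic f \<Longrightarrow> f (ang (par t)) = f t"
proof -
  assume f: "periodic f"
  have "periodic par" by (simp add: periodic_def par_periodic)
  then have "ang (par t) = wrap t"
    using ang_par[OF wrap_range(1) wrap_range(2)] periodic_wrap[of par t] by metis
  then show "f (ang (par t)) = f t" by (simp add: periodic_wrap[OF f])
qed

text \<open>The difference of the squared speeds is (a^2 - b^2) sin(s + t) sin(s - t); the last sine
  is at most twice the half-angle sine, and the sum of the speeds is at least 2 b.\<close>

lemma chordlip_speed: "chordlip speed ((a\<^sup>2 - b\<^sup>2) / b)"
  unfolding chordlip_def
proof (intro conjI allI)
  fix s t
  have ab: "0 \<le> a\<^sup>2 - b\<^sup>2" using b_pos b_less by (simp add: power_mono)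
  have "(speed s)\<^sup>2 - (speed t)\<^sup>2 = (a\<^sup>2 - b\<^sup>2) * (sin (s + t) * sin (s - t))"
  proof -
    have "cos (2*t) - cos (2 * s) = 2 * sin (t + s) * sin (s - t)"
      using sin_times_sin[of "t + s" "s - t"] by (simp add: algebra_simps)
    then show ?thesis unfolding speed_el using el_pos[of "2 * s"] el_pos[of "2*t"]
      by (simp add: el_def add.commute) (simp add: field_simps)
  qed
  then have e: "(speed s - speed t) * (speed s + speed t) = (a\<^sup>2 - b\<^sup>2) * (sin (s + t) * sin (s - t))"
    by (simp add: power2_eq_square algebra_simps)
  have "2 * ((s - t)/2) = s - t" by simp
  then have "sin (s - t) = 2 * sin ((s - t)/2) * cos ((s - t)/2)" using sin_double[of "(s - t)/2"] by (simp only:)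
  then have s1: "\<bar>sin (s - t)\<bar> \<le> 2 * \<bar>sin ((s - t)/2)\<bar>"
    using mult_left_mono[OF abs_cos_le_one[of "(s - t)/2"], of "2 * \<bar>sin ((s - t)/2)\<bar>"] by (simp add: abs_mult)
  have "\<bar>speed s - speed t\<bar> * (2 * b) \<le> \<bar>speed s - speed t\<bar> * (speed s + speed t)"
    using speed_bounds[of s] speed_bounds[of t] by (intro mult_left_mono) auto
  also have "\<dots> = \<bar>(speed s - speed t) * (speed s + speed t)\<bar>"
    using speed_pos[of s] speed_pos[of t] by (simp add: abs_mult)
  also have "\<dots> \<le> (a\<^sup>2 - b\<^sup>2) * (1 * (2 * \<bar>sin ((s - t)/2)\<bar>))"
    unfolding e abs_mult using ab s1 by (intro mult_mono) auto
  finally show "norm (speed s - speed t) \<le> (a\<^sup>2 - b\<^sup>2) / b * \<bar>sin ((s - t)/2)\<bar>"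
    using b_pos by (simp add: field_simps)
qed (rule speed_periodic)

lemma chordlip_inverse_speed: "chordlip (\<lambda>t. 1 / speed t) ((a\<^sup>2 - b\<^sup>2) / b / b\<^sup>2)"
  unfolding chordlip_def
proof (intro conjI allI)
  show "periodic (\<lambda>t. 1 / speed t)" using speed_periodic by (simp add: periodic_def)
  fix s t
  have "1 / speed s - 1 / speed t = (speed t - speed s) / (speed s * speed t)"
    using speed_pos[of s] speed_pos[of t] by (simp add: field_simps)
  then have "norm (1 / speed s - 1 / speed t) = norm (speed s - speed t) / (speed s * speed t)"
    using speed_pos[of s] speed_pos[of t] by (simp add: abs_divide abs_mult abs_minus_commute)
  also have "\<dots> \<le> ((a\<^sup>2 - b\<^sup>2) / b * \<bar>sin ((s - t)/2)\<bar>) / b\<^sup>2"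
  proof (rule frac_le)
    show "norm (speed s - speed t) \<le> (a\<^sup>2 - b\<^sup>2) / b * \<bar>sin ((s - t)/2)\<bar>" by (rule chordlipD[OF chordlip_speed])
    then show "0 \<le> (a\<^sup>2 - b\<^sup>2) / b * \<bar>sin ((s - t)/2)\<bar>" by (rule order_trans[OF norm_ge_zero])
    show "b\<^sup>2 \<le> speed s * speed t" unfolding power2_eq_square
      using speed_bounds[of s] speed_bounds[of t] b_pos by (intro mult_mono) auto
  qed (use b_pos in simp)
  finally show "norm (1 / speed s - 1 / speed t) \<le> (a\<^sup>2 - b\<^sup>2) / b / b\<^sup>2 * \<bar>sin ((s - t)/2)\<bar>" by simp
qed

lemma lipschitz_chordlip:
  assumes "L-lipschitz_on (frontier (ellipse a b)) \<phi>"
  shows "chordlip (\<lambda>t. \<phi> (par t)) (L * (2 * a))"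
  unfolding chordlip_def
proof (intro conjI allI)
  show "periodic (\<lambda>t. \<phi> (par t))" by (simp add: periodic_def par_periodic)
  fix s t
  have "norm (\<phi> (par s) - \<phi> (par t)) \<le> L * dist (par s) (par t)"
    using lipschitz_onD[OF assms par_in_frontier par_in_frontier, of s t] by (simp add: dist_norm)
  also have "\<dots> \<le> L * (2 * a * \<bar>sin ((s - t)/2)\<bar>)"
    by (intro mult_left_mono dist_par_bounds lipschitz_on_nonneg[OF assms])
  finally show "norm (\<phi> (par s) - \<phi> (par t)) \<le> L * (2 * a) * \<bar>sin ((s - t)/2)\<bar>" by (simp add: mult.assoc)
qed

lemma chordlip_lipschitz:
  assumes g: "chordlip g L" and eq: "\<And>t. \<phi> (par t) = g t"
  shows "(L / (2*b))-lipschitz_on (frontier (ellipse a b)) \<phi>"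
proof (rule lipschitz_onI)
  show "0 \<le> L / (2*b)" using chordlip_nonneg[OF g] b_pos by simp
  fix x y assume "x \<in> frontier (ellipse a b)" "y \<in> frontier (ellipse a b)"
  then obtain s t where st: "x = par s" "y = par t" by (metis frontier_par)
  have "dist (\<phi> x) (\<phi> y) \<le> L * \<bar>sin ((s - t)/2)\<bar>" using chordlipD[OF g, of s t] by (simp add: st eq dist_norm)
  also have "\<dots> = L / (2*b) * (2 * b * \<bar>sin ((s - t)/2)\<bar>)" using b_pos by simp
  also have "\<dots> \<le> L / (2*b) * dist x y"
    unfolding st using chordlip_nonneg[OF g] b_pos by (intro mult_left_mono dist_par_bounds) auto
  finally show "dist (\<phi> x) (\<phi> y) \<le> L / (2*b) * dist x y" .
qed

lemma kP_continuous [continuous_intros]: "continuous_on A kP"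
  and kQ_continuous [continuous_intros]: "continuous_on A kQ"
  unfolding kP_def[abs_def] kQ_def[abs_def]
  by (intro continuous_intros; use el_pos in \<open>simp add: less_imp_neq[symmetric]\<close>)+

lemma kZ_continuous [continuous_intros]: "continuous_on A kZ"
  and kY_continuous [continuous_intros]: "continuous_on A kY"
  unfolding kZ_def[abs_def] kY_def[abs_def]
  by (intro continuous_intros; use el_pos in \<open>simp add: less_imp_neq[symmetric]\<close>)+

lemma smooth_kernel_continuous: "continuous_on A (smooth_kernel \<kappa> i j)"
  unfolding smooth_kernel_def[abs_def] by (cases "i = 1"; cases "j = 1") (auto intro!: continuous_intros)

lemma kPQ_periodic: "periodic kP" "periodic kQ" "periodic kZ" "periodic kY"
  by (simp_all add: periodic_def kP_def kQ_def kZ_def kY_def el_periodic)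

lemma smooth_kernel_periodic: "periodic (smooth_kernel \<kappa> i j)"
  using kPQ_periodic by (simp add: periodic_def smooth_kernel_def)

section \<open>The principal value in the angular variable and its Fourier coefficients\<close>

definition ju :: "2 \<Rightarrow> (real \<Rightarrow> complex^2) \<Rightarrow> real \<Rightarrow> complex" where
  "ju i u t = of_real (rot90 i 1) * u t $ 1 + of_real (rot90 i 2) * u t $ 2"

definition gint :: "real \<Rightarrow> 2 \<Rightarrow> (real \<Rightarrow> complex^2) \<Rightarrow> real \<Rightarrow> complex" where
  "gint \<kappa> i u \<omega> = (\<integral>t. of_real (smooth_kernel \<kappa> i 1 (\<omega> + t)) * u t $ 1 \<partial>circ) + (\<integral>t. of_real (smooth_kernel \<kappa> i 2 (\<omega> + t)) * u t $ 2 \<partial>circ)"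

definition pv_trace :: "real \<Rightarrow> (real \<Rightarrow> complex^2) \<Rightarrow> real \<Rightarrow> complex^2" where
  "pv_trace \<kappa> u \<omega> = (\<chi> i. of_real (\<kappa> / (4*pi)) * hilbert (ju i u) \<omega> + gint \<kappa> i u \<omega>)"

lemma chordlip_ju: assumes "chordlip u L" shows "chordlip (ju i u) L"
proof -
  have "ju 1 u = (\<lambda>t. - u t $ 2)" "ju 2 u = (\<lambda>t. u t $ 1)" by (auto simp: ju_def rot90_def)
  then show ?thesis using exhaust_2[of i] chordlip_component[OF assms] chordlip_minus[OF chordlip_component[OF assms]] by auto
qed

text \<open>The speed at t comes from arc length and is part of u. The speed at \<omega> cancels the
  normalisation of the normal, as in \<open>kernel_par\<close>.\<close>

lemma NP_pv_par:
  assumes mu: "0 < mu" and lm: "0 < 2 * mu + lam"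
    and u: "chordlip u L" and eq: "\<And>t. u t = speed t *\<^sub>R \<phi> (par t)"
  defines "\<kappa> \<equiv> mu / (2 * mu + lam)"
  shows "speed \<omega> *\<^sub>R NP_pv lam mu sig (ellipse_normal a b) \<phi> (par \<omega>) = pv_trace \<kappa> u \<omega>"
proof -
  define K where "K y = NP_kernel lam mu (ellipse_normal a b) (par \<omega>) y" for y
  define Bf where "Bf i t = of_real (smooth_kernel \<kappa> i 1 (\<omega> + t)) * u t $ 1 + of_real (smooth_kernel \<kappa> i 2 (\<omega> + t)) * u t $ 2" for i t
  define Af where "Af e i t = of_real (cut e \<omega> t * cot ((\<omega> - t)/2)) * ju i u t" for e i t
  define W where "W e t = (\<chi> i. of_real (\<kappa> / (4*pi)) * Af e i t + of_real (cut e \<omega> t) * Bf i t)" for e t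
  define I where "I e = (\<integral>y\<in>{y. e < dist (par \<omega>) y}. (cmat (K y) *v \<phi> y) \<partial>sig)" for e
  have [measurable]: "(\<lambda>t. u t $ i) \<in> borel_measurable borel" "ju i u \<in> borel_measurable borel" for i
    by (rule chordlip_measurable[OF chordlip_component[OF u]], rule chordlip_measurable[OF chordlip_ju[OF u]])
  have [measurable]: "smooth_kernel \<kappa> i j \<in> borel_measurable borel" for i j
    by (rule borel_measurable_continuous_onI[OF smooth_kernel_continuous])
  have Am[measurable]: "Af e i \<in> borel_measurable borel" for e i unfolding Af_def by measurable
  have Bm[measurable]: "Bf i \<in> borel_measurable borel" for i unfolding Bf_def by measurable
  have Wm[measurable]: "W e \<in> borel_measurable borel" for e
    unfolding W_def by (rule vec2_measurable) measurable
  have Bper: "periodic (Bf i)" for i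
  proof -
    have "smooth_kernel \<kappa> i j (\<omega> + (t + 2*pi)) = smooth_kernel \<kappa> i j (\<omega> + t)" for j t
      using periodicD[OF smooth_kernel_periodic, of \<kappa> i j "\<omega> + t"] by (simp add: add_ac)
    then show ?thesis using periodicD[OF chordlip_periodic[OF u]] by (simp add: periodic_def Bf_def)
  qed
  have "continuous_on UNIV (Bf i)" for i
    unfolding Bf_def
    by (intro continuous_intros continuous_on_compose2[OF smooth_kernel_continuous[of UNIV]] chordlip_continuous[OF chordlip_component[OF u]]) auto
  then have "\<exists>B. \<forall>t. cmod (Bf i t) \<le> B" for i
    using periodic_continuous_bounded[OF _ Bper, of i] by blast
  then obtain B where B: "\<And>i t. cmod (Bf i t) \<le> B i" by metis
  have Ab: "cmod (Af e i t) \<le> 2 * a / e * (cmod (ju i u 0) + L)" if "0 < e" for e i t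
    unfolding Af_def norm_mult norm_of_real using cut_cot_bound[OF that, of \<omega> t] chordlip_bound[OF chordlip_ju[OF u], of i t]
    by (intro mult_mono) auto
  have Ai: "integrable circ (Af e i)" if "0 < e" for e i
    by (rule integrable_circ_bounded[OF Am Ab[OF that]])
  have cB: "cmod (of_real (cut e \<omega> t) * Bf i t) \<le> B i" for e i t
    unfolding norm_mult using mult_mono[OF cut_abs[of e \<omega> t] B[of i t]] by simp
  have Bi: "integrable circ (\<lambda>t. of_real (cut e \<omega> t) * Bf i t)" for e i
    by (rule integrable_circ_bounded[where B="B i"]) (use cB in auto)
  have Wi: "integrable circ (W e)" if "0 < e" for e
  proof (rule integrable_circ_bounded[OF Wm])
    fix t
    have "cmod (W e t $ i) \<le> cmod (of_real (\<kappa> / (4*pi))) * (2 * a / e * (cmod (ju i u 0) + L)) + B i" for i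
      unfolding W_def vec_lambda_beta
      using norm_triangle_ineq[of "of_real (\<kappa> / (4*pi)) * Af e i t" "of_real (cut e \<omega> t) * Bf i t"]
        mult_left_mono[OF Ab[OF that, of i t], of "cmod (of_real (\<kappa> / (4*pi)))"] cB[of e t i] norm_mult
      by (smt (verit) norm_ge_zero)
    from add_mono[OF this[of 1] this[of 2]]
    show "norm (W e t) \<le> cmod (of_real (\<kappa> / (4*pi))) * (2 * a / e * (cmod (ju 1 u 0) + L)) + B 1
       + (cmod (of_real (\<kappa> / (4*pi))) * (2 * a / e * (cmod (ju 2 u 0) + L)) + B 2)"
      by (rule order_trans[OF norm_vec2_le])
  qed
  \<comment> \<open>Outside the cut-off both sides are 0. Inside it the half-angle sine is nonzero,
    which is what \<open>kernel_par\<close> requires.\<close>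
  have key: "speed \<omega> *\<^sub>R (speed t *\<^sub>R (indicator {y. e < dist (par \<omega>) y} (par t) *\<^sub>R (cmat (K (par t)) *v \<phi> (par t)))) = W e t" if "0 < e" for e t
  proof (cases "e < dist (par \<omega>) (par t)")
    case True
    have sn: "sin ((\<omega> - t)/2) \<noteq> 0"
    proof
      assume "sin ((\<omega> - t)/2) = 0"
      then show False using True dist_par_bounds(2)[of \<omega> t] that by simp
    qed
    have un: "u t $ j = of_real (speed t) * \<phi> (par t) $ j" for j by (metis eq vector_scaleR_component scaleR_conv_of_real)
    have Kn: "of_real (speed \<omega>) * of_real (K (par t) $ i $ j) = (of_real (\<kappa> / (4*pi) * cot ((\<omega> - t)/2) * rot90 i j + smooth_kernel \<kappa> i j (\<omega> + t)) :: complex)" for i j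
      unfolding of_real_mult[symmetric] K_def kernel_par[OF mu lm sn] \<kappa>_def ..
    have "(speed \<omega> *\<^sub>R (speed t *\<^sub>R (cmat (K (par t)) *v \<phi> (par t)))) $ i
        = (of_real (speed \<omega>) * of_real (K (par t) $ i $ 1)) * u t $ 1 + (of_real (speed \<omega>) * of_real (K (par t) $ i $ 2)) * u t $ 2" for i
      unfolding vector_scaleR_component un scaleR_conv_of_real[where 'a=complex]
      by (simp add: matrix_vector_mult_def sum_2 cmat_def algebra_simps)
    also have "\<dots> i = W e t $ i" for i
      unfolding Kn W_def vec_lambda_beta Af_def Bf_def ju_def using True by (simp add: cut_def algebra_simps)
    finally show ?thesis using True by (simp add: vec_eq_iff)
  next
    case False
    then show ?thesis by (simp add: W_def Af_def cut_def vec_eq_iff)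
  qed
  have Ieq: "I e = (1 / speed \<omega>) *\<^sub>R (\<integral>t. W e t \<partial>circ)" if e: "0 < e" for e
  proof -
    have k2: "speed t *\<^sub>R (indicator {y. e < dist (par \<omega>) y} (par t) *\<^sub>R (cmat (K (par t)) *v \<phi> (par t))) = (1 / speed \<omega>) *\<^sub>R W e t" for t
      using speed_pos[of \<omega>] unfolding key[OF e, of t, symmetric] by simp
    have "(\<lambda>y. indicator {y. e < dist (par \<omega>) y} y *\<^sub>R (cmat (K y) *v \<phi> y)) \<in> borel_measurable sig"
    proof (rule sig_measurable_par[where u="\<lambda>t. (1 / speed t) *\<^sub>R ((1 / speed \<omega>) *\<^sub>R W e t)"])
      show "indicator {y. e < dist (par \<omega>) y} (par t) *\<^sub>R (cmat (K (par t)) *v \<phi> (par t)) = (1 / speed t) *\<^sub>R ((1 / speed \<omega>) *\<^sub>R W e t)" for t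
        unfolding k2[symmetric] using speed_pos[of t] by simp
    qed measurable
    then show ?thesis unfolding I_def set_lebesgue_integral_def
      by (subst integral_sig) (simp_all only: k2 integral_scaleR_right)
  qed
  have Wint: "(\<integral>t. W e t \<partial>circ) $ i = of_real (\<kappa> / (4*pi)) * (\<integral>t. Af e i t \<partial>circ) + (\<integral>t. of_real (cut e \<omega> t) * Bf i t \<partial>circ)" if e: "0 < e" for e i
  proof -
    have "(\<integral>t. W e t \<partial>circ) $ i = (\<integral>t. W e t $ i \<partial>circ)"
      by (rule integral_bounded_linear[OF bounded_linear_vec_nth Wi[OF e], symmetric])
    also have "\<dots> = (\<integral>t. of_real (\<kappa> / (4*pi)) * Af e i t + of_real (cut e \<omega> t) * Bf i t \<partial>circ)" by (simp add: W_def)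
    also have "\<dots> = of_real (\<kappa> / (4*pi)) * (\<integral>t. Af e i t \<partial>circ) + (\<integral>t. of_real (cut e \<omega> t) * Bf i t \<partial>circ)"
      by (subst Bochner_Integration.integral_add[OF integrable_mult_right[OF Ai[OF e]] Bi]) (simp only: integral_mult_right_zero)
    finally show ?thesis .
  qed
  have gB: "(\<integral>t. Bf i t \<partial>circ) = gint \<kappa> i u \<omega>" for i
    unfolding Bf_def gint_def
    by (intro Bochner_Integration.integral_add convolution_coefficient(3)[OF smooth_kernel_continuous smooth_kernel_periodic chordlip_component[OF u]])
  \<comment> \<open>The one-sided limit is tested along positive null sequences, so that dominated
    convergence is applicable.\<close>
  have lim: "(I \<longlongrightarrow> (1 / speed \<omega>) *\<^sub>R pv_trace \<kappa> u \<omega>) (at_right 0)"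
    unfolding tendsto_at_iff_sequentially
  proof (intro allI impI)
    fix X :: "nat \<Rightarrow> real" assume "\<forall>i. X i \<in> {0<..} - {0}" and X: "X \<longlonglongrightarrow> 0"
    then have Xp: "0 < X n" for n by auto
    have "(\<lambda>n. (\<integral>t. W (X n) t \<partial>circ)) \<longlonglongrightarrow> pv_trace \<kappa> u \<omega>"
    proof (rule vec_tendstoI)
      fix i
      have "(\<lambda>n. of_real (\<kappa> / (4*pi)) * (\<integral>t. Af (X n) i t \<partial>circ) + (\<integral>t. of_real (cut (X n) \<omega> t) * Bf i t \<partial>circ))
        \<longlonglongrightarrow> of_real (\<kappa> / (4*pi)) * hilbert (ju i u) \<omega> + (\<integral>t. Bf i t \<partial>circ)"
        unfolding Af_def
        by (intro tendsto_add tendsto_mult_left pv_cot_tendsto[OF chordlip_ju[OF u] X Xp] pv_bounded_tendsto[OF Bm Bper B X Xp])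
      then show "(\<lambda>n. (\<integral>t. W (X n) t \<partial>circ) $ i) \<longlonglongrightarrow> pv_trace \<kappa> u \<omega> $ i"
        unfolding Wint[OF Xp] gB by (simp add: pv_trace_def)
    qed
    then have "(\<lambda>n. (1 / speed \<omega>) *\<^sub>R (\<integral>t. W (X n) t \<partial>circ)) \<longlonglongrightarrow> (1 / speed \<omega>) *\<^sub>R pv_trace \<kappa> u \<omega>"
      by (intro tendsto_intros)
    then show "(I \<circ> X) \<longlonglongrightarrow> (1 / speed \<omega>) *\<^sub>R pv_trace \<kappa> u \<omega>" by (simp add: o_def Ieq[OF Xp])
  qed
  have "NP_pv lam mu sig (ellipse_normal a b) \<phi> (par \<omega>) = (1 / speed \<omega>) *\<^sub>R pv_trace \<kappa> u \<omega>"
    unfolding NP_pv_def using tendsto_Lim[OF _ lim] by (simp add: I_def[abs_def] K_def)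
  then show ?thesis using speed_pos[of \<omega>] by simp
qed

definition smooth_coeff :: "real \<Rightarrow> 2 \<Rightarrow> 2 \<Rightarrow> int \<Rightarrow> complex" where
  "smooth_coeff \<kappa> i j n = (\<integral>t. of_real (smooth_kernel \<kappa> i j t) * cis (of_int n * t) \<partial>circ)"

text \<open>The factor \<kappa>/2 is \<kappa>/(4 pi) times the modulus 2 pi of the Hilbert
  multiplier. The smooth part reads the sequence at -n because its kernel depends on \<omega> +
  \<theta>.\<close>

definition NP_symbol :: "real \<Rightarrow> (int \<Rightarrow> 2 \<Rightarrow> complex) \<Rightarrow> int \<Rightarrow> 2 \<Rightarrow> complex" where
  "NP_symbol \<kappa> x n i = \<i> * of_real (\<kappa>/2) * of_int (sgn n) * (of_real (rot90 i 1) * x n 1 + of_real (rot90 i 2) * x n 2)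
     + (smooth_coeff \<kappa> i 1 n * x (-n) 1 + smooth_coeff \<kappa> i 2 n * x (-n) 2)"

lemma
  assumes u: "chordlip u L"
  shows pv_trace_measurable: "pv_trace \<kappa> u \<in> borel_measurable borel"
    and pv_trace_periodic: "periodic (pv_trace \<kappa> u)"
    and pv_trace_bounded: "\<exists>B. \<forall>t. norm (pv_trace \<kappa> u t) \<le> B"
    and pv_trace_coefficient: "(\<integral>t. pv_trace \<kappa> u t $ i * cis (of_int n * t) \<partial>circ) = NP_symbol \<kappa> (\<lambda>n i. \<integral>t. u t $ i * cis (of_int n * t) \<partial>circ) n i"
proof -
  note cc = convolution_coefficient[OF smooth_kernel_continuous smooth_kernel_periodic chordlip_component[OF u]]
  note cj = chordlip_ju[OF u]
  have gm[measurable]: "gint \<kappa> i u \<in> borel_measurable borel" for i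
    unfolding gint_def[abs_def] by (intro borel_measurable_add cc)
  have [measurable]: "hilbert (ju i u) \<in> borel_measurable borel" for i by (rule hilbert_measurable[OF cj])
  show "pv_trace \<kappa> u \<in> borel_measurable borel" unfolding pv_trace_def[abs_def] by (rule vec2_measurable) measurable
  have gp: "gint \<kappa> i u (t + 2*pi) = gint \<kappa> i u t" for i t
    unfolding gint_def using periodicD[OF cc(5)[of \<kappa> i 1 1]] periodicD[OF cc(5)[of \<kappa> i 2 2]] by simp
  show "periodic (pv_trace \<kappa> u)"
    using periodicD[OF hilbert_periodic[OF cj]] gp by (simp add: periodic_def pv_trace_def)
  obtain B where B: "\<And>i t. cmod (gint \<kappa> i u t) \<le> B i"
  proof -
    have "\<exists>B. \<forall>t. cmod (gint \<kappa> i u t) \<le> B" for i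
    proof -
      obtain B1 B2 where "\<forall>\<omega>. cmod (\<integral>t. of_real (smooth_kernel \<kappa> i 1 (\<omega> + t)) * u t $ 1 \<partial>circ) \<le> B1" "\<forall>\<omega>. cmod (\<integral>t. of_real (smooth_kernel \<kappa> i 2 (\<omega> + t)) * u t $ 2 \<partial>circ) \<le> B2"
        using cc(2)[of \<kappa> i 1 1] cc(2)[of \<kappa> i 2 2] by blast
      then show ?thesis unfolding gint_def by (intro exI[of _ "B1 + B2"] allI order_trans[OF norm_triangle_ineq] add_mono) auto
    qed
    then show ?thesis using that by metis
  qed
  have Vb: "cmod (pv_trace \<kappa> u t $ i) \<le> cmod (of_real (\<kappa> / (4*pi))) * (2*pi*L) + B i" for t i
    unfolding pv_trace_def vec_lambda_beta
    using mult_left_mono[OF hilbert_bound[OF cj, of i t], of "cmod (of_real (\<kappa> / (4*pi)))"] B[of i t]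
    by (intro order_trans[OF norm_triangle_ineq] add_mono) (simp_all only: norm_mult norm_ge_zero simp_thms)
  show "\<exists>B. \<forall>t. norm (pv_trace \<kappa> u t) \<le> B"
    using add_mono[OF Vb[of _ 1] Vb[of _ 2]] order_trans[OF norm_vec2_le] by blast
  define x where "x = (\<lambda>n i. \<integral>t. u t $ i * cis (of_int n * t) \<partial>circ)"
  have Hi: "integrable circ (\<lambda>t. hilbert (ju i u) t * cis (of_int n * t))"
    by (rule integrable_circ_bounded[where B="2*pi*L"]) (use hilbert_bound[OF cj] in \<open>auto simp: norm_mult\<close>)
  have gi: "integrable circ (\<lambda>\<omega>. (\<integral>t. of_real (smooth_kernel \<kappa> i j (\<omega> + t)) * u t $ j \<partial>circ) * cis (of_int n * \<omega>))" for j
  proof -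
    obtain B where "\<forall>\<omega>. cmod (\<integral>t. of_real (smooth_kernel \<kappa> i j (\<omega> + t)) * u t $ j \<partial>circ) \<le> B" using cc(2)[of \<kappa> i j j] by blast
    then show ?thesis
      using cc(4)[of \<kappa> i j j] by (intro integrable_circ_bounded[where B=B]) (auto simp: norm_mult)
  qed
  have ui: "integrable circ (\<lambda>t. u t $ j * cis (of_int n * t))" for j
    using integrable_fourier[OF chordlip_L2[OF chordlip_component[OF u, of j]], of "-n"] by simp
  have "(\<integral>t. ju i u t * cis (of_int n * t) \<partial>circ) = (\<integral>t. of_real (rot90 i 1) * (u t $ 1 * cis (of_int n * t)) + of_real (rot90 i 2) * (u t $ 2 * cis (of_int n * t)) \<partial>circ)"
    by (simp add: ju_def distrib_right mult.assoc)
  also have "\<dots> = of_real (rot90 i 1) * x n 1 + of_real (rot90 i 2) * x n 2"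
    unfolding x_def by (subst Bochner_Integration.integral_add) (auto intro!: integrable_mult_right ui)
  finally have j: "(\<integral>t. ju i u t * cis (of_int n * t) \<partial>circ) = of_real (rot90 i 1) * x n 1 + of_real (rot90 i 2) * x n 2" .
  have "(\<integral>t. pv_trace \<kappa> u t $ i * cis (of_int n * t) \<partial>circ) = (\<integral>\<omega>. of_real (\<kappa> / (4*pi)) * (hilbert (ju i u) \<omega> * cis (of_int n * \<omega>))
     + ((\<integral>t. of_real (smooth_kernel \<kappa> i 1 (\<omega> + t)) * u t $ 1 \<partial>circ) * cis (of_int n * \<omega>) + (\<integral>t. of_real (smooth_kernel \<kappa> i 2 (\<omega> + t)) * u t $ 2 \<partial>circ) * cis (of_int n * \<omega>)) \<partial>circ)"
    by (simp add: pv_trace_def gint_def distrib_right mult.assoc)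
  also have "\<dots> = of_real (\<kappa> / (4*pi)) * (\<integral>\<omega>. hilbert (ju i u) \<omega> * cis (of_int n * \<omega>) \<partial>circ)
     + ((\<integral>\<omega>. (\<integral>t. of_real (smooth_kernel \<kappa> i 1 (\<omega> + t)) * u t $ 1 \<partial>circ) * cis (of_int n * \<omega>) \<partial>circ) + (\<integral>\<omega>. (\<integral>t. of_real (smooth_kernel \<kappa> i 2 (\<omega> + t)) * u t $ 2 \<partial>circ) * cis (of_int n * \<omega>) \<partial>circ))"
    by (simp only: Bochner_Integration.integral_add Bochner_Integration.integrable_add integrable_mult_right Hi gi integral_mult_right_zero)
  also have "\<dots> = of_real (\<kappa> / (4*pi)) * (2*pi * \<i> * of_int (sgn n) * (of_real (rot90 i 1) * x n 1 + of_real (rot90 i 2) * x n 2))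
     + (smooth_coeff \<kappa> i 1 n * x (-n) 1 + smooth_coeff \<kappa> i 2 n * x (-n) 2)"
    unfolding hilbert_coefficient[OF cj] j cc(1) smooth_coeff_def x_def ..
  also have "\<dots> = NP_symbol \<kappa> x n i" unfolding NP_symbol_def by (simp add: field_simps)
  finally show "(\<integral>t. pv_trace \<kappa> u t $ i * cis (of_int n * t) \<partial>circ) = NP_symbol \<kappa> x n i" .
qed

text \<open>The coefficients of the smooth part are integrals of bounded functions over a set of
  finite measure, hence bounded uniformly in n; one constant serves for all four entries and the
  Hilbert part.\<close>

lemma NP_symbol_mult_seq: "\<exists>K. mult_seq (NP_symbol \<kappa>) K"
proof -
  have "\<exists>B. \<forall>n. cmod (smooth_coeff \<kappa> i j n) \<le> B" for i j
  proof -
    obtain B where B: "\<And>t. norm (smooth_kernel \<kappa> i j t) \<le> B" using periodic_continuous_bounded[OF smooth_kernel_continuous smooth_kernel_periodic] by blast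
    have [measurable]: "smooth_kernel \<kappa> i j \<in> borel_measurable borel" by (rule borel_measurable_continuous_onI[OF smooth_kernel_continuous])
    show ?thesis unfolding smooth_coeff_def
      by (intro exI[of _ "2*pi*B"] allI norm_integral_circ_le) (use B in \<open>auto simp: norm_mult\<close>)
  qed
  then obtain B where B: "\<And>i j n. cmod (smooth_coeff \<kappa> i j n) \<le> B i j" by metis
  define C where "C = \<bar>\<kappa>\<bar> + (\<bar>B 1 1\<bar> + \<bar>B 1 2\<bar> + \<bar>B 2 1\<bar> + \<bar>B 2 2\<bar>)"
  have C: "0 \<le> C" by (simp add: C_def)
  have gC: "cmod (smooth_coeff \<kappa> i j n) \<le> C" for i j n
    using B[where i=i and j=j and n=n] exhaust_2[of i] exhaust_2[of j] by (auto simp: C_def)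
  have one: "cmod (NP_symbol \<kappa> x n i) \<le> C * ((cmod (x n 1) + cmod (x n 2)) + (cmod (x (-n) 1) + cmod (x (-n) 2)))" for x n i
  proof -
    have p1: "cmod (\<i> * of_real (\<kappa>/2) * of_int (sgn n) * (of_real (rot90 i 1) * x n 1 + of_real (rot90 i 2) * x n 2)) \<le> C * (cmod (x n 1) + cmod (x n 2))"
      unfolding norm_mult
    proof (rule mult_mono)
      have "cmod (of_int (sgn n)) \<le> 1" by (simp add: sgn_if)
      then have "cmod (of_real (\<kappa>/2)) * cmod (of_int (sgn n)) \<le> \<bar>\<kappa>\<bar> * 1" by (intro mult_mono) auto
      moreover have "\<bar>\<kappa>\<bar> \<le> C" by (simp add: C_def)
      ultimately have "cmod (of_real (\<kappa>/2)) * cmod (of_int (sgn n)) \<le> C" by linarith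
      then show "cmod \<i> * cmod (of_real (\<kappa>/2)) * cmod (of_int (sgn n)) \<le> C" by simp
      show "cmod (of_real (rot90 i 1) * x n 1 + of_real (rot90 i 2) * x n 2) \<le> cmod (x n 1) + cmod (x n 2)"
        using exhaust_2[of i] by (auto simp: rot90_def)
    qed (use C in auto)
    have p2: "cmod (smooth_coeff \<kappa> i 1 n * x (-n) 1 + smooth_coeff \<kappa> i 2 n * x (-n) 2) \<le> C * (cmod (x (-n) 1) + cmod (x (-n) 2))"
      using mult_right_mono[OF gC[of i 1 n], of "cmod (x (-n) 1)"] mult_right_mono[OF gC[of i 2 n], of "cmod (x (-n) 2)"]
      by (intro order_trans[OF norm_triangle_ineq]) (simp add: norm_mult distrib_left)
    show ?thesis unfolding NP_symbol_def distrib_left[of C "cmod (x n 1) + cmod (x n 2)"]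
      by (rule order_trans[OF norm_triangle_ineq add_mono[OF p1 p2]])
  qed
  have sq: "(p + q + (r + s))\<^sup>2 \<le> 4 * (p\<^sup>2 + q\<^sup>2 + (r\<^sup>2 + s\<^sup>2))" for p q r s :: real
    using sum_squares_bound[of p q] sum_squares_bound[of r s] sum_squares_bound[of p r] sum_squares_bound[of p s]
      sum_squares_bound[of q r] sum_squares_bound[of q s]
    by (simp add: power2_eq_square algebra_simps)
  have "nsq (NP_symbol \<kappa> x) n \<le> (8 * C\<^sup>2) * (nsq x n + nsq x (-n))" for x n
  proof -
    have "(cmod (NP_symbol \<kappa> x n i))\<^sup>2 \<le> C\<^sup>2 * (4 * (nsq x n + nsq x (-n)))" for i
    proof -
      have "(cmod (NP_symbol \<kappa> x n i))\<^sup>2 \<le> (C * ((cmod (x n 1) + cmod (x n 2)) + (cmod (x (-n) 1) + cmod (x (-n) 2))))\<^sup>2"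
        by (intro power_mono one) simp
      also have "\<dots> \<le> C\<^sup>2 * (4 * (nsq x n + nsq x (-n)))"
        unfolding power_mult_distrib nsq_def by (intro mult_left_mono sq) simp
      finally show ?thesis .
    qed
    from add_mono[OF this[of 1] this[of 2]] show ?thesis by (simp add: nsq_def[of "NP_symbol \<kappa> x"] algebra_simps)
  qed
  moreover have "NP_symbol \<kappa> (\<lambda>n i. x n i + y n i) = (\<lambda>n i. NP_symbol \<kappa> x n i + NP_symbol \<kappa> y n i)" for x y
    by (auto simp: NP_symbol_def fun_eq_iff algebra_simps)
  moreover have "NP_symbol \<kappa> (\<lambda>n i. c * x n i) = (\<lambda>n i. c * NP_symbol \<kappa> x n i)" for c x
    by (auto simp: NP_symbol_def fun_eq_iff algebra_simps)
  ultimately have "mult_seq (NP_symbol \<kappa>) (8 * C\<^sup>2)" unfolding mult_seq_def by (simp only:) simp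
  then show ?thesis by blast
qed

text \<open>Supplies the dense class for uniqueness: a functional with finitely many frequencies
  comes from a trigonometric polynomial divided by the speed, and this quotient is Lipschitz on the
  curve.\<close>

lemma finite_support_density:
  assumes F: "F \<in> Hm" and supp: "\<And>n i. n \<notin> {-int N..int N} \<Longrightarrow> hat F n i = 0"
  obtains \<phi> L where "L-lipschitz_on (frontier (ellipse a b)) \<phi>" "F = density_functional sig \<phi>"
proof -
  define J where "J = {-int N..int N}"
  \<comment> \<open>Frequencies are reversed and divided by 2 pi because \<open>hat\<close> tests
    against \<open>cis (of_int n * t)\<close>.\<close>
  define u where "u t = (\<chi> i. trig J (\<lambda>n. hat F (-n) i / (2*pi)) t)" for t
  have "\<exists>L. chordlip (trig J (\<lambda>n. hat F (-n) i / (2*pi))) L" for i by (rule chordlip_trig) (simp add: J_def)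
  then obtain L where "\<And>i. chordlip (trig J (\<lambda>n. hat F (-n) i / (2*pi))) (L i)" by metis
  from chordlip_vec[of "\<lambda>i. trig J (\<lambda>n. hat F (-n) i / (2*pi))", OF this]
  have u: "chordlip u (L 1 + L 2)" unfolding u_def .
  define g where "g t = (1 / speed t) *\<^sub>R u t" for t
  obtain M where g: "chordlip g M" using chordlip_scaleR[OF chordlip_inverse_speed u] unfolding g_def by blast
  define \<phi> where "\<phi> x = g (ang x)" for x
  have \<phi>: "\<phi> (par t) = g t" for t unfolding \<phi>_def by (rule ang_periodic[OF chordlip_periodic[OF g]])
  have uV: "u t = speed t *\<^sub>R \<phi> (par t)" for t using speed_pos[of t] by (simp add: \<phi> g_def)
  note D = density_functional_Hm[OF chordlip_measurable[OF u] chordlip_periodic[OF u] chordlip_bound[OF u] uV]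
  have "F = density_functional sig \<phi>"
  proof (rule Hm_eqI[OF F D(1)])
    fix n i
    have fin: "finite J" by (simp add: J_def)
    have "(\<integral>t. u t $ i * cis (of_int n * t) \<partial>circ) = 2*pi * fourier (trig J (\<lambda>n. hat F (-n) i / (2*pi))) (-n)"
      by (simp add: fourier_def u_def)
    also have "\<dots> = hat F n i" using supp[of n i] by (simp add: fourier_trig[OF fin]) (auto simp: J_def)
    finally show "hat F n i = hat (density_functional sig \<phi>) n i" using D(2) by simp
  qed
  then show ?thesis using that chordlip_lipschitz[OF g \<phi>] by blast
qed

text \<open>On Lipschitz densities the principal value and the multiplier have the same
  coefficients. Any other admissible operator agrees with the multiplier on finitely many
  frequencies, hence everywhere by \<open>bounded_operator_eqI\<close>.\<close>

theorem NP_operator_eq: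
  assumes mu: "0 < mu" and lm: "0 < 2 * mu + lam"
  shows "NP_operator lam mu sig (ellipse_normal a b) = mult_op (NP_symbol (mu / (2 * mu + lam)))"
proof -
  define \<kappa> where "\<kappa> = mu / (2 * mu + lam)"
  obtain K where K: "mult_seq (NP_symbol \<kappa>) K" using NP_symbol_mult_seq by blast
  note bT = bounded_mult_op[OF K]
  have dens: "mult_op (NP_symbol \<kappa>) (density_functional sig \<phi>) = density_functional sig (NP_pv lam mu sig (ellipse_normal a b) \<phi>)"
    if lip: "L-lipschitz_on (space sig) \<phi>" for \<phi> L
  proof -
    define u where "u t = speed t *\<^sub>R \<phi> (par t)" for t
    obtain M where u: "chordlip u M"
      using chordlip_scaleR[OF chordlip_speed lipschitz_chordlip[OF lip[unfolded space_sig]]] unfolding u_def by blast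
    note D = density_functional_Hm[OF chordlip_measurable[OF u] chordlip_periodic[OF u] chordlip_bound[OF u] u_def]
    obtain B where B: "\<And>t. norm (pv_trace \<kappa> u t) \<le> B" using pv_trace_bounded[OF u] by blast
    note E = density_functional_Hm[OF pv_trace_measurable[OF u] pv_trace_periodic[OF u] B NP_pv_par[OF mu lm u u_def, folded \<kappa>_def, symmetric]]
    have h: "hat (density_functional sig \<phi>) = (\<lambda>n i. \<integral>t. u t $ i * cis (of_int n * t) \<partial>circ)"
      by (intro ext D(2))
    show ?thesis
    proof (rule Hm_eqI[OF mult_op_Hm[OF K D(1)] E(1)])
      show "hat (mult_op (NP_symbol \<kappa>) (density_functional sig \<phi>)) n i = hat (density_functional sig (NP_pv lam mu sig (ellipse_normal a b) \<phi>)) n i" for n i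
        unfolding hat_mult_op[OF D(1)] h E(2) pv_trace_coefficient[OF u] ..
    qed
  qed
  show ?thesis
    unfolding NP_operator_def \<kappa>_def[symmetric]
  proof (rule the_equality)
    show "bounded_operator_on sig (mult_op (NP_symbol \<kappa>)) \<and>
     (\<forall>\<phi>. (\<exists>L. L-lipschitz_on (space sig) \<phi>) \<longrightarrow> mult_op (NP_symbol \<kappa>) (density_functional sig \<phi>) = density_functional sig (NP_pv lam mu sig (ellipse_normal a b) \<phi>)) \<and>
     (\<forall>F. F \<notin> Hm \<longrightarrow> mult_op (NP_symbol \<kappa>) F = 0)"
    proof (intro conjI allI impI)
      show "mult_op (NP_symbol \<kappa>) F = 0" if "F \<notin> Hm" for F using that by (simp add: mult_op_def)
    qed (use bT dens in blast)+
  next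
    fix T
    assume T: "bounded_operator_on sig T \<and>
     (\<forall>\<phi>. (\<exists>L. L-lipschitz_on (space sig) \<phi>) \<longrightarrow> T (density_functional sig \<phi>) = density_functional sig (NP_pv lam mu sig (ellipse_normal a b) \<phi>)) \<and>
     (\<forall>F. F \<notin> Hm \<longrightarrow> T F = 0)"
    show "T = mult_op (NP_symbol \<kappa>)"
    proof
      fix F
      show "T F = mult_op (NP_symbol \<kappa>) F"
      proof (cases "F \<in> Hm")
        case True
        show ?thesis
        proof (rule bounded_operator_eqI[OF _ bT _ True])
          show "bounded_operator_on sig T" using T by blast
          fix G N assume "G \<in> Hm" "\<And>n i. n \<notin> {-int N..int N} \<Longrightarrow> hat G n i = 0"
          then obtain \<phi> L where \<phi>: "L-lipschitz_on (frontier (ellipse a b)) \<phi>" "G = density_functional sig \<phi>"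
            by (rule finite_support_density)
          then have l: "L-lipschitz_on (space sig) \<phi>" by (simp add: space_sig)
          show "T G = mult_op (NP_symbol \<kappa>) G" unfolding \<phi>(2) dens[OF l] using T l by blast
        qed
      next
        case False
        then show ?thesis using T by (simp add: mult_op_def)
      qed
    qed
  qed
qed

end

section \<open>The symbol\<close>

context ell
begin

section \<open>Poisson kernels of the ellipse and their Fourier coefficients\<close>

definition rr :: real where "rr = (a - b) / (a + b)"
definition SS :: real where "SS = 2 * a * b / (a\<^sup>2 - b\<^sup>2)"

lemma rr_bounds: "0 < rr" "rr < 1"
  using b_pos b_less by (simp_all add: rr_def field_simps)

text \<open>Up to a constant \<open>el\<close> is |1 - rr e^(it)|^2, the denominator of the Poisson
  kernel. In elliptic coordinates \<open>rr\<close> is e^(-2 \<rho>0) and \<open>SS\<close> is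
  sinh(2 \<rho>0).\<close>

lemma el_rr: "el t = (a + b)\<^sup>2 / 4 * (1 + rr\<^sup>2 - 2 * rr * cos t)"
  and ab_rr: "a * b = (a + b)\<^sup>2 / 4 * (1 - rr\<^sup>2)"
  and a2b2_rr: "a\<^sup>2 - b\<^sup>2 = (a + b)\<^sup>2 * rr"
proof -
  define m where "m = a + b"
  define r where "r = rr"
  have m: "m \<noteq> 0" using a_pos b_pos by (simp add: m_def)
  have "a - b = m * r" using m by (simp add: r_def rr_def m_def)
  then have ab: "a = m * (1 + r) / 2" "b = m * (1 - r) / 2"
    by (simp_all add: m_def field_simps)
  show "el t = (a + b)\<^sup>2 / 4 * (1 + rr\<^sup>2 - 2 * rr * cos t)"
    unfolding el_def r_def[symmetric] unfolding ab by (simp add: power2_eq_square field_simps)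
  show "a * b = (a + b)\<^sup>2 / 4 * (1 - rr\<^sup>2)"
    unfolding r_def[symmetric] unfolding ab by (simp add: power2_eq_square field_simps)
  show "a\<^sup>2 - b\<^sup>2 = (a + b)\<^sup>2 * rr"
    unfolding r_def[symmetric] unfolding ab by (simp add: power2_eq_square field_simps)
qed

lemma kP_rr: "kP t = (1 - rr\<^sup>2) / (1 + rr\<^sup>2 - 2 * rr * cos t)"
  and kQ_rr: "kQ t = 2 * rr * sin t / (1 + rr\<^sup>2 - 2 * rr * cos t)"
  and poisson_pos: "0 < 1 + rr\<^sup>2 - 2 * rr * cos t"
proof -
  have m: "0 < (a + b)\<^sup>2 / 4" using a_pos b_pos by simp
  show p: "0 < 1 + rr\<^sup>2 - 2 * rr * cos t"
    using el_pos[of t] m unfolding el_rr by (simp add: zero_less_mult_iff)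
  show "kP t = (1 - rr\<^sup>2) / (1 + rr\<^sup>2 - 2 * rr * cos t)"
    unfolding kP_def el_rr ab_rr using m by simp
  show "kQ t = 2 * rr * sin t / (1 + rr\<^sup>2 - 2 * rr * cos t)"
  proof -
    define D where "D = 1 + rr\<^sup>2 - 2 * rr * cos t"
    define M where "M = (a + b)\<^sup>2"
    have "0 < D" "0 < M" using p m by (simp_all add: D_def M_def)
    then show ?thesis unfolding kQ_def el_rr a2b2_rr D_def[symmetric] M_def[symmetric] by (simp add: field_simps)
  qed
qed

text \<open>The Herglotz kernel (1 + rr z) / (1 - rr z) at z = e^(it), with the two Poisson kernels
  as real and imaginary parts.\<close>

definition Wf :: "real \<Rightarrow> complex" where "Wf t = Complex (kP t) (kQ t)"

lemma Wf_eq: "Wf t * (1 - rr * cis t) = 1 + rr * cis t"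
proof -
  define D where "D = 1 + rr\<^sup>2 - 2 * rr * cos t"
  have D: "D \<noteq> 0" using poisson_pos[of t] by (simp add: D_def)
  have s: "sin t * sin t = 1 - cos t * cos t" using sin_squared_eq[of t] by (simp add: power2_eq_square)
  have "kP t * (1 - rr * cos t) + kQ t * (rr * sin t) = ((1 - rr\<^sup>2) * (1 - rr * cos t) + 2 * rr * rr * (sin t * sin t)) / D"
    unfolding kP_rr kQ_rr D_def[symmetric] by (simp add: add_divide_distrib mult_ac)
  also have "(1 - rr\<^sup>2) * (1 - rr * cos t) + 2 * rr * rr * (sin t * sin t) = (1 + rr * cos t) * D"
    unfolding s D_def by (simp add: power2_eq_square algebra_simps)
  finally have 1: "kP t * (1 - rr * cos t) + kQ t * (rr * sin t) = 1 + rr * cos t" using D by simp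
  have "kQ t * (1 - rr * cos t) - kP t * (rr * sin t) = (2 * rr * sin t * (1 - rr * cos t) - (1 - rr\<^sup>2) * (rr * sin t)) / D"
    unfolding kP_rr kQ_rr D_def[symmetric] by (simp only: times_divide_eq_left diff_divide_distrib[symmetric])
  also have "2 * rr * sin t * (1 - rr * cos t) - (1 - rr\<^sup>2) * (rr * sin t) = (rr * sin t) * D"
    unfolding D_def by (simp add: power2_eq_square algebra_simps)
  finally have 2: "kQ t * (1 - rr * cos t) - kP t * (rr * sin t) = rr * sin t" using D by simp
  show ?thesis using 1 2 by (simp add: complex_eq_iff Wf_def algebra_simps)
qed

definition Wh :: "int \<Rightarrow> complex" where "Wh n = (\<integral>t. Wf t * cis (of_int n * t) \<partial>circ)"

lemma Wf_measurable [measurable]: "Wf \<in> borel_measurable borel"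
proof -
  have "Wf = (\<lambda>t. of_real (kP t) + \<i> * of_real (kQ t))" by (auto simp: Wf_def complex_eq_iff)
  then show ?thesis by (simp only:) (intro borel_measurable_continuous_onI continuous_intros)
qed

lemma Wf_bounded: "\<exists>B. \<forall>t. cmod (Wf t) \<le> B"
proof -
  obtain B1 where B1: "\<And>t. norm (kP t) \<le> B1" using periodic_continuous_bounded[OF kP_continuous kPQ_periodic(1)] by blast
  obtain B2 where B2: "\<And>t. norm (kQ t) \<le> B2" using periodic_continuous_bounded[OF kQ_continuous kPQ_periodic(2)] by blast
  have "cmod (Wf t) \<le> B1 + B2" for t
    using cmod_le[of "Wf t"] B1[of t] B2[of t] by (simp add: Wf_def)
  then show ?thesis by blast
qed

lemma Wf_integrable: "integrable circ (\<lambda>t. Wf t * cis (of_int n * t))"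
proof -
  obtain B where "\<And>t. cmod (Wf t) \<le> B" using Wf_bounded by blast
  then show ?thesis by (intro integrable_circ_bounded[where B=B]) (auto simp: norm_mult)
qed

text \<open>Clearing the denominator in the Herglotz kernel and integrating against an exponential
  gives a two-term recursion with sources only at n = 0 and n = -1.\<close>

lemma Wh_rec: "Wh n = rr * Wh (n + 1) + (if n = 0 then 2*pi else 0) + (if n = -1 then rr * (2*pi) else 0)"
proof -
  have "Wf t * cis (of_int n * t) - rr * (Wf t * cis (of_int (n + 1) * t)) = cis (of_int n * t) + rr * cis (of_int (n + 1) * t)" for t
  proof -
    have c: "cis (of_int (n + 1) * t) = cis t * cis (of_int n * t)" by (simp add: cis_mult algebra_simps)
    have "Wf t * cis (of_int n * t) - rr * (Wf t * cis (of_int (n + 1) * t)) = (Wf t * (1 - rr * cis t)) * cis (of_int n * t)"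
      unfolding c by (simp add: algebra_simps)
    also have "\<dots> = cis (of_int n * t) + rr * cis (of_int (n + 1) * t)"
      unfolding Wf_eq c by (simp only: distrib_right mult_1 mult.assoc)
    finally show ?thesis .
  qed
  then have "(\<integral>t. Wf t * cis (of_int n * t) - rr * (Wf t * cis (of_int (n + 1) * t)) \<partial>circ) = (\<integral>t. cis (of_int n * t) + rr * cis (of_int (n + 1) * t) \<partial>circ)"
    by (simp only:)
  then have "Wh n - rr * Wh (n + 1) = (if n = 0 then 2*pi else 0) + rr * (if n + 1 = 0 then 2*pi else 0)"
    unfolding Wh_def
    by (simp only: Bochner_Integration.integral_diff Bochner_Integration.integral_add Wf_integrable integrable_cis integrable_mult_right integral_mult_right_zero integral_cis of_real_add of_real_mult)
  then show ?thesis by (auto simp: algebra_simps)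
qed

text \<open>Moving to higher frequencies the recursion gains a factor rr each time while the
  integrals stay bounded. This reflects that the Herglotz kernel is analytic in the disc.\<close>

lemma Wh_pos: assumes "0 < n" shows "Wh n = 0"
proof -
  obtain B where B: "\<And>t. cmod (Wf t) \<le> B" using Wf_bounded by blast
  have bd: "cmod (Wh m) \<le> 2*pi * B" for m
    unfolding Wh_def by (rule norm_integral_circ_le) (use B in \<open>auto simp: norm_mult\<close>)
  have "Wh n = rr ^ k * Wh (n + int k)" for k
  proof (induction k)
    case (Suc k)
    have "Wh (n + int k) = rr * Wh (n + int k + 1)" using Wh_rec[of "n + int k"] assms by simp
    then show ?case using Suc by (simp add: algebra_simps)
  qed simp
  then have "cmod (Wh n) = rr ^ k * cmod (Wh (n + int k))" for k
    using rr_bounds by (metis norm_mult norm_of_real abs_of_pos zero_less_power of_real_power)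
  moreover have "rr ^ k * cmod (Wh (n + int k)) \<le> rr ^ k * (2*pi * B)" for k
    using rr_bounds by (intro mult_left_mono bd) simp
  ultimately have le: "cmod (Wh n) \<le> rr ^ k * (2*pi * B)" for k
    by metis
  have "(\<lambda>k. rr ^ k * (2*pi * B)) \<longlonglongrightarrow> 0"
    using tendsto_mult_left_zero[OF LIMSEQ_power_zero[of rr]] rr_bounds by simp
  then have "cmod (Wh n) \<le> 0" by (rule LIMSEQ_le_const) (use le in blast)
  then show ?thesis by simp
qed

lemma Wh_0: "Wh 0 = 2*pi" using Wh_rec[of 0] Wh_pos[of 1] by simp

lemma Wh_neg: "Wh (- int (Suc k)) = 4*pi * rr ^ Suc k"
proof (induction k)
  case 0
  have "Wh (-1) = rr * Wh 0 + rr * (2*pi)" using Wh_rec[of "-1"] by simp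
  then show ?case unfolding Wh_0 by simp
next
  case (Suc k)
  have "- int (Suc (Suc k)) + 1 = - int (Suc k)" "- int (Suc (Suc k)) \<noteq> 0" "- int (Suc (Suc k)) \<noteq> -1" by simp_all
  then have "Wh (- int (Suc (Suc k))) = rr * Wh (- int (Suc k)) + 0 + 0" using Wh_rec[of "- int (Suc (Suc k))"] by (simp only: if_False of_real_0)
  then show ?case unfolding Suc.IH by simp
qed

lemma kP_integrable: "integrable circ (\<lambda>t. of_real (kP t) * cis (of_int n * t))"
  and kQ_integrable: "integrable circ (\<lambda>t. of_real (kQ t) * cis (of_int n * t))"
  and kZ_integrable: "integrable circ (\<lambda>t. of_real (kZ t) * cis (of_int n * t))"
  and kY_integrable: "integrable circ (\<lambda>t. of_real (kY t) * cis (of_int n * t))"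
proof -
  have i: "integrable circ (\<lambda>t. of_real (g t) * cis (of_int n * t))" if g: "continuous_on UNIV g" "periodic g" for g :: "real \<Rightarrow> real"
  proof -
    obtain B where "\<And>t. norm (g t) \<le> B" using periodic_continuous_bounded[OF g] by blast
    moreover have [measurable]: "g \<in> borel_measurable borel" by (rule borel_measurable_continuous_onI[OF g(1)])
    ultimately show ?thesis by (intro integrable_circ_bounded[where B=B]) (auto simp: norm_mult)
  qed
  show "integrable circ (\<lambda>t. of_real (kP t) * cis (of_int n * t))" "integrable circ (\<lambda>t. of_real (kQ t) * cis (of_int n * t))"
    "integrable circ (\<lambda>t. of_real (kZ t) * cis (of_int n * t))" "integrable circ (\<lambda>t. of_real (kY t) * cis (of_int n * t))"
    by (rule i[OF kP_continuous kPQ_periodic(1)] i[OF kQ_continuous kPQ_periodic(2)]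
        i[OF kZ_continuous kPQ_periodic(3)] i[OF kY_continuous kPQ_periodic(4)])+
qed

definition Ph :: "int \<Rightarrow> complex" where "Ph n = (\<integral>t. of_real (kP t) * cis (of_int n * t) \<partial>circ)"
definition Qh :: "int \<Rightarrow> complex" where "Qh n = (\<integral>t. of_real (kQ t) * cis (of_int n * t) \<partial>circ)"

text \<open>Both Poisson kernels are real, so \<open>Wh m\<close> and the conjugate of
  \<open>Wh (-m)\<close> are \<open>Ph m\<close> plus and minus i times \<open>Qh m\<close>, which
  can be solved for the two.\<close>

lemma Ph_eq: "Ph n = 2*pi * rr ^ nat \<bar>n\<bar>" and Qh_eq: "Qh n = 2*pi * \<i> * of_int (sgn n) * rr ^ nat \<bar>n\<bar>"
proof -
  have W1: "Wh m = Ph m + \<i> * Qh m" for m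
  proof -
    have "Wh m = (\<integral>t. of_real (kP t) * cis (of_int m * t) + \<i> * (of_real (kQ t) * cis (of_int m * t)) \<partial>circ)"
      unfolding Wh_def by (rule Bochner_Integration.integral_cong) (auto simp: Wf_def complex_eq_iff algebra_simps)
    then show ?thesis unfolding Ph_def Qh_def
      by (simp only: Bochner_Integration.integral_add kP_integrable kQ_integrable integrable_mult_right integral_mult_right_zero)
  qed
  have cP: "cnj (Ph (-m)) = Ph m" and cQ: "cnj (Qh (-m)) = Qh m" for m
    unfolding Ph_def Qh_def Bochner_Integration.integral_cnj[symmetric] by (simp_all add: cis_cnj)
  have W2: "cnj (Wh (-m)) = Ph m - \<i> * Qh m" for m
    unfolding W1 by (simp add: cP cQ)
  have P: "Ph m = (Wh m + cnj (Wh (-m))) / 2" and Q: "Qh m = \<i> * (cnj (Wh (-m)) - Wh m) / 2" for m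
    unfolding W2 unfolding W1 by (simp_all add: field_simps)
  have wn: "Wh (- m) = 4*pi * rr ^ nat m" if "0 < m" for m
    using Wh_neg[of "nat m - 1"] that by simp
  have "Ph n = 2*pi * rr ^ nat \<bar>n\<bar> \<and> Qh n = 2*pi * \<i> * of_int (sgn n) * rr ^ nat \<bar>n\<bar>"
  proof -
    consider "n = 0" | "0 < n" | "n < 0" by linarith
    then show ?thesis
    proof cases
      case 1
      then show ?thesis by (simp add: P Q Wh_0)
    next
      case 2
      then show ?thesis by (simp add: P Q Wh_pos wn)
    next
      case 3
      then have "Wh n = 4*pi * rr ^ nat (-n)" "Wh (-n) = 0" using wn[of "-n"] Wh_pos[of "-n"] by simp_all
      then show ?thesis using 3 by (simp add: P Q)
    qed
  qed
  then show "Ph n = 2*pi * rr ^ nat \<bar>n\<bar>" "Qh n = 2*pi * \<i> * of_int (sgn n) * rr ^ nat \<bar>n\<bar>" by blast+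
qed

lemma integral_by_parts:
  fixes f f' :: "real \<Rightarrow> real"
  assumes d: "\<And>t. (f has_real_derivative f' t) (at t)" and c: "continuous_on UNIV f'" and p: "periodic f"
    and i: "integrable circ (\<lambda>t. of_real (f t) * cis (of_int n * t))" "integrable circ (\<lambda>t. of_real (f' t) * cis (of_int n * t))"
  shows "(\<integral>t. of_real (f' t) * cis (of_int n * t) \<partial>circ) = - (\<i> * of_int n * (\<integral>t. of_real (f t) * cis (of_int n * t) \<partial>circ))"
proof -
  have fourier: "continuous_on UNIV f" using d by (meson DERIV_isCont continuous_at_imp_continuous_on)
  have dc: "((\<lambda>t. cis (of_int n * t)) has_vector_derivative of_int n *\<^sub>R (\<i> * cis (of_int n * t))) (at t)" for t
    by (rule vector_diff_chain_at[unfolded o_def, where g=cis and g'="\<i> * cis (of_int n * t)"])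
       (auto intro!: derivative_eq_intros simp: has_vector_derivative_def cis_conv_exp scaleR_conv_of_real
          has_real_derivative_iff_has_vector_derivative[symmetric] algebra_simps)
  have "((\<lambda>t. f t *\<^sub>R cis (of_int n * t)) has_vector_derivative
     (f t *\<^sub>R (of_int n *\<^sub>R (\<i> * cis (of_int n * t))) + f' t *\<^sub>R cis (of_int n * t))) (at t)" for t
    by (rule has_vector_derivative_scaleR[OF d dc])
  moreover have "continuous_on UNIV (\<lambda>t. f t *\<^sub>R (of_int n *\<^sub>R (\<i> * cis (of_int n * t))) + f' t *\<^sub>R cis (of_int n * t))"
    by (intro continuous_intros fourier c)
  ultimately have "(\<integral>t. f t *\<^sub>R (of_int n *\<^sub>R (\<i> * cis (of_int n * t))) + f' t *\<^sub>R cis (of_int n * t) \<partial>circ)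
    = f (2*pi) *\<^sub>R cis (of_int n * (2*pi)) - f 0 *\<^sub>R cis (of_int n * 0)"
    by (rule integral_circ_FTC)
  also have "\<dots> = 0" using periodicD[OF p, of 0] periodicD[OF periodic_cis, of n 0] by simp
  finally have "(\<integral>t. (\<i> * of_int n) * (of_real (f t) * cis (of_int n * t)) + of_real (f' t) * cis (of_int n * t) \<partial>circ) = 0"
    by (simp add: scaleR_conv_of_real mult_ac)
  then have "(\<i> * of_int n) * (\<integral>t. of_real (f t) * cis (of_int n * t) \<partial>circ) + (\<integral>t. of_real (f' t) * cis (of_int n * t) \<partial>circ) = 0"
    by (simp only: Bochner_Integration.integral_add i integrable_mult_right integral_mult_right_zero)
  then show ?thesis by (simp add: add_eq_0_iff)
qed

lemma SS_nonzero: "SS \<noteq> 0" "0 < SS"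
proof -
  have "b\<^sup>2 < a\<^sup>2" using b_pos b_less by (intro power_strict_mono) auto
  then show "0 < SS" using a_pos b_pos by (simp add: SS_def)
  then show "SS \<noteq> 0" by simp
qed

text \<open>Integration by parts for the two Poisson kernels. The factor n it produces becomes the
  term n q of the roots, with \<open>SS\<close> as sinh(2 \<rho>0).\<close>

lemma kY_coefficient: "(\<integral>t. of_real (kY t) * cis (of_int n * t) \<partial>circ) = - (2*pi * \<i> * of_int n * SS * rr ^ nat \<bar>n\<bar>)"
  and kZ_coefficient: "(\<integral>t. of_real (kZ t) * cis (of_int n * t) \<partial>circ) = - (2*pi * of_int \<bar>n\<bar> * SS * rr ^ nat \<bar>n\<bar>)"
proof -
  have ab: "a\<^sup>2 - b\<^sup>2 \<noteq> 0" using SS_nonzero by (auto simp: SS_def)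
  have dP: "(kP has_real_derivative kY t / SS) (at t)" for t
  proof -
    have "(kP has_real_derivative - (a * b * el' t) / (el t * el t)) (at t)"
      unfolding kP_def[abs_def] using el_pos[of t]
      by (auto intro!: derivative_eq_intros el_deriv)
    moreover have "- (a * b * el' t) / (el t * el t) = kY t / SS"
    proof -
      define p where "p = a * b"
      define c where "c = a\<^sup>2 - b\<^sup>2"
      have "p \<noteq> 0" "c \<noteq> 0" using ab a_pos b_pos by (simp_all add: p_def c_def)
      moreover have Se: "SS = 2 * p / c" by (simp add: SS_def p_def c_def)
      ultimately show ?thesis
        unfolding kY_def kP_def el'_def p_def[symmetric] c_def[symmetric] Se using el_pos[of t] by (simp add: field_simps)
    qed
    ultimately show ?thesis by simp
  qed
  have dQ: "(kQ has_real_derivative - kZ t / SS) (at t)" for t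
  proof -
    have "(kQ has_real_derivative ((a\<^sup>2 - b\<^sup>2) * cos t * (2 * el t) - (a\<^sup>2 - b\<^sup>2) * sin t * (2 * el' t)) / ((2 * el t) * (2 * el t))) (at t)"
      unfolding kQ_def[abs_def] using el_pos[of t]
      by (auto intro!: derivative_eq_intros el_deriv)
    moreover have "((a\<^sup>2 - b\<^sup>2) * cos t * (2 * el t) - (a\<^sup>2 - b\<^sup>2) * sin t * (2 * el' t)) / ((2 * el t) * (2 * el t)) = - kZ t / SS"
    proof -
      have s: "sin t * sin t = 1 - cos t * cos t" using sin_squared_eq[of t] by (simp add: power2_eq_square)
      have e: "cos t * el t - sin t * el' t = - (((a\<^sup>2 - b\<^sup>2) - (a\<^sup>2 + b\<^sup>2) * cos t) / 2)"
      proof -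
        define w where "w = (a\<^sup>2 - b\<^sup>2) / 2"
        define u where "u = (a\<^sup>2 + b\<^sup>2) / 2"
        have "cos t * (u - w * cos t) - sin t * (w * sin t) = u * cos t - w * (cos t * cos t) - w * (sin t * sin t)"
          by (simp add: algebra_simps)
        also have "\<dots> = u * cos t - w" unfolding s by (simp add: algebra_simps)
        finally have "cos t * el t - sin t * el' t = u * cos t - w"
          unfolding el_def el'_def w_def u_def .
        then show ?thesis by (simp add: u_def w_def field_simps)
      qed
      have "((a\<^sup>2 - b\<^sup>2) * cos t * (2 * el t) - (a\<^sup>2 - b\<^sup>2) * sin t * (2 * el' t)) = 2 * (a\<^sup>2 - b\<^sup>2) * (cos t * el t - sin t * el' t)"
        by (simp add: algebra_simps)
      then have q: "((a\<^sup>2 - b\<^sup>2) * cos t * (2 * el t) - (a\<^sup>2 - b\<^sup>2) * sin t * (2 * el' t)) = - ((a\<^sup>2 - b\<^sup>2) * ((a\<^sup>2 - b\<^sup>2) - (a\<^sup>2 + b\<^sup>2) * cos t))"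
        unfolding e by simp
      define p where "p = a * b"
      define c where "c = a\<^sup>2 - b\<^sup>2"
      define d where "d = c - (a\<^sup>2 + b\<^sup>2) * cos t"
      have "p \<noteq> 0" "c \<noteq> 0" using ab a_pos b_pos by (simp_all add: p_def c_def)
      moreover have Se: "SS = 2 * p / c" by (simp add: SS_def p_def c_def)
      ultimately show ?thesis
        unfolding q kZ_def kP_def p_def[symmetric] unfolding c_def[symmetric] d_def[symmetric] Se
        using el_pos[of t] by (simp add: field_simps)
    qed
    ultimately show ?thesis by simp
  qed
  have S: "complex_of_real SS \<noteq> 0" using SS_nonzero by simp
  have e1: "(\<integral>t. of_real (kY t / SS) * cis (of_int n * t) \<partial>circ) = - (\<i> * of_int n * Ph n)"
    unfolding Ph_def
  proof (rule integral_by_parts[OF dP _ kPQ_periodic(1) kP_integrable])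
    show "integrable circ (\<lambda>t. of_real (kY t / SS) * cis (of_int n * t))"
      using integrable_mult_right[OF kY_integrable, of "1 / SS"] by simp
  qed (intro continuous_intros SS_nonzero ballI)
  have e2: "(\<integral>t. of_real (- kZ t / SS) * cis (of_int n * t) \<partial>circ) = - (\<i> * of_int n * Qh n)"
    unfolding Qh_def
  proof (rule integral_by_parts[OF dQ _ kPQ_periodic(2) kQ_integrable])
    show "integrable circ (\<lambda>t. of_real (- kZ t / SS) * cis (of_int n * t))"
      using integrable_mult_right[OF kZ_integrable, of "- 1 / SS"] by simp
  qed (intro continuous_intros SS_nonzero ballI)
  have "(\<integral>t. of_real (kY t) * cis (of_int n * t) \<partial>circ) = (\<integral>t. of_real SS * (of_real (kY t / SS) * cis (of_int n * t)) \<partial>circ)"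
    using S by simp
  also have "\<dots> = of_real SS * - (\<i> * of_int n * Ph n)" by (simp only: integral_mult_right_zero e1)
  finally show "(\<integral>t. of_real (kY t) * cis (of_int n * t) \<partial>circ) = - (2*pi * \<i> * of_int n * SS * rr ^ nat \<bar>n\<bar>)"
    unfolding Ph_eq by (simp add: mult_ac)
  have "(\<integral>t. of_real (kZ t) * cis (of_int n * t) \<partial>circ) = (\<integral>t. - of_real SS * (of_real (- kZ t / SS) * cis (of_int n * t)) \<partial>circ)"
    using S by simp
  also have "\<dots> = - of_real SS * - (\<i> * of_int n * Qh n)" by (simp only: integral_mult_right_zero e2)
  also have "\<dots> = - (2*pi * (of_int n * of_int (sgn n)) * SS * rr ^ nat \<bar>n\<bar>)"
    unfolding Qh_eq by (simp add: mult_ac)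
  also have "real_of_int n * of_int (sgn n) = of_int \<bar>n\<bar>" by (simp add: sgn_if abs_if)
  finally show "(\<integral>t. of_real (kZ t) * cis (of_int n * t) \<partial>circ) = - (2*pi * of_int \<bar>n\<bar> * SS * rr ^ nat \<bar>n\<bar>)" .
qed

lemma smooth_coeff_eq:
  "smooth_coeff \<kappa> 1 1 n = rr ^ nat \<bar>n\<bar> / 2 * (1 - (1 - \<kappa>) * SS * of_int \<bar>n\<bar>)"
  "smooth_coeff \<kappa> 2 2 n = rr ^ nat \<bar>n\<bar> / 2 * (1 + (1 - \<kappa>) * SS * of_int \<bar>n\<bar>)"
  "smooth_coeff \<kappa> 1 2 n = \<i> * (rr ^ nat \<bar>n\<bar> / 2 * (- \<kappa> * of_int (sgn n) - (1 - \<kappa>) * SS * of_int n))"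
  "smooth_coeff \<kappa> 2 1 n = \<i> * (rr ^ nat \<bar>n\<bar> / 2 * (\<kappa> * of_int (sgn n) - (1 - \<kappa>) * SS * of_int n))"
proof -
  have lin: "(\<integral>t. of_real ((c * f t + d * g t) / (4*pi)) * cis (of_int n * t) \<partial>circ)
    = (of_real c * (\<integral>t. of_real (f t) * cis (of_int n * t) \<partial>circ) + of_real d * (\<integral>t. of_real (g t) * cis (of_int n * t) \<partial>circ)) / (4*pi)"
    if "integrable circ (\<lambda>t. of_real (f t) * cis (of_int n * t))" "integrable circ (\<lambda>t. of_real (g t) * cis (of_int n * t))"
    for f g :: "real \<Rightarrow> real" and c d :: real
  proof -
    have "of_real ((c * f t + d * g t) / (4*pi)) * cis (of_int n * t)
      = (of_real c * (of_real (f t) * cis (of_int n * t)) + of_real d * (of_real (g t) * cis (of_int n * t))) / (4*pi)" for t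
      by (simp add: field_simps)
    then show ?thesis
      by (simp only: integral_divide_zero Bochner_Integration.integral_add that integrable_mult_right integral_mult_right_zero)
  qed
  show "smooth_coeff \<kappa> 1 1 n = rr ^ nat \<bar>n\<bar> / 2 * (1 - (1 - \<kappa>) * SS * of_int \<bar>n\<bar>)"
    using lin[OF kP_integrable kZ_integrable, of 1 "1 - \<kappa>"] unfolding Ph_def[symmetric] Ph_eq kZ_coefficient
    by (simp add: smooth_coeff_def smooth_kernel_def field_simps)
  show "smooth_coeff \<kappa> 2 2 n = rr ^ nat \<bar>n\<bar> / 2 * (1 + (1 - \<kappa>) * SS * of_int \<bar>n\<bar>)"
    using lin[OF kP_integrable kZ_integrable, of 1 "- (1 - \<kappa>)"] unfolding Ph_def[symmetric] Ph_eq kZ_coefficient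
    by (simp add: smooth_coeff_def smooth_kernel_def field_simps)
  show "smooth_coeff \<kappa> 1 2 n = \<i> * (rr ^ nat \<bar>n\<bar> / 2 * (- \<kappa> * of_int (sgn n) - (1 - \<kappa>) * SS * of_int n))"
    using lin[OF kQ_integrable kY_integrable, of "- \<kappa>" "1 - \<kappa>"] unfolding Qh_def[symmetric] Qh_eq kY_coefficient
    by (simp add: smooth_coeff_def smooth_kernel_def field_simps)
  show "smooth_coeff \<kappa> 2 1 n = \<i> * (rr ^ nat \<bar>n\<bar> / 2 * (\<kappa> * of_int (sgn n) - (1 - \<kappa>) * SS * of_int n))"
    using lin[OF kQ_integrable kY_integrable, of \<kappa> "1 - \<kappa>"] unfolding Qh_def[symmetric] Qh_eq kY_coefficient
    by (simp add: smooth_coeff_def smooth_kernel_def field_simps)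
qed

text \<open>Coefficients of x1 + i x2, and next of x1 - i x2. The rotation by a right angle
  multiplies them by i and -i, so the Hilbert part of the symbol becomes a real scalar on
  each.\<close>

definition cA :: "(int \<Rightarrow> 2 \<Rightarrow> complex) \<Rightarrow> int \<Rightarrow> complex" where "cA x n = x n 1 + \<i> * x n 2"
definition cB :: "(int \<Rightarrow> 2 \<Rightarrow> complex) \<Rightarrow> int \<Rightarrow> complex" where "cB x n = x n 1 - \<i> * x n 2"

lemma cAB_eqI: assumes "\<And>n. cA x n = cA y n" "\<And>n. cB x n = cB y n" shows "x n i = y n i"
proof -
  have e: "z n 1 = (cA z n + cB z n) / 2" "z n 2 = (cA z n - cB z n) / (2 * \<i>)" for z
    by (simp_all add: cA_def cB_def)
  have "x n 1 = y n 1" "x n 2 = y n 2" by (simp_all only: e[of x] e[of y] assms)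
  then show ?thesis using exhaust_2[of i] by auto
qed

text \<open>\<open>pn\<close> is the number p_n of the statement; \<open>tn\<close> gathers the
  contribution of the derivative kernels and is the only entry with a factor n.\<close>

definition pn :: "real \<Rightarrow> nat \<Rightarrow> real" where "pn \<kappa> n = (1 - \<kappa>) / 2 * rr ^ n"
definition sn :: "real \<Rightarrow> nat \<Rightarrow> real" where "sn \<kappa> n = (1 + \<kappa>) / 2 * rr ^ n"
definition tn :: "real \<Rightarrow> nat \<Rightarrow> real" where "tn \<kappa> n = (1 - \<kappa>) * SS * real n * rr ^ n"

text \<open>The four equations are unchanged when the A-coefficient at n is exchanged with the
  B-coefficient at -n, and that of A at -n with that of B at n. The even and odd combinations
  therefore decouple into two blocks.\<close>

lemma NP_symbol_blocks:
  assumes "0 < n"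
  shows "cA (NP_symbol \<kappa> x) (int n) = - of_real (\<kappa>/2) * cA x (int n) + of_real (pn \<kappa> n) * cA x (- int n)"
    and "cB (NP_symbol \<kappa> x) (int n) = of_real (\<kappa>/2) * cB x (int n) + of_real (sn \<kappa> n) * cB x (- int n) - of_real (tn \<kappa> n) * cA x (- int n)"
    and "cA (NP_symbol \<kappa> x) (- int n) = of_real (\<kappa>/2) * cA x (- int n) + of_real (sn \<kappa> n) * cA x (int n) - of_real (tn \<kappa> n) * cB x (int n)"
    and "cB (NP_symbol \<kappa> x) (- int n) = - of_real (\<kappa>/2) * cB x (- int n) + of_real (pn \<kappa> n) * cB x (int n)"
proof -
  have m: "sgn (int n) = 1" "sgn (- int n) = -1" "nat \<bar>int n\<bar> = n" "nat \<bar>- int n\<bar> = n"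
    "real_of_int \<bar>int n\<bar> = real n" "real_of_int \<bar>- int n\<bar> = real n" "real_of_int (int n) = real n" "real_of_int (- int n) = - real n"
    "- (- int n) = int n"
    using assms(1) by simp_all
  have ii: "\<i> * (\<i> * z) = - z" for z by (simp flip: mult.assoc)
  have T: "NP_symbol \<kappa> x (int n) 1 = - \<i> * of_real (\<kappa>/2) * x (int n) 2
      + (of_real (rr ^ n / 2 * (1 - (1 - \<kappa>) * SS * real n)) * x (- int n) 1 + \<i> * of_real (rr ^ n / 2 * (- \<kappa> - (1 - \<kappa>) * SS * real n)) * x (- int n) 2)"
    "NP_symbol \<kappa> x (int n) 2 = \<i> * of_real (\<kappa>/2) * x (int n) 1
      + (\<i> * of_real (rr ^ n / 2 * (\<kappa> - (1 - \<kappa>) * SS * real n)) * x (- int n) 1 + of_real (rr ^ n / 2 * (1 + (1 - \<kappa>) * SS * real n)) * x (- int n) 2)"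
    "NP_symbol \<kappa> x (- int n) 1 = \<i> * of_real (\<kappa>/2) * x (- int n) 2
      + (of_real (rr ^ n / 2 * (1 - (1 - \<kappa>) * SS * real n)) * x (int n) 1 + \<i> * of_real (rr ^ n / 2 * (\<kappa> + (1 - \<kappa>) * SS * real n)) * x (int n) 2)"
    "NP_symbol \<kappa> x (- int n) 2 = - \<i> * of_real (\<kappa>/2) * x (- int n) 1
      + (\<i> * of_real (rr ^ n / 2 * (- \<kappa> + (1 - \<kappa>) * SS * real n)) * x (int n) 1 + of_real (rr ^ n / 2 * (1 + (1 - \<kappa>) * SS * real n)) * x (int n) 2)"
    unfolding NP_symbol_def smooth_coeff_eq m rot90_def by simp_all
  define K where "K = complex_of_real (\<kappa>/2)"
  define e where "e = complex_of_real (rr ^ n / 2)"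
  define w where "w = complex_of_real ((1 - \<kappa>) * SS * real n)"
  have c: "complex_of_real (rr ^ n / 2 * (1 - (1 - \<kappa>) * SS * real n)) = e * (1 - w)"
    "complex_of_real (rr ^ n / 2 * (1 + (1 - \<kappa>) * SS * real n)) = e * (1 + w)"
    "complex_of_real (rr ^ n / 2 * (- \<kappa> - (1 - \<kappa>) * SS * real n)) = e * (- (2 * K) - w)"
    "complex_of_real (rr ^ n / 2 * (\<kappa> - (1 - \<kappa>) * SS * real n)) = e * (2 * K - w)"
    "complex_of_real (rr ^ n / 2 * (\<kappa> + (1 - \<kappa>) * SS * real n)) = e * (2 * K + w)"
    "complex_of_real (rr ^ n / 2 * (- \<kappa> + (1 - \<kappa>) * SS * real n)) = e * (- (2 * K) + w)"
    "complex_of_real (pn \<kappa> n) = e * (1 - 2 * K)" "complex_of_real (sn \<kappa> n) = e * (1 + 2 * K)"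
    "complex_of_real (tn \<kappa> n) = 2 * e * w"
    unfolding K_def e_def w_def pn_def sn_def tn_def
    by (simp_all add: algebra_simps)
  show "cA (NP_symbol \<kappa> x) (int n) = - of_real (\<kappa>/2) * cA x (int n) + of_real (pn \<kappa> n) * cA x (- int n)"
    unfolding cA_def T c K_def[symmetric] by (simp add: algebra_simps ii)
  show "cB (NP_symbol \<kappa> x) (int n) = of_real (\<kappa>/2) * cB x (int n) + of_real (sn \<kappa> n) * cB x (- int n) - of_real (tn \<kappa> n) * cA x (- int n)"
    unfolding cA_def cB_def T c K_def[symmetric] by (simp add: algebra_simps ii)
  show "cA (NP_symbol \<kappa> x) (- int n) = of_real (\<kappa>/2) * cA x (- int n) + of_real (sn \<kappa> n) * cA x (int n) - of_real (tn \<kappa> n) * cB x (int n)"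
    unfolding cA_def cB_def T c K_def[symmetric] by (simp add: algebra_simps ii)
  show "cB (NP_symbol \<kappa> x) (- int n) = - of_real (\<kappa>/2) * cB x (- int n) + of_real (pn \<kappa> n) * cB x (int n)"
    unfolding cB_def T c K_def[symmetric] by (simp add: algebra_simps ii)
qed

text \<open>At frequency 0 every term with sgn n or n drops out, leaving the mass of the Poisson
  kernel; this is the eigenvalue 1/2 on constants.\<close>

lemma NP_symbol_zero: "cA (NP_symbol \<kappa> x) 0 = cA x 0 / 2" "cB (NP_symbol \<kappa> x) 0 = cB x 0 / 2"
  by (simp_all add: NP_symbol_def smooth_coeff_eq cA_def cB_def algebra_simps)

end

section \<open>The eigenvalue problem\<close>

locale lame_ell = ell +
  fixes lam mu R \<rho>0 :: real
  assumes mu_pos: "0 < mu" and lm_pos: "0 < lam + mu"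
    and R_eq: "R = sqrt (a\<^sup>2 - b\<^sup>2)" and rho_pos: "0 < \<rho>0"
    and aR: "a = R * cosh \<rho>0" and bR: "b = R * sinh \<rho>0"
begin

definition kap :: real where "kap = mu / (2 * mu + lam)"

abbreviation "k0' \<equiv> k0 lam mu"
abbreviation "T \<equiv> mult_op (NP_symbol kap)"
abbreviation "bd \<equiv> boundary_density a b R \<rho>0"

lemma M_pos: "0 < lam + 2 * mu" "0 < 2 * mu + lam" using mu_pos lm_pos by simp_all

lemma R_pos: "0 < R"
  using a_pos aR cosh_real_pos[of \<rho>0] by (simp add: zero_less_mult_iff)

lemma rr_exp: "rr = exp (- 2 * \<rho>0)"
proof -
  have "a - b = R * exp (- \<rho>0)" "a + b = R * exp \<rho>0"
    unfolding aR bR by (simp_all add: cosh_def sinh_def field_simps)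
  then have "rr = exp (- \<rho>0) / exp \<rho>0" unfolding rr_def using R_pos by simp
  then show ?thesis by (simp add: exp_diff[symmetric])
qed

lemma rr_power: "rr ^ n = exp (- 2 * real n * \<rho>0)"
  unfolding rr_exp exp_of_nat_mult[symmetric] by (simp add: mult_ac)

lemma SS_sinh: "SS = sinh (2 * \<rho>0)"
proof -
  have "a\<^sup>2 - b\<^sup>2 = R\<^sup>2 * ((cosh \<rho>0)\<^sup>2 - (sinh \<rho>0)\<^sup>2)" unfolding aR bR by (simp add: power_mult_distrib right_diff_distrib)
  then have "a\<^sup>2 - b\<^sup>2 = R\<^sup>2" by (simp add: cosh_square_eq)
  moreover have "2 * a * b = R\<^sup>2 * sinh (2 * \<rho>0)" unfolding aR bR by (simp add: sinh_double power2_eq_square)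
  ultimately show ?thesis unfolding SS_def using R_pos by simp
qed

lemma elliptic_par: "elliptic_coord R \<rho>0 t = par t"
  by (simp add: elliptic_coord_def vec_eq_iff forall_2 aR[symmetric] bR[symmetric])

text \<open>The scale factor of elliptic coordinates on the boundary is the speed, so multiplication
  by it turns the listed functions into trigonometric polynomials.\<close>

lemma h0_speed: "h0 R \<rho>0 t = speed t"
proof -
  have "a\<^sup>2 * (sin t)\<^sup>2 + b\<^sup>2 * (cos t)\<^sup>2 = R\<^sup>2 * ((sinh \<rho>0)\<^sup>2 + (sin t)\<^sup>2)"
    unfolding aR bR power_mult_distrib cos_squared_eq cosh_square_eq by (simp add: algebra_simps)
  then show ?thesis unfolding h0_def speed_def using R_pos by (simp add: real_sqrt_mult)
qed

lemma k0_kap: "k0' = kap / 2"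
  by (simp add: k0_def kap_def)

lemma kap_bounds: "0 < kap" "kap < 1"
  using mu_pos lm_pos by (simp_all add: kap_def field_simps)

lemma p0_pn: "p0 lam mu \<rho>0 n = pn kap n"
  unfolding p0_def pn_def rr_power k0_kap by (simp add: field_simps)

lemma pn_pos: "0 < pn kap n" and sn_pos: "0 < sn kap n"
  using kap_bounds rr_bounds by (simp_all add: pn_def sn_def)

lemma integral_cis_pair:
  fixes \<alpha> \<beta> :: complex
  shows "(\<integral>t. (\<alpha> * cis (real n * t) + \<beta> * cis (- (real n * t))) * cis (of_int m * t) \<partial>circ)
   = 2*pi * ((if m = - int n then \<alpha> else 0) + (if m = int n then \<beta> else 0))"
proof -
  have e: "(\<alpha> * cis (real n * t) + \<beta> * cis (- (real n * t))) * cis (of_int m * t)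
     = \<alpha> * cis (of_int (int n + m) * t) + \<beta> * cis (of_int (m - int n) * t)" for t
    by (simp add: distrib_right cis_mult mult.assoc algebra_simps)
  have "(\<integral>t. (\<alpha> * cis (real n * t) + \<beta> * cis (- (real n * t))) * cis (of_int m * t) \<partial>circ)
     = \<alpha> * (if int n + m = 0 then 2*pi else 0) + \<beta> * (if m - int n = 0 then 2*pi else 0)"
    unfolding e by (simp only: Bochner_Integration.integral_add integrable_cis integrable_mult_right integral_mult_right_zero integral_cis)
  then show ?thesis by (auto simp: algebra_simps)
qed

text \<open>A real plane field is read as one complex function v1 + i v2 with two frequencies. Its
  conjugate gives the B-coefficients, and \<alpha> appears at -n because \<open>hat\<close> tests
  with the frequency +m.\<close>

lemma bd_coefficients:
  fixes v1 v2 :: "real \<Rightarrow> real" and \<alpha> \<beta> :: complex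
  assumes g: "\<And>t. speed t *\<^sub>R g t = vector [v1 t, v2 t]"
    and v: "\<And>t. of_real (v1 t) + \<i> * of_real (v2 t) = \<alpha> * cis (real n * t) + \<beta> * cis (- (real n * t))"
  shows bd_Hm: "bd g \<in> Hm"
    and bd_cA: "cA (hat (bd g)) m = 2*pi * ((if m = - int n then \<alpha> else 0) + (if m = int n then \<beta> else 0))"
    and bd_cB: "cB (hat (bd g)) m = 2*pi * ((if m = int n then cnj \<alpha> else 0) + (if m = - int n then cnj \<beta> else 0))"
proof -
  define w where "w t = \<alpha> * cis (real n * t) + \<beta> * cis (- (real n * t))" for t
  have v12: "v1 t = Re (w t)" "v2 t = Im (w t)" for t
    using v[of t] by (auto simp: w_def complex_eq_iff)
  have wper: "periodic w"
    using periodicD[OF periodic_cis[of "int n"]] periodicD[OF periodic_cis[of "- int n"]]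
    by (simp add: periodic_def w_def)
  have wc: "continuous_on UNIV w" unfolding w_def by (intro continuous_intros)
  have [measurable]: "w \<in> borel_measurable borel" by (rule borel_measurable_continuous_onI[OF wc])
  obtain B where B: "\<And>t. cmod (w t) \<le> B" using periodic_continuous_bounded[OF wc wper] by blast
  define u :: "real \<Rightarrow> complex^2" where "u t = (\<chi> i. if i = 1 then of_real (Re (w t)) else of_real (Im (w t)))" for t
  define ch where "ch x = cvec (g (THE \<omega>. 0 \<le> \<omega> \<and> \<omega> < 2 * pi \<and> elliptic_coord R \<rho>0 \<omega> = x))" for x
  have um: "u \<in> borel_measurable borel" unfolding u_def
  proof (rule vec2_measurable)
    show "(\<lambda>t. if i = 1 then complex_of_real (Re (w t)) else complex_of_real (Im (w t))) \<in> borel_measurable borel" for i :: 2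
      by (cases "i = 1") simp_all
  qed
  have up: "periodic u" unfolding periodic_def u_def periodicD[OF wper] by simp
  have ub: "norm (u t) \<le> B + B" for t
    using norm_vec2_le[of "u t"] abs_Re_le_cmod[of "w t"] abs_Im_le_cmod[of "w t"] B[of t] by (simp add: u_def)
  have ueq: "u t = speed t *\<^sub>R ch (par t)" for t
  proof -
    have pw: "par (wrap t) = par t" using periodic_wrap[of par t] by (simp add: periodic_def par_periodic)
    \<comment> \<open>The half-open range makes the angle in \<open>boundary_density\<close> unique;
      it is the reduction of t modulo 2 pi.\<close>
    have "(THE \<omega>. 0 \<le> \<omega> \<and> \<omega> < 2 * pi \<and> elliptic_coord R \<rho>0 \<omega> = par t) = wrap t"
    proof (rule the_equality)
      show "0 \<le> wrap t \<and> wrap t < 2 * pi \<and> elliptic_coord R \<rho>0 (wrap t) = par t"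
        using wrap_range[of t] pw by (simp add: elliptic_par)
      show "\<omega> = wrap t" if "0 \<le> \<omega> \<and> \<omega> < 2 * pi \<and> elliptic_coord R \<rho>0 \<omega> = par t" for \<omega>
        using that wrap_range[of t] pw par_inj[of \<omega> "wrap t"] by (simp add: elliptic_par)
    qed
    then have c: "ch (par t) = cvec (g (wrap t))" by (simp add: ch_def)
    have "speed (wrap t) * g (wrap t) $ 1 = Re (w t)" "speed (wrap t) * g (wrap t) $ 2 = Im (w t)"
      using arg_cong[OF g[of "wrap t"], of "\<lambda>z. z $ 1"] arg_cong[OF g[of "wrap t"], of "\<lambda>z. z $ 2"]
      by (simp_all add: v12 periodic_wrap[OF wper])
    then have s: "speed t * g (wrap t) $ 1 = Re (w t)" "speed t * g (wrap t) $ 2 = Im (w t)"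
      by (simp_all add: periodic_wrap[OF speed_periodic])
    have cvn: "(speed t *\<^sub>R cvec (g (wrap t))) $ i = of_real (speed t * g (wrap t) $ i)" for i
      unfolding vector_scaleR_component cvec_def vec_lambda_beta by (simp add: scaleR_conv_of_real)
    show ?thesis unfolding c vec_eq_iff forall_2 cvn s by (simp add: u_def)
  qed
  have bdch: "bd g = density_functional sig ch"
    unfolding boundary_density_def sig_def ch_def[abs_def] ..
  note D = density_functional_Hm[OF um up ub ueq]
  show "bd g \<in> Hm" unfolding bdch by (rule D(1))
  have ui: "integrable circ (\<lambda>t. u t $ i * cis (of_int m * t))" for i
  proof (rule integrable_circ_bounded[where B="B + B"])
    show "(\<lambda>t. u t $ i * cis (of_int m * t)) \<in> borel_measurable borel" using um by measurable
    show "norm (u t $ i * cis (of_int m * t)) \<le> B + B" for t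
      using order_trans[OF Finite_Cartesian_Product.norm_nth_le[of "u t" i] ub[of t]] by (simp add: norm_mult)
  qed
  have "cA (hat (bd g)) m = (\<integral>t. u t $ 1 * cis (of_int m * t) + \<i> * (u t $ 2 * cis (of_int m * t)) \<partial>circ)"
    unfolding cA_def bdch D(2)
    by (simp only: Bochner_Integration.integral_add ui integrable_mult_right integral_mult_right_zero)
  also have "\<dots> = (\<integral>t. w t * cis (of_int m * t) \<partial>circ)"
  proof (rule Bochner_Integration.integral_cong[OF refl])
    fix t
    have "u t $ 1 + \<i> * u t $ 2 = w t" by (simp add: u_def complex_eq_iff)
    then show "u t $ 1 * cis (of_int m * t) + \<i> * (u t $ 2 * cis (of_int m * t)) = w t * cis (of_int m * t)"
      by (metis distrib_right mult.assoc)
  qed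
  finally show "cA (hat (bd g)) m = 2*pi * ((if m = - int n then \<alpha> else 0) + (if m = int n then \<beta> else 0))"
    unfolding w_def integral_cis_pair .
  have "cB (hat (bd g)) m = (\<integral>t. u t $ 1 * cis (of_int m * t) - \<i> * (u t $ 2 * cis (of_int m * t)) \<partial>circ)"
    unfolding cB_def bdch D(2)
    by (simp only: Bochner_Integration.integral_diff ui integrable_mult_right integral_mult_right_zero)
  also have "\<dots> = (\<integral>t. (cnj \<beta> * cis (real n * t) + cnj \<alpha> * cis (- (real n * t))) * cis (of_int m * t) \<partial>circ)"
  proof (rule Bochner_Integration.integral_cong[OF refl])
    fix t
    have "u t $ 1 - \<i> * u t $ 2 = cnj (w t)" by (simp add: u_def complex_eq_iff)
    also have "\<dots> = cnj \<beta> * cis (real n * t) + cnj \<alpha> * cis (- (real n * t))"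
      unfolding w_def by (simp add: cis_cnj)
    finally show "u t $ 1 * cis (of_int m * t) - \<i> * (u t $ 2 * cis (of_int m * t)) = (cnj \<beta> * cis (real n * t) + cnj \<alpha> * cis (- (real n * t))) * cis (of_int m * t)"
      by (metis left_diff_distrib mult.assoc)
  qed
  finally show "cB (hat (bd g)) m = 2*pi * ((if m = int n then cnj \<alpha> else 0) + (if m = - int n then cnj \<beta> else 0))"
    unfolding integral_cis_pair by (simp add: add.commute)
qed

subsection \<open>Blocks and their characteristic equation\<close>

text \<open>The frequencies \<open>n\<close> and \<open>-n\<close> split into the block \<open>\<epsilon> = 1\<close> with eigenvalues \<open>k1\<close>, \<open>k3\<close> and the
  block \<open>\<epsilon> = -1\<close> with eigenvalues \<open>k2\<close>, \<open>k4\<close>.\<close>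

definition is_block_root :: "real \<Rightarrow> nat \<Rightarrow> complex \<Rightarrow> bool" where
  "is_block_root \<epsilon> n \<kappa> \<longleftrightarrow> (\<kappa> + of_real k0') * (\<kappa> - of_real k0' + of_real (\<epsilon> * tn kap n)) = of_real (pn kap n * sn kap n)"

text \<open>The entries \<open>pn kap n\<close> and \<kappa> + k0 solve the first row of the block
  for any \<kappa>. The sign \<epsilon> reflects the A-coefficients to the B-coefficients at
  opposite frequencies.\<close>

definition block_form :: "real \<Rightarrow> nat \<Rightarrow> complex \<Rightarrow> complex \<Rightarrow> functional \<Rightarrow> bool" where
  "block_form \<epsilon> n \<kappa> c F \<longleftrightarrow> F \<in> Hm \<and>
    (\<forall>m. cA (hat F) m = c * ((if m = - int n then \<kappa> + of_real k0' else 0) + (if m = int n then of_real (pn kap n) else 0))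
       \<and> cB (hat F) m = of_real \<epsilon> * (c * ((if m = int n then \<kappa> + of_real k0' else 0) + (if m = - int n then of_real (pn kap n) else 0))))"

lemma T_Hm: "F \<in> Hm \<Longrightarrow> T F \<in> Hm"
  using mult_op_Hm NP_symbol_mult_seq by blast

lemma T_eqI:
  assumes F: "F \<in> Hm"
    and "cA (hat F) 0 / 2 = \<kappa> * cA (hat F) 0" "cB (hat F) 0 / 2 = \<kappa> * cB (hat F) 0"
    and n: "\<And>n. 0 < n \<Longrightarrow> cA (NP_symbol kap (hat F)) (int n) = \<kappa> * cA (hat F) (int n)"
      "\<And>n. 0 < n \<Longrightarrow> cB (NP_symbol kap (hat F)) (int n) = \<kappa> * cB (hat F) (int n)"
      "\<And>n. 0 < n \<Longrightarrow> cA (NP_symbol kap (hat F)) (- int n) = \<kappa> * cA (hat F) (- int n)"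
      "\<And>n. 0 < n \<Longrightarrow> cB (NP_symbol kap (hat F)) (- int n) = \<kappa> * cB (hat F) (- int n)"
  shows "T F = (\<lambda>f. \<kappa> * F f)"
proof (rule Hm_eqI[OF T_Hm[OF F] Hm_cmult[OF F]])
  have sc: "cA (hat (\<lambda>f. \<kappa> * F f)) m = \<kappa> * cA (hat F) m" "cB (hat (\<lambda>f. \<kappa> * F f)) m = \<kappa> * cB (hat F) m" for m
    by (simp_all add: cA_def cB_def hat_cmult algebra_simps)
  have "cA (hat (T F)) m = cA (hat (\<lambda>f. \<kappa> * F f)) m \<and> cB (hat (T F)) m = cB (hat (\<lambda>f. \<kappa> * F f)) m" for m
  proof -
    consider "m = 0" | k where "0 < k" "m = int k" | k where "0 < k" "m = - int k"
      by (metis int_cases2 of_nat_0 of_nat_0_less_iff minus_zero neq0_conv)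
    then show ?thesis
      by cases (simp_all only: sc hat_mult_op[OF F] NP_symbol_zero assms(2,3) n simp_thms)
  qed
  then have "cA (hat (T F)) m = cA (hat (\<lambda>f. \<kappa> * F f)) m" "cB (hat (T F)) m = cB (hat (\<lambda>f. \<kappa> * F f)) m" for m
    by simp_all
  then show "hat (T F) n i = hat (\<lambda>f. \<kappa> * F f) n i" for n i by (rule cAB_eqI)
qed

text \<open>Two of the four equations hold by the shape of the vector; the other two are the
  characteristic equation, the second of them after using \<epsilon>^2 = 1.\<close>

lemma block_form_eigen:
  assumes F: "block_form \<epsilon> n \<kappa> c F" and n: "0 < n" and e: "\<epsilon> = 1 \<or> \<epsilon> = -1" and r: "is_block_root \<epsilon> n \<kappa>"
  shows "T F = (\<lambda>f. \<kappa> * F f)"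
proof (rule T_eqI)
  show FH: "F \<in> Hm" using F by (simp add: block_form_def)
  have A: "cA (hat F) m = c * ((if m = - int n then \<kappa> + of_real k0' else 0) + (if m = int n then of_real (pn kap n) else 0))"
    and B: "cB (hat F) m = of_real \<epsilon> * (c * ((if m = int n then \<kappa> + of_real k0' else 0) + (if m = - int n then of_real (pn kap n) else 0)))" for m
    using F by (auto simp: block_form_def)
  show "cA (hat F) 0 / 2 = \<kappa> * cA (hat F) 0" "cB (hat F) 0 / 2 = \<kappa> * cB (hat F) 0"
    using n by (simp_all add: A B)
  define K where "K = complex_of_real k0'"
  define p where "p = complex_of_real (pn kap n)"
  define s where "s = complex_of_real (sn kap n)"
  define t where "t = complex_of_real (tn kap n)"
  define e where "e = complex_of_real \<epsilon>"
  have K2: "complex_of_real (kap/2) = K" by (simp add: K_def k0_kap)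
  have ee: "e * e = 1" using e by (auto simp: e_def)
  have rt: "(\<kappa> + K) * (\<kappa> - K + e * t) = p * s" using r by (simp add: is_block_root_def K_def p_def s_def t_def e_def)
  fix k :: nat assume k: "0 < k"
  have vals: "cA (hat F) (int k) = (if k = n then c * p else 0)" "cA (hat F) (- int k) = (if k = n then c * (\<kappa> + K) else 0)"
    "cB (hat F) (int k) = (if k = n then e * (c * (\<kappa> + K)) else 0)" "cB (hat F) (- int k) = (if k = n then e * (c * p) else 0)"
    unfolding A B using k n by (auto simp: K_def p_def e_def)
  note bl = NP_symbol_blocks[OF k, of kap "hat F", unfolded K2 vals]
  show "cA (NP_symbol kap (hat F)) (int k) = \<kappa> * cA (hat F) (int k)"
    unfolding bl vals by (simp add: p_def[symmetric] algebra_simps)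
  show "cB (NP_symbol kap (hat F)) (- int k) = \<kappa> * cB (hat F) (- int k)"
    unfolding bl vals by (simp add: p_def[symmetric] algebra_simps)
  show "cA (NP_symbol kap (hat F)) (- int k) = \<kappa> * cA (hat F) (- int k)"
  proof (cases "k = n")
    case True
    have "K * (c * (\<kappa> + K)) + s * (c * p) - t * (e * (c * (\<kappa> + K))) = \<kappa> * (c * (\<kappa> + K))"
      using arg_cong[OF rt, of "\<lambda>z. c * z"] by (simp add: algebra_simps)
    then show ?thesis unfolding bl vals using True by (simp add: s_def t_def)
  qed (simp add: bl vals)
  show "cB (NP_symbol kap (hat F)) (int k) = \<kappa> * cB (hat F) (int k)"
  proof (cases "k = n")
    case True
    have "s * (e * (c * p)) = e * c * ((\<kappa> + K) * (\<kappa> - K + e * t))" unfolding rt by (simp add: mult_ac)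
    also have "\<dots> = e * c * (\<kappa> + K) * (\<kappa> - K) + (e * e) * c * (\<kappa> + K) * t" by (simp add: algebra_simps)
    finally have "K * (e * (c * (\<kappa> + K))) + s * (e * (c * p)) - t * (c * (\<kappa> + K)) = \<kappa> * (e * (c * (\<kappa> + K)))"
      unfolding ee by (simp add: algebra_simps)
    then show ?thesis unfolding bl vals using True by (simp add: s_def t_def)
  qed (simp add: bl vals)
qed

text \<open>The right side of the characteristic equation is positive, so neither factor on the left
  vanishes. This legitimises the divisions in \<open>phi1\<close> and \<open>phi2\<close>.\<close>

lemma is_block_root_neq: "is_block_root \<epsilon> n \<kappa> \<Longrightarrow> \<kappa> + of_real k0' \<noteq> 0"
  using pn_pos[of n] sn_pos[of n] by (auto simp: is_block_root_def)

section \<open>Closed form of the block roots\<close>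

definition block_root :: "real \<Rightarrow> real \<Rightarrow> nat \<Rightarrow> real" where
  "block_root \<epsilon> \<delta> n = exp (- 2 * real n * \<rho>0) / (2 * (lam + 2 * mu)) *
     (\<delta> * (if \<epsilon> = 1 then gamma_minus lam mu \<rho>0 n else gamma_plus lam mu \<rho>0 n) - \<epsilon> * (q0 lam mu \<rho>0 * real n))"

lemma k_block_root: "k1 lam mu \<rho>0 n = block_root 1 1 n" "k2 lam mu \<rho>0 n = block_root (-1) 1 n" "k3 lam mu \<rho>0 n = block_root 1 (-1) n" "k4 lam mu \<rho>0 n = block_root (-1) (-1) n"
  by (simp_all add: block_root_def k1_def k2_def k3_def k4_def algebra_simps)

text \<open>Completing the square: the radicand is a square plus (lam + mu)(lam + 3 mu), which is
  positive, so the square roots are genuine.\<close>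

lemma gamma_sq:
  "(gamma_minus lam mu \<rho>0 n)\<^sup>2 = (q0 lam mu \<rho>0 * real n - exp (2 * real n * \<rho>0) * mu)\<^sup>2 + (lam + mu) * (lam + 3 * mu)"
  "(gamma_plus lam mu \<rho>0 n)\<^sup>2 = (q0 lam mu \<rho>0 * real n + exp (2 * real n * \<rho>0) * mu)\<^sup>2 + (lam + mu) * (lam + 3 * mu)"
  "0 \<le> gamma_plus lam mu \<rho>0 n"
proof -
  define q where "q = q0 lam mu \<rho>0"
  define E where "E = exp (2 * real n * \<rho>0)"
  have E4: "exp (4 * real n * \<rho>0) = E\<^sup>2" unfolding E_def exp_of_nat_mult[symmetric] by (simp add: exp_double[symmetric] mult_ac flip: exp_add)
  have l: "0 < (lam + mu) * (lam + 3 * mu)" using mu_pos lm_pos by (intro mult_pos_pos) auto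
  have m: "exp (4 * real n * \<rho>0) * mu\<^sup>2 + (lam + mu) * (lam + 3 * mu) + real n * q * (- (2 * E * mu) + real n * q) = (q * real n - E * mu)\<^sup>2 + (lam + mu) * (lam + 3 * mu)"
    and p: "exp (4 * real n * \<rho>0) * mu\<^sup>2 + (lam + mu) * (lam + 3 * mu) + real n * q * (2 * E * mu + real n * q) = (q * real n + E * mu)\<^sup>2 + (lam + mu) * (lam + 3 * mu)"
    unfolding E4 by (simp_all add: power2_eq_square algebra_simps)
  show "(gamma_minus lam mu \<rho>0 n)\<^sup>2 = (q0 lam mu \<rho>0 * real n - exp (2 * real n * \<rho>0) * mu)\<^sup>2 + (lam + mu) * (lam + 3 * mu)"
    unfolding gamma_minus_def Let_def q_def[symmetric] E_def[symmetric] m using l by (simp add: add_nonneg_nonneg)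
  show "(gamma_plus lam mu \<rho>0 n)\<^sup>2 = (q0 lam mu \<rho>0 * real n + exp (2 * real n * \<rho>0) * mu)\<^sup>2 + (lam + mu) * (lam + 3 * mu)"
    unfolding gamma_plus_def Let_def q_def[symmetric] E_def[symmetric] p using l by (simp add: add_nonneg_nonneg)
  show "0 \<le> gamma_plus lam mu \<rho>0 n"
    unfolding gamma_plus_def Let_def q_def[symmetric] E_def[symmetric] p using l by (simp add: add_nonneg_nonneg)
qed

lemma tn_eq: "tn kap n = exp (- 2 * real n * \<rho>0) / (lam + 2 * mu) * (q0 lam mu \<rho>0 * real n)"
proof -
  have "1 - kap = (lam + mu) / (lam + 2 * mu)" unfolding kap_def using M_pos by (simp add: field_simps)
  then show ?thesis unfolding tn_def SS_sinh rr_power q0_def by simp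
qed

text \<open>With the common factor x / (2 M) taken out, the product is the difference of squares of
  \<delta> G and \<epsilon> Q - E mu, which \<open>gamma_sq\<close> evaluates.\<close>

lemma block_root_real_root:
  assumes e: "\<epsilon> = 1 \<or> \<epsilon> = -1" and d: "\<delta> = 1 \<or> \<delta> = -1"
  shows "(block_root \<epsilon> \<delta> n + k0') * (block_root \<epsilon> \<delta> n - k0' + \<epsilon> * tn kap n) = pn kap n * sn kap n"
proof -
  define M where "M = lam + 2 * mu"
  define x where "x = exp (- 2 * real n * \<rho>0)"
  define E where "E = exp (2 * real n * \<rho>0)"
  define Q where "Q = q0 lam mu \<rho>0 * real n"
  define G where "G = (if \<epsilon> = 1 then gamma_minus lam mu \<rho>0 n else gamma_plus lam mu \<rho>0 n)"
  have M: "0 < M" "2 * mu + lam = M" using M_pos by (simp_all add: M_def)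
  \<comment> \<open>Lets k0, which contains no exponential, be written with the same factor x / (2
    M) as the root.\<close>
  have xE: "x * E = 1" by (simp add: x_def E_def flip: exp_add)
  have G2: "G\<^sup>2 = (\<epsilon> * Q - E * mu)\<^sup>2 + (lam + mu) * (lam + 3 * mu)"
    using e gamma_sq[of n] by (auto simp: G_def Q_def E_def power2_eq_square algebra_simps)
  have block_root: "block_root \<epsilon> \<delta> n = x / (2 * M) * (\<delta> * G - \<epsilon> * Q)" by (simp add: block_root_def x_def M_def Q_def G_def)
  have k0M: "k0' = x / (2 * M) * (E * mu)"
  proof -
    have "x / (2 * M) * (E * mu) = (x * E) * mu / (2 * M)" by simp
    then show ?thesis unfolding xE k0_def M(2) by simp
  qed
  have tM: "tn kap n = x / (2 * M) * (2 * Q)" unfolding tn_eq x_def[symmetric] Q_def[symmetric] M_def[symmetric] by simp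
  have "(block_root \<epsilon> \<delta> n + k0') * (block_root \<epsilon> \<delta> n - k0' + \<epsilon> * tn kap n)
     = (x / (2 * M))\<^sup>2 * ((\<delta> * G - (\<epsilon> * Q - E * mu)) * (\<delta> * G + (\<epsilon> * Q - E * mu)))"
  proof -
    define z where "z = x / (2 * M)"
    show ?thesis unfolding block_root k0M tM z_def[symmetric] by (simp add: power2_eq_square algebra_simps)
  qed
  also have "(\<delta> * G - (\<epsilon> * Q - E * mu)) * (\<delta> * G + (\<epsilon> * Q - E * mu)) = (\<delta> * \<delta>) * G\<^sup>2 - (\<epsilon> * Q - E * mu)\<^sup>2"
    by (simp add: power2_eq_square algebra_simps)
  also have "\<dots> = (lam + mu) * (lam + 3 * mu)" using d G2 by auto
  also have "(x / (2 * M))\<^sup>2 * ((lam + mu) * (lam + 3 * mu)) = pn kap n * sn kap n"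
  proof -
    have "1 - kap = (lam + mu) / M" "1 + kap = (lam + 3 * mu) / M"
      unfolding kap_def M(2) using M by (simp_all add: M_def field_simps)
    then show ?thesis unfolding pn_def sn_def rr_power x_def[symmetric] by (simp add: power2_eq_square)
  qed
  finally show ?thesis .
qed

lemma block_root_root: "\<epsilon> = 1 \<or> \<epsilon> = -1 \<Longrightarrow> \<delta> = 1 \<or> \<delta> = -1 \<Longrightarrow> is_block_root \<epsilon> n (of_real (block_root \<epsilon> \<delta> n))"
  unfolding is_block_root_def block_root_real_root[of \<epsilon> \<delta> n, symmetric] by simp

text \<open>The two closed forms have the sum of roots prescribed by the quadratic, so the quadratic
  factors as the product of the two differences.\<close>

lemma is_block_root_cases:
  assumes e: "\<epsilon> = 1 \<or> \<epsilon> = -1" and r: "is_block_root \<epsilon> n \<kappa>"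
  shows "\<kappa> = of_real (block_root \<epsilon> 1 n) \<or> \<kappa> = of_real (block_root \<epsilon> (-1) n)"
proof -
  have s: "block_root \<epsilon> 1 n + block_root \<epsilon> (-1) n = - (\<epsilon> * tn kap n)"
  proof -
    define M where "M = lam + 2 * mu"
    define x where "x = exp (- 2 * real n * \<rho>0)"
    have "x / M = 2 * (x / (2 * M))" by simp
    then show ?thesis unfolding block_root_def tn_eq x_def[symmetric] M_def[symmetric] by (simp add: algebra_simps)
  qed
  define A where "A = complex_of_real (block_root \<epsilon> 1 n)"
  define B where "B = complex_of_real (block_root \<epsilon> (-1) n)"
  define K where "K = complex_of_real k0'"
  define t where "t = complex_of_real (\<epsilon> * tn kap n)"
  have st: "t = - (A + B)" unfolding A_def B_def t_def of_real_add[symmetric] s by simp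
  have 1: "(\<kappa> + K) * (\<kappa> - K + t) = (A + K) * (A - K + t)"
    using r block_root_root[OF e, of 1 n] by (simp add: is_block_root_def A_def K_def t_def)
  have "(\<kappa> - A) * (\<kappa> - B) = (\<kappa> + K) * (\<kappa> - K + t) - (A + K) * (A - K + t)"
    unfolding st by (simp add: algebra_simps)
  then have "(\<kappa> - A) * (\<kappa> - B) = 0" unfolding 1 by simp
  then show ?thesis by (simp add: A_def B_def)
qed

text \<open>The identity 2 SS rr = 1 - rr^2 makes 1/2 a root at frequency 1, and the other root is
  not positive. So the second family at n = 1 coincides with the eigenvalue 1/2 and is listed only
  from n = 2 on.\<close>

lemma block_root_half: "block_root (-1) 1 1 = 1/2"
proof -
  have r1: "rr ^ 1 = rr" by simp
  have "2 * SS * rr = 1 - rr\<^sup>2"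
  proof -
    have "SS = (exp (2 * \<rho>0) - exp (- 2 * \<rho>0)) / 2" unfolding SS_sinh by (simp add: sinh_def)
    moreover define x where "x = exp (2 * \<rho>0)"
    moreover define y where "y = exp (- 2 * \<rho>0)"
    ultimately have SSxy: "SS = (x - y) / 2" and "rr = y" using rr_exp by simp_all
    have "x * y = 1" by (simp add: x_def y_def flip: exp_add)
    moreover have "2 * ((x - y) / 2) * y = x * y - y\<^sup>2" by (simp add: power2_eq_square left_diff_distrib)
    ultimately show ?thesis unfolding SSxy \<open>rr = y\<close> by simp
  qed
  then have t: "tn kap 1 = (1 - kap) * (1 - rr\<^sup>2) / 2" by (simp add: tn_def mult_ac)
  have "(1/2 + kap/2) * (1/2 - kap/2 + (-1) * tn kap 1) = pn kap 1 * sn kap 1"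
    unfolding t pn_def sn_def r1 by (simp add: power2_eq_square field_simps)
  then have "complex_of_real ((1/2 + kap/2) * (1/2 - kap/2 + (-1) * tn kap 1)) = complex_of_real (pn kap 1 * sn kap 1)" by (simp only:)
  then have "is_block_root (-1) 1 (of_real (1/2))" unfolding is_block_root_def k0_kap
    by (simp only: of_real_mult of_real_add of_real_diff)
  then have "complex_of_real (1/2) = of_real (block_root (-1) 1 1) \<or> complex_of_real (1/2) = of_real (block_root (-1) (-1) 1)"
    by (rule is_block_root_cases[rotated]) simp
  then have "1/2 = block_root (-1) 1 1 \<or> 1/2 = block_root (-1) (-1) 1" by (simp only: of_real_eq_iff)
  moreover have "block_root (-1) (-1) 1 < 1/2"
  proof -
    define Q where "Q = q0 lam mu \<rho>0 * real 1"
    have Q: "0 \<le> Q" using lm_pos rho_pos by (simp add: Q_def q0_def)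
    have "Q\<^sup>2 \<le> (Q + exp (2 * real 1 * \<rho>0) * mu)\<^sup>2" using Q mu_pos by (intro power_mono) auto
    moreover have "0 \<le> (lam + mu) * (lam + 3 * mu)" using mu_pos lm_pos by (intro mult_nonneg_nonneg) auto
    ultimately have "Q\<^sup>2 \<le> (gamma_plus lam mu \<rho>0 1)\<^sup>2" unfolding gamma_sq Q_def by linarith
    then have "Q \<le> gamma_plus lam mu \<rho>0 1" using gamma_sq(3) by (rule power2_le_imp_le)
    then have "block_root (-1) (-1) 1 \<le> 0" unfolding block_root_def Q_def[symmetric] using M_pos by (intro mult_nonneg_nonpos) (auto simp: Q_def)
    then show ?thesis by simp
  qed
  ultimately show ?thesis by auto
qed

end

lemma module_functional: "module (\<lambda>(c::complex) (F::functional) f. c * F f)"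
  by standard (auto simp: fun_eq_iff algebra_simps)

text \<open>Gives the span calculus for exactly the scalar multiplication that occurs in
  \<open>cspan\<close>.\<close>

interpretation functional: module "\<lambda>(c::complex) (F::functional) f. c * F f"
  by (rule module_functional)

section \<open>The listed densities as block vectors\<close>

context lame_ell
begin

text \<open>The phase D is 1 for \<epsilon> = 1 and i for \<epsilon> = -1: reality of the density
  ties the B-coefficients to the conjugate of D, and the condition on D turns this into the sign
  \<epsilon>.\<close>

lemma block_form_bd:
  fixes D :: complex and k c :: real
  assumes g: "\<And>t. speed t *\<^sub>R g t = vector [v1 t, v2 t]"
    and v: "\<And>t. of_real (v1 t) + \<i> * of_real (v2 t) = D * of_real (c * (k + k0')) * cis (real n * t) + D * of_real (c * pn kap n) * cis (- (real n * t))"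
    and D: "cnj D = of_real \<epsilon> * D"
  shows "block_form \<epsilon> n (of_real k) (2 * of_real pi * D * of_real c) (bd g)"
  unfolding block_form_def
proof (intro conjI allI)
  note b = bd_coefficients[OF g v]
  show "bd g \<in> Hm" by (rule b(1))
  show "cA (hat (bd g)) m = 2 * of_real pi * D * of_real c * ((if m = - int n then of_real k + of_real k0' else 0) + (if m = int n then of_real (pn kap n) else 0))" for m
    unfolding b(2) by (simp add: algebra_simps)
  show "cB (hat (bd g)) m = of_real \<epsilon> * (2 * of_real pi * D * of_real c * ((if m = int n then of_real k + of_real k0' else 0) + (if m = - int n then of_real (pn kap n) else 0)))" for m
    unfolding b(3) by (simp add: D algebra_simps)
qed

lemma block_root_neq: "\<epsilon> = 1 \<or> \<epsilon> = -1 \<Longrightarrow> \<delta> = 1 \<or> \<delta> = -1 \<Longrightarrow> k0' + block_root \<epsilon> \<delta> n \<noteq> 0"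
  using is_block_root_neq[OF block_root_root[of \<epsilon> \<delta> n]] by (simp add: add.commute flip: of_real_add)

text \<open>Scaling by the reciprocal of k0 + k1 makes the amplitude of \<open>psi1\<close> equal to
  1, and that of \<open>psi3\<close> the stated quotient. \<open>phi2\<close> is the same with the
  phase i.\<close>

lemma phi1_form:
  "\<exists>c\<noteq>0. block_form 1 n (of_real (k1 lam mu \<rho>0 n)) c (bd (phi1 lam mu R \<rho>0 n))"
proof -
  define x where "x = p0 lam mu \<rho>0 n / (k0' + block_root 1 1 n)"
  define c where "c = 1 / (k0' + block_root 1 1 n)"
  have nz: "k0' + block_root 1 1 n \<noteq> 0" by (rule block_root_neq) auto
  have c: "c * (block_root 1 1 n + k0') = 1" "c * pn kap n = x"
    using nz by (simp_all add: c_def x_def p0_pn add.commute)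
  have cn: "c \<noteq> 0" using nz by (simp add: c_def)
  have "block_form 1 n (of_real (block_root 1 1 n)) (2 * of_real pi * 1 * of_real c) (bd (phi1 lam mu R \<rho>0 n))"
  proof (rule block_form_bd)
    show "speed t *\<^sub>R phi1 lam mu R \<rho>0 n t = vector [(1 + x) * cos (real n * t), (1 - x) * sin (real n * t)]" for t
      using speed_pos[of t] by (simp add: phi1_def psi1_def psi3_def h0_speed k_block_root x_def[symmetric] vec_eq_iff forall_2 field_simps)
    show "of_real ((1 + x) * cos (real n * t)) + \<i> * of_real ((1 - x) * sin (real n * t))
      = (1::complex) * of_real (c * (block_root 1 1 n + k0')) * cis (real n * t) + 1 * of_real (c * pn kap n) * cis (- (real n * t))" for t
      unfolding c by (simp add: complex_eq_iff algebra_simps)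
  qed simp
  then show ?thesis unfolding k_block_root using cn by (intro exI[of _ "2 * of_real pi * 1 * of_real c"]) simp
qed

lemma phi2_form:
  "\<exists>c\<noteq>0. block_form (-1) n (of_real (k2 lam mu \<rho>0 n)) c (bd (phi2 lam mu R \<rho>0 n))"
proof -
  define x where "x = p0 lam mu \<rho>0 n / (k0' + block_root (-1) 1 n)"
  define c where "c = 1 / (k0' + block_root (-1) 1 n)"
  have nz: "k0' + block_root (-1) 1 n \<noteq> 0" by (rule block_root_neq) auto
  have c: "c * (block_root (-1) 1 n + k0') = 1" "c * pn kap n = x"
    using nz by (simp_all add: c_def x_def p0_pn add.commute)
  have cn: "c \<noteq> 0" using nz by (simp add: c_def)
  have "block_form (-1) n (of_real (block_root (-1) 1 n)) (2 * of_real pi * \<i> * of_real c) (bd (phi2 lam mu R \<rho>0 n))"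
  proof (rule block_form_bd)
    show "speed t *\<^sub>R phi2 lam mu R \<rho>0 n t = vector [(x - 1) * sin (real n * t), (1 + x) * cos (real n * t)]" for t
      using speed_pos[of t] by (simp add: phi2_def psi2_def psi4_def h0_speed k_block_root x_def[symmetric] vec_eq_iff forall_2 field_simps)
    show "of_real ((x - 1) * sin (real n * t)) + \<i> * of_real ((1 + x) * cos (real n * t))
      = \<i> * of_real (c * (block_root (-1) 1 n + k0')) * cis (real n * t) + \<i> * of_real (c * pn kap n) * cis (- (real n * t))" for t
      unfolding c by (simp add: complex_eq_iff algebra_simps)
  qed simp
  then show ?thesis unfolding k_block_root using cn by (intro exI[of _ "2 * of_real pi * \<i> * of_real c"]) simp
qed

text \<open>Here the scale 1 / \<open>pn kap n\<close> makes the amplitude of \<open>psi3\<close>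
  equal to 1; \<open>phi4\<close> is the same with the phase i.\<close>

lemma phi3_form:
  "\<exists>c\<noteq>0. block_form 1 n (of_real (k3 lam mu \<rho>0 n)) c (bd (phi3 lam mu R \<rho>0 n))"
proof -
  define y where "y = (k0' + block_root 1 (-1) n) / p0 lam mu \<rho>0 n"
  define c where "c = 1 / pn kap n"
  have c: "c * (block_root 1 (-1) n + k0') = y" "c * pn kap n = 1"
    using pn_pos[of n] by (simp_all add: c_def y_def p0_pn add.commute)
  have "block_form 1 n (of_real (block_root 1 (-1) n)) (2 * of_real pi * 1 * of_real c) (bd (phi3 lam mu R \<rho>0 n))"
  proof (rule block_form_bd)
    show "speed t *\<^sub>R phi3 lam mu R \<rho>0 n t = vector [(y + 1) * cos (real n * t), (y - 1) * sin (real n * t)]" for t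
      using speed_pos[of t] by (simp add: phi3_def psi1_def psi3_def h0_speed k_block_root y_def[symmetric] vec_eq_iff forall_2 field_simps)
    show "of_real ((y + 1) * cos (real n * t)) + \<i> * of_real ((y - 1) * sin (real n * t))
      = (1::complex) * of_real (c * (block_root 1 (-1) n + k0')) * cis (real n * t) + 1 * of_real (c * pn kap n) * cis (- (real n * t))" for t
      unfolding c by (simp add: complex_eq_iff algebra_simps)
  qed simp
  then show ?thesis unfolding k_block_root using pn_pos[of n] by (intro exI[of _ "2 * of_real pi * 1 * of_real c"]) (simp add: c_def)
qed

lemma phi4_form:
  "\<exists>c\<noteq>0. block_form (-1) n (of_real (k4 lam mu \<rho>0 n)) c (bd (phi4 lam mu R \<rho>0 n))"
proof -
  define y where "y = (k0' + block_root (-1) (-1) n) / p0 lam mu \<rho>0 n"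
  define c where "c = 1 / pn kap n"
  have c: "c * (block_root (-1) (-1) n + k0') = y" "c * pn kap n = 1"
    using pn_pos[of n] by (simp_all add: c_def y_def p0_pn add.commute)
  have "block_form (-1) n (of_real (block_root (-1) (-1) n)) (2 * of_real pi * \<i> * of_real c) (bd (phi4 lam mu R \<rho>0 n))"
  proof (rule block_form_bd)
    show "speed t *\<^sub>R phi4 lam mu R \<rho>0 n t = vector [(1 - y) * sin (real n * t), (y + 1) * cos (real n * t)]" for t
      using speed_pos[of t] by (simp add: phi4_def psi2_def psi4_def h0_speed k_block_root y_def[symmetric] vec_eq_iff forall_2 field_simps)
    show "of_real ((1 - y) * sin (real n * t)) + \<i> * of_real ((y + 1) * cos (real n * t))
      = \<i> * of_real (c * (block_root (-1) (-1) n + k0')) * cis (real n * t) + \<i> * of_real (c * pn kap n) * cis (- (real n * t))" for t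
      unfolding c by (simp add: complex_eq_iff algebra_simps)
  qed simp
  then show ?thesis unfolding k_block_root using pn_pos[of n] by (intro exI[of _ "2 * of_real pi * \<i> * of_real c"]) (simp add: c_def)
qed

definition g3 :: "real \<Rightarrow> real^2" where
  "g3 = (\<lambda>\<omega>. (1 / h0 R \<rho>0 \<omega>) *\<^sub>R
         vector [((lam + mu) * exp (- 2 * \<rho>0) - (lam + 3 * mu)) * sin \<omega>,
                 ((lam + mu) * exp (- 2 * \<rho>0) + (lam + 3 * mu)) * cos \<omega>])"

text \<open>The third function for the eigenvalue \<open>1/2\<close> is the missing case \<open>n = 1\<close> of the
  second family.\<close>

lemma g3_form: "\<exists>c\<noteq>0. block_form (-1) 1 (of_real (1/2)) c (bd g3)"
proof -
  define M where "M = lam + 2 * mu"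
  define c where "c = 2 * M"
  have M: "0 < M" using M_pos by (simp add: M_def)
  have kM: "1 - kap = (lam + mu) / M" "1 + kap = (lam + 3 * mu) / M"
    unfolding kap_def using M by (simp_all add: M_def field_simps)
  have "c * (1/2 + k0') = M * (1 + kap)" by (simp add: c_def k0_kap field_simps)
  then have c1: "c * (1/2 + k0') = lam + 3 * mu" unfolding kM using M by simp
  have "c * pn kap 1 = M * (1 - kap) * rr" by (simp add: c_def pn_def)
  then have c2: "c * pn kap 1 = (lam + mu) * exp (- 2 * \<rho>0)" unfolding kM rr_exp using M by simp
  have "block_form (-1) 1 (of_real (1/2)) (2 * of_real pi * \<i> * of_real c) (bd g3)"
  proof (rule block_form_bd)
    show "speed t *\<^sub>R g3 t = vector [((lam + mu) * exp (- 2 * \<rho>0) - (lam + 3 * mu)) * sin t, ((lam + mu) * exp (- 2 * \<rho>0) + (lam + 3 * mu)) * cos t]" for t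
      using speed_pos[of t] by (simp add: g3_def h0_speed)
    show "of_real (((lam + mu) * exp (- 2 * \<rho>0) - (lam + 3 * mu)) * sin t) + \<i> * of_real (((lam + mu) * exp (- 2 * \<rho>0) + (lam + 3 * mu)) * cos t)
      = \<i> * of_real (c * (1/2 + k0')) * cis (real 1 * t) + \<i> * of_real (c * pn kap 1) * cis (- (real 1 * t))" for t
      unfolding c1 c2 by (simp add: complex_eq_iff algebra_simps)
  qed simp
  then show ?thesis using M by (intro exI[of _ "2 * of_real pi * \<i> * of_real c"]) (simp add: c_def)
qed

definition zform :: "complex \<Rightarrow> functional \<Rightarrow> bool" where
  "zform \<alpha> F \<longleftrightarrow> F \<in> Hm \<and> (\<forall>m. cA (hat F) m = (if m = 0 then 2 * of_real pi * \<alpha> else 0) \<and> cB (hat F) m = (if m = 0 then 2 * of_real pi * cnj \<alpha> else 0))"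

definition g1 :: "real \<Rightarrow> real^2" where "g1 = (\<lambda>\<omega>. (1 / h0 R \<rho>0 \<omega>) *\<^sub>R vector [1, 0])"
definition g2 :: "real \<Rightarrow> real^2" where "g2 = (\<lambda>\<omega>. (1 / h0 R \<rho>0 \<omega>) *\<^sub>R vector [0, 1])"

lemma g1_form: "zform 1 (bd g1)" and g2_form: "zform \<i> (bd g2)"
proof -
  have g1: "speed t *\<^sub>R g1 t = vector [1, 0]" for t using speed_pos[of t] by (simp add: g1_def h0_speed)
  have v1: "of_real 1 + \<i> * of_real 0 = 1 * cis (real 0 * t) + 0 * cis (- (real 0 * t))" for t :: real by simp
  show "zform 1 (bd g1)" unfolding zform_def using bd_coefficients[OF g1 v1] by simp
  have g2: "speed t *\<^sub>R g2 t = vector [0, 1]" for t using speed_pos[of t] by (simp add: g2_def h0_speed)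
  have v2: "of_real 0 + \<i> * of_real 1 = \<i> * cis (real 0 * t) + 0 * cis (- (real 0 * t))" for t :: real by simp
  show "zform \<i> (bd g2)" unfolding zform_def using bd_coefficients[OF g2 v2] by simp
qed

lemma zform_eigen: assumes "zform \<alpha> F" shows "T F = (\<lambda>f. of_real (1/2) * F f)"
proof (rule T_eqI)
  show "F \<in> Hm" using assms by (simp add: zform_def)
  have A: "cA (hat F) m = (if m = 0 then 2 * of_real pi * \<alpha> else 0)" and B: "cB (hat F) m = (if m = 0 then 2 * of_real pi * cnj \<alpha> else 0)" for m
    using assms by (auto simp: zform_def)
  show "cA (hat F) 0 / 2 = of_real (1/2) * cA (hat F) 0" "cB (hat F) 0 / 2 = of_real (1/2) * cB (hat F) 0" by simp_all
  fix n :: nat assume n: "0 < n"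
  show "cA (NP_symbol kap (hat F)) (int n) = of_real (1/2) * cA (hat F) (int n)"
    "cB (NP_symbol kap (hat F)) (int n) = of_real (1/2) * cB (hat F) (int n)"
    "cA (NP_symbol kap (hat F)) (- int n) = of_real (1/2) * cA (hat F) (- int n)"
    "cB (NP_symbol kap (hat F)) (- int n) = of_real (1/2) * cB (hat F) (- int n)"
    unfolding NP_symbol_blocks[OF n] A B using n by simp_all
qed

lemma eigenpairs_eq:
  "eigenpairs lam mu R \<rho>0 = {(1/2, g1), (1/2, g2), (1/2, g3)}
     \<union> {(k1 lam mu \<rho>0 n, phi1 lam mu R \<rho>0 n) | n. 1 \<le> n}
     \<union> {(k2 lam mu \<rho>0 n, phi2 lam mu R \<rho>0 n) | n. 2 \<le> n}
     \<union> {(k3 lam mu \<rho>0 n, phi3 lam mu R \<rho>0 n) | n. 1 \<le> n}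
     \<union> {(k4 lam mu \<rho>0 n, phi4 lam mu R \<rho>0 n) | n. 1 \<le> n}"
  unfolding eigenpairs_def g1_def g2_def g3_def ..

lemma hat_zero: "hat 0 n i = 0" by (simp add: hat_def)

lemma block_form_nonzero: assumes "block_form \<epsilon> n \<kappa> c F" "c \<noteq> 0" "0 < n" shows "F \<noteq> 0"
proof
  assume "F = 0"
  then have "cA (hat F) (int n) = 0" by (simp add: cA_def hat_zero)
  moreover have "cA (hat F) (int n) = c * of_real (pn kap n)" using assms by (simp add: block_form_def)
  ultimately show False using assms pn_pos[of n] by simp
qed

lemma zform_nonzero: assumes "zform \<alpha> F" "\<alpha> \<noteq> 0" shows "F \<noteq> 0"
proof
  assume "F = 0"
  then have "cA (hat F) 0 = 0" by (simp add: cA_def hat_zero)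
  moreover have "cA (hat F) 0 = 2 * of_real pi * \<alpha>" using assms by (simp add: zform_def)
  ultimately show False using assms by simp
qed

lemma eigenpair_eigen:
  assumes "(k, g) \<in> eigenpairs lam mu R \<rho>0"
  shows "bd g \<in> eigenspace Hm T (of_real k)" and "bd g \<noteq> 0"
proof -
  have b: "bd g \<in> eigenspace Hm T (of_real k) \<and> bd g \<noteq> 0"
    if F: "\<exists>c\<noteq>0. block_form \<epsilon> n (of_real k) c (bd g)" and rt: "is_block_root \<epsilon> n (of_real k)" and n: "1 \<le> n" and e: "\<epsilon> = 1 \<or> \<epsilon> = -1" for \<epsilon> n k g
  proof -
    obtain c where c: "c \<noteq> 0" "block_form \<epsilon> n (of_real k) c (bd g)" using F by (elim exE conjE)
    then have "bd g \<in> Hm" by (simp add: block_form_def)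
    moreover have "0 < n" using n by simp
    ultimately show ?thesis using block_form_eigen[OF c(2) _ e rt] block_form_nonzero[OF c(2,1)] unfolding eigenspace_def by blast
  qed
  have z: "bd g \<in> eigenspace Hm T (of_real (1/2)) \<and> bd g \<noteq> 0" if "zform \<alpha> (bd g)" "\<alpha> \<noteq> 0" for \<alpha> g
    using zform_eigen[OF that(1)] zform_nonzero[OF that] that(1) unfolding eigenspace_def zform_def by blast
  have r: "is_block_root 1 n (of_real (k1 lam mu \<rho>0 n))" "is_block_root (-1) n (of_real (k2 lam mu \<rho>0 n))"
    "is_block_root 1 n (of_real (k3 lam mu \<rho>0 n))" "is_block_root (-1) n (of_real (k4 lam mu \<rho>0 n))" for n
    unfolding k_block_root by (rule block_root_root; simp)+
  \<comment> \<open>The value 1/2 enters as k2 at n = 1, an index outside the listed second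
    family.\<close>
  have r3: "is_block_root (-1) 1 (of_real (1/2))" using r(2)[of 1] unfolding k_block_root block_root_half .
  have "bd g \<in> eigenspace Hm T (of_real k) \<and> bd g \<noteq> 0"
    using assms unfolding eigenpairs_eq
  proof (elim UnE)
    assume "(k, g) \<in> {(1/2, g1), (1/2, g2), (1/2, g3)}"
    then have k: "k = 1/2" and "g = g1 \<or> g = g2 \<or> g = g3" by blast+
    then show ?thesis using z[OF g1_form] z[OF g2_form] b[OF g3_form r3] unfolding k by auto
  next
    assume "(k, g) \<in> {(k1 lam mu \<rho>0 n, phi1 lam mu R \<rho>0 n) | n. 1 \<le> n}"
    then show ?thesis using b[OF phi1_form r(1)] by auto
  next
    assume "(k, g) \<in> {(k2 lam mu \<rho>0 n, phi2 lam mu R \<rho>0 n) | n. 2 \<le> n}"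
    then obtain n where "2 \<le> n" "k = k2 lam mu \<rho>0 n" "g = phi2 lam mu R \<rho>0 n" by auto
    then show ?thesis using b[OF phi2_form r(2), of n] by simp
  next
    assume "(k, g) \<in> {(k3 lam mu \<rho>0 n, phi3 lam mu R \<rho>0 n) | n. 1 \<le> n}"
    then show ?thesis using b[OF phi3_form r(3)] by auto
  next
    assume "(k, g) \<in> {(k4 lam mu \<rho>0 n, phi4 lam mu R \<rho>0 n) | n. 1 \<le> n}"
    then show ?thesis using b[OF phi4_form r(4)] by auto
  qed
  then show "bd g \<in> eigenspace Hm T (of_real k)" "bd g \<noteq> 0" by auto
qed

text \<open>Converse direction: every root of every block is represented in the list, with
  \<open>g3\<close> standing in for the second family at n = 1.\<close>

lemma root_eigenpair:
  assumes n: "1 \<le> n" and e: "\<epsilon> = 1 \<or> \<epsilon> = -1" and r: "is_block_root \<epsilon> n \<kappa>"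
  shows "\<exists>k g c. (k, g) \<in> eigenpairs lam mu R \<rho>0 \<and> of_real k = \<kappa> \<and> c \<noteq> 0 \<and> block_form \<epsilon> n \<kappa> c (bd g)"
proof -
  have mem1: "(k1 lam mu \<rho>0 n, phi1 lam mu R \<rho>0 n) \<in> eigenpairs lam mu R \<rho>0"
    and mem3: "(k3 lam mu \<rho>0 n, phi3 lam mu R \<rho>0 n) \<in> eigenpairs lam mu R \<rho>0"
    and mem4: "(k4 lam mu \<rho>0 n, phi4 lam mu R \<rho>0 n) \<in> eigenpairs lam mu R \<rho>0"
    using n unfolding eigenpairs_eq by blast+
  from is_block_root_cases[OF e r] e consider
    "\<epsilon> = 1" "\<kappa> = of_real (k1 lam mu \<rho>0 n)" | "\<epsilon> = -1" "\<kappa> = of_real (k2 lam mu \<rho>0 n)"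
    | "\<epsilon> = 1" "\<kappa> = of_real (k3 lam mu \<rho>0 n)" | "\<epsilon> = -1" "\<kappa> = of_real (k4 lam mu \<rho>0 n)"
    unfolding k_block_root by blast
  then show ?thesis
  proof cases
    case 1
    then show ?thesis using phi1_form[of n] mem1 by blast
  next
    case 2
    show ?thesis
    proof (cases "n = 1")
      case True
      have "\<kappa> = of_real (1/2)" using 2 True unfolding k_block_root block_root_half[symmetric] by simp
      moreover have "(1/2, g3) \<in> eigenpairs lam mu R \<rho>0" unfolding eigenpairs_eq by blast
      ultimately show ?thesis using g3_form 2(1) True by blast
    next
      case False
      then have "(k2 lam mu \<rho>0 n, phi2 lam mu R \<rho>0 n) \<in> eigenpairs lam mu R \<rho>0"
        using n unfolding eigenpairs_eq by fastforce
      then show ?thesis using phi2_form[of n] 2 by blast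
    qed
  next
    case 3
    then show ?thesis using phi3_form[of n] mem3 by blast
  next
    case 4
    then show ?thesis using phi4_form[of n] mem4 by blast
  qed
qed

text \<open>As \<open>n\<close> grows the roots tend to \<open>k0\<close> and \<open>- k0\<close>. The value \<open>- k0\<close> is never a root,
  and \<open>k0\<close> is a root for at most finitely many \<open>n\<close>.\<close>

lemma finitely_many_roots: "\<exists>N. \<forall>n>N. \<not> is_block_root 1 n \<kappa> \<and> \<not> is_block_root (-1) n \<kappa>"
proof -
  define K where "K = complex_of_real k0'"
  have r0: "(\<lambda>n. rr ^ n) \<longlonglongrightarrow> 0" using rr_bounds by (intro LIMSEQ_power_zero) simp
  have "(\<lambda>n. real n * rr ^ n) \<longlonglongrightarrow> 0" using rr_bounds by (intro powser_times_n_limit_0) simp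
  then have "(\<lambda>n. (1 - kap) * SS * (real n * rr ^ n)) \<longlonglongrightarrow> 0" by (rule tendsto_mult_right_zero)
  then have t0: "(\<lambda>n. tn kap n) \<longlonglongrightarrow> 0" by (simp add: tn_def mult.assoc)
  have p0: "(\<lambda>n. pn kap n) \<longlonglongrightarrow> 0" and s0: "(\<lambda>n. sn kap n) \<longlonglongrightarrow> 0"
    unfolding pn_def sn_def by (intro tendsto_mult_right_zero r0)+
  have ev: "eventually (\<lambda>n. \<not> is_block_root \<epsilon> n \<kappa>) sequentially" if e: "\<epsilon> = 1 \<or> \<epsilon> = -1" for \<epsilon>
  proof (cases "(\<kappa> + K) * (\<kappa> - K) = 0")
    case False
    have "(\<lambda>n. (\<kappa> + K) * (\<kappa> - K + of_real (\<epsilon> * tn kap n)) - of_real (pn kap n * sn kap n)) \<longlonglongrightarrow> (\<kappa> + K) * (\<kappa> - K + of_real (\<epsilon> * 0)) - of_real (0 * 0)"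
      by (intro tendsto_intros t0 p0 s0)
    then have "eventually (\<lambda>n. (\<kappa> + K) * (\<kappa> - K + of_real (\<epsilon> * tn kap n)) - of_real (pn kap n * sn kap n) \<noteq> 0) sequentially"
      by (rule tendsto_imp_eventually_ne) (use False in simp)
    then show ?thesis by eventually_elim (simp add: is_block_root_def K_def)
  next
    case True
    show ?thesis
    proof (cases "\<kappa> = K")
      case False
      then have "\<kappa> + K = 0" using True by simp
      then have "\<not> is_block_root \<epsilon> n \<kappa>" for n using is_block_root_neq[of \<epsilon> n \<kappa>] by (auto simp: K_def)
      then show ?thesis by simp
    next
      case True
      \<comment> \<open>At \<kappa> = k0 the equation reduces to \<epsilon> kap tn = pn sn. The left
        side carries n rr^n and the right side rr^(2n), which bounds n; a negative \<epsilon> is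
        excluded by sign.\<close>
      have key: "real n \<le> 1 / (2 * kap * SS)" if "is_block_root \<epsilon> n \<kappa>" for n
      proof -
        have "complex_of_real (kap * (\<epsilon> * tn kap n)) = of_real (pn kap n * sn kap n)"
          using that unfolding is_block_root_def True K_def k0_kap by (simp add: mult.assoc)
        then have eq: "kap * (\<epsilon> * tn kap n) = pn kap n * sn kap n" by (simp only: of_real_eq_iff)
        have tp: "0 \<le> tn kap n" unfolding tn_def using kap_bounds rr_bounds SS_nonzero by (intro mult_nonneg_nonneg) auto
        have ps: "0 < pn kap n * sn kap n" using pn_pos sn_pos by simp
        have "\<epsilon> = 1"
        proof (rule ccontr)
          assume "\<epsilon> \<noteq> 1"
          then have "kap * (\<epsilon> * tn kap n) \<le> 0" using e tp kap_bounds by (simp add: mult_nonneg_nonneg)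
          then show False using eq ps by simp
        qed
        then have "((1 - kap) * rr ^ n) * (kap * SS * real n) = ((1 - kap) * rr ^ n) * ((1 + kap) * rr ^ n / 4)"
          using eq by (simp add: tn_def pn_def sn_def mult_ac)
        moreover have "(1 - kap) * rr ^ n \<noteq> 0" using kap_bounds rr_bounds by simp
        ultimately have "kap * SS * real n = (1 + kap) * rr ^ n / 4" by (simp only: mult_cancel_left simp_thms)
        also have "\<dots> \<le> 2 * 1 / 4" using kap_bounds rr_bounds
          by (intro divide_right_mono mult_mono power_le_one) auto
        finally show ?thesis using kap_bounds SS_nonzero by (simp add: field_simps)
      qed
      have "eventually (\<lambda>n. 1 / (2 * kap * SS) < real n) sequentially"
        by (rule eventually_gt_at_top[THEN filterlim_real_sequentially[unfolded filterlim_iff, rule_format]])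
      then show ?thesis by eventually_elim (use key in force)
    qed
  qed
  have "eventually (\<lambda>n. \<not> is_block_root 1 n \<kappa> \<and> \<not> is_block_root (-1) n \<kappa>) sequentially"
    using ev[of 1] ev[of "-1"] by (intro eventually_conj) auto
  then obtain N where "\<forall>n\<ge>N. \<not> is_block_root 1 n \<kappa> \<and> \<not> is_block_root (-1) n \<kappa>" unfolding eventually_sequentially by blast
  then show ?thesis by (intro exI[of _ N]) simp
qed

section \<open>Eigenspaces as spans of the listed densities\<close>

definition eset :: "complex \<Rightarrow> functional set" where
  "eset \<kappa> = {bd g | k g. (k, g) \<in> eigenpairs lam mu R \<rho>0 \<and> complex_of_real k = \<kappa>}"

lemma hat_add_AB: "cA (hat (F + G)) m = cA (hat F) m + cA (hat G) m" "cB (hat (F + G)) m = cB (hat F) m + cB (hat G) m"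
  and hat_cmult_AB: "cA (hat (\<lambda>f. c * F f)) m = c * cA (hat F) m" "cB (hat (\<lambda>f. c * F f)) m = c * cB (hat F) m"
  by (simp_all add: cA_def cB_def hat_plus hat_cmult algebra_simps)

lemma hat_zero_AB: "cA (hat 0) m = 0" "cB (hat 0) m = 0"
  by (simp_all add: cA_def cB_def hat_zero)

lemma eigenspace_subspace: "functional.subspace (eigenspace Hm T \<kappa>)"
proof (rule functional.subspaceI)
  obtain K where K: "mult_seq (NP_symbol kap) K" using NP_symbol_mult_seq by blast
  note bT = bounded_mult_op[OF K, unfolded bounded_operator_on_def]
  have z: "0 \<in> Hm" unfolding H_mhalf_def by (auto intro!: exI[of _ 0])
  have "T 0 = 0"
  proof -
    have "T (\<lambda>f. 0 * (0::functional) f) = (\<lambda>f. 0 * T 0 f)" using bT z by blast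
    then show ?thesis by (simp add: fun_eq_iff zero_fun_def)
  qed
  then show "0 \<in> eigenspace Hm T \<kappa>" using z by (simp add: eigenspace_def fun_eq_iff)
  show "F + G \<in> eigenspace Hm T \<kappa>" if "F \<in> eigenspace Hm T \<kappa>" "G \<in> eigenspace Hm T \<kappa>" for F G
    using that bT Hm_plus by (auto simp: eigenspace_def fun_eq_iff distrib_left)
  show "(\<lambda>f. c * F f) \<in> eigenspace Hm T \<kappa>" if "F \<in> eigenspace Hm T \<kappa>" for c F
  proof -
    have "T (\<lambda>f. c * F f) = (\<lambda>f. c * T F f)" using that bT by (simp add: eigenspace_def)
    then show ?thesis using that Hm_cmult by (auto simp: eigenspace_def fun_eq_iff)
  qed
qed

lemma eset_sub: "eset \<kappa> \<subseteq> eigenspace Hm T \<kappa>"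
  using eigenpair_eigen(1) by (auto simp: eset_def)

lemma span_sub: "functional.span (eset \<kappa>) \<subseteq> eigenspace Hm T \<kappa>"
  by (rule functional.span_minimal[OF eset_sub eigenspace_subspace])

lemma span_Hm: "D \<in> functional.span (eset \<kappa>) \<Longrightarrow> D \<in> Hm"
  using span_sub by (auto simp: eigenspace_def)

lemma eigen_coefficients:
  assumes F: "F \<in> eigenspace Hm T \<kappa>"
  shows "cA (NP_symbol kap (hat F)) m = \<kappa> * cA (hat F) m" "cB (NP_symbol kap (hat F)) m = \<kappa> * cB (hat F) m"
proof -
  have "F \<in> Hm" "T F = (\<lambda>f. \<kappa> * F f)" using F by (auto simp: eigenspace_def)
  then have "NP_symbol kap (hat F) = hat (\<lambda>f. \<kappa> * F f)" using hat_mult_op[of F "NP_symbol kap"] by simp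
  then show "cA (NP_symbol kap (hat F)) m = \<kappa> * cA (hat F) m" "cB (NP_symbol kap (hat F)) m = \<kappa> * cB (hat F) m"
    by (simp_all add: hat_cmult_AB)
qed

text \<open>X and Y are the even or odd combinations that satisfy a two by two system. A nonzero X
  forces the characteristic equation, and X = 0 forces Y = 0 because \<open>pn\<close> is not zero,
  so each block contributes at most one dimension.\<close>

lemma half_block:
  assumes F: "F \<in> eigenspace Hm T \<kappa>" and n: "0 < n" and e: "\<epsilon> = 1 \<or> \<epsilon> = -1"
  defines "X \<equiv> cA (hat F) (int n) + of_real \<epsilon> * cB (hat F) (- int n)"
    and "Y \<equiv> cA (hat F) (- int n) + of_real \<epsilon> * cB (hat F) (int n)"
  shows "\<not> is_block_root \<epsilon> n \<kappa> \<Longrightarrow> X = 0 \<and> Y = 0"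
    and "\<exists>D \<in> functional.span (eset \<kappa>). \<forall>m.
      cA (hat D) m = (if m = int n then X/2 else 0) + (if m = - int n then Y/2 else 0) \<and>
      cB (hat D) m = of_real \<epsilon> * ((if m = int n then Y/2 else 0) + (if m = - int n then X/2 else 0))"
proof -
  define K where "K = complex_of_real k0'"
  define p where "p = complex_of_real (pn kap n)"
  define s where "s = complex_of_real (sn kap n)"
  define t where "t = complex_of_real (tn kap n)"
  define e' where "e' = complex_of_real \<epsilon>"
  have K2: "complex_of_real (kap/2) = K" by (simp add: K_def k0_kap)
  have ee: "e' * e' = 1" using e by (auto simp: e'_def)
  have p0: "p \<noteq> 0" using pn_pos[of n] by (simp add: p_def)
  define u where "u = cA (hat F) (int n)"
  define v where "v = cB (hat F) (int n)"
  define u' where "u' = cA (hat F) (- int n)"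
  define v' where "v' = cB (hat F) (- int n)"
  note bl = NP_symbol_blocks[OF n, of kap "hat F", unfolded eigen_coefficients[OF F] K2, folded p_def s_def t_def u_def v_def u'_def v'_def]
  have XY: "X = u + e' * v'" "Y = u' + e' * v" by (simp_all add: X_def Y_def u_def v_def u'_def v'_def e'_def)
  have "\<kappa> * X = \<kappa> * u + e' * (\<kappa> * v')" by (simp add: XY algebra_simps)
  also have "\<dots> = - K * X + p * Y" unfolding bl XY by (simp add: algebra_simps)
  finally have x: "(\<kappa> + K) * X = p * Y" by (simp add: algebra_simps)
  have "\<kappa> * Y = \<kappa> * u' + e' * (\<kappa> * v)" by (simp add: XY algebra_simps)
  also have "\<dots> = K * u' + s * u - t * v + e' * (K * v + s * v' - t * u')" unfolding bl ..
  also have "\<dots> = K * Y + s * X - e' * t * u' - (e' * e') * t * v" unfolding XY ee by (simp add: algebra_simps)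
  also have "\<dots> = K * Y + s * X - e' * t * Y" unfolding XY by (simp add: algebra_simps)
  finally have y: "(\<kappa> - K + e' * t) * Y = s * X" by (simp add: algebra_simps)
  have "((\<kappa> + K) * (\<kappa> - K + e' * t)) * X = (\<kappa> - K + e' * t) * ((\<kappa> + K) * X)" by (simp add: mult_ac)
  also have "\<dots> = p * ((\<kappa> - K + e' * t) * Y)" unfolding x by (simp add: mult_ac)
  also have "\<dots> = (p * s) * X" unfolding y by (simp add: mult_ac)
  finally have r: "X \<noteq> 0 \<Longrightarrow> is_block_root \<epsilon> n \<kappa>"
    by (simp add: is_block_root_def K_def p_def s_def t_def e'_def)
  have Y0: "X = 0 \<Longrightarrow> Y = 0" using x p0 by simp
  show "\<not> is_block_root \<epsilon> n \<kappa> \<Longrightarrow> X = 0 \<and> Y = 0" using r Y0 by blast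
  show "\<exists>D \<in> functional.span (eset \<kappa>). \<forall>m.
      cA (hat D) m = (if m = int n then X/2 else 0) + (if m = - int n then Y/2 else 0) \<and>
      cB (hat D) m = of_real \<epsilon> * ((if m = int n then Y/2 else 0) + (if m = - int n then X/2 else 0))"
  proof (cases "X = 0")
    case True
    then show ?thesis using Y0 functional.span_zero by (intro bexI[of _ 0]) (simp_all add: hat_zero_AB)
  next
    case False
    then obtain k g c where g: "(k, g) \<in> eigenpairs lam mu R \<rho>0" "of_real k = \<kappa>" "c \<noteq> 0" "block_form \<epsilon> n \<kappa> c (bd g)"
      using root_eigenpair[of n \<epsilon> \<kappa>] n e r by (metis Suc_leI One_nat_def)
    \<comment> \<open>Matches the entry at frequency n; the equation (\<kappa> + K) X = p Y then
      makes the entry at -n correct as well. The halves anticipate that the two blocks are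
      added.\<close>
    define w where "w = X / (2 * p * c)"
    have "bd g \<in> eset \<kappa>" using g by (auto simp: eset_def)
    then have D: "(\<lambda>f. w * bd g f) \<in> functional.span (eset \<kappa>)"
      by (intro functional.span_scale functional.span_base)
    have w1: "w * (c * p) = X / 2" using p0 g(3) by (simp add: w_def)
    have w2: "w * (c * (\<kappa> + K)) = Y / 2"
    proof -
      have "w * (c * (\<kappa> + K)) = ((\<kappa> + K) * X) / (2 * p)" using g(3) by (simp add: w_def)
      then show ?thesis unfolding x using p0 by simp
    qed
    have AB: "cA (hat (bd g)) m = c * ((if m = - int n then \<kappa> + K else 0) + (if m = int n then p else 0))"
      "cB (hat (bd g)) m = of_real \<epsilon> * (c * ((if m = int n then \<kappa> + K else 0) + (if m = - int n then p else 0)))" for m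
      using g(4) by (auto simp: block_form_def K_def p_def)
    have nn: "int n \<noteq> - int n" using n by simp
    show ?thesis
    proof (rule bexI[OF _ D], intro allI conjI)
      fix m
      show "cA (hat (\<lambda>f. w * bd g f)) m = (if m = int n then X/2 else 0) + (if m = - int n then Y/2 else 0)"
        unfolding hat_cmult_AB AB using nn w1 w2 by auto
      have "w * (of_real \<epsilon> * z) = of_real \<epsilon> * (w * z)" for z by simp
      then show "cB (hat (\<lambda>f. w * bd g f)) m = of_real \<epsilon> * ((if m = int n then Y/2 else 0) + (if m = - int n then X/2 else 0))"
        unfolding hat_cmult_AB AB using nn w1 w2 by auto
    qed
  qed
qed

text \<open>The even part and the odd part add up to the original coefficients at n and -n.\<close>

lemma block:
  assumes F: "F \<in> eigenspace Hm T \<kappa>" and n: "0 < n"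
  shows "\<not> is_block_root 1 n \<kappa> \<and> \<not> is_block_root (-1) n \<kappa> \<Longrightarrow> \<bar>m\<bar> = int n \<Longrightarrow> cA (hat F) m = 0 \<and> cB (hat F) m = 0"
    and "\<exists>D \<in> functional.span (eset \<kappa>). \<forall>m.
      cA (hat D) m = (if \<bar>m\<bar> = int n then cA (hat F) m else 0) \<and> cB (hat D) m = (if \<bar>m\<bar> = int n then cB (hat F) m else 0)"
proof -
  have nn: "int n \<noteq> - int n" using n by simp
  {
    assume "\<not> is_block_root 1 n \<kappa> \<and> \<not> is_block_root (-1) n \<kappa>" "\<bar>m\<bar> = int n"
    moreover from this have "m = int n \<or> m = - int n" by linarith
    ultimately show "cA (hat F) m = 0 \<and> cB (hat F) m = 0"
      using half_block(1)[OF F n, of 1] half_block(1)[OF F n, of "-1"] by auto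
  }
  obtain D1 where D1: "D1 \<in> functional.span (eset \<kappa>)"
    "\<And>m. cA (hat D1) m = (if m = int n then (cA (hat F) (int n) + of_real 1 * cB (hat F) (- int n))/2 else 0) + (if m = - int n then (cA (hat F) (- int n) + of_real 1 * cB (hat F) (int n))/2 else 0)"
    "\<And>m. cB (hat D1) m = of_real 1 * ((if m = int n then (cA (hat F) (- int n) + of_real 1 * cB (hat F) (int n))/2 else 0) + (if m = - int n then (cA (hat F) (int n) + of_real 1 * cB (hat F) (- int n))/2 else 0))"
    using half_block(2)[OF F n, of 1] by blast
  obtain D2 where D2: "D2 \<in> functional.span (eset \<kappa>)"
    "\<And>m. cA (hat D2) m = (if m = int n then (cA (hat F) (int n) + of_real (-1) * cB (hat F) (- int n))/2 else 0) + (if m = - int n then (cA (hat F) (- int n) + of_real (-1) * cB (hat F) (int n))/2 else 0)"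
    "\<And>m. cB (hat D2) m = of_real (-1) * ((if m = int n then (cA (hat F) (- int n) + of_real (-1) * cB (hat F) (int n))/2 else 0) + (if m = - int n then (cA (hat F) (int n) + of_real (-1) * cB (hat F) (- int n))/2 else 0))"
    using half_block(2)[OF F n, of "-1"] by blast
  show "\<exists>D \<in> functional.span (eset \<kappa>). \<forall>m.
      cA (hat D) m = (if \<bar>m\<bar> = int n then cA (hat F) m else 0) \<and> cB (hat D) m = (if \<bar>m\<bar> = int n then cB (hat F) m else 0)"
  proof (rule bexI[OF _ functional.span_add[OF D1(1) D2(1)]], intro allI)
    fix m
    consider "m = int n" | "m = - int n" | "\<bar>m\<bar> \<noteq> int n" by linarith
    then show "cA (hat (D1 + D2)) m = (if \<bar>m\<bar> = int n then cA (hat F) m else 0) \<and> cB (hat (D1 + D2)) m = (if \<bar>m\<bar> = int n then cB (hat F) m else 0)"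
      by cases (use nn in \<open>auto simp: hat_add_AB D1 D2 field_simps\<close>)
  qed
qed

text \<open>For \<kappa> = 1/2 the two constant fields span the frequency 0; for every other
  \<kappa> the coefficients at 0 vanish.\<close>

lemma zero_block:
  assumes F: "F \<in> eigenspace Hm T \<kappa>"
  shows "\<exists>D \<in> functional.span (eset \<kappa>). \<forall>m.
      cA (hat D) m = (if m = 0 then cA (hat F) m else 0) \<and> cB (hat D) m = (if m = 0 then cB (hat F) m else 0)"
proof (cases "\<kappa> = of_real (1/2)")
  case True
  define x where "x = (cA (hat F) 0 + cB (hat F) 0) / (4 * of_real pi)"
  define y where "y = (cA (hat F) 0 - cB (hat F) 0) / (4 * of_real pi * \<i>)"
  have "bd g1 \<in> eset \<kappa>" "bd g2 \<in> eset \<kappa>" unfolding eset_def eigenpairs_eq using True by blast+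
  then have D: "(\<lambda>f. x * bd g1 f) + (\<lambda>f. y * bd g2 f) \<in> functional.span (eset \<kappa>)"
    by (intro functional.span_add functional.span_scale functional.span_base)
  have c: "x * (2 * of_real pi) + y * (2 * of_real pi * \<i>) = cA (hat F) 0" "x * (2 * of_real pi) - y * (2 * of_real pi * \<i>) = cB (hat F) 0"
    by (simp_all add: x_def y_def field_simps)
  show ?thesis
  proof (rule bexI[OF _ D], intro allI)
    fix m
    show "cA (hat ((\<lambda>f. x * bd g1 f) + (\<lambda>f. y * bd g2 f))) m = (if m = 0 then cA (hat F) m else 0) \<and>
      cB (hat ((\<lambda>f. x * bd g1 f) + (\<lambda>f. y * bd g2 f))) m = (if m = 0 then cB (hat F) m else 0)"
      unfolding hat_add_AB hat_cmult_AB using g1_form g2_form c by (auto simp: zform_def)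
  qed
next
  case False
  have "cA (hat F) 0 / 2 = \<kappa> * cA (hat F) 0" "cB (hat F) 0 / 2 = \<kappa> * cB (hat F) 0"
    using eigen_coefficients[OF F, of 0] unfolding NP_symbol_zero by auto
  then have "cA (hat F) 0 = 0" "cB (hat F) 0 = 0" using False by (auto simp: field_simps)
  then show ?thesis using functional.span_zero by (intro bexI[of _ 0]) (auto simp: hat_zero_AB)
qed

text \<open>The components of F at frequencies up to N lie in the span, by induction on N. Beyond
  the last frequency at which \<kappa> is a root all coefficients of F vanish, so F is a finite
  combination.\<close>

theorem eigenspace_eq: "eigenspace Hm T \<kappa> = functional.span (eset \<kappa>)"
proof
  show "eigenspace Hm T \<kappa> \<subseteq> functional.span (eset \<kappa>)"
  proof
    fix F assume F: "F \<in> eigenspace Hm T \<kappa>"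
    have part: "\<exists>D \<in> functional.span (eset \<kappa>). \<forall>m.
      cA (hat D) m = (if \<bar>m\<bar> \<le> int N then cA (hat F) m else 0) \<and> cB (hat D) m = (if \<bar>m\<bar> \<le> int N then cB (hat F) m else 0)" for N
    proof (induction N)
      case 0
      show ?case using zero_block[OF F] by simp
    next
      case (Suc N)
      then obtain D where D: "D \<in> functional.span (eset \<kappa>)"
        "\<And>m. cA (hat D) m = (if \<bar>m\<bar> \<le> int N then cA (hat F) m else 0)" "\<And>m. cB (hat D) m = (if \<bar>m\<bar> \<le> int N then cB (hat F) m else 0)"
        by blast
      obtain E where E: "E \<in> functional.span (eset \<kappa>)"
        "\<And>m. cA (hat E) m = (if \<bar>m\<bar> = int (Suc N) then cA (hat F) m else 0)" "\<And>m. cB (hat E) m = (if \<bar>m\<bar> = int (Suc N) then cB (hat F) m else 0)"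
        using block(2)[OF F, of "Suc N"] by blast
      show ?case
      proof (rule bexI[OF _ functional.span_add[OF D(1) E(1)]], intro allI)
        fix m
        show "cA (hat (D + E)) m = (if \<bar>m\<bar> \<le> int (Suc N) then cA (hat F) m else 0) \<and>
          cB (hat (D + E)) m = (if \<bar>m\<bar> \<le> int (Suc N) then cB (hat F) m else 0)"
          unfolding hat_add_AB D E by auto
      qed
    qed
    obtain N where N: "\<And>n. N < n \<Longrightarrow> \<not> is_block_root 1 n \<kappa> \<and> \<not> is_block_root (-1) n \<kappa>" using finitely_many_roots by blast
    obtain D where D: "D \<in> functional.span (eset \<kappa>)"
      "\<And>m. cA (hat D) m = (if \<bar>m\<bar> \<le> int N then cA (hat F) m else 0)" "\<And>m. cB (hat D) m = (if \<bar>m\<bar> \<le> int N then cB (hat F) m else 0)"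
      using part[of N] by blast
    have far: "cA (hat F) m = 0 \<and> cB (hat F) m = 0" if "\<not> \<bar>m\<bar> \<le> int N" for m
    proof -
      have "N < nat \<bar>m\<bar>" "\<bar>m\<bar> = int (nat \<bar>m\<bar>)" using that by linarith+
      then show ?thesis using block(1)[OF F, of "nat \<bar>m\<bar>" m] N[of "nat \<bar>m\<bar>"] by simp
    qed
    have "F = D"
    proof (rule Hm_eqI)
      show "F \<in> Hm" using F by (simp add: eigenspace_def)
      show "D \<in> Hm" by (rule span_Hm[OF D(1)])
      show "hat F n i = hat D n i" for n i
        by (rule cAB_eqI) (use D far in auto)
    qed
    then show "F \<in> functional.span (eset \<kappa>)" using D(1) by simp
  qed
qed (rule span_sub)

text \<open>A nonzero element of the span needs a generator, and a generator for \<kappa> exists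
  only if \<kappa> is listed.\<close>

lemma eigenvalues_eq: "eigenvalues Hm T = of_real ` fst ` eigenpairs lam mu R \<rho>0"
proof
  show "of_real ` fst ` eigenpairs lam mu R \<rho>0 \<subseteq> eigenvalues Hm T"
    using eigenpair_eigen unfolding eigenvalues_def by fastforce
  show "eigenvalues Hm T \<subseteq> of_real ` fst ` eigenpairs lam mu R \<rho>0"
  proof
    fix \<kappa> assume "\<kappa> \<in> eigenvalues Hm T"
    then obtain F where F: "F \<in> functional.span (eset \<kappa>)" "F \<noteq> 0" unfolding eigenvalues_def eigenspace_eq by blast
    then have "eset \<kappa> \<noteq> {}" by auto
    then show "\<kappa> \<in> of_real ` fst ` eigenpairs lam mu R \<rho>0" by (force simp: eset_def)
  qed
qed

lemma fst_eigenpairs: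
  "fst ` eigenpairs lam mu R \<rho>0 = {1/2} \<union> {k1 lam mu \<rho>0 n | n. 1 \<le> n} \<union> {k2 lam mu \<rho>0 n | n. 2 \<le> n}
     \<union> {k3 lam mu \<rho>0 n | n. 1 \<le> n} \<union> {k4 lam mu \<rho>0 n | n. 1 \<le> n}"
proof -
  have "fst ` {(f n, g n) | n. P n} = {f n | n. P n}" for f :: "nat \<Rightarrow> real" and g :: "nat \<Rightarrow> real \<Rightarrow> real^2" and P
    by force
  then show ?thesis unfolding eigenpairs_eq image_Un by simp
qed

end

theorem mainTheorem5:
  fixes lam mu a b R \<rho>0 :: real
  assumes "mu > 0" and "2 * lam + 2 * mu > 0"
    and "a > b" and "b > 0"
    and "R = sqrt (a\<^sup>2 - b\<^sup>2)"
    and "\<rho>0 > 0" and "a = R * cosh \<rho>0" and "b = R * sinh \<rho>0"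
  shows "eigenvalues (H_star a b) (K_star lam mu a b) =
           complex_of_real ` ({1/2}
             \<union> {k1 lam mu \<rho>0 n | n. 1 \<le> n} \<union> {k2 lam mu \<rho>0 n | n. 2 \<le> n}
             \<union> {k3 lam mu \<rho>0 n | n. 1 \<le> n} \<union> {k4 lam mu \<rho>0 n | n. 1 \<le> n})
       \<and> (\<forall>(k, g) \<in> eigenpairs lam mu R \<rho>0.
             boundary_density a b R \<rho>0 g \<in> eigenspace (H_star a b) (K_star lam mu a b) (complex_of_real k)
             \<and> boundary_density a b R \<rho>0 g \<noteq> 0)
       \<and> (\<forall>\<kappa>. eigenspace (H_star a b) (K_star lam mu a b) \<kappa> =
             cspan {boundary_density a b R \<rho>0 g | k g.
                      (k, g) \<in> eigenpairs lam mu R \<rho>0 \<and> complex_of_real k = \<kappa>})"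
proof -
  interpret lame_ell a b lam mu R \<rho>0
  proof
    show "0 < lam + mu" using assms(2) by simp
  qed (fact assms)+
  have H: "H_star a b = H_mhalf sig" by (simp add: H_star_def sig_def)
  have K: "K_star lam mu a b = mult_op (NP_symbol kap)"
    using NP_operator_eq[OF mu_pos M_pos(2)] by (simp add: K_star_def sig_def kap_def)
  show ?thesis
  proof (intro conjI ballI allI)
    show "eigenvalues (H_star a b) (K_star lam mu a b) =
           complex_of_real ` ({1/2}
             \<union> {k1 lam mu \<rho>0 n | n. 1 \<le> n} \<union> {k2 lam mu \<rho>0 n | n. 2 \<le> n}
             \<union> {k3 lam mu \<rho>0 n | n. 1 \<le> n} \<union> {k4 lam mu \<rho>0 n | n. 1 \<le> n})"
      unfolding H K by (rule eigenvalues_eq[unfolded fst_eigenpairs])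
    show "case p of (k, g) \<Rightarrow> bd g \<in> eigenspace (H_star a b) (K_star lam mu a b) (complex_of_real k) \<and> bd g \<noteq> 0"
      if "p \<in> eigenpairs lam mu R \<rho>0" for p
      unfolding H K using eigenpair_eigen[of "fst p" "snd p"] that by (simp add: case_prod_beta)
    show "eigenspace (H_star a b) (K_star lam mu a b) \<kappa> =
        cspan {bd g | k g. (k, g) \<in> eigenpairs lam mu R \<rho>0 \<and> complex_of_real k = \<kappa>}" for \<kappa>
      unfolding H K by (rule eigenspace_eq[unfolded eset_def])
  qed
qed

end
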